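(* Let $k,n$ be integers with $1\le k<n$, let $F:\mathbf{G}_0(n,k)\to[0,\infty)$ be an integrand which is Lipschitz (i.e. $\operatorname{Lip}F<\infty$ with respect to the Euclidean norm of $\bigwedge_k\mathbf{R}^n$ restricted to $\mathbf{G}_0(n,k)$), and let $0<c_2<c_1<\infty$. Let $\mathcal{P}$ be the set of polyhedral test pairs. If $F\in\mathrm{AUE}(\mathcal{P},c_1)$, i.e. $$\Phi_F(S)-\Phi_F(D)\ \ge\ c_1\bigl(\mathbf{M}(S)-\mathbf{M}(D)\bigr)\quad\text{for all }(S,D)\in\mathcal{P},$$ then $F\in\mathrm{UPC}(c_2)$, i.e. $$\sum_{i=1}^d m_iF(\eta_i)-F(\eta_0)\ \ge\ c_2\Bigl(\sum_{i=1}^d m_i|\eta_i|-|\eta_0|\Bigr)$$ whenever $d$ is a positive integer, $m_1,\dots,m_d\in(0,\infty)$, and $\eta_0,\dots,\eta_d\in\mathbf{G}_0(n,k)$ satisfy $\eta_0=\sum_{i=1}^d m_i\eta_i$.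
   Context: $\bigwedge_k\mathbf{R}^n$ carries the Euclidean inner product for which $e_{\lambda(1)}\wedge\cdots\wedge e_{\lambda(k)}$ ($\lambda:\{1,\dots,k\}\to\{1,\dots,n\}$ increasing, $e_1,\dots,e_n$ the standard basis of $\mathbf{R}^n$) form an orthonormal basis; $|\cdot|$ is its norm. The oriented Grassmannian is $\mathbf{G}_0(n,k)=\{\xi\in\bigwedge_k\mathbf{R}^n:\xi\text{ is simple},\ |\xi|=1\}$, where $\xi$ is simple if $\xi=v_1\wedge\cdots\wedge v_k$ for some $v_i\in\mathbf{R}^n$. An integrand is a continuous non-negative function $F:\mathbf{G}_0(n,k)\to\mathbf{R}$ (not assumed even). Polyhedral chains: for affinely independent $u_0,\dots,u_k\in\mathbf{R}^n$ with convex hull $\sigma$ and $\tau=\frac{(u_1-u_0)\wedge\cdots\wedge(u_k-u_{k-1})}{|(u_1-u_0)\wedge\cdots\wedge(u_k-u_{k-1})|}$, the oriented $k$-simplex $[\![u_0,\dots,u_k]\!]$ is the $k$-dimensional current $\omega\mapsto\int_\sigma\langle\omega(x),\tau\rangle\,d\mathscr{H}^k(x)$ acting on smooth compactly supported differential $k$-forms $\omega$ on $\mathbf{R}^n$ (degenerate simplices give the zero current). $\mathbf{P}_k(\mathbf{R}^n)$ is the real vector space of currents spanned by oriented $k$-simplices in $\mathbf{R}^n$. Each $T=\sum_{i=1}^m a_i\Delta_i\in\mathbf{P}_k(\mathbf{R}^n)$ ($a_i\in\mathbf{R}$, $\Delta_i$ non-degenerate oriented simplices with convex hulls $\sigma_i$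 and orientations $\tau_i$) is represented by $\tilde\tau(x)=\sum_i a_i\tau_i\,\boldsymbol{\chi}_{\sigma_i}(x)$: for $\mathscr{H}^k$-almost every $x$, $\tilde\tau(x)$ is simple; put $\theta=|\tilde\tau|$ and $\tau=\tilde\tau/|\tilde\tau|$ where $\theta>0$. Then $T(\omega)=\int\theta\langle\omega,\tau\rangle\,d\mathscr{H}^k$, the mass is $\mathbf{M}(T)=\int\theta\,d\mathscr{H}^k$, and the anisotropic energy is $\Phi_F(T)=\int_{\{\theta>0\}}\theta\,F(\tau)\,d\mathscr{H}^k$. These depend only on $T$. The boundary $\partial T$ is the usual boundary of currents, $\partial T(\omega)=T(d\omega)$. Polyhedral test pairs: $Q_k\in\mathbf{P}_k(\mathbf{R}^k)$ is the current of integration over the unit cube $[0,1]^k$ with the standard orientation of $\mathbf{R}^k$. A linear map $p:\mathbf{R}^n\to\mathbf{R}^k$ is an orthogonal projection if its adjoint $p^*:\mathbf{R}^k\to\mathbf{R}^n$ satisfies $p\circ p^*=\mathrm{id}_{\mathbf{R}^k}$. A pair $(S,D)$ is a polyhedral test pair, $(S,D)\in\mathcal{P}$, if $S\in\mathbf{P}_k(\mathbf{R}^n)$ and there is an orthogonal projection $p:\mathbf{R}^n\to\mathbf{R}^k$ such that $D=(p^* )_\#Q_k$ (push-forward of currents, i.e. the oriented unit $k$-cube $p^*([0,1]^k)$ with orientation $p^*(\epsilon_1)\wedge\cdots\wedge p^*(\epsilon_k)$, $\epsilon_1,\dots,\epsilon_k$ the standard basis of $\mathbf{R}^k$) and $\partial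 S=\partial D$. *)

theory Defs
  imports "HOL-Analysis.Analysis"
begin

section \<open>Exterior algebra\<close>

text \<open>
  The exterior algebra of \<open>\<real>\<^sup>n\<close>, with \<open>n = CARD('n)\<close>, is represented by its coordinates: the coordinate
  with index \<open>{i\<^sub>1 < \<dots> < i\<^sub>k}\<close> belongs to the basis vector \<open>e\<^bsub>i\<^sub>1\<^esub> \<and> \<dots> \<and> e\<^bsub>i\<^sub>k\<^esub>\<close>.  The library's inner product
  on this type is the one that makes these basis vectors orthonormal.  The same type represents
  covectors in the dual basis, so that the pairing of covectors with vectors is the inner product.
\<close>

type_synonym 'n ext = "(real, 'n set) vec"

definition multivectors :: "nat \<Rightarrow> 'n::finite ext set" where
  "multivectors k = {\<xi>. \<forall>A. card A \<noteq> k \<longrightarrow> \<xi> $ A = 0}"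

text \<open>
  For disjoint \<open>A\<close>, \<open>B\<close> one has \<open>e\<^sub>A \<and> e\<^sub>B = wedge_sign A B *\<^sub>R e\<^bsub>A \<union> B\<^esub>\<close>: the exponent counts the
  inversions of the concatenation of the increasing enumerations of \<open>A\<close> and \<open>B\<close>.
\<close>

definition wedge_sign :: "'n::linorder set \<Rightarrow> 'n set \<Rightarrow> real" where
  "wedge_sign A B = (- 1) ^ card {(a, b). a \<in> A \<and> b \<in> B \<and> b < a}"

definition wedge :: "'n::{finite,linorder} ext \<Rightarrow> 'n ext \<Rightarrow> 'n ext" (infixr "\<and>\<^sub>e" 70) where
  "\<xi> \<and>\<^sub>e \<eta> = (\<chi> C. \<Sum>A\<in>Pow C. wedge_sign A (C - A) * \<xi> $ A * \<eta> $ (C - A))"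

definition ext_of_vec :: "real ^ 'n::finite \<Rightarrow> 'n ext" where
  "ext_of_vec v = (\<Sum>i\<in>UNIV. (v $ i) *\<^sub>R axis {i} 1)"

definition wedge_list :: "(real ^ 'n::{finite,linorder}) list \<Rightarrow> 'n ext" where
  "wedge_list vs = foldr (\<lambda>v \<xi>. ext_of_vec v \<and>\<^sub>e \<xi>) vs (axis {} 1)"

definition simple_multivector :: "nat \<Rightarrow> 'n::{finite,linorder} ext \<Rightarrow> bool" where
  "simple_multivector k \<xi> \<longleftrightarrow> (\<exists>vs. length vs = k \<and> \<xi> = wedge_list vs)"

definition oriented_grassmannian :: "nat \<Rightarrow> 'n::{finite,linorder} ext set" where
  "oriented_grassmannian k = {\<xi>. simple_multivector k \<xi> \<and> norm \<xi> = 1}"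

text \<open>Only the values of an integrand on the oriented Grassmannian matter.\<close>

definition integrand :: "nat \<Rightarrow> ('n::{finite,linorder} ext \<Rightarrow> real) \<Rightarrow> bool" where
  "integrand k F \<longleftrightarrow> continuous_on (oriented_grassmannian k) F \<and>
     (\<forall>\<xi>\<in>oriented_grassmannian k. 0 \<le> F \<xi>)"


section \<open>Hausdorff measure\<close>

definition hausdorff_pre :: "nat \<Rightarrow> real \<Rightarrow> 'a::metric_space set \<Rightarrow> ennreal" where
  "hausdorff_pre k \<delta> A =
     (INF E\<in>{E :: nat \<Rightarrow> 'a set. A \<subseteq> (\<Union>i. E i) \<and> (\<forall>i. bounded (E i) \<and> diameter (E i) \<le> \<delta>)}.
        \<Sum>i. if E i = {} then 0 else ennreal (unit_ball_vol (real k) * (diameter (E i) / 2) ^ k))"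

definition hausdorff_outer :: "nat \<Rightarrow> 'a::metric_space set \<Rightarrow> ennreal" where
  "hausdorff_outer k A = (SUP \<delta>\<in>{0<..}. hausdorff_pre k \<delta> A)"

text \<open>
  \<open>measure_of\<close> yields the zero measure unless the given set function is countably additive on the
  given sets; \<open>measure_space_hausdorff\<close> and \<open>emeasure_hausdorff\<close> below show that it is.
\<close>

definition hausdorff :: "nat \<Rightarrow> 'a::metric_space measure" where
  "hausdorff k = measure_of UNIV (sets borel) (hausdorff_outer k)"

lemma hausdorff_pre_mono: "A \<subseteq> B \<Longrightarrow> hausdorff_pre k \<delta> A \<le> hausdorff_pre k \<delta> B"
  unfolding hausdorff_pre_def by (intro INF_superset_mono) auto

lemma hausdorff_pre_empty:
  assumes "\<delta> > 0"
  shows "hausdorff_pre k \<delta> {} = 0"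
proof -
  have "hausdorff_pre k \<delta> ({} :: 'a set) \<le> (\<Sum>i::nat. 0)"
    unfolding hausdorff_pre_def
    by (rule INF_lower2[where i = "\<lambda>_. {}"]) (use assms in auto)
  then show ?thesis by simp
qed

lemma hausdorff_pre_subadditive:
  "hausdorff_pre k \<delta> (\<Union>n. A n) \<le> (\<Sum>n::nat. hausdorff_pre k \<delta> (A n))"
proof (rule ennreal_le_epsilon)
  fix e :: real
  assume fin: "(\<Sum>n. hausdorff_pre k \<delta> (A n)) < top" and e: "0 < e"
  define w where
    "w E = (if E = {} then 0 else ennreal (unit_ball_vol (real k) * (diameter E / 2) ^ k))"
    for E :: "'a set"
  let ?cov = "\<lambda>A. {E :: nat \<Rightarrow> 'a set. A \<subseteq> (\<Union>i. E i) \<and> (\<forall>i. bounded (E i) \<and> diameter (E i) \<le> \<delta>)}"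
  have pre: "hausdorff_pre k \<delta> A = (INF E\<in>?cov A. \<Sum>i. w (E i))" for A
    unfolding hausdorff_pre_def w_def by simp
  have finn: "hausdorff_pre k \<delta> (A n) < top" for n
    using fin ennreal_suminf_lessD by blast
  have small: "\<exists>E. E \<in> ?cov (A n) \<and>
      (\<Sum>i. w (E i)) < hausdorff_pre k \<delta> (A n) + ennreal (e * (1 / 2) ^ Suc n)" for n
  proof -
    have "hausdorff_pre k \<delta> (A n) < hausdorff_pre k \<delta> (A n) + ennreal (e * (1 / 2) ^ Suc n)"
      using finn[of n] e by (auto simp: ennreal_zero_less_mult_iff ennreal_add_left_cancel_less)
    then show ?thesis unfolding pre INF_less_iff Bex_def .
  qed
  define E where "E n = (SOME E. E \<in> ?cov (A n) \<and>
      (\<Sum>i. w (E i)) < hausdorff_pre k \<delta> (A n) + ennreal (e * (1 / 2) ^ Suc n))" for n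
  have E: "E n \<in> ?cov (A n)"
      "(\<Sum>i. w (E n i)) < hausdorff_pre k \<delta> (A n) + ennreal (e * (1 / 2) ^ Suc n)" for n
    using someI_ex[OF small[of n]] unfolding E_def[symmetric] by (rule conjunct1, rule conjunct2)
  define G where "G j = (case prod_decode j of (n, i) \<Rightarrow> E n i)" for j
  have cov: "G \<in> ?cov (\<Union>n. A n)"
  proof -
    have "x \<in> (\<Union>j. G j)" if x: "x \<in> A n" for x n
    proof -
      obtain i where "x \<in> E n i" using E(1)[of n] x by blast
      then have "x \<in> G (prod_encode (n, i))" by (simp add: G_def)
      then show ?thesis by blast
    qed
    moreover have "bounded (G j) \<and> diameter (G j) \<le> \<delta>" for j
      using E(1) by (cases "prod_decode j") (auto simp: G_def)
    ultimately show ?thesis by auto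
  qed
  have "hausdorff_pre k \<delta> (\<Union>n. A n) \<le> (\<Sum>j. w (G j))"
    unfolding pre by (rule INF_lower[OF cov])
  also have "\<dots> = (\<Sum>j. (\<lambda>(n, i). w (E n i)) (prod_decode j))"
    by (intro suminf_cong) (auto simp: G_def split: prod.split)
  also have "\<dots> = (\<Sum>n. \<Sum>i. w (E n i))"
    by (rule suminf_ennreal_2dimen) simp
  also have "\<dots> \<le> (\<Sum>n. hausdorff_pre k \<delta> (A n) + ennreal (e * (1 / 2) ^ Suc n))"
    by (intro suminf_le) (use E(2) in \<open>auto intro: less_imp_le\<close>)
  also have "\<dots> = (\<Sum>n. hausdorff_pre k \<delta> (A n)) + (\<Sum>n. ennreal (e * (1 / 2) ^ Suc n))"
    by (intro suminf_add[symmetric]) auto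
  also have "(\<Sum>n. ennreal (e * (1 / 2) ^ Suc n)) = ennreal e"
    using e sums_mult[OF power_half_series, of e] by (intro suminf_ennreal_eq) auto
  finally show "hausdorff_pre k \<delta> (\<Union>n. A n) \<le> (\<Sum>n. hausdorff_pre k \<delta> (A n)) + ennreal e" .
qed

lemma hausdorff_pre_separated:
  assumes sep: "\<And>x y. x \<in> A \<Longrightarrow> y \<in> B \<Longrightarrow> \<delta> < dist x y" and "\<delta> > 0"
  shows "hausdorff_pre k \<delta> A + hausdorff_pre k \<delta> B \<le> hausdorff_pre k \<delta> (A \<union> B)"
proof -
  define w where
    "w E = (if E = {} then 0 else ennreal (unit_ball_vol (real k) * (diameter E / 2) ^ k))"
    for E :: "'a set"
  let ?cov = "\<lambda>A. {E :: nat \<Rightarrow> 'a set. A \<subseteq> (\<Union>i. E i) \<and> (\<forall>i. bounded (E i) \<and> diameter (E i) \<le> \<delta>)}"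
  have pre: "hausdorff_pre k \<delta> A = (INF E\<in>?cov A. \<Sum>i. w (E i))" for A
    unfolding hausdorff_pre_def w_def by simp
  show ?thesis unfolding pre[of "A \<union> B"]
  proof (rule INF_greatest)
    fix E assume E: "E \<in> ?cov (A \<union> B)"
    define restr where "restr X i = (if E i \<inter> X = {} then {} else E i)" for X i
    have cov: "restr X \<in> ?cov X" if "X \<subseteq> A \<union> B" for X
    proof -
      have "x \<in> (\<Union>i. restr X i)" if x: "x \<in> X" for x
      proof -
        obtain i where "x \<in> E i" using E \<open>X \<subseteq> A \<union> B\<close> x by blast
        with x have "x \<in> restr X i" by (auto simp: restr_def)
        then show ?thesis by blast
      qed
      moreover have "bounded (restr X i) \<and> diameter (restr X i) \<le> \<delta>" for i
        using E \<open>\<delta> > 0\<close> by (auto simp: restr_def)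
      ultimately show ?thesis by auto
    qed
    have "hausdorff_pre k \<delta> A + hausdorff_pre k \<delta> B \<le> (\<Sum>i. w (restr A i)) + (\<Sum>i. w (restr B i))"
      unfolding pre by (intro add_mono INF_lower cov) auto
    also have "\<dots> = (\<Sum>i. w (restr A i) + w (restr B i))"
      by (intro suminf_add) auto
    also have "\<dots> \<le> (\<Sum>i. w (E i))"
    proof (intro suminf_le)
      fix i
      have "E i \<inter> A = {} \<or> E i \<inter> B = {}"
      proof (rule ccontr)
        assume "\<not> ?thesis"
        then obtain x y where "x \<in> E i" "x \<in> A" "y \<in> E i" "y \<in> B" by blast
        moreover have "bounded (E i)" "diameter (E i) \<le> \<delta>" using E by auto
        ultimately show False using sep[of x y] diameter_bounded_bound[of "E i" x y] by linarith
      qed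
      then show "w (restr A i) + w (restr B i) \<le> w (E i)"
        by (auto simp: restr_def w_def)
    qed auto
    finally show "hausdorff_pre k \<delta> A + hausdorff_pre k \<delta> B \<le> (\<Sum>i. w (E i))" .
  qed
qed

lemma hausdorff_pre_antimono:
  "\<delta> \<le> \<delta>' \<Longrightarrow> hausdorff_pre k \<delta>' A \<le> hausdorff_pre k \<delta> A"
  unfolding hausdorff_pre_def by (rule INF_superset_mono) (use order_trans in blast)+

lemma hausdorff_outer_mono: "A \<subseteq> B \<Longrightarrow> hausdorff_outer k A \<le> hausdorff_outer k B"
  unfolding hausdorff_outer_def by (intro SUP_mono') (rule hausdorff_pre_mono)

lemma hausdorff_outer_empty: "hausdorff_outer k {} = 0"
  unfolding hausdorff_outer_def by (simp add: hausdorff_pre_empty)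

lemma hausdorff_outer_subadditive:
  "hausdorff_outer k (\<Union>n. A n) \<le> (\<Sum>n::nat. hausdorff_outer k (A n))"
proof -
  have "hausdorff_pre k \<delta> (\<Union>n. A n) \<le> (\<Sum>n. hausdorff_outer k (A n))" if "\<delta> > 0" for \<delta>
  proof -
    have "hausdorff_pre k \<delta> (\<Union>n. A n) \<le> (\<Sum>n. hausdorff_pre k \<delta> (A n))"
      by (rule hausdorff_pre_subadditive)
    also have "\<dots> \<le> (\<Sum>n. hausdorff_outer k (A n))"
      by (intro suminf_le) (use that in \<open>auto simp: hausdorff_outer_def intro: SUP_upper\<close>)
    finally show ?thesis .
  qed
  then show ?thesis unfolding hausdorff_outer_def[of k "\<Union>n. A n"] by (intro SUP_least) auto
qed

lemma hausdorff_outer_Un: "hausdorff_outer k (A \<union> B) \<le> hausdorff_outer k A + hausdorff_outer k B"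
proof -
  have "hausdorff_outer k (\<Union>n. binaryset A B n) \<le> (\<Sum>n. hausdorff_outer k (binaryset A B n))"
    by (rule hausdorff_outer_subadditive)
  also have "\<dots> = hausdorff_outer k A + hausdorff_outer k B"
    by (rule suminf_binaryset_eq) (rule hausdorff_outer_empty)
  finally show ?thesis by (simp add: UN_binaryset_eq)
qed

lemma hausdorff_outer_separated:
  assumes sep: "\<And>x y. x \<in> A \<Longrightarrow> y \<in> B \<Longrightarrow> d \<le> dist x y" and "d > 0"
  shows "hausdorff_outer k A + hausdorff_outer k B \<le> hausdorff_outer k (A \<union> B)"
proof -
  have "hausdorff_pre k \<delta> A + hausdorff_pre k \<delta>' B \<le> hausdorff_outer k (A \<union> B)"
    if "\<delta> > 0" "\<delta>' > 0" for \<delta> \<delta>'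
  proof -
    define \<epsilon> where "\<epsilon> = min (d / 2) (min \<delta> \<delta>')"
    have \<epsilon>: "\<epsilon> > 0" "\<epsilon> < d" "\<epsilon> \<le> \<delta>" "\<epsilon> \<le> \<delta>'" using that \<open>d > 0\<close> by (auto simp: \<epsilon>_def)
    have "hausdorff_pre k \<delta> A + hausdorff_pre k \<delta>' B \<le> hausdorff_pre k \<epsilon> A + hausdorff_pre k \<epsilon> B"
      by (intro add_mono hausdorff_pre_antimono \<epsilon>)
    also have "\<dots> \<le> hausdorff_pre k \<epsilon> (A \<union> B)"
      by (rule hausdorff_pre_separated) (use sep \<epsilon> in force)+
    also have "\<dots> \<le> hausdorff_outer k (A \<union> B)"
      unfolding hausdorff_outer_def by (intro SUP_upper) (use \<epsilon> in auto)
    finally show ?thesis .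
  qed
  then have "hausdorff_pre k \<delta> A + hausdorff_outer k B \<le> hausdorff_outer k (A \<union> B)" if "\<delta> > 0" for \<delta>
    unfolding hausdorff_outer_def[of k B] using that
    by (subst ennreal_SUP_add_right) (auto intro!: SUP_least)
  then show ?thesis
    unfolding hausdorff_outer_def[of k A] add.commute[of _ "hausdorff_outer k B"]
    by (subst ennreal_SUP_add_right) (auto intro!: SUP_least)
qed

text \<open>Caratheodory's criterion: closed sets are measurable for a metric outer measure.\<close>

lemma hausdorff_outer_closed:
  assumes "closed C"
  shows "hausdorff_outer k (X \<inter> C) + hausdorff_outer k (X - C) \<le> hausdorff_outer k X"
proof (cases "C = {} \<or> hausdorff_outer k X = top")
  case True
  then show ?thesis by (auto simp: hausdorff_outer_empty)
next
  case False
  define Y where "Y r = {x \<in> X. r \<le> infdist x C}" for r :: real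
  define R where "R n = {x \<in> X. 1 / (real n + 2) \<le> infdist x C \<and> infdist x C < 1 / (real n + 1)}" for n
  let ?\<mu> = "hausdorff_outer k"
  have odd_even: "(\<Sum>j<N. ?\<mu> (R (2 * j + c))) \<le> ?\<mu> (Y (1 / real (2 * N + c)))" if "c > 0" for N c
  proof (induction N)
    case (Suc N)
    let ?m = "2 * N + c"
    have "(\<Sum>j<Suc N. ?\<mu> (R (2 * j + c))) \<le> ?\<mu> (Y (1 / real ?m)) + ?\<mu> (R ?m)"
      using Suc by (auto intro: add_mono)
    also have "\<dots> \<le> ?\<mu> (Y (1 / real ?m) \<union> R ?m)"
    proof (rule hausdorff_outer_separated)
      show "0 < 1 / real ?m - 1 / (real ?m + 1)"
        using that by (simp add: divide_simps)
      fix x y assume "x \<in> Y (1 / real ?m)" "y \<in> R ?m"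
      then have "1 / real ?m \<le> infdist x C" "infdist y C < 1 / (real ?m + 1)"
        unfolding Y_def R_def by blast+
      then show "1 / real ?m - 1 / (real ?m + 1) \<le> dist x y"
        using infdist_triangle[of x C y] by linarith
    qed
    also have "\<dots> \<le> ?\<mu> (Y (1 / real (2 * Suc N + c)))"
    proof (rule hausdorff_outer_mono)
      have "1 / real (2 * Suc N + c) \<le> 1 / real ?m" using that by (simp add: frac_le)
      moreover have "real ?m + 2 = real (2 * Suc N + c)" by simp
      ultimately show "Y (1 / real ?m) \<union> R ?m \<subseteq> Y (1 / real (2 * Suc N + c))"
        unfolding Y_def R_def by (auto simp: algebra_simps)
    qed
    finally show ?case .
  qed simp
  define a where "a n = ?\<mu> (R (Suc n))" for n
  have YX: "?\<mu> (Y r) \<le> ?\<mu> X" for r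
    by (intro hausdorff_outer_mono) (auto simp: Y_def)
  have "(\<Sum>n<N. a n) \<le> 2 * ?\<mu> X" for N
  proof -
    have "(\<Sum>n<N. a n) \<le> (\<Sum>n<2 * N. a n)" by (intro sum_mono2) auto
    also have "\<dots> = (\<Sum>j<N. ?\<mu> (R (2 * j + 1))) + (\<Sum>j<N. ?\<mu> (R (2 * j + 2)))"
      by (induction N) (auto simp: a_def algebra_simps)
    also have "\<dots> \<le> ?\<mu> X + ?\<mu> X"
      by (intro add_mono order_trans[OF odd_even YX]) auto
    finally show ?thesis by (simp add: mult_2)
  qed
  then have "(\<Sum>n. a n) \<le> 2 * ?\<mu> X" by (intro suminf_le_const) auto
  moreover have "2 * ?\<mu> X < top" using False by (auto simp: ennreal_mult_less_top less_top)
  ultimately have fin: "(\<Sum>n. a n) \<noteq> top" by (auto simp: top_unique)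
  have "?\<mu> (X \<inter> C) + ?\<mu> (X - C) + (\<Sum>n<N. a n) \<le> ?\<mu> X + (\<Sum>n. a n)" for N
  proof -
    let ?r = "1 / (real N + 2)"
    have cover: "X - C \<subseteq> Y ?r \<union> (\<Union>n. R (Suc (n + N)))"
    proof
      fix x assume x: "x \<in> X - C"
      show "x \<in> Y ?r \<union> (\<Union>n. R (Suc (n + N)))"
      proof (cases "?r \<le> infdist x C")
        case True
        then show ?thesis using x by (auto simp: Y_def)
      next
        case f: False
        have pos: "0 < infdist x C"
          using x assms False by (metis DiffD2 in_closed_iff_infdist_zero infdist_nonneg order_le_less)
        define q where "q = nat \<lceil>1 / infdist x C\<rceil>"
        have inv: "real N + 2 < 1 / infdist x C"
          using f pos by (simp add: field_simps not_le)
        have "1 / infdist x C \<le> real q" "real q < 1 / infdist x C + 1"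
          unfolding q_def using pos by (simp_all add: of_nat_nat, linarith+)
        moreover then have "N + 3 \<le> q" using inv by linarith
        ultimately have "x \<in> R (Suc ((q - N - 3) + N))"
          using x pos by (auto simp: R_def of_nat_diff field_simps)
        then show ?thesis by blast
      qed
    qed
    have "?\<mu> (X - C) \<le> ?\<mu> (Y ?r) + ?\<mu> (\<Union>n. R (Suc (n + N)))"
      using hausdorff_outer_mono[OF cover] hausdorff_outer_Un order_trans by blast
    also have "\<dots> \<le> ?\<mu> (Y ?r) + (\<Sum>n. a (n + N))"
      unfolding a_def by (intro add_left_mono hausdorff_outer_subadditive)
    finally have "?\<mu> (X \<inter> C) + ?\<mu> (X - C) + (\<Sum>n<N. a n)
        \<le> ?\<mu> (X \<inter> C) + (?\<mu> (Y ?r) + (\<Sum>n. a (n + N))) + (\<Sum>n<N. a n)"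
      by (intro add_mono) auto
    also have "\<dots> = (?\<mu> (X \<inter> C) + ?\<mu> (Y ?r)) + (\<Sum>n. a n)"
      by (subst suminf_offset[of a N]) (auto simp: ac_simps)
    also have "?\<mu> (X \<inter> C) + ?\<mu> (Y ?r) \<le> ?\<mu> (X \<inter> C \<union> Y ?r)"
    proof (rule hausdorff_outer_separated)
      fix x y assume "x \<in> X \<inter> C" "y \<in> Y ?r"
      then show "?r \<le> dist x y"
        using infdist_le[of x C y] by (auto simp: Y_def dist_commute)
    qed simp
    also have "\<dots> \<le> ?\<mu> X" by (intro hausdorff_outer_mono) (auto simp: Y_def)
    finally show ?thesis by (simp add: add_right_mono)
  qed
  then have "?\<mu> (X \<inter> C) + ?\<mu> (X - C) + (\<Sum>n. a n) \<le> ?\<mu> X + (\<Sum>n. a n)"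
    by (intro LIMSEQ_le_const2[OF tendsto_add[OF tendsto_const summable_LIMSEQ]]) auto
  then show ?thesis using fin by (simp add: ennreal_add_left_cancel_le add.commute[of _ "\<Sum>n. a n"])
qed

lemma measure_space_hausdorff: "measure_space UNIV (sets borel) (hausdorff_outer k)"
proof -
  let ?L = "lambda_system UNIV UNIV (hausdorff_outer k :: 'a set \<Rightarrow> ennreal)"
  interpret sigma_algebra "UNIV :: 'a set" UNIV
    using sigma_algebra_Pow[of "UNIV :: 'a set"] by simp
  have "outer_measure_space UNIV (hausdorff_outer k :: 'a set \<Rightarrow> ennreal)"
    unfolding outer_measure_space_def positive_def increasing_def countably_subadditive_def
    by (auto simp: hausdorff_outer_empty hausdorff_outer_mono hausdorff_outer_subadditive)
  then have L: "measure_space UNIV ?L (hausdorff_outer k)" by (rule caratheodory_lemma)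
  then have sL: "sigma_algebra UNIV ?L" by (simp add: measure_space_def)
  have "C \<in> ?L" if "closed C" for C
  proof -
    have "hausdorff_outer k X \<le> hausdorff_outer k (X \<inter> C) + hausdorff_outer k (X - C)" for X
      using hausdorff_outer_Un[of k "X \<inter> C" "X - C"] by (simp add: Int_Diff_Un)
    then show ?thesis
      using hausdorff_outer_closed[OF that] by (auto simp: lambda_system_eq intro: antisym)
  qed
  then have "sigma_sets UNIV (Collect closed) \<subseteq> ?L"
    by (intro sigma_algebra.sigma_sets_subset[OF sL]) auto
  then have "sets (borel :: 'a measure) \<subseteq> ?L" by (simp add: borel_eq_closed)
  then show ?thesis
    using measure_down[OF L, of "sets borel"] sets.sigma_algebra_axioms[of borel] by simp
qed

lemma space_hausdorff [simp]: "space (hausdorff k) = UNIV"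
  unfolding hausdorff_def by (simp add: space_measure_of_conv)

lemma sets_hausdorff [simp, measurable_cong]: "sets (hausdorff k) = sets borel"
  unfolding hausdorff_def using sets.sigma_sets_eq[of borel] by simp

lemma emeasure_hausdorff: "A \<in> sets borel \<Longrightarrow> emeasure (hausdorff k) A = hausdorff_outer k A"
  using measure_space_hausdorff[of k] unfolding hausdorff_def
  by (intro emeasure_measure_of_sigma) (auto simp: measure_space_def)


section \<open>Differential forms and currents\<close>

primrec iter_partial ::
    "'n::finite list \<Rightarrow> (real ^ 'n \<Rightarrow> 'b::real_normed_vector) \<Rightarrow> real ^ 'n \<Rightarrow> 'b" where
  "iter_partial [] f = f"
| "iter_partial (i # js) f = (\<lambda>x. frechet_derivative (iter_partial js f) (at x) (axis i 1))"

definition smooth :: "(real ^ 'n::finite \<Rightarrow> 'b::real_normed_vector) \<Rightarrow> bool" where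
  "smooth f \<longleftrightarrow> (\<forall>js. iter_partial js f differentiable_on UNIV)"

type_synonym 'n form = "real ^ 'n \<Rightarrow> 'n ext"

definition test_forms :: "nat \<Rightarrow> 'n::finite form set" where
  "test_forms k = {\<omega>. smooth \<omega> \<and> compact (closure {x. \<omega> x \<noteq> 0}) \<and> range \<omega> \<subseteq> multivectors k}"

definition ext_deriv :: "'n::{finite,linorder} form \<Rightarrow> 'n form" where
  "ext_deriv \<omega> = (\<lambda>x. \<Sum>i\<in>UNIV. axis {i} 1 \<and>\<^sub>e frechet_derivative \<omega> (at x) (axis i 1))"

definition pullback ::
    "(real ^ 'm::{finite,linorder} \<Rightarrow> real ^ 'n::{finite,linorder}) \<Rightarrow> 'n form \<Rightarrow> 'm form" where
  "pullback f \<omega> = (\<lambda>x. \<chi> A. \<omega> (f x) \<bullet>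
     wedge_list (map (\<lambda>a. frechet_derivative f (at x) (axis a 1)) (sorted_list_of_set A)))"

text \<open>
  A \<open>k\<close>-dimensional current is a functional on \<open>test_forms k\<close>.  All currents below are given the value
  \<open>0\<close> on every other argument, so that equality of currents is equality of functions.
\<close>

type_synonym 'n current = "'n form \<Rightarrow> real"

definition boundary :: "nat \<Rightarrow> 'n::{finite,linorder} current \<Rightarrow> 'n current" where
  "boundary k T = (\<lambda>\<omega>. if \<omega> \<in> test_forms (k - 1) then T (ext_deriv \<omega>) else 0)"

text \<open>Meaningful for smooth proper \<open>f\<close>, where pullback preserves test forms.\<close>

definition pushforward ::
    "nat \<Rightarrow> (real ^ 'm::{finite,linorder} \<Rightarrow> real ^ 'n::{finite,linorder}) \<Rightarrow>
       'm current \<Rightarrow> 'n current" where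
  "pushforward k f T = (\<lambda>\<omega>. if \<omega> \<in> test_forms k then T (pullback f \<omega>) else 0)"


section \<open>Polyhedral chains\<close>

text \<open>
  A simplex is given by the list of its vertices \<open>u\<^sub>0, \<dots>, u\<^sub>k\<close>; \<open>map2 (-) (tl us) us\<close> is the list
  \<open>u\<^sub>1 - u\<^sub>0, \<dots>, u\<^sub>k - u\<^bsub>k-1\<^esub>\<close>.  Since \<open>sgn \<xi> = \<xi> /\<^sub>R norm \<xi>\<close> and \<open>sgn 0 = 0\<close>, a degenerate simplex
  has orientation \<open>0\<close> and gives the zero current.
\<close>

definition orientation :: "(real ^ 'n::{finite,linorder}) list \<Rightarrow> 'n ext" where
  "orientation us = sgn (wedge_list (map2 (-) (tl us) us))"

definition simplex_current :: "nat \<Rightarrow> (real ^ 'n::{finite,linorder}) list \<Rightarrow> 'n current" where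
  "simplex_current k us = (\<lambda>\<omega>. if \<omega> \<in> test_forms k
     then (LINT x:convex hull (set us)|hausdorff k. \<omega> x \<bullet> orientation us) else 0)"

definition nondegenerate_simplex :: "nat \<Rightarrow> (real ^ 'n::finite) list \<Rightarrow> bool" where
  "nondegenerate_simplex k us \<longleftrightarrow>
     length us = Suc k \<and> distinct us \<and> \<not> affine_dependent (set us)"

text \<open>The list \<open>[(a\<^sub>1, \<Delta>\<^sub>1), \<dots>, (a\<^sub>m, \<Delta>\<^sub>m)]\<close> represents the current \<open>\<Sum>i. a\<^sub>i \<Delta>\<^sub>i\<close>.\<close>

type_synonym 'n chain = "(real \<times> (real ^ 'n) list) list"

definition represents :: "nat \<Rightarrow> 'n::{finite,linorder} chain \<Rightarrow> 'n current \<Rightarrow> bool" where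
  "represents k c T \<longleftrightarrow> (\<forall>(a, us)\<in>set c. nondegenerate_simplex k us) \<and>
     T = (\<lambda>\<omega>. \<Sum>(a, us)\<leftarrow>c. a * simplex_current k us \<omega>)"

definition polyhedral_chains :: "nat \<Rightarrow> 'n::{finite,linorder} current set" where
  "polyhedral_chains k = {T. \<exists>c. represents k c T}"

definition chain_density :: "'n::{finite,linorder} chain \<Rightarrow> real ^ 'n::{finite,linorder} \<Rightarrow> 'n ext" where
  "chain_density c x = (\<Sum>(a, us)\<leftarrow>c. (a * indicator (convex hull (set us)) x) *\<^sub>R orientation us)"

definition chain_mass :: "nat \<Rightarrow> 'n::{finite,linorder} chain \<Rightarrow> real" where
  "chain_mass k c = (LINT x|hausdorff k. norm (chain_density c x))"

definition chain_energy ::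
    "nat \<Rightarrow> ('n::{finite,linorder} ext \<Rightarrow> real) \<Rightarrow> 'n chain \<Rightarrow> real" where
  "chain_energy k F c = (LINT x:{x. norm (chain_density c x) > 0}|hausdorff k.
     norm (chain_density c x) * F (sgn (chain_density c x)))"

text \<open>
  Mass and energy of a representation depend only on the represented current, since the density of
  a representation is determined almost everywhere by the current.
\<close>

definition mass :: "nat \<Rightarrow> 'n::{finite,linorder} current \<Rightarrow> real" where
  "mass k T = chain_mass k (SOME c. represents k c T)"

definition energy ::
    "nat \<Rightarrow> ('n::{finite,linorder} ext \<Rightarrow> real) \<Rightarrow> 'n current \<Rightarrow> real" where
  "energy k F T = chain_energy k F (SOME c. represents k c T)"


section \<open>Test pairs and ellipticity\<close>

definition orthogonal_projection :: "(real ^ 'n::finite \<Rightarrow> real ^ 'k::finite) \<Rightarrow> bool" where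
  "orthogonal_projection p \<longleftrightarrow> linear p \<and> p \<circ> adjoint p = id"

definition unit_cube_current :: "'k::{finite,linorder} current" where
  "unit_cube_current = (\<lambda>\<omega>. if \<omega> \<in> test_forms CARD('k)
     then (LINT x:{x. \<forall>i. 0 \<le> x $ i \<and> x $ i \<le> 1}|hausdorff CARD('k).
       \<omega> x \<bullet> wedge_list (map (\<lambda>i. axis i 1) (sorted_list_of_set (UNIV :: 'k set))))
     else 0)"

definition polyhedral_test_pairs ::
    "'k::{finite,linorder} itself \<Rightarrow> ('n::{finite,linorder} current \<times> 'n current) set" where
  "polyhedral_test_pairs _ = {(S, D). S \<in> polyhedral_chains CARD('k) \<and>
     (\<exists>p :: real ^ 'n::{finite,linorder} \<Rightarrow> real ^ 'k::{finite,linorder}. orthogonal_projection p \<and>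
        D = pushforward CARD('k) (adjoint p) unit_cube_current) \<and>
     boundary CARD('k) S = boundary CARD('k) D}"

definition AUE ::
    "nat \<Rightarrow> ('n::{finite,linorder} current \<times> 'n current) set \<Rightarrow> real \<Rightarrow> ('n ext \<Rightarrow> real) \<Rightarrow> bool" where
  "AUE k P c F \<longleftrightarrow>
     (\<forall>(S, D)\<in>P. energy k F S - energy k F D \<ge> c * (mass k S - mass k D))"

definition UPC :: "nat \<Rightarrow> real \<Rightarrow> ('n::{finite,linorder} ext \<Rightarrow> real) \<Rightarrow> bool" where
  "UPC k c F \<longleftrightarrow>
     (\<forall>(d::nat) (m :: nat \<Rightarrow> real) (\<eta> :: nat \<Rightarrow> 'n ext).
        d > 0 \<and> (\<forall>i\<in>{1..d}. m i > 0) \<and> (\<forall>i\<in>{0..d}. \<eta> i \<in> oriented_grassmannian k) \<and>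
        \<eta> 0 = (\<Sum>i=1..d. m i *\<^sub>R \<eta> i) \<longrightarrow>
        (\<Sum>i=1..d. m i * F (\<eta> i)) - F (\<eta> 0) \<ge>
          c * ((\<Sum>i=1..d. m i * norm (\<eta> i)) - norm (\<eta> 0)))"

end

(*
  Stokes' theorem for a prism shows that the boundary of the parallelepiped spanned by w 1, ..., w k
  is multilinear and alternating in w modulo the differences of translates, which become boundaries
  of chains of small mass when averaged over many translations.  It therefore depends, modulo such
  negligible functionals, only on the k-vector of w, and a relation eta_0 = sum_i m_i eta_i makes the
  boundary of the sum of the parallelepipeds m_i P_i minus that of a unit cube P_0 negligible.
  Placing N^k translated copies along the subdivision of a cube of side N, averaging and rescaling
  gives polyhedral competitors of P_0 of energy at most sum_i m_i F(eta_i) + o(1), so that the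
  hypothesis yields F(eta_0) - c_1 <= sum_i m_i (F(eta_i) - c_1).

  Here xi |-> |xi| (F(xi / |xi|) - c_1) has to be subadditive along a common tangent plane, where
  pieces may cancel; this amounts to F(xi) + F(-xi) >= 2 c_1, and follows from the hypothesis with a
  competitor that contains the cube twice and a parallel copy of the opposite orientation.  Hausdorff
  measure enters only through its translation invariance, which makes it proportional to Lebesgue
  measure on every k-plane; the same constant occurs on isometric planes.
*)
theory Submission
  imports Defs "HOL-Library.Function_Algebras"
begin

section \<open>Multilinear algebra of k-vectors and frames\<close>

section \<open>Exterior and interior multiplication\<close>

text \<open>The hypothesis speaks only of chains whose boundary agrees exactly with that of a cube,
  so nothing may be lost in a limit: every error has to be filled by a chain of small mass. This is
  why the proof computes with boundaries as functionals and keeps, for each error, an explicit list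
  of pieces that bounds it. Parallelepipeds with equal k-vectors have different boundaries in
  general; they become comparable after averaging over translations, because sums of differences of
  translates telescope. Enlarging the cube then pays for the remaining displacement: moving a cube
  of side N by a bounded vector sweeps out lateral mass of order N^(k-1), against N^k for the cube
  itself. The Lipschitz condition enters as a bound |\<phi>(\<xi>)| \<le> C |\<xi>| for the
  homogeneous extension of F - c_1, so that small mass means small energy; k < n provides the normal
  direction for the parallel copy; and c_2 < c_1 enters in the last lines, where the inequality with
  c_1 is weakened by means of \<Sum> m_i \<ge> 1.\<close>

definition insertion_sign :: "'n::linorder \<Rightarrow> 'n set \<Rightarrow> real" where
  "insertion_sign i A = (- 1) ^ card {a \<in> A. a < i}"

text \<open>For \<open>i\<close> outside \<open>A\<close>, \<open>insertion_sign i A\<close> is the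
  sign of the permutation that sorts \<open>i\<close> into \<open>A\<close>, that is, the sign that
  relates e_i \<and> e_A to the basis vector of the enlarged set. A new element below
  \<open>i\<close> adds one transposition; this is the source of the anticommutation signs.\<close>

lemma insertion_sign_insert:
  fixes A :: "'n::{finite,linorder} set"
  assumes "j \<notin> A"
  shows "insertion_sign i (insert j A) = (if j < i then - insertion_sign i A else insertion_sign i A)"
proof -
  have "{a \<in> insert j A. a < i} = (if j < i then insert j {a \<in> A. a < i} else {a \<in> A. a < i})"
    by auto
  then show ?thesis using assms by (simp add: insertion_sign_def)
qed

lemma insertion_sign_square [simp]: "insertion_sign i A * insertion_sign i A = 1"
  by (simp add: insertion_sign_def flip: power_add)

lemma ext_of_vec_nth: "ext_of_vec v $ A = (\<Sum>i\<in>UNIV. if A = {i} then v $ i else 0)"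
  unfolding ext_of_vec_def by (auto simp: axis_def intro!: sum.cong)

lemma ext_of_vec_singleton: "ext_of_vec v $ {i} = v $ i"
  unfolding ext_of_vec_nth by (simp add: eq_commute)

text \<open>A vector has coordinates only at singletons, so the sum over all subsets in
  \<open>wedge\<close> collapses to a sum over the elements of \<open>C\<close>.\<close>

lemma wedge_vec_nth:
  fixes v :: "real ^ 'n::{finite,linorder}"
  shows "(ext_of_vec v \<and>\<^sub>e \<xi>) $ C
    = (\<Sum>i\<in>C. insertion_sign i (C - {i}) * v $ i * \<xi> $ (C - {i}))"
proof -
  have sgn: "wedge_sign {i} B = insertion_sign i B" for i and B :: "'n set"
  proof -
    have "{(a, b). a \<in> {i} \<and> b \<in> B \<and> b < a} = Pair i ` {a \<in> B. a < i}" by auto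
    then show ?thesis unfolding wedge_sign_def insertion_sign_def
      by (simp add: card_image inj_on_def)
  qed
  have "(ext_of_vec v \<and>\<^sub>e \<xi>) $ C
      = (\<Sum>A\<in>Pow C. wedge_sign A (C - A) * ext_of_vec v $ A * \<xi> $ (C - A))"
    by (simp add: wedge_def)
  also have "\<dots> = (\<Sum>A\<in>(\<lambda>i. {i}) ` C. wedge_sign A (C - A) * ext_of_vec v $ A * \<xi> $ (C - A))"
  proof (rule sum.mono_neutral_right)
    show "\<forall>A\<in>Pow C - (\<lambda>i. {i}) ` C. wedge_sign A (C - A) * ext_of_vec v $ A * \<xi> $ (C - A) = 0"
    proof
      fix A assume "A \<in> Pow C - (\<lambda>i. {i}) ` C"
      then have "A \<noteq> {i}" for i by auto
      then have "ext_of_vec v $ A = 0" unfolding ext_of_vec_nth by simp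
      then show "wedge_sign A (C - A) * ext_of_vec v $ A * \<xi> $ (C - A) = 0" by simp
    qed
  qed auto
  also have "\<dots> = (\<Sum>i\<in>C. insertion_sign i (C - {i}) * v $ i * \<xi> $ (C - {i}))"
    by (subst sum.reindex) (auto simp: sgn ext_of_vec_singleton inj_on_def)
  finally show ?thesis .
qed

text \<open>Interior multiplication by \<open>v\<close>, the adjoint of exterior multiplication by
  \<open>v\<close>. Inner products of wedges are evaluated below by moving a factor to the other
  side as a contraction.\<close>

definition contract :: "real ^ 'n::{finite,linorder} \<Rightarrow> 'n ext \<Rightarrow> 'n ext" where
  "contract v \<xi> = (\<chi> B. \<Sum>i\<in>- B. insertion_sign i B * v $ i * \<xi> $ insert i B)"

lemma linear_wedge_vec: "linear (\<lambda>\<xi>. ext_of_vec v \<and>\<^sub>e \<xi>)"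
  by (rule linearI) (simp_all add: vec_eq_iff wedge_vec_nth algebra_simps sum.distrib sum_distrib_left)

lemma linear_wedge_vec_left: "linear (\<lambda>v. ext_of_vec v \<and>\<^sub>e \<xi>)"
  by (rule linearI) (simp_all add: vec_eq_iff wedge_vec_nth algebra_simps sum.distrib sum_distrib_left)

lemmas wedge_vec_linear_simps =
  linear_add[OF linear_wedge_vec] linear_scale[OF linear_wedge_vec] linear_0[OF linear_wedge_vec]
  linear_neg[OF linear_wedge_vec] linear_diff[OF linear_wedge_vec]
  linear_add[OF linear_wedge_vec_left] linear_scale[OF linear_wedge_vec_left]
  linear_0[OF linear_wedge_vec_left] linear_neg[OF linear_wedge_vec_left]
  linear_diff[OF linear_wedge_vec_left]

text \<open>Both sides sum over a set together with one of its elements: the pair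
  \<open>(C, i)\<close> on the left is matched with \<open>(C - {i}, i)\<close> on the
  right.\<close>

lemma inner_wedge_contract: "(ext_of_vec v \<and>\<^sub>e \<xi>) \<bullet> \<eta> = \<xi> \<bullet> contract v \<eta>"
proof -
  have "(ext_of_vec v \<and>\<^sub>e \<xi>) \<bullet> \<eta>
      = (\<Sum>(C, i)\<in>Sigma UNIV (\<lambda>C. C). insertion_sign i (C - {i}) * v $ i * \<xi> $ (C - {i}) * \<eta> $ C)"
    by (simp add: inner_vec_def wedge_vec_nth sum.Sigma sum_distrib_right)
  also have "\<dots> = (\<Sum>(B, i)\<in>Sigma UNIV (\<lambda>B. - B). \<xi> $ B * (insertion_sign i B * v $ i * \<eta> $ insert i B))"
    by (rule sum.reindex_bij_witness[of _ "\<lambda>(B, i). (insert i B, i)" "\<lambda>(C, i). (C - {i}, i)"])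
      (auto simp: insert_absorb)
  also have "\<dots> = \<xi> \<bullet> contract v \<eta>"
    by (simp add: inner_vec_def contract_def sum.Sigma sum_distrib_left)
  finally show ?thesis .
qed

text \<open>Contraction is an antiderivation. Terms that insert \<open>i\<close> and remove a
  different \<open>j\<close> occur in both products with opposite signs; the diagonal terms supply
  the part of \<open>u \<bullet> v\<close> outside \<open>B\<close> in the first product and the
  part inside \<open>B\<close> in the second.\<close>

lemma contract_wedge:
  "contract u (ext_of_vec v \<and>\<^sub>e \<xi>) = (u \<bullet> v) *\<^sub>R \<xi> - ext_of_vec v \<and>\<^sub>e contract u \<xi>"
proof -
  have "contract u (ext_of_vec v \<and>\<^sub>e \<xi>) $ B + (ext_of_vec v \<and>\<^sub>e contract u \<xi>) $ B
      = (u \<bullet> v) * \<xi> $ B" for B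
  proof -
    define s where "s i j = (insertion_sign j (B - {j}) * v $ j)
        * (insertion_sign i (B - {j}) * u $ i * \<xi> $ insert i (B - {j}))" for i j
    have "contract u (ext_of_vec v \<and>\<^sub>e \<xi>) $ B
        = (\<Sum>i\<in>- B. insertion_sign i B * u $ i *
             (\<Sum>j\<in>insert i B. insertion_sign j (insert i B - {j}) * v $ j * \<xi> $ (insert i B - {j})))"
      by (simp add: contract_def wedge_vec_nth)
    also have "\<dots> = (\<Sum>i\<in>- B. u $ i * v $ i * \<xi> $ B - (\<Sum>j\<in>B. s i j))"
    proof (rule sum.cong[OF refl])
      fix i assume i: "i \<in> - B"
      have "insertion_sign i B * u $ i * (insertion_sign j (insert i B - {j}) * v $ j * \<xi> $ (insert i B - {j}))
          = - s i j" if j: "j \<in> B" for j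
      proof -
        have "i \<noteq> j" using i j by auto
        have 1: "insert i B - {j} = insert i (B - {j})" using i j by auto
        have "insertion_sign i B = insertion_sign i (insert j (B - {j}))" using j by (simp add: insert_absorb)
        also have "\<dots> = (if j < i then - insertion_sign i (B - {j}) else insertion_sign i (B - {j}))"
          by (rule insertion_sign_insert) simp
        finally have 2: "insertion_sign i B = (if j < i then - insertion_sign i (B - {j}) else insertion_sign i (B - {j}))" .
        have 3: "insertion_sign j (insert i (B - {j})) = (if i < j then - insertion_sign j (B - {j}) else insertion_sign j (B - {j}))"
          by (rule insertion_sign_insert) (use i in simp)
        show ?thesis unfolding 1 2 3 s_def using \<open>i \<noteq> j\<close> by auto
      qed
      then have "(\<Sum>j\<in>B. insertion_sign i B * u $ i * (insertion_sign j (insert i B - {j}) * v $ j * \<xi> $ (insert i B - {j})))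
          = - (\<Sum>j\<in>B. s i j)" by (simp add: sum_negf)
      moreover have "insert i B - {i} = B" using i by auto
      moreover have "insertion_sign i B * (insertion_sign i B * x) = x" for x
        by (simp flip: mult.assoc)
      ultimately show "insertion_sign i B * u $ i * (\<Sum>j\<in>insert i B. insertion_sign j (insert i B - {j}) * v $ j * \<xi> $ (insert i B - {j}))
          = u $ i * v $ i * \<xi> $ B - (\<Sum>j\<in>B. s i j)"
        using i by (subst sum.insert) (auto simp: sum_distrib_left algebra_simps)
    qed
    also have "\<dots> = (\<Sum>i\<in>- B. u $ i * v $ i) * \<xi> $ B - (\<Sum>j\<in>B. \<Sum>i\<in>- B. s i j)"
      by (simp add: sum_subtractf sum_distrib_right sum.swap[of s])
    finally have 1: "contract u (ext_of_vec v \<and>\<^sub>e \<xi>) $ B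
        = (\<Sum>i\<in>- B. u $ i * v $ i) * \<xi> $ B - (\<Sum>j\<in>B. \<Sum>i\<in>- B. s i j)" .
    have "(ext_of_vec v \<and>\<^sub>e contract u \<xi>) $ B = (\<Sum>j\<in>B. \<Sum>i\<in>- (B - {j}). s i j)"
      by (simp only: contract_def wedge_vec_nth s_def sum_distrib_left vec_lambda_beta)
    also have "\<dots> = (\<Sum>j\<in>B. u $ j * v $ j * \<xi> $ B + (\<Sum>i\<in>- B. s i j))"
    proof (rule sum.cong[OF refl])
      fix j assume j: "j \<in> B"
      have "- (B - {j}) = insert j (- B)" by auto
      moreover have "s j j = u $ j * v $ j * \<xi> $ B"
        using j insertion_sign_square[of j "B - {j}"] unfolding s_def
        by (simp add: insert_absorb mult.commute mult.left_commute)
      ultimately show "(\<Sum>i\<in>- (B - {j}). s i j) = u $ j * v $ j * \<xi> $ B + (\<Sum>i\<in>- B. s i j)"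
        using j by simp
    qed
    also have "\<dots> = (\<Sum>i\<in>B. u $ i * v $ i) * \<xi> $ B + (\<Sum>j\<in>B. \<Sum>i\<in>- B. s i j)"
      by (simp add: sum.distrib sum_distrib_right)
    finally have 2: "(ext_of_vec v \<and>\<^sub>e contract u \<xi>) $ B
        = (\<Sum>i\<in>B. u $ i * v $ i) * \<xi> $ B + (\<Sum>j\<in>B. \<Sum>i\<in>- B. s i j)" .
    have "u \<bullet> v = (\<Sum>i\<in>B. u $ i * v $ i) + (\<Sum>i\<in>- B. u $ i * v $ i)"
      by (simp add: inner_vec_def flip: sum.union_disjoint)
    then show ?thesis using 1 2 by (simp add: algebra_simps)
  qed
  then show ?thesis by (simp add: vec_eq_iff algebra_simps)
qed

text \<open>Inserting \<open>i\<close> and \<open>j\<close> in the two possible orders differs by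
  one transposition, so the terms for \<open>(i, j)\<close> and \<open>(j, i)\<close> are matched
  with opposite signs.\<close>

lemma wedge_vec_anticommute:
  fixes u v :: "real ^ 'n::{finite,linorder}"
  shows "ext_of_vec u \<and>\<^sub>e (ext_of_vec v \<and>\<^sub>e \<xi>) = - (ext_of_vec v \<and>\<^sub>e (ext_of_vec u \<and>\<^sub>e \<xi>))"
proof -
  have "(ext_of_vec u \<and>\<^sub>e (ext_of_vec v \<and>\<^sub>e \<xi>)) $ C = - (ext_of_vec v \<and>\<^sub>e (ext_of_vec u \<and>\<^sub>e \<xi>)) $ C" for C
  proof -
    define s where "s u v i j = insertion_sign i (C - {i}) * u $ i * (insertion_sign j (C - {i} - {j}) * v $ j * \<xi> $ (C - {i} - {j}))"
      for u v :: "real ^ 'n::{finite,linorder}" and i j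
    have exp: "(ext_of_vec u \<and>\<^sub>e (ext_of_vec v \<and>\<^sub>e \<xi>)) $ C = (\<Sum>(i, j)\<in>{(i, j). i \<in> C \<and> j \<in> C \<and> i \<noteq> j}. s u v i j)" for u v
    proof -
      have "{(i, j). i \<in> C \<and> j \<in> C \<and> i \<noteq> j} = Sigma C (\<lambda>i. C - {i})" by auto
      then show ?thesis
        by (simp add: wedge_vec_nth s_def sum.Sigma[symmetric] sum_distrib_left)
    qed
    have "s u v i j = - s v u j i" if "i \<in> C" "j \<in> C" "i \<noteq> j" for i j
    proof -
      define A where "A = C - {i} - {j}"
      have A: "C - {i} = insert j A" "C - {j} = insert i A" "i \<notin> A" "j \<notin> A" "C - {j} - {i} = A"
        using that unfolding A_def by auto
      have "s u v i j = insertion_sign i (insert j A) * u $ i * (insertion_sign j A * v $ j * \<xi> $ A)"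
        unfolding s_def A(1) using A(4) by simp
      moreover have "s v u j i = insertion_sign j (insert i A) * v $ j * (insertion_sign i A * u $ i * \<xi> $ A)"
        unfolding s_def A(2) using A(3) by simp
      ultimately show ?thesis using that A(3,4) insertion_sign_insert[of j A i] insertion_sign_insert[of i A j]
        by (cases "i < j") auto
    qed
    then have "(\<Sum>(i, j)\<in>{(i, j). i \<in> C \<and> j \<in> C \<and> i \<noteq> j}. s u v i j)
        = (\<Sum>(i, j)\<in>{(i, j). i \<in> C \<and> j \<in> C \<and> i \<noteq> j}. - s v u j i)"
      by (intro sum.cong) auto
    also have "\<dots> = (\<Sum>(i, j)\<in>{(i, j). i \<in> C \<and> j \<in> C \<and> i \<noteq> j}. - s v u i j)"
      by (rule sum.reindex_bij_witness[of _ "\<lambda>(i, j). (j, i)" "\<lambda>(i, j). (j, i)"]) auto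
    finally show ?thesis unfolding exp by (simp add: case_prod_unfold sum_negf)
  qed
  then show ?thesis by (simp add: vec_eq_iff)
qed

lemma wedge_vec_self: "ext_of_vec v \<and>\<^sub>e (ext_of_vec v \<and>\<^sub>e \<xi>) = 0"
proof -
  have "2 *\<^sub>R (ext_of_vec v \<and>\<^sub>e (ext_of_vec v \<and>\<^sub>e \<xi>)) = 0"
    using wedge_vec_anticommute[of v v \<xi>] by (simp add: scaleR_2 eq_neg_iff_add_eq_0)
  then show ?thesis by simp
qed

text \<open>The identity \<open>contract_wedge\<close> with \<open>u = v\<close>, paired with
  \<open>\<xi>\<close>, is a Pythagorean identity: the squared norms of the wedge and of the
  contraction add up to |v|^2 |\<xi>|^2.\<close>

lemma norm_wedge_vec_le: "norm (ext_of_vec v \<and>\<^sub>e \<xi>) \<le> norm v * norm \<xi>"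
proof -
  have "(ext_of_vec v \<and>\<^sub>e \<xi>) \<bullet> (ext_of_vec v \<and>\<^sub>e \<xi>) + contract v \<xi> \<bullet> contract v \<xi> = (v \<bullet> v) * (\<xi> \<bullet> \<xi>)"
    by (simp add: inner_wedge_contract contract_wedge inner_diff_right)
      (simp add: inner_commute[of \<xi>] inner_wedge_contract)
  then have "(norm (ext_of_vec v \<and>\<^sub>e \<xi>))\<^sup>2 + (norm (contract v \<xi>))\<^sup>2 = (norm v * norm \<xi>)\<^sup>2"
    by (simp add: power2_norm_eq_inner power_mult_distrib)
  then have "(norm (ext_of_vec v \<and>\<^sub>e \<xi>))\<^sup>2 \<le> (norm v * norm \<xi>)\<^sup>2"
    using zero_le_power2[of "norm (contract v \<xi>)"] by linarith
  then show ?thesis by (rule power2_le_imp_le) simp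
qed

lemma wedge_list_simps [simp]:
  "wedge_list [] = axis {} 1"
  "wedge_list (v # vs) = ext_of_vec v \<and>\<^sub>e wedge_list vs"
  by (simp_all add: wedge_list_def)

lemma wedge_list_multivectors: "wedge_list vs \<in> multivectors (length vs)"
proof (induction vs)
  case Nil
  then show ?case by (auto simp: multivectors_def axis_def)
next
  case (Cons v vs)
  have "(ext_of_vec v \<and>\<^sub>e wedge_list vs) $ A = 0" if "card A \<noteq> Suc (length vs)" for A
    unfolding wedge_vec_nth
  proof (rule sum.neutral, rule ballI)
    fix i assume "i \<in> A"
    then have "card (A - {i}) \<noteq> length vs" using that
      by (metis card.remove finite)
    then show "insertion_sign i (A - {i}) * v $ i * wedge_list vs $ (A - {i}) = 0"
      using Cons by (simp add: multivectors_def)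
  qed
  then show ?case by (simp add: multivectors_def)
qed

text \<open>Anticommutation moves one copy of \<open>v\<close> next to the other at the cost of
  signs, where \<open>wedge_vec_self\<close> applies.\<close>

lemma wedge_list_not_distinct: "wedge_list (xs @ v # ys @ v # zs) = 0"
proof -
  have "ext_of_vec v \<and>\<^sub>e wedge_list (ys @ v # zs) = 0"
  proof (induction ys)
    case (Cons y ys)
    have "ext_of_vec v \<and>\<^sub>e wedge_list ((y # ys) @ v # zs)
        = - (ext_of_vec y \<and>\<^sub>e (ext_of_vec v \<and>\<^sub>e wedge_list (ys @ v # zs)))"
      by (simp add: wedge_vec_anticommute[of v y])
    then show ?case by (simp add: Cons wedge_vec_linear_simps)
  qed (simp add: wedge_vec_self)
  then show ?thesis by (induction xs) (simp_all add: wedge_vec_linear_simps)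
qed

lemma contract_wedge_list_orthogonal:
  "(\<And>v. v \<in> set vs \<Longrightarrow> u \<bullet> v = 0) \<Longrightarrow> contract u (wedge_list vs) = 0"
proof (induction vs)
  case Nil
  then show ?case by (simp add: contract_def vec_eq_iff axis_def)
next
  case (Cons v vs)
  then show ?case by (simp add: contract_wedge wedge_vec_linear_simps)
qed

text \<open>Contraction removes \<open>vs ! j\<close> with the sign of its position, and moving
  \<open>t\<close> from the front to the vacant place produces the same sign again, so the sum
  carries no signs. This turns the coordinate form of closedness into a statement about
  frames.\<close>

lemma wedge_contract_wedge_list:
  "ext_of_vec t \<and>\<^sub>e contract u (wedge_list vs)
    = (\<Sum>j<length vs. (u \<bullet> vs ! j) *\<^sub>R wedge_list (vs[j := t]))"
proof (induction vs)
  case Nil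
  then show ?case by (simp add: contract_def vec_eq_iff axis_def wedge_vec_nth)
next
  case (Cons v vs)
  have "ext_of_vec t \<and>\<^sub>e contract u (wedge_list (v # vs))
      = (u \<bullet> v) *\<^sub>R wedge_list (t # vs) + ext_of_vec v \<and>\<^sub>e (ext_of_vec t \<and>\<^sub>e contract u (wedge_list vs))"
    by (simp add: contract_wedge wedge_vec_linear_simps wedge_vec_anticommute[of t v])
  also have "\<dots> = (\<Sum>j<length (v # vs). (u \<bullet> (v # vs) ! j) *\<^sub>R wedge_list ((v # vs)[j := t]))"
    by (simp del: sum.lessThan_Suc add: Cons sum.lessThan_Suc_shift linear_sum[OF linear_wedge_vec] wedge_vec_linear_simps o_def)
  finally show ?case .
qed

section \<open>Alternating multilinear maps modulo a subspace\<close>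

text \<open>Multilinearity and vanishing on repeated arguments, each up to an element of
  \<open>N\<close>: the boundary of a parallelepiped obeys these laws only modulo negligible
  functionals.\<close>

definition alternating_mod :: "'v::real_vector set \<Rightarrow> (('k \<Rightarrow> 'a::real_vector) \<Rightarrow> 'v) \<Rightarrow> bool" where
  "alternating_mod N g \<longleftrightarrow> subspace N
    \<and> (\<forall>w i x y. g (w(i := x + y)) - g (w(i := x)) - g (w(i := y)) \<in> N)
    \<and> (\<forall>w i r x. g (w(i := r *\<^sub>R x)) - r *\<^sub>R g (w(i := x)) \<in> N)
    \<and> (\<forall>w i j. i \<noteq> j \<longrightarrow> w i = w j \<longrightarrow> g w \<in> N)"

text \<open>Polarization: the vanishing with \<open>?a + ?b\<close> in both slots is
  expanded.\<close>

lemma alternating_mod_swap: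
  assumes g: "alternating_mod N g" and "i \<noteq> j"
  shows "g (w(i := w j, j := w i)) + g w \<in> N"
proof -
  note N = g[unfolded alternating_mod_def, THEN conjunct1]
  note add = g[unfolded alternating_mod_def, THEN conjunct2, THEN conjunct1, rule_format]
  note eq = g[unfolded alternating_mod_def, THEN conjunct2, THEN conjunct2, THEN conjunct2, rule_format]
  define h where "h x y = g (w(i := x, j := y))" for x y
  have h0: "h x x \<in> N" for x unfolding h_def by (rule eq[of i j]) (use \<open>i \<noteq> j\<close> in auto)
  have h1: "h x (y + z) - h x y - h x z \<in> N" for x y z unfolding h_def by (rule add)
  have h2: "h (x + y) z - h x z - h y z \<in> N" for x y z
    using add[of "w(j := z)" i x y] \<open>i \<noteq> j\<close> unfolding h_def by (simp add: fun_upd_twist)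
  let ?a = "w i" let ?b = "w j"
  have "(h (?a + ?b) (?a + ?b)) - (h (?a + ?b) (?a + ?b) - h (?a + ?b) ?a - h (?a + ?b) ?b)
     - (h (?a + ?b) ?a - h ?a ?a - h ?b ?a) - (h (?a + ?b) ?b - h ?a ?b - h ?b ?b) - h ?a ?a - h ?b ?b \<in> N"
    by (intro subspace_diff[OF N] h0 h1 h2)
  then have "h ?b ?a + h ?a ?b \<in> N" by (simp add: algebra_simps)
  moreover have "h ?a ?b = g w" by (simp add: h_def)
  ultimately show ?thesis by (simp add: h_def)
qed

text \<open>Multilinearity reduces the arguments to members of the spanning family, and swaps reduce
  these to increasing selections. This is the uniqueness part of the universal property of the
  exterior power.\<close>

lemma alternating_mod_basis:
  fixes g :: "('k::{finite,linorder} \<Rightarrow> 'a::real_vector) \<Rightarrow> 'v::real_vector"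
    and e :: "'m::{finite,linorder} \<Rightarrow> 'a"
  assumes g: "alternating_mod N g"
    and mono: "\<And>\<phi> :: 'k \<Rightarrow> 'm. strict_mono \<phi> \<Longrightarrow> g (e \<circ> \<phi>) \<in> N"
    and w: "range w \<subseteq> span (range e)"
  shows "g w \<in> N"
proof -
  note N = g[unfolded alternating_mod_def, THEN conjunct1]
  note add = g[unfolded alternating_mod_def, THEN conjunct2, THEN conjunct1, rule_format]
  note scale = g[unfolded alternating_mod_def, THEN conjunct2, THEN conjunct2, THEN conjunct1, rule_format]
  note eq = g[unfolded alternating_mod_def, THEN conjunct2, THEN conjunct2, THEN conjunct2, rule_format]
  define rk where "rk i = card {..<i}" for i :: 'k
  define rm where "rm i = card {..<i}" for i :: 'm
  have rk: "rk i < rk j" if "i < j" for i j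
    unfolding rk_def by (rule psubset_card_mono) (use that in auto)
  have rm: "rm i < rm j" if "i < j" for i j
    unfolding rm_def by (rule psubset_card_mono) (use that in auto)
  \<comment> \<open>A potential takes the place of sorting: by the rearrangement inequality,
    exchanging the values at an inversion increases it strictly, so a bad selection of maximal
    potential has no inversion; selections with repeated values are never bad.\<close>
  define pot where "pot \<phi> = (\<Sum>i\<in>UNIV. rk i * rm (\<phi> i))" for \<phi> :: "'k \<Rightarrow> 'm"
  have basis: "g (e \<circ> \<phi>) \<in> N" for \<phi> :: "'k \<Rightarrow> 'm"
  proof (rule ccontr)
    assume "g (e \<circ> \<phi>) \<notin> N"
    then have ne: "{\<phi> :: 'k \<Rightarrow> 'm. g (e \<circ> \<phi>) \<notin> N} \<noteq> {}" (is "?B \<noteq> {}") by auto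
    have "finite ?B" by (rule finite_subset[OF subset_UNIV]) simp
    then obtain \<psi> where \<psi>: "\<psi> \<in> ?B" "\<And>\<phi>. \<phi> \<in> ?B \<Longrightarrow> pot \<phi> \<le> pot \<psi>"
    proof -
      have "Max (pot ` ?B) \<in> pot ` ?B" using \<open>finite ?B\<close> ne by (intro Max_in) auto
      then obtain \<psi> where \<psi>: "\<psi> \<in> ?B" "Max (pot ` ?B) = pot \<psi>" by blast
      have "pot \<phi> \<le> pot \<psi>" if "\<phi> \<in> ?B" for \<phi>
        unfolding \<psi>(2)[symmetric] using \<open>finite ?B\<close> that by (intro Max_ge) auto
      with \<psi>(1) show thesis by (rule that)
    qed
    have "\<not> strict_mono \<psi>" using mono \<psi>(1) by auto
    then obtain i j where ij: "i < j" "\<psi> j \<le> \<psi> i" unfolding strict_mono_def by force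
    have "\<psi> j \<noteq> \<psi> i" using \<psi>(1) eq[OF less_imp_neq[OF ij(1)], of "e \<circ> \<psi>"] by auto
    then have lt: "\<psi> j < \<psi> i" using ij by simp
    define \<rho> where "\<rho> = \<psi>(i := \<psi> j, j := \<psi> i)"
    have "e \<circ> \<rho> = (e \<circ> \<psi>)(i := (e \<circ> \<psi>) j, j := (e \<circ> \<psi>) i)" by (auto simp: \<rho>_def)
    then have "g (e \<circ> \<rho>) + g (e \<circ> \<psi>) \<in> N"
      using alternating_mod_swap[OF g, of i j "e \<circ> \<psi>"] ij(1) by simp
    then have "\<rho> \<in> ?B" using \<psi>(1) subspace_diff[OF N, of "g (e \<circ> \<rho>) + g (e \<circ> \<psi>)" "g (e \<circ> \<rho>)"] by auto
    then have le: "pot \<rho> \<le> pot \<psi>" by (rule \<psi>(2))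
    have split: "pot \<phi> = rk i * rm (\<phi> i) + rk j * rm (\<phi> j) + (\<Sum>l\<in>UNIV - {i, j}. rk l * rm (\<phi> l))" for \<phi>
      unfolding pot_def using ij(1)
      by (subst sum.subset_diff[of "{i, j}"]) auto
    have \<rho>: "\<rho> i = \<psi> j" "\<rho> j = \<psi> i" using ij(1) by (auto simp: \<rho>_def)
    have "(\<Sum>l\<in>UNIV - {i, j}. rk l * rm (\<rho> l)) = (\<Sum>l\<in>UNIV - {i, j}. rk l * rm (\<psi> l))"
      by (rule sum.cong) (auto simp: \<rho>_def)
    then have "rk i * rm (\<psi> j) + rk j * rm (\<psi> i) \<le> rk i * rm (\<psi> i) + rk j * rm (\<psi> j)"
      using le[unfolded split \<rho>] by linarith
    moreover obtain a where "rk j = rk i + a" "a > 0" using less_imp_add_positive[OF rk[OF ij(1)]] by metis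
    moreover obtain b where "rm (\<psi> i) = rm (\<psi> j) + b" "b > 0" using less_imp_add_positive[OF rm[OF lt]] by metis
    ultimately show False by (simp add: algebra_simps)
  qed
  \<comment> \<open>\<open>I\<close> contains the slots whose entries need not belong to the family.
    For one such slot the vectors that may stand in it form a subspace \<open>V\<close> that
    contains the family.\<close>
  have "g w \<in> N" if "finite I" "\<forall>i. i \<notin> I \<longrightarrow> w i \<in> range e" "range w \<subseteq> span (range e)" for I w
    using that
  proof (induction I arbitrary: w rule: finite_induct)
    case empty
    then have "\<exists>\<phi>. \<forall>i. w i = e (\<phi> i)" by (intro choice) auto
    then obtain \<phi> where "w = e \<circ> \<phi>" by (auto simp: fun_eq_iff)
    then show ?case using basis[of \<phi>] by (simp only:)
  next
    case (insert i I)
    define V where "V = {v. g (w(i := v)) \<in> N}"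
    have V: "subspace V"
    proof (rule subspaceI)
      show "0 \<in> V" using scale[of w i 0 0] by (simp add: V_def)
      show "x + y \<in> V" if "x \<in> V" "y \<in> V" for x y
        using subspace_add[OF N add[of w i x y], of "g (w(i := x)) + g (w(i := y))"] that
        by (simp add: V_def subspace_add[OF N] algebra_simps)
      show "c *\<^sub>R x \<in> V" if "x \<in> V" for c x
        using subspace_add[OF N scale[of w i c x], of "c *\<^sub>R g (w(i := x))"] that
        by (simp add: V_def subspace_scale[OF N])
    qed
    have "e m \<in> V" for m unfolding V_def mem_Collect_eq
      by (rule insert.IH) (use insert.prems in \<open>auto simp: span_base\<close>)
    then have "span (range e) \<subseteq> V" by (intro span_minimal V) auto
    then have "w i \<in> V" using insert.prems(2) by auto
    then show ?case by (simp add: V_def)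
  qed
  from this[of UNIV] show ?thesis using w by simp
qed

section \<open>Frames\<close>

text \<open>A frame is a family indexed by a finite linear order \<open>'k\<close>, so that k is
  \<open>CARD('k)\<close>. Compared with lists, a slot is changed by a function update and length
  conditions become part of the type.\<close>

definition frame_wedge :: "('k::{finite,linorder} \<Rightarrow> real ^ 'n::{finite,linorder}) \<Rightarrow> 'n ext" where
  "frame_wedge w = wedge_list (map w (sorted_list_of_set UNIV))"

lemma frame_of_list:
  fixes vs :: "'a list"
  assumes "length vs = CARD('k::{finite,linorder})"
  obtains w :: "'k::{finite,linorder} \<Rightarrow> 'a" where "map w (sorted_list_of_set UNIV) = vs"
proof -
  let ?ks = "sorted_list_of_set (UNIV :: 'k set)"
  have "\<exists>w. \<forall>j < CARD('k). w (?ks ! j) = vs ! j"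
  proof (intro exI allI impI)
    fix j assume "j < CARD('k)"
    then have "(THE l. l < CARD('k) \<and> ?ks ! l = ?ks ! j) = j"
      by (intro the_equality) (auto simp: nth_eq_iff_index_eq)
    then show "(\<lambda>i. vs ! (THE l. l < CARD('k) \<and> ?ks ! l = i)) (?ks ! j) = vs ! j" by simp
  qed
  then obtain w where "\<forall>j < CARD('k). w (?ks ! j) = vs ! j" by auto
  then have "map w ?ks = vs" using assms by (intro nth_equalityI) auto
  then show thesis by (rule that)
qed

lemma frame_split:
  fixes i :: "'k::{finite,linorder}"
  obtains A B where "sorted_list_of_set (UNIV :: 'k set) = A @ i # B"
    "i \<notin> set A" "i \<notin> set B"
proof -
  have "i \<in> set (sorted_list_of_set (UNIV :: 'k set))" by simp
  then obtain A B where "sorted_list_of_set (UNIV :: 'k set) = A @ i # B"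
    by (meson split_list)
  moreover have "distinct (A @ i # B)" using calculation distinct_sorted_list_of_set[of UNIV] by metis
  ultimately show thesis using that by auto
qed

lemma linear_wedge_list: "linear (\<lambda>v. wedge_list (xs @ v # ys))"
proof (induction xs)
  case (Cons x xs)
  then show ?case
    using linear_compose[OF Cons linear_wedge_vec[of x]] by (simp add: o_def)
qed (simp add: linear_wedge_vec_left)

lemma linear_frame_wedge: "linear (\<lambda>v. frame_wedge (w(i := v)))"
proof -
  obtain A B where "sorted_list_of_set UNIV = A @ i # B" "i \<notin> set A" "i \<notin> set B" by (rule frame_split)
  then have "(\<lambda>v. frame_wedge (w(i := v))) = (\<lambda>v. wedge_list (map w A @ v # map w B))"
    by (auto simp: frame_wedge_def fun_eq_iff intro!: arg_cong[where f = wedge_list] map_cong)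
  then show ?thesis by (simp add: linear_wedge_list)
qed

lemma frame_wedge_eq_0:
  assumes "i \<noteq> j" "w i = w j"
  shows "frame_wedge w = 0"
proof -
  obtain A B where AB: "sorted_list_of_set UNIV = A @ i # B" "i \<notin> set A" "i \<notin> set B" by (rule frame_split)
  have "set (A @ i # B) = UNIV" unfolding AB(1)[symmetric] by simp
  then have "j \<in> set A \<or> j \<in> set B" using assms(1) by auto
  then show ?thesis
  proof
    assume "j \<in> set A"
    then obtain A1 A2 where "A = A1 @ j # A2" by (meson split_list)
    then show ?thesis using AB(1) assms(2) wedge_list_not_distinct[of "map w A1" "w i" "map w A2"]
      by (simp add: frame_wedge_def)
  next
    assume "j \<in> set B"
    then obtain A1 A2 where "B = A1 @ j # A2" by (meson split_list)
    then show ?thesis using AB(1) assms(2) wedge_list_not_distinct[of "map w A" "w i" "map w A1"]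
      by (simp add: frame_wedge_def)
  qed
qed

lemma alternating_frame_wedge:
  assumes "linear G" "subspace N"
  shows "alternating_mod N (\<lambda>w. G (frame_wedge w))"
  unfolding alternating_mod_def
  using assms
  by (auto simp: frame_wedge_eq_0 subspace_0 linear_add[OF linear_frame_wedge] linear_scale[OF linear_frame_wedge]
      linear_add[of G] linear_scale[of G] linear_0)

lemma strict_mono_endo_id:
  fixes \<phi> :: "'k::{finite,linorder} \<Rightarrow> 'k"
  assumes "strict_mono \<phi>"
  shows "\<phi> = id"
proof -
  have "map \<phi> (sorted_list_of_set UNIV) = sorted_list_of_set UNIV"
  proof (rule sorted_distinct_set_unique)
    show "sorted (map \<phi> (sorted_list_of_set UNIV))"
      using sorted_map_mono[OF sorted_sorted_list_of_set strict_mono_mono[OF assms, THEN mono_on_subset]] by auto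
    show "distinct (map \<phi> (sorted_list_of_set UNIV))"
      using assms by (simp add: distinct_map strict_mono_imp_inj_on)
    show "set (map \<phi> (sorted_list_of_set UNIV)) = set (sorted_list_of_set UNIV)"
      using finite_UNIV_inj_surj[of \<phi>] strict_mono_imp_inj_on[OF assms] by simp
  qed auto
  then have "map \<phi> (sorted_list_of_set UNIV) = map id (sorted_list_of_set UNIV)" by simp
  then have "\<forall>x\<in>set (sorted_list_of_set UNIV). \<phi> x = id x" by (simp only: map_eq_conv)
  then show ?thesis by (intro ext) auto
qed

text \<open>Modulo the line through \<open>frame_wedge v\<close>, the map \<open>frame_wedge\<close>
  vanishes on the only increasing selection from \<open>v\<close>, the identity, hence on all frames
  in the span. The factor is a determinant that never has to be computed.\<close>

lemma frame_wedge_proportional: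
  fixes v w :: "'k::{finite,linorder} \<Rightarrow> real ^ 'n::{finite,linorder}"
  assumes "range w \<subseteq> span (range v)"
  obtains c where "frame_wedge w = c *\<^sub>R frame_wedge v"
proof -
  have "frame_wedge w \<in> span {frame_wedge v}"
  proof (rule alternating_mod_basis[where e = v and g = frame_wedge and N = "span {frame_wedge v}"])
    show "alternating_mod (span {frame_wedge v}) frame_wedge"
      by (rule alternating_frame_wedge[OF linear_ident subspace_span])
    show "frame_wedge (v \<circ> \<phi>) \<in> span {frame_wedge v}" if "strict_mono \<phi>" for \<phi> :: "'k \<Rightarrow> 'k"
      unfolding strict_mono_endo_id[OF that] by (simp add: span_base)
  qed (rule assms)
  then obtain c where "frame_wedge w = c *\<^sub>R frame_wedge v" unfolding span_singleton by blast
  then show thesis by (rule that)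
qed

text \<open>Hadamard's inequality, by repeated use of \<open>norm_wedge_vec_le\<close>.\<close>

lemma norm_frame_wedge_le:
  fixes w :: "'k::{finite,linorder} \<Rightarrow> real ^ 'n::{finite,linorder}"
  shows "norm (frame_wedge w) \<le> (\<Prod>i\<in>UNIV. norm (w i))"
proof -
  have "norm (wedge_list vs) \<le> prod_list (map norm vs)" for vs :: "(real ^ 'n::{finite,linorder}) list"
  proof (induction vs)
    case (Cons v vs)
    then show ?case
      using order_trans[OF norm_wedge_vec_le mult_left_mono[OF Cons]] by simp
  qed simp
  from this[of "map w (sorted_list_of_set UNIV)"] show ?thesis
    by (simp add: frame_wedge_def o_def prod.distinct_set_conv_list[OF distinct_sorted_list_of_set, symmetric])
qed

definition orthonormal_frame :: "('k \<Rightarrow> 'a::real_inner) \<Rightarrow> bool" where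
  "orthonormal_frame w \<longleftrightarrow> (\<forall>i j. w i \<bullet> w j = (if i = j then 1 else 0))"

text \<open>In the recursion for the squared norm the contraction term vanishes, since each vector
  is orthogonal to those that follow it in the list.\<close>

lemma norm_frame_wedge_orthonormal:
  assumes "orthonormal_frame w"
  shows "norm (frame_wedge w) = 1"
proof -
  have "wedge_list (map w xs) \<bullet> wedge_list (map w xs) = 1" if "distinct xs" for xs
    using that
  proof (induction xs)
    case (Cons x xs)
    have "contract (w x) (wedge_list (map w xs)) = 0"
      by (rule contract_wedge_list_orthogonal) (use Cons assms in \<open>auto simp: orthonormal_frame_def\<close>)
    then show ?case using Cons assms
      by (simp add: inner_wedge_contract contract_wedge wedge_vec_linear_simps orthonormal_frame_def)
  qed (simp add: inner_axis)
  then show ?thesis by (simp add: frame_wedge_def norm_eq_sqrt_inner)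
qed

section \<open>Calculus of smooth forms\<close>

section \<open>Smooth maps and test forms\<close>

abbreviation partial_deriv :: "'n::finite \<Rightarrow> (real ^ 'n \<Rightarrow> 'b::real_normed_vector) \<Rightarrow> real ^ 'n \<Rightarrow> 'b" where
  "partial_deriv i f \<equiv> \<lambda>x. frechet_derivative f (at x) (axis i 1)"

lemma partial_deriv_eqI:
  "(\<And>x. (f has_derivative f' x) (at x)) \<Longrightarrow> partial_deriv i f = (\<lambda>x. f' x (axis i 1))"
  by (metis frechet_derivative_at)

lemma smooth_imp_has_derivative:
  assumes "smooth f"
  shows "(f has_derivative frechet_derivative f (at x)) (at x)"
proof -
  have "iter_partial [] f differentiable_on UNIV" using assms unfolding smooth_def by blast
  then show ?thesis by (simp add: differentiable_on_def frechet_derivative_works[symmetric])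
qed

lemma smooth_partial_deriv:
  assumes "smooth f"
  shows "smooth (partial_deriv i f)"
proof -
  have "iter_partial js (partial_deriv i f) = iter_partial (js @ [i]) f" for js
    by (induction js) auto
  then show ?thesis using assms unfolding smooth_def by simp
qed

text \<open>Iterated partial derivatives never leave a class that is closed under partial
  derivatives, so it is enough that its members are differentiable. Closure properties of
  \<open>smooth\<close> are proved by exhibiting such a class.\<close>

lemma smooth_coinduct:
  fixes f :: "real ^ 'n::finite \<Rightarrow> 'b::real_normed_vector"
  assumes "f \<in> S"
    and diff: "\<And>g x. g \<in> S \<Longrightarrow> g differentiable (at x)"
    and closed: "\<And>g i. g \<in> S \<Longrightarrow> partial_deriv i g \<in> S"
  shows "smooth f"
proof -
  have "iter_partial js f \<in> S" for js by (induction js) (simp_all add: assms)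
  then show ?thesis unfolding smooth_def differentiable_on_def
    using diff differentiable_at_withinI by blast
qed

lemma smooth_const:
  fixes c :: "'b::real_normed_vector"
  shows "smooth (\<lambda>x :: real ^ 'n::finite. c)"
proof (rule smooth_coinduct[of _ "range (\<lambda>c x. c)"])
  show "partial_deriv i g \<in> range (\<lambda>c x. c)" if "g \<in> range (\<lambda>c x. c)" for g :: "real ^ 'n::finite \<Rightarrow> 'b::real_normed_vector" and i
    using that by auto
qed auto

lemma smooth_add:
  fixes f g :: "real ^ 'n::finite \<Rightarrow> 'b::real_normed_vector"
  assumes "smooth f" "smooth g"
  shows "smooth (\<lambda>x. f x + g x)"
proof (rule smooth_coinduct[of _ "{(\<lambda>x. f x + g x) | f g. smooth f \<and> smooth g}"])
  show "h differentiable at x" if "h \<in> {(\<lambda>x. f x + g x) | f g. smooth f \<and> smooth g}" for h :: "real ^ 'n::finite \<Rightarrow> 'b::real_normed_vector" and x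
    using that differentiableI[OF smooth_imp_has_derivative] by (auto intro!: differentiable_add)
  show "partial_deriv i h \<in> {(\<lambda>x. f x + g x) | f g. smooth f \<and> smooth g}"
    if "h \<in> {(\<lambda>x. f x + g x) | f g. smooth f \<and> smooth g}" for h :: "real ^ 'n::finite \<Rightarrow> 'b::real_normed_vector" and i
  proof -
    from that obtain f g where h: "h = (\<lambda>x. f x + g x)" and fg: "smooth f" "smooth g" by blast
    have "partial_deriv i h = (\<lambda>x. partial_deriv i f x + partial_deriv i g x)"
      unfolding h by (rule partial_deriv_eqI) (intro has_derivative_add smooth_imp_has_derivative fg)
    then show ?thesis using smooth_partial_deriv[OF fg(1), of i] smooth_partial_deriv[OF fg(2), of i]
      by (intro CollectI exI conjI)
  qed
qed (use assms in auto)

lemma smooth_bounded_linear: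
  fixes f :: "real ^ 'n::finite \<Rightarrow> 'b::real_normed_vector" and A :: "'b \<Rightarrow> 'c::real_normed_vector"
  assumes A: "bounded_linear A" and "smooth f"
  shows "smooth (\<lambda>x. A (f x))"
proof (rule smooth_coinduct[of _ "{(\<lambda>x. A (f x)) | f. smooth f}"])
  have der: "((\<lambda>x. A (f x)) has_derivative (\<lambda>v. A (frechet_derivative f (at x) v))) (at x)" if "smooth f"
    for f :: "real ^ 'n::finite \<Rightarrow> 'b::real_normed_vector" and x
    by (rule bounded_linear.has_derivative[OF A smooth_imp_has_derivative[OF that]])
  show "h differentiable at x" if "h \<in> {(\<lambda>x. A (f x)) | f. smooth f}" for h :: "real ^ 'n::finite \<Rightarrow> 'c::real_normed_vector" and x
    using that differentiableI[OF der] by auto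
  show "partial_deriv i h \<in> {(\<lambda>x. A (f x)) | f. smooth f}" if "h \<in> {(\<lambda>x. A (f x)) | f. smooth f}" for h :: "real ^ 'n::finite \<Rightarrow> 'c::real_normed_vector" and i
  proof -
    from that obtain f where h: "h = (\<lambda>x. A (f x))" and f: "smooth f" by blast
    have "partial_deriv i h = (\<lambda>x. A (partial_deriv i f x))"
      unfolding h by (rule partial_deriv_eqI) (rule der[OF f])
    then show ?thesis using smooth_partial_deriv[OF f, of i] by (intro CollectI exI conjI)
  qed
qed (use assms in auto)

lemma smooth_sum:
  assumes "\<And>i. i \<in> I \<Longrightarrow> smooth (f i)"
  shows "smooth (\<lambda>x. \<Sum>i\<in>I. f i x)"
  using assms
proof (induction I rule: infinite_finite_induct)
  case (insert i I)
  then show ?case using smooth_add[of "f i" "\<lambda>x. \<Sum>i\<in>I. f i x"] by simp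
qed (simp_all add: smooth_const)

lemma frechet_derivative_partial_derivs:
  assumes "(f has_derivative frechet_derivative f (at x)) (at x)"
  shows "frechet_derivative f (at x) v = (\<Sum>i\<in>UNIV. v $ i *\<^sub>R partial_deriv i f x)"
proof -
  have lin: "linear (frechet_derivative f (at x))" using has_derivative_linear[OF assms] .
  have "v = (\<Sum>i\<in>UNIV. v $ i *\<^sub>R axis i 1)" using basis_expansion[of v] by (simp add: scalar_mult_eq_scaleR)
  then have "frechet_derivative f (at x) v = frechet_derivative f (at x) (\<Sum>i\<in>UNIV. v $ i *\<^sub>R axis i 1)" by simp
  then show ?thesis by (simp add: linear_sum[OF lin] linear_scale[OF lin])
qed

lemma smooth_affine:
  fixes f :: "real ^ 'n::finite \<Rightarrow> 'b::real_normed_vector" and L :: "real ^ 'm::finite \<Rightarrow> real ^ 'n::finite"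
  assumes L: "linear L" and "smooth f"
  shows "smooth (\<lambda>x. f (u + L x))"
proof (rule smooth_coinduct[of _ "{(\<lambda>x. f (u + L x)) | f. smooth f}"])
  have der: "((\<lambda>x. f (u + L x)) has_derivative (\<lambda>v. frechet_derivative f (at (u + L x)) (L v))) (at x)"
    if "smooth f" for f :: "real ^ 'n::finite \<Rightarrow> 'b::real_normed_vector" and x
  proof (rule has_derivative_compose[of "\<lambda>x. u + L x" L])
    show "((\<lambda>x. u + L x) has_derivative L) (at x)"
      by (auto intro!: derivative_eq_intros bounded_linear_imp_has_derivative simp: linear_conv_bounded_linear[symmetric] L)
    show "(f has_derivative frechet_derivative f (at (u + L x))) (at (u + L x))"
      by (rule smooth_imp_has_derivative[OF that])
  qed
  show "h differentiable at x" if "h \<in> {(\<lambda>x. f (u + L x)) | f. smooth f}" for h :: "real ^ 'm::finite \<Rightarrow> 'b::real_normed_vector" and x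
    using that differentiableI[OF der] by auto
  show "partial_deriv i h \<in> {(\<lambda>x. f (u + L x)) | f. smooth f}"
    if "h \<in> {(\<lambda>x. f (u + L x)) | f. smooth f}" for h :: "real ^ 'm::finite \<Rightarrow> 'b::real_normed_vector" and i
  proof -
    from that obtain f where h: "h = (\<lambda>x. f (u + L x))" and f: "smooth f" by blast
    let ?g = "\<lambda>y. \<Sum>l\<in>UNIV. L (axis i 1) $ l *\<^sub>R partial_deriv l f y"
    have "partial_deriv i h = (\<lambda>x. frechet_derivative f (at (u + L x)) (L (axis i 1)))"
      unfolding h by (rule partial_deriv_eqI) (rule der[OF f])
    also have "\<dots> = (\<lambda>x. ?g (u + L x))"
      by (simp add: frechet_derivative_partial_derivs[OF smooth_imp_has_derivative[OF f], of _ "L _"])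
    finally have "partial_deriv i h = (\<lambda>x. ?g (u + L x))" .
    moreover have "smooth ?g"
      by (intro smooth_sum smooth_bounded_linear[OF bounded_linear_scaleR_right] smooth_partial_deriv f)
    ultimately show ?thesis by (intro CollectI exI conjI)
  qed
qed (use assms in auto)

lemma smooth_continuous_on: "smooth f \<Longrightarrow> continuous_on S f"
  by (intro continuous_at_imp_continuous_on ballI has_derivative_continuous[OF smooth_imp_has_derivative])

text \<open>The second difference of \<open>f\<close> over the parallelogram with sides
  \<open>h *\<^sub>R a\<close> and \<open>h *\<^sub>R b\<close> is symmetric in \<open>a\<close> and
  \<open>b\<close>. Two applications of the mean value theorem, in either order, make it h^2 times a
  value of the corresponding mixed derivative near \<open>x\<close>.\<close>

lemma mixed_derivatives_eq:
  fixes f :: "'a::real_normed_vector \<Rightarrow> real"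
  assumes fa: "\<And>x s. ((\<lambda>s. f (x + s *\<^sub>R a)) has_real_derivative fa (x + s *\<^sub>R a)) (at s)"
    and fb: "\<And>x s. ((\<lambda>s. f (x + s *\<^sub>R b)) has_real_derivative fb (x + s *\<^sub>R b)) (at s)"
    and fab: "\<And>x s. ((\<lambda>s. fa (x + s *\<^sub>R b)) has_real_derivative fab (x + s *\<^sub>R b)) (at s)"
    and fba: "\<And>x s. ((\<lambda>s. fb (x + s *\<^sub>R a)) has_real_derivative fba (x + s *\<^sub>R a)) (at s)"
    and cont: "isCont fab x" "isCont fba x"
  shows "fab x = fba x"
proof -
  have diff: "\<exists>s t. 0 < s \<and> s < h \<and> 0 < t \<and> t < h \<and>
      f (x + h *\<^sub>R a + h *\<^sub>R b) - f (x + h *\<^sub>R a) - f (x + h *\<^sub>R b) + f x = h * (h * fab (x + s *\<^sub>R a + t *\<^sub>R b))"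
    if h: "h > 0"
      and fa: "\<And>x s. ((\<lambda>s. f (x + s *\<^sub>R a)) has_real_derivative fa (x + s *\<^sub>R a)) (at s)"
      and fab: "\<And>x s. ((\<lambda>s. fa (x + s *\<^sub>R b)) has_real_derivative fab (x + s *\<^sub>R b)) (at s)"
    for a b fa fab h
  proof -
    have "\<exists>s>0. s < h \<and> (f (x + h *\<^sub>R b + h *\<^sub>R a) - f (x + h *\<^sub>R a)) - (f (x + h *\<^sub>R b + 0 *\<^sub>R a) - f (x + 0 *\<^sub>R a))
        = (h - 0) * (fa (x + h *\<^sub>R b + s *\<^sub>R a) - fa (x + s *\<^sub>R a))"
      by (rule MVT2[OF h]) (intro DERIV_diff fa)
    then obtain s where s: "0 < s" "s < h" "(f (x + h *\<^sub>R b + h *\<^sub>R a) - f (x + h *\<^sub>R a)) - (f (x + h *\<^sub>R b) - f x)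
        = h * (fa (x + h *\<^sub>R b + s *\<^sub>R a) - fa (x + s *\<^sub>R a))" by auto
    have "\<exists>t>0. t < h \<and> fa (x + s *\<^sub>R a + h *\<^sub>R b) - fa (x + s *\<^sub>R a + 0 *\<^sub>R b)
        = (h - 0) * fab (x + s *\<^sub>R a + t *\<^sub>R b)"
      by (rule MVT2[OF h]) (rule fab)
    then obtain t where t: "0 < t" "t < h" "fa (x + s *\<^sub>R a + h *\<^sub>R b) - fa (x + s *\<^sub>R a) = h * fab (x + s *\<^sub>R a + t *\<^sub>R b)"
      by auto
    have "f (x + h *\<^sub>R a + h *\<^sub>R b) - f (x + h *\<^sub>R a) - f (x + h *\<^sub>R b) + f x
        = h * (fa (x + s *\<^sub>R a + h *\<^sub>R b) - fa (x + s *\<^sub>R a))"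
      using s(3) by (simp add: algebra_simps)
    then show ?thesis using s t by metis
  qed
  show ?thesis
  proof (rule ccontr)
    assume ne: "fab x \<noteq> fba x"
    define e where "e = \<bar>fab x - fba x\<bar> / 2"
    have e: "e > 0" using ne by (simp add: e_def)
    obtain d1 where d1: "d1 > 0" "\<And>y. dist y x < d1 \<Longrightarrow> dist (fab y) (fab x) < e"
      using cont(1) e unfolding continuous_at_eps_delta by (auto simp: dist_norm)
    obtain d2 where d2: "d2 > 0" "\<And>y. dist y x < d2 \<Longrightarrow> dist (fba y) (fba x) < e"
      using cont(2) e unfolding continuous_at_eps_delta by (auto simp: dist_norm)
    \<comment> \<open>With this \<open>h\<close> all points that the mean value theorem may produce
      lie within both continuity radii of \<open>x\<close>; the summand 1 keeps the denominator
      positive.\<close>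
    define h where "h = min d1 d2 / (norm a + norm b + 1)"
    have pos: "0 < norm a + norm b + 1" using norm_ge_zero[of a] norm_ge_zero[of b] by linarith
    have h: "h > 0" unfolding h_def using d1 d2 pos by simp
    have near: "dist (x + s *\<^sub>R a + t *\<^sub>R b) x < min d1 d2" if "0 < s" "s < h" "0 < t" "t < h" for s t
    proof -
      have "dist (x + s *\<^sub>R a + t *\<^sub>R b) x = norm (s *\<^sub>R a + t *\<^sub>R b)" by (simp add: dist_norm algebra_simps)
      also have "\<dots> \<le> s * norm a + t * norm b" using norm_triangle_ineq[of "s *\<^sub>R a" "t *\<^sub>R b"] that by simp
      also have "\<dots> \<le> h * norm a + h * norm b" by (intro add_mono mult_right_mono) (use that in auto)
      also have "\<dots> < h * (norm a + norm b + 1)" using h by (simp add: algebra_simps)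
      also have "\<dots> = min d1 d2" unfolding h_def using pos by simp
      finally show ?thesis .
    qed
    obtain s t where st: "0 < s" "s < h" "0 < t" "t < h"
      "f (x + h *\<^sub>R a + h *\<^sub>R b) - f (x + h *\<^sub>R a) - f (x + h *\<^sub>R b) + f x = h * (h * fab (x + s *\<^sub>R a + t *\<^sub>R b))"
      using diff[OF h fa fab] by auto
    obtain s' t' where st': "0 < s'" "s' < h" "0 < t'" "t' < h"
      "f (x + h *\<^sub>R b + h *\<^sub>R a) - f (x + h *\<^sub>R b) - f (x + h *\<^sub>R a) + f x = h * (h * fba (x + s' *\<^sub>R b + t' *\<^sub>R a))"
      using diff[OF h fb fba] by auto
    have "h * (h * fab (x + s *\<^sub>R a + t *\<^sub>R b)) = h * (h * fba (x + t' *\<^sub>R a + s' *\<^sub>R b))"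
      using st(5) st'(5) by (simp add: algebra_simps)
    then have eq: "fab (x + s *\<^sub>R a + t *\<^sub>R b) = fba (x + t' *\<^sub>R a + s' *\<^sub>R b)" using h by simp
    have "dist (fab (x + s *\<^sub>R a + t *\<^sub>R b)) (fab x) < e" "dist (fba (x + t' *\<^sub>R a + s' *\<^sub>R b)) (fba x) < e"
      using d1(2) d2(2) near st st' by auto
    then show False unfolding eq e_def dist_real_def by (simp add: abs_if split: if_splits)
  qed
qed

lemma has_vector_derivative_line:
  assumes "smooth f"
  shows "((\<lambda>s. f (x + s *\<^sub>R a)) has_vector_derivative frechet_derivative f (at (x + s *\<^sub>R a)) a) (at s)"
proof -
  have "((\<lambda>s. x + s *\<^sub>R a) has_vector_derivative a) (at s)"
    by (auto intro!: derivative_eq_intros)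
  from vector_derivative_diff_chain_within[OF this, of f "frechet_derivative f (at (x + s *\<^sub>R a))"]
  show ?thesis using smooth_imp_has_derivative[OF assms]
    by (auto simp: o_def intro: has_derivative_at_withinI)
qed

lemma partial_deriv_commute:
  fixes f :: "real ^ 'n::finite \<Rightarrow> 'b::euclidean_space"
  assumes "smooth f"
  shows "partial_deriv i (partial_deriv j f) x = partial_deriv j (partial_deriv i f) x"
proof (rule euclidean_eqI)
  fix b :: 'b
  have line: "((\<lambda>s. g (x + s *\<^sub>R axis i 1) \<bullet> b) has_real_derivative partial_deriv i g (x + s *\<^sub>R axis i 1) \<bullet> b) (at s)"
    if "smooth g" for g :: "real ^ 'n::finite \<Rightarrow> 'b::euclidean_space" and x i s
    unfolding has_real_derivative_iff_has_vector_derivative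
    by (rule bounded_linear.has_vector_derivative[OF bounded_linear_inner_left has_vector_derivative_line[OF that]])
  have cont: "isCont (\<lambda>x. g x \<bullet> b) x" if "smooth g" for g :: "real ^ 'n::finite \<Rightarrow> 'b::euclidean_space"
    by (intro continuous_intros has_derivative_continuous[OF smooth_imp_has_derivative[OF that]])
  note sm = smooth_partial_deriv
  show "partial_deriv i (partial_deriv j f) x \<bullet> b = partial_deriv j (partial_deriv i f) x \<bullet> b"
    by (rule mixed_derivatives_eq[where f = "\<lambda>x. f x \<bullet> b" and a = "axis j 1" and b = "axis i 1"
          and fa = "\<lambda>x. partial_deriv j f x \<bullet> b" and fb = "\<lambda>x. partial_deriv i f x \<bullet> b"
          and fab = "\<lambda>x. partial_deriv i (partial_deriv j f) x \<bullet> b" and fba = "\<lambda>x. partial_deriv j (partial_deriv i f) x \<bullet> b"])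
      (intro line cont sm assms)+
qed

lemma ext_of_vec_axis: "ext_of_vec (axis i 1) = axis {i} 1"
proof -
  have "ext_of_vec (axis i 1) = (\<Sum>j\<in>UNIV. if j = i then axis {j} 1 else 0)"
    unfolding ext_of_vec_def by (rule sum.cong) (auto simp: axis_def)
  then show ?thesis by simp
qed

lemma ext_deriv_alt:
  "ext_deriv \<omega> = (\<lambda>x. \<Sum>i\<in>UNIV. ext_of_vec (axis i 1) \<and>\<^sub>e partial_deriv i \<omega> x)"
  by (simp add: ext_deriv_def ext_of_vec_axis)

lemma smooth_ext_deriv: "smooth \<omega> \<Longrightarrow> smooth (ext_deriv \<omega>)"
  unfolding ext_deriv_alt
  by (intro smooth_sum smooth_bounded_linear[of "\<lambda>\<xi>. _ \<and>\<^sub>e \<xi>"] smooth_partial_deriv)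
    (simp_all add: linear_wedge_vec linear_conv_bounded_linear[symmetric])

text \<open>This is d d \<alpha> = 0: second partial derivatives are symmetric while basis vectors
  anticommute, so the double sum equals its own negative.\<close>

lemma ext_deriv_closed:
  fixes \<alpha> :: "'n::{finite,linorder} form"
  assumes "smooth \<alpha>"
  shows "(\<Sum>i\<in>UNIV. ext_of_vec (axis i 1) \<and>\<^sub>e partial_deriv i (ext_deriv \<alpha>) x) = 0"
proof -
  define A where "A i j = ext_of_vec (axis i 1) \<and>\<^sub>e (ext_of_vec (axis j 1) \<and>\<^sub>e partial_deriv i (partial_deriv j \<alpha>) x)" for i j :: "'n::{finite,linorder}"
  have pd: "partial_deriv i (ext_deriv \<alpha>) x = (\<Sum>j\<in>UNIV. ext_of_vec (axis j 1) \<and>\<^sub>e partial_deriv i (partial_deriv j \<alpha>) x)" for i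
  proof -
    have "((\<lambda>x. \<Sum>j\<in>UNIV. ext_of_vec (axis j 1) \<and>\<^sub>e partial_deriv j \<alpha> x) has_derivative
      (\<lambda>v. \<Sum>j\<in>UNIV. ext_of_vec (axis j 1) \<and>\<^sub>e frechet_derivative (partial_deriv j \<alpha>) (at x) v)) (at x)" for x
      by (intro has_derivative_sum bounded_linear.has_derivative[of "\<lambda>\<xi>. _ \<and>\<^sub>e \<xi>"] smooth_imp_has_derivative smooth_partial_deriv assms)
        (simp add: linear_wedge_vec linear_conv_bounded_linear[symmetric])
    from partial_deriv_eqI[OF this, of i] show ?thesis unfolding ext_deriv_alt by (rule fun_cong)
  qed
  have "A i j = - A j i" for i j
    unfolding A_def partial_deriv_commute[OF assms, where i = i and j = j] by (rule wedge_vec_anticommute)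
  then have "(\<Sum>i\<in>UNIV. \<Sum>j\<in>UNIV. A i j) = (\<Sum>i\<in>UNIV. \<Sum>j\<in>UNIV. - A j i)"
    by (intro sum.cong refl)
  also have "\<dots> = - (\<Sum>i\<in>UNIV. \<Sum>j\<in>UNIV. A j i)"
    by (simp add: sum_negf)
  also have "(\<Sum>i\<in>UNIV. \<Sum>j\<in>UNIV. A j i) = (\<Sum>i\<in>UNIV. \<Sum>j\<in>UNIV. A i j)" by (rule sum.swap)
  finally have "2 *\<^sub>R (\<Sum>i\<in>UNIV. \<Sum>j\<in>UNIV. A i j) = 0" by (simp add: scaleR_2 eq_neg_iff_add_eq_0)
  then have "(\<Sum>i\<in>UNIV. \<Sum>j\<in>UNIV. A i j) = 0" by simp
  then show ?thesis by (simp add: pd A_def linear_sum[OF linear_wedge_vec])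
qed

text \<open>Here d d \<alpha> = 0 is evaluated on \<open>t\<close> and \<open>w\<close>, in the
  shape that Stokes' theorem for a prism requires: each derivative along an edge is paired with the
  frame of the face from which that edge is missing.\<close>

lemma ext_deriv_closed_frame:
  fixes \<alpha> :: "'n::{finite,linorder} form" and w :: "'k::{finite,linorder} \<Rightarrow> real ^ 'n::{finite,linorder}"
  assumes "smooth \<alpha>"
  shows "frechet_derivative (ext_deriv \<alpha>) (at x) t \<bullet> frame_wedge w
    = (\<Sum>j\<in>UNIV. frechet_derivative (ext_deriv \<alpha>) (at x) (w j) \<bullet> frame_wedge (w(j := t)))"
proof -
  let ?\<omega> = "ext_deriv \<alpha>"
  let ?ks = "sorted_list_of_set (UNIV :: 'k set)"
  let ?p = "\<lambda>i. partial_deriv i ?\<omega> x"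
  have D: "frechet_derivative ?\<omega> (at x) v = (\<Sum>i\<in>UNIV. v $ i *\<^sub>R ?p i)" for v
    by (rule frechet_derivative_partial_derivs[OF smooth_imp_has_derivative[OF smooth_ext_deriv[OF assms]]])
  have E: "ext_of_vec t \<and>\<^sub>e contract u (frame_wedge w) = (\<Sum>j\<in>UNIV. (u \<bullet> w j) *\<^sub>R frame_wedge (w(j := t)))" for u
  proof -
    have "ext_of_vec t \<and>\<^sub>e contract u (frame_wedge w)
        = (\<Sum>j<CARD('k). (u \<bullet> w (?ks ! j)) *\<^sub>R wedge_list ((map w ?ks)[j := t]))"
      unfolding frame_wedge_def wedge_contract_wedge_list by simp
    also have "\<dots> = (\<Sum>j<CARD('k). (u \<bullet> w (?ks ! j)) *\<^sub>R frame_wedge (w(?ks ! j := t)))"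
    proof (rule sum.cong[OF refl])
      fix j assume "j \<in> {..<CARD('k)}"
      then have "(map w ?ks)[j := t] = map (w(?ks ! j := t)) ?ks"
        by (intro nth_equalityI) (auto simp: nth_list_update nth_eq_iff_index_eq)
      then show "(u \<bullet> w (?ks ! j)) *\<^sub>R wedge_list ((map w ?ks)[j := t]) = (u \<bullet> w (?ks ! j)) *\<^sub>R frame_wedge (w(?ks ! j := t))"
        by (simp add: frame_wedge_def)
    qed
    also have "\<dots> = (\<Sum>j\<in>UNIV. (u \<bullet> w j) *\<^sub>R frame_wedge (w(j := t)))"
      by (rule sum.reindex_bij_betw[where h = "(!) ?ks"]) (rule bij_betw_nth; simp)
    finally show ?thesis .
  qed
  have "0 = (\<Sum>i\<in>UNIV. ext_of_vec (axis i 1) \<and>\<^sub>e ?p i) \<bullet> (ext_of_vec t \<and>\<^sub>e frame_wedge w)"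
    by (simp add: ext_deriv_closed[OF assms])
  also have "\<dots> = (\<Sum>i\<in>UNIV. ?p i \<bullet> (t $ i *\<^sub>R frame_wedge w - ext_of_vec t \<and>\<^sub>e contract (axis i 1) (frame_wedge w)))"
    by (simp add: inner_sum_left inner_wedge_contract contract_wedge inner_axis')
  also have "\<dots> = (\<Sum>i\<in>UNIV. t $ i * (?p i \<bullet> frame_wedge w)) - (\<Sum>i\<in>UNIV. \<Sum>j\<in>UNIV. w j $ i * (?p i \<bullet> frame_wedge (w(j := t))))"
    unfolding E by (simp add: inner_diff_right inner_sum_right inner_axis' sum_subtractf)
  also have "(\<Sum>i\<in>UNIV. t $ i * (?p i \<bullet> frame_wedge w)) = frechet_derivative ?\<omega> (at x) t \<bullet> frame_wedge w"
    by (simp add: D[of t] inner_sum_left)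
  also have "(\<Sum>i\<in>UNIV. \<Sum>j\<in>UNIV. w j $ i * (?p i \<bullet> frame_wedge (w(j := t))))
      = (\<Sum>j\<in>UNIV. frechet_derivative ?\<omega> (at x) (w j) \<bullet> frame_wedge (w(j := t)))"
    by (subst sum.swap) (simp add: D[of "w j" for j] inner_sum_left)
  finally show ?thesis by simp
qed

lemma test_forms_iff: "\<omega> \<in> test_forms m \<longleftrightarrow> smooth \<omega> \<and> bounded {x. \<omega> x \<noteq> 0} \<and> range \<omega> \<subseteq> multivectors m"
  by (simp add: test_forms_def compact_closure)

lemma multivectors_subspace: "subspace (multivectors m)"
  by (auto simp: subspace_def multivectors_def)

lemma wedge_vec_multivectors:
  assumes "\<xi> \<in> multivectors m"
  shows "ext_of_vec v \<and>\<^sub>e \<xi> \<in> multivectors (Suc m)"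
proof -
  have "(ext_of_vec v \<and>\<^sub>e \<xi>) $ A = 0" if "card A \<noteq> Suc m" for A
    unfolding wedge_vec_nth
  proof (rule sum.neutral, rule ballI)
    fix i assume "i \<in> A"
    then have "card (A - {i}) \<noteq> m" using that by (metis card.remove finite)
    then show "insertion_sign i (A - {i}) * v $ i * \<xi> $ (A - {i}) = 0"
      using assms by (simp add: multivectors_def)
  qed
  then show ?thesis by (simp add: multivectors_def)
qed

lemma smooth_pd_multivectors:
  assumes "smooth \<alpha>" "range \<alpha> \<subseteq> multivectors m"
  shows "partial_deriv i \<alpha> x \<in> multivectors m"
proof -
  have "partial_deriv i \<alpha> x $ A = 0" if "card A \<noteq> m" for A
  proof -
    have "((\<lambda>x. \<alpha> x $ A) has_derivative (\<lambda>v. frechet_derivative \<alpha> (at x) v $ A)) (at x)"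
      by (rule bounded_linear.has_derivative[OF bounded_linear_vec_nth smooth_imp_has_derivative[OF assms(1)]])
    moreover have "\<alpha> x $ A = 0" for x using assms(2) that by (auto simp: multivectors_def)
    ultimately have "((\<lambda>x. 0) has_derivative (\<lambda>v. frechet_derivative \<alpha> (at x) v $ A)) (at x)" by simp
    then have "(\<lambda>v. frechet_derivative \<alpha> (at x) v $ A) = (\<lambda>v. 0)"
      using has_derivative_unique has_derivative_const by blast
    then show ?thesis by (rule fun_cong)
  qed
  then show ?thesis by (simp add: multivectors_def)
qed

lemma test_forms_ext_deriv:
  assumes "\<alpha> \<in> test_forms m"
  shows "ext_deriv \<alpha> \<in> test_forms (Suc m)"
proof -
  have sm: "smooth \<alpha>" and bd: "bounded {x. \<alpha> x \<noteq> 0}" and mv: "range \<alpha> \<subseteq> multivectors m"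
    using assms by (auto simp: test_forms_iff)
  have "ext_deriv \<alpha> x = 0" if x: "x \<notin> closure {x. \<alpha> x \<noteq> 0}" for x
  proof -
    have "(\<alpha> has_derivative (\<lambda>v. 0)) (at x)"
    proof (rule has_derivative_transform_within_open[of "\<lambda>x. 0"])
      show "open (- closure {x. \<alpha> x \<noteq> 0})" by (rule open_Compl[OF closed_closure])
      show "0 = \<alpha> y" if "y \<in> - closure {x. \<alpha> x \<noteq> 0}" for y
        using that closure_subset[of "{x. \<alpha> x \<noteq> 0}"] by auto
    qed (use x in auto)
    then have "frechet_derivative \<alpha> (at x) = (\<lambda>v. 0)" by (metis frechet_derivative_at)
    then show ?thesis by (simp add: ext_deriv_alt wedge_vec_linear_simps)
  qed
  then have "{x. ext_deriv \<alpha> x \<noteq> 0} \<subseteq> closure {x. \<alpha> x \<noteq> 0}" by auto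
  then have "bounded {x. ext_deriv \<alpha> x \<noteq> 0}" using bd bounded_closure bounded_subset by blast
  moreover have "range (ext_deriv \<alpha>) \<subseteq> multivectors (Suc m)"
    unfolding ext_deriv_alt
    by (auto intro!: subspace_sum[OF multivectors_subspace] wedge_vec_multivectors smooth_pd_multivectors sm mv)
  ultimately show ?thesis using smooth_ext_deriv[OF sm] by (simp add: test_forms_iff)
qed

lemma ext_deriv_affine:
  assumes "smooth \<alpha>"
  shows "ext_deriv (\<lambda>x. \<alpha> (u + c *\<^sub>R x)) = (\<lambda>x. c *\<^sub>R ext_deriv \<alpha> (u + c *\<^sub>R x))"
proof -
  have "partial_deriv i (\<lambda>x. \<alpha> (u + c *\<^sub>R x)) = (\<lambda>x. c *\<^sub>R partial_deriv i \<alpha> (u + c *\<^sub>R x))" for i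
  proof -
    have "((\<lambda>x. \<alpha> (u + c *\<^sub>R x)) has_derivative (\<lambda>v. frechet_derivative \<alpha> (at (u + c *\<^sub>R x)) (c *\<^sub>R v))) (at x)" for x
      by (rule has_derivative_compose[of "\<lambda>x. u + c *\<^sub>R x" "\<lambda>v. c *\<^sub>R v"])
        (auto intro!: derivative_eq_intros smooth_imp_has_derivative assms)
    from partial_deriv_eqI[OF this, of i]
    show ?thesis
      by (simp add: linear_scale[OF has_derivative_linear[OF smooth_imp_has_derivative[OF assms]]])
  qed
  then show ?thesis unfolding ext_deriv_alt
    by (simp add: fun_eq_iff scaleR_sum_right wedge_vec_linear_simps)
qed

section \<open>Lebesgue integration over parallelepipeds and Stokes' theorem\<close>

section \<open>Translation-invariant measures\<close>

text \<open>
  The two sides are the two ways of integrating \<open>indicator A x * indicator B (y - x)\<close> over the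
  product of the two measures.
\<close>

lemma translation_invariant_measure:
  fixes M :: "'a::euclidean_space measure"
  assumes sets: "sets M = sets borel"
    and inv: "\<And>v. distr M borel (\<lambda>x. v + x) = M"
    and fin: "emeasure M (cbox 0 One) \<noteq> \<infinity>"
    and A: "A \<in> sets borel"
  shows "emeasure M A = emeasure M (cbox 0 One) * emeasure lborel A"
proof -
  have sp: "space M = UNIV" using sets_eq_imp_space_eq[OF sets] by simp
  have mM: "f \<in> borel_measurable M" if "f \<in> borel_measurable borel" for f :: "'a \<Rightarrow> ennreal"
    using that measurable_cong_sets[OF sets refl, of "borel :: ennreal measure"] by simp
  have nn: "(\<integral>\<^sup>+x. f (v + x) \<partial>M) = (\<integral>\<^sup>+x. f x \<partial>M)" if [measurable]: "f \<in> borel_measurable borel" for f :: "'a \<Rightarrow> ennreal" and v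
  proof -
    have "(\<lambda>x. v + x) \<in> M \<rightarrow>\<^sub>M borel" unfolding measurable_cong_sets[OF sets refl] by measurable
    then have "(\<integral>\<^sup>+x. f x \<partial>distr M borel (\<lambda>x. v + x)) = (\<integral>\<^sup>+x. f (v + x) \<partial>M)"
      by (rule nn_integral_distr) (use that in simp)
    then show ?thesis by (simp add: inv)
  qed
  have nnl: "(\<integral>\<^sup>+x. f (v + x) \<partial>lborel) = (\<integral>\<^sup>+x. f x \<partial>lborel)" if [measurable]: "f \<in> borel_measurable borel" for f :: "'a \<Rightarrow> ennreal" and v
  proof -
    have "(\<integral>\<^sup>+x. f x \<partial>distr lborel borel ((+) v)) = (\<integral>\<^sup>+x. f (v + x) \<partial>lborel)"
      by (rule nn_integral_distr) simp_all
    then show ?thesis by (simp add: lborel_distr_plus)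
  qed
  \<comment> \<open>Fubini's theorem requires \<sigma>-finiteness: the translates of the unit cube
    by a countable dense set cover the space and have the same finite measure.\<close>
  interpret M: sigma_finite_measure M
  proof
    obtain D :: "'a set" where D: "countable D" "\<And>X. open X \<Longrightarrow> X \<noteq> {} \<Longrightarrow> \<exists>d\<in>D. d \<in> X"
      using countable_dense_exists[where 'a = 'a] by auto
    define C where "C d = {x. x - d \<in> cbox 0 One}" for d :: 'a
    have C: "C d \<in> sets borel" for d
    proof -
      have "C d = (\<lambda>x. x - d) -` cbox 0 One \<inter> space borel" by (auto simp: C_def)
      also have "\<dots> \<in> sets borel" by (rule measurable_sets[of _ borel borel]) auto
      finally show ?thesis .
    qed
    have CM: "emeasure M (C d) = emeasure M (cbox 0 One)" for d
    proof -
      have "emeasure M (C d) = (\<integral>\<^sup>+x. indicator (cbox 0 One) (- d + x) \<partial>M)"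
      proof -
        have "indicator (C d) x = (indicator (cbox 0 One) (- d + x) :: ennreal)" for x
          by (simp add: C_def indicator_def)
        then show ?thesis using C[of d] sets by (simp flip: nn_integral_indicator)
      qed
      also have "\<dots> = (\<integral>\<^sup>+x. indicator (cbox 0 One) x \<partial>M)" by (rule nn) simp
      finally show ?thesis using sets by simp
    qed
    show "\<exists>A. countable A \<and> A \<subseteq> sets M \<and> \<Union>A = space M \<and> (\<forall>a\<in>A. emeasure M a \<noteq> \<infinity>)"
    proof (intro exI[of _ "C ` D"] conjI)
      have "x \<in> \<Union>(C ` D)" for x
      proof -
        have "open ((\<lambda>y. x - y) -` box 0 One)" by (intro open_vimage open_box continuous_intros)
        moreover have "x - (1/2) *\<^sub>R One \<in> (\<lambda>y. x - y) -` box 0 One"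
          by (simp add: mem_box)
        ultimately have "\<exists>d\<in>D. d \<in> (\<lambda>y. x - y) -` box 0 One" by (intro D(2)) blast+
        then obtain d where "d \<in> D" "x - d \<in> box 0 One" by auto
        then show ?thesis using box_subset_cbox[of 0 One] by (auto simp: C_def)
      qed
      then show "\<Union>(C ` D) = space M" using sp by auto
    qed (use D C CM fin sets in auto)
  qed
  interpret P: pair_sigma_finite M lborel ..
  have setsP: "sets (M \<Otimes>\<^sub>M (lborel :: 'a measure)) = sets (borel \<Otimes>\<^sub>M borel)"
    by (rule sets_pair_measure_cong) (simp_all add: sets)
  have mP: "f \<in> borel_measurable (M \<Otimes>\<^sub>M (lborel :: 'a measure))" if "f \<in> borel_measurable (borel \<Otimes>\<^sub>M borel)" for f :: "'a \<times> 'a \<Rightarrow> ennreal"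
    using that measurable_cong_sets[OF setsP refl] by auto
  \<comment> \<open>The reflected unit cube: \<open>indicator B (- x + y)\<close> has Lebesgue
    integral 1 in \<open>y\<close>, and after the substitution the remaining factor
    \<open>indicator B (- x)\<close> is the indicator of the unit cube.\<close>
  define B where "B = cbox (- One) (0 :: 'a)"
  have B[measurable]: "B \<in> sets borel" by (simp add: B_def)
  note A[measurable]
  have "emeasure M A = (\<integral>\<^sup>+x. indicator A x * (\<integral>\<^sup>+y. indicator B (- x + y) \<partial>lborel) \<partial>M)"
  proof -
    have "(\<integral>\<^sup>+y. indicator B (- x + y) \<partial>lborel) = 1" for x
      by (subst nnl) (auto simp: B_def emeasure_lborel_cbox_eq)
    then show ?thesis using sets by simp
  qed
  also have "\<dots> = (\<integral>\<^sup>+x. (\<integral>\<^sup>+y. indicator A x * indicator B (- x + y) \<partial>lborel) \<partial>M)"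
    by (intro nn_integral_cong) (simp add: nn_integral_cmult)
  also have "\<dots> = (\<integral>\<^sup>+y. (\<integral>\<^sup>+x. indicator A x * indicator B (- x + y) \<partial>M) \<partial>lborel)"
    by (rule P.Fubini'[symmetric]) (simp only: case_prod_beta', rule mP, measurable)
  also have "\<dots> = (\<integral>\<^sup>+y. (\<integral>\<^sup>+x. indicator A (y + x) * indicator B (- x) \<partial>M) \<partial>lborel)"
  proof (rule nn_integral_cong)
    fix y
    have "(\<integral>\<^sup>+x. (indicator A (y + x) * indicator B (- (y + x) + y) :: ennreal) \<partial>M) = (\<integral>\<^sup>+x. indicator A x * indicator B (- x + y) \<partial>M)"
      by (rule nn[of "\<lambda>x. indicator A x * indicator B (- x + y)"]) simp
    then show "(\<integral>\<^sup>+x. indicator A x * indicator B (- x + y) \<partial>M) = (\<integral>\<^sup>+x. indicator A (y + x) * indicator B (- x) \<partial>M)"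
      by simp
  qed
  also have "\<dots> = (\<integral>\<^sup>+x. (\<integral>\<^sup>+y. indicator A (y + x) * indicator B (- x) \<partial>lborel) \<partial>M)"
    by (rule P.Fubini') (simp only: case_prod_beta', rule mP, measurable)
  also have "\<dots> = (\<integral>\<^sup>+x. emeasure lborel A * indicator B (- x) \<partial>M)"
  proof (rule nn_integral_cong)
    fix x
    have "(\<integral>\<^sup>+y. indicator A (x + y) \<partial>lborel) = emeasure lborel A"
      by (subst nnl) auto
    then show "(\<integral>\<^sup>+y. indicator A (y + x) * indicator B (- x) \<partial>lborel) = emeasure lborel A * indicator B (- x)"
      by (simp add: nn_integral_multc add.commute)
  qed
  also have "\<dots> = emeasure lborel A * (\<integral>\<^sup>+x. indicator (cbox 0 One) x \<partial>M)"
  proof -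
    have "indicator B (- x) = (indicator (cbox 0 One) x :: ennreal)" for x
      by (auto simp: B_def indicator_def mem_box)
    then show ?thesis by (simp add: nn_integral_cmult mM)
  qed
  finally show ?thesis using sets by (simp add: mult.commute)
qed

section \<open>Integrals over parametrised pieces\<close>

definition unit_cube :: "(real ^ 'k::finite) set" where
  "unit_cube = {y. \<forall>i. 0 \<le> y $ i \<and> y $ i \<le> 1}"

lemma One_cart: "(One :: real ^ 'k::finite) $ i = 1"
proof -
  have "(One :: real ^ 'k) \<bullet> axis i 1 = 1" by (rule inner_sum_Basis) (simp add: axis_in_Basis_iff)
  then show ?thesis by (simp add: inner_axis)
qed

lemma unit_cube_cbox: "unit_cube = cbox 0 (One :: real ^ 'k::finite)"
  unfolding unit_cube_def set_eq_iff mem_box_cart One_cart by simp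

lemma compact_unit_cube: "compact unit_cube"
  unfolding unit_cube_cbox by (rule compact_cbox)

definition frame_point :: "('k::finite \<Rightarrow> 'a::real_vector) \<Rightarrow> real ^ 'k \<Rightarrow> 'a" where
  "frame_point w y = (\<Sum>i\<in>UNIV. y $ i *\<^sub>R w i)"

text \<open>The integral of a form over the affine image of \<open>K\<close>, computed in the
  parameters: the unnormalised k-vector of \<open>w\<close> contains both orientation and Jacobian.
  Hausdorff measure is thus absent from Stokes' theorem, and a degenerate frame simply gives
  0.\<close>

definition piece_integral ::
    "real ^ 'n::{finite,linorder} \<Rightarrow> ('k::{finite,linorder} \<Rightarrow> real ^ 'n::{finite,linorder}) \<Rightarrow>
      (real ^ 'k::{finite,linorder}) set \<Rightarrow> 'n form \<Rightarrow> real" where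
  "piece_integral u w K \<omega> = (LINT y:K|lborel. \<omega> (u + frame_point w y) \<bullet> frame_wedge w)"

lemma linear_frame_point: "linear (frame_point w)"
  unfolding frame_point_def
  by (rule linearI) (simp_all add: scaleR_add_left sum.distrib scaleR_sum_right)

lemma continuous_on_frame_point: "continuous_on S (frame_point (w :: 'k::finite \<Rightarrow> 'a::real_normed_vector))"
  unfolding frame_point_def by (intro continuous_intros)

lemma frame_point_upd:
  fixes w :: "'k::finite \<Rightarrow> 'a::real_vector"
  shows "frame_point (w(i := v)) y = frame_point w y + y $ i *\<^sub>R (v - w i)"
proof -
  have "frame_point w' y = y $ i *\<^sub>R w' i + (\<Sum>l\<in>UNIV - {i}. y $ l *\<^sub>R w' l)" for w' :: "'k::finite \<Rightarrow> 'a::real_vector"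
    unfolding frame_point_def by (rule sum.remove) auto
  from this[of w] this[of "w(i := v)"] show ?thesis by (simp add: algebra_simps)
qed

definition cart_upd :: "'k \<Rightarrow> real \<Rightarrow> real ^ 'k \<Rightarrow> real ^ 'k::finite" where
  "cart_upd j s y = (\<chi> i. if i = j then s else y $ i)"

lemma frame_point_cart_upd: "frame_point w (cart_upd j s y) = frame_point w y + (s - y $ j) *\<^sub>R w j"
proof -
  have "frame_point w z = z $ j *\<^sub>R w j + (\<Sum>l\<in>UNIV - {j}. z $ l *\<^sub>R w l)" for z
    unfolding frame_point_def by (rule sum.remove) auto
  moreover have "(\<Sum>l\<in>UNIV - {j}. cart_upd j s y $ l *\<^sub>R w l) = (\<Sum>l\<in>UNIV - {j}. y $ l *\<^sub>R w l)"
    by (rule sum.cong) (auto simp: cart_upd_def)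
  ultimately show ?thesis by (simp add: cart_upd_def algebra_simps)
qed

text \<open>Interchanges the height \<open>s\<close> over a point \<open>y\<close> with coordinate
  \<open>j\<close> of \<open>y\<close>, so that the lemma that integrates along the height also
  serves for the direction of coordinate \<open>j\<close>.\<close>

definition exchange :: "'k \<Rightarrow> (real ^ 'k) \<times> real \<Rightarrow> (real ^ 'k::finite) \<times> real" where
  "exchange j = (\<lambda>(y, s). (cart_upd j s y, y $ j))"

lemma exchange_exchange: "exchange j (exchange j z) = z"
  by (cases z) (simp add: exchange_def cart_upd_def vec_eq_iff)

lemma exchange_add: "exchange j (x + y) = exchange j x + exchange j y"
  by (cases x, cases y) (simp add: exchange_def cart_upd_def vec_eq_iff)

lemma continuous_exchange: "continuous_on S (exchange j)"
proof -
  have "continuous_on S (\<lambda>z. if i = j then snd z else fst z $ i)" for i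
    by (cases "i = j") (auto intro!: continuous_intros)
  then show ?thesis unfolding exchange_def cart_upd_def case_prod_beta'
    by (intro continuous_on_Pair continuous_on_vec_lambda continuous_intros)
qed

lemma exchange_measurable [measurable]: "exchange j \<in> borel \<rightarrow>\<^sub>M borel"
  by (rule borel_measurable_continuous_onI[OF continuous_exchange])

text \<open>The image of Lebesgue measure is translation invariant, because the exchange is
  additive, and it gives measure 1 to the unit cube, because the exchange permutes
  coordinates.\<close>

lemma lborel_distr_exchange: "distr lborel borel (exchange j) = lborel"
proof (rule measure_eqI)
  let ?M = "distr lborel borel (exchange j)"
  have one: "exchange j -` cbox 0 One = cbox 0 (One :: (real ^ 'a) \<times> real)"
  proof -
    have 1: "z \<in> cbox 0 (One :: (real ^ 'a) \<times> real) \<longleftrightarrow> (\<forall>i. 0 \<le> fst z $ i \<and> fst z $ i \<le> 1) \<and> 0 \<le> snd z \<and> snd z \<le> 1" for z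
    proof -
      have "z \<in> cbox 0 One \<longleftrightarrow> (\<forall>b\<in>Basis. 0 \<le> z \<bullet> b \<and> z \<bullet> b \<le> 1)"
        by (simp add: mem_box)
      also have "\<dots> \<longleftrightarrow> (\<forall>i. 0 \<le> fst z $ i \<and> fst z $ i \<le> 1) \<and> 0 \<le> snd z \<and> snd z \<le> 1"
        by (cases z) (auto simp: Basis_prod_def Basis_vec_def inner_axis ball_Un)
      finally show ?thesis .
    qed
    show ?thesis unfolding set_eq_iff vimage_eq 1
      by (auto simp: exchange_def cart_upd_def)
  qed
  have fin: "emeasure ?M (cbox 0 One) = 1"
    by (subst emeasure_distr) (auto simp: one emeasure_lborel_cbox_eq)
  have inv: "distr ?M borel (\<lambda>x. v + x) = ?M" for v
  proof -
    have "distr ?M borel (\<lambda>x. v + x) = distr lborel borel ((\<lambda>x. v + x) \<circ> exchange j)"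
      by (rule distr_distr) auto
    also have "(\<lambda>x. v + x) \<circ> exchange j = exchange j \<circ> (+) (exchange j v)"
      by (auto simp: exchange_add exchange_exchange)
    also have "distr lborel borel (exchange j \<circ> (+) (exchange j v)) = distr (distr lborel borel ((+) (exchange j v))) borel (exchange j)"
      by (rule distr_distr[symmetric]) auto
    finally show ?thesis by (simp add: lborel_distr_plus)
  qed
  fix A assume "A \<in> sets ?M"
  then show "emeasure ?M A = emeasure lborel A"
    using translation_invariant_measure[of ?M A] inv fin by simp
qed simp

lemma lborel_integral_exchange:
  fixes f :: "(real ^ 'k::finite) \<times> real \<Rightarrow> real"
  assumes "f \<in> borel_measurable borel"
  shows "(LINT z|lborel. f (exchange j z)) = (LINT z|lborel. f z)"
proof -
  have "(LINT z|distr lborel borel (exchange j). f z) = (LINT z|lborel. f (exchange j z))"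
    by (rule integral_distr) (use assms in auto)
  then show ?thesis by (simp add: lborel_distr_exchange)
qed

lemma compact_strip:
  assumes "compact K" "continuous_on UNIV l" "continuous_on UNIV h"
  shows "compact {(y, s). y \<in> K \<and> l y \<le> s \<and> s \<le> (h y :: real)}"
proof -
  obtain a where a: "\<And>y. y \<in> K \<Longrightarrow> a \<le> l y"
    using compact_imp_bounded[OF compact_continuous_image[OF continuous_on_subset[OF assms(2)] assms(1)]]
    by (auto simp: bounded_iff) (metis abs_le_iff minus_le_iff)
  obtain b where b: "\<And>y. y \<in> K \<Longrightarrow> h y \<le> b"
    using compact_imp_bounded[OF compact_continuous_image[OF continuous_on_subset[OF assms(3)] assms(1)]]
    by (auto simp: bounded_iff) (metis abs_le_iff)
  have "closed {z. l (fst z) \<le> snd z \<and> snd z \<le> h (fst z)}"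
    by (intro closed_Collect_conj closed_Collect_le continuous_intros
        continuous_on_compose2[OF assms(2)] continuous_on_compose2[OF assms(3)]) auto
  then have "compact ((K \<times> {a..b}) \<inter> {z. l (fst z) \<le> snd z \<and> snd z \<le> h (fst z)})"
    by (intro compact_Int_closed compact_Times assms(1)) auto
  also have "(K \<times> {a..b}) \<inter> {z. l (fst z) \<le> snd z \<and> snd z \<le> h (fst z)} = {(y, s). y \<in> K \<and> l y \<le> s \<and> s \<le> h y}"
    using a b order_trans by force
  finally show ?thesis .
qed

lemma continuous_frechet_derivative:
  assumes "smooth f"
  shows "continuous_on S (\<lambda>x. frechet_derivative f (at x) c)"
proof -
  have "(\<lambda>x. frechet_derivative f (at x) c) = (\<lambda>x. \<Sum>i\<in>UNIV. c $ i *\<^sub>R partial_deriv i f x)"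
    by (rule ext) (rule frechet_derivative_partial_derivs[OF smooth_imp_has_derivative[OF assms]])
  then show ?thesis
    by (simp only:) (intro continuous_intros smooth_continuous_on smooth_partial_deriv assms)
qed

text \<open>Fubini's theorem for the region between two graphs, followed by the fundamental theorem
  of calculus on each fibre, along which the integrand is a derivative of \<open>\<omega>\<close> in
  direction \<open>c\<close>.\<close>

lemma strip_integral:
  fixes \<omega> :: "'n::finite form" and K :: "(real ^ 'k::finite) set"
  assumes K: "compact K" and l: "continuous_on UNIV l" and h: "continuous_on UNIV h"
    and lh: "\<And>y. y \<in> K \<Longrightarrow> l y \<le> h y"
    and \<omega>: "smooth \<omega>" and q: "continuous_on UNIV q"
  shows "(LINT z|lborel. indicator {(y, s). y \<in> K \<and> l y \<le> s \<and> s \<le> h y} z *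
        (frechet_derivative \<omega> (at (q (fst z) + snd z *\<^sub>R c)) c \<bullet> \<xi>))
    = (LINT y:K|lborel. (\<omega> (q y + h y *\<^sub>R c) - \<omega> (q y + l y *\<^sub>R c)) \<bullet> \<xi>)"
proof -
  let ?R = "{(y, s). y \<in> K \<and> l y \<le> s \<and> s \<le> h y}"
  let ?D = "\<lambda>y s. frechet_derivative \<omega> (at (q y + s *\<^sub>R c)) c \<bullet> \<xi>"
  let ?f = "\<lambda>z. indicator ?R z * ?D (fst z) (snd z)"
  have cont: "continuous_on S (\<lambda>z. ?D (fst z) (snd z))" for S
    by (intro continuous_intros continuous_on_compose2[OF continuous_frechet_derivative[OF \<omega>, of UNIV]]
        continuous_on_compose2[OF q]) auto
  have "integrable lborel (\<lambda>z. indicator ?R z *\<^sub>R ?D (fst z) (snd z))"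
    by (rule borel_integrable_compact[OF compact_strip[OF K l h] cont])
  then have int: "integrable (lborel \<Otimes>\<^sub>M lborel) ?f" by (simp add: lborel_prod)
  have "(LINT z|lborel. ?f z) = (LINT z|(lborel \<Otimes>\<^sub>M lborel). ?f z)" by (simp only: lborel_prod)
  also have "\<dots> = (LINT y|lborel. (LINT s|lborel. ?f (y, s)))"
    by (rule lborel_pair.integral_fst'[OF int, symmetric])
  also have "\<dots> = (LINT y|lborel. indicator K y *\<^sub>R ((\<omega> (q y + h y *\<^sub>R c) - \<omega> (q y + l y *\<^sub>R c)) \<bullet> \<xi>))"
  proof (rule Bochner_Integration.integral_cong[OF refl])
    fix y
    show "(LINT s|lborel. ?f (y, s)) = indicator K y *\<^sub>R ((\<omega> (q y + h y *\<^sub>R c) - \<omega> (q y + l y *\<^sub>R c)) \<bullet> \<xi>)"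
    proof (cases "y \<in> K")
      case True
      have "(LINT s|lborel. indicator {l y..h y} s *\<^sub>R ?D y s) = \<omega> (q y + h y *\<^sub>R c) \<bullet> \<xi> - \<omega> (q y + l y *\<^sub>R c) \<bullet> \<xi>"
      proof (rule integral_FTC_Icc[OF lh[OF True]])
        show "((\<lambda>s. \<omega> (q y + s *\<^sub>R c) \<bullet> \<xi>) has_vector_derivative ?D y s) (at s within {l y..h y})" for s
          by (rule has_vector_derivative_at_within)
            (rule bounded_linear.has_vector_derivative[OF bounded_linear_inner_left has_vector_derivative_line[OF \<omega>]])
        show "continuous_on {l y..h y} (?D y)"
          by (intro continuous_intros continuous_on_compose2[OF continuous_frechet_derivative[OF \<omega>, of UNIV]]) auto
      qed
      moreover have "(LINT s|lborel. ?f (y, s)) = (LINT s|lborel. indicator {l y..h y} s *\<^sub>R ?D y s)"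
        by (intro Bochner_Integration.integral_cong refl) (use True in \<open>auto simp: indicator_def\<close>)
      ultimately show ?thesis using True by (simp only: indicator_simps inner_diff_left scaleR_one)
    qed (simp add: indicator_def)
  qed
  finally show ?thesis by (simp add: set_lebesgue_integral_def)
qed

text \<open>Parametrises the sides y_j = 0 and y_j = 1 of the prism whose height is y_i: after the
  exchange the height is stored in coordinate \<open>j\<close> and is bounded by coordinate
  \<open>i\<close>.\<close>

definition below_diagonal :: "'k \<Rightarrow> 'k \<Rightarrow> (real ^ 'k::finite) set" where
  "below_diagonal i j = {y \<in> unit_cube. y $ j \<le> y $ i}"

lemma compact_below_diagonal: "compact (below_diagonal i j)"
proof -
  have "closed {y :: real ^ 'a. y $ j \<le> y $ i}" by (intro closed_Collect_le continuous_intros)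
  then have "compact (unit_cube \<inter> {y :: real ^ 'a. y $ j \<le> y $ i})"
    by (rule compact_Int_closed[OF compact_unit_cube])
  moreover have "unit_cube \<inter> {y :: real ^ 'a. y $ j \<le> y $ i} = below_diagonal i j"
    by (auto simp: below_diagonal_def)
  ultimately show ?thesis by simp
qed

lemma set_integrable_continuous:
  fixes f :: "'a::euclidean_space \<Rightarrow> real"
  assumes "compact K" "continuous_on UNIV f"
  shows "set_integrable lborel K f"
  unfolding set_integrable_def
  by (rule borel_integrable_compact[OF assms(1) continuous_on_subset[OF assms(2)]]) auto

text \<open>
  Stokes' theorem for the prism \<open>{u + frame_point w y + s *\<^sub>R b | 0 \<le> s \<le> y $ i \<le> 1}\<close> and the
  closed form \<open>ext_deriv \<alpha>\<close>: every face is parametrised over a subset of the unit cube after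
  exchanging \<open>s\<close> with one of the coordinates of \<open>y\<close>.
\<close>

lemma prism:
  fixes w :: "'k::{finite,linorder} \<Rightarrow> real ^ 'n::{finite,linorder}"
  assumes \<alpha>: "smooth \<alpha>"
  defines "\<omega> \<equiv> ext_deriv \<alpha>"
  shows "piece_integral u (w(i := w i + b)) unit_cube \<omega>
    = piece_integral u w unit_cube \<omega> + piece_integral (u + w i) (w(i := b)) unit_cube \<omega>
      + (\<Sum>j\<in>UNIV - {i}. piece_integral (u + w j) (w(j := b)) (below_diagonal i j) \<omega>
          - piece_integral u (w(j := b)) (below_diagonal i j) \<omega>)"
proof -
  have \<omega>: "smooth \<omega>" unfolding \<omega>_def by (rule smooth_ext_deriv[OF \<alpha>])
  define R where "R = {(y, s). y \<in> unit_cube \<and> 0 \<le> s \<and> s \<le> (y :: real ^ 'k::{finite,linorder}) $ i}"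
  define G where "G j z = frechet_derivative \<omega> (at (u + frame_point w (fst z) + snd z *\<^sub>R b)) (w j) \<bullet> frame_wedge (w(j := b))"
    for j and z :: "(real ^ 'k::{finite,linorder}) \<times> real"
  have compR: "compact R" unfolding R_def
    by (rule compact_strip[OF compact_unit_cube]) (intro continuous_intros)+
  have contG: "continuous_on S (G j)" for S j
    unfolding G_def
    by (intro continuous_intros continuous_on_compose2[OF continuous_frechet_derivative[OF \<omega>, of UNIV]]
        continuous_on_compose2[OF continuous_on_frame_point[of UNIV]]) auto
  have intG: "integrable lborel (\<lambda>z. indicator R z * G j z)" for j
    using borel_integrable_compact[OF compR contG[of R j]] by simp
  have contq: "continuous_on UNIV (\<lambda>y. u + frame_point w' y)" for w' :: "'k::{finite,linorder} \<Rightarrow> real ^ 'n::{finite,linorder}"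
    by (intro continuous_intros continuous_on_frame_point)
  have cont\<omega>: "continuous_on UNIV (\<lambda>y. \<omega> (p + frame_point w' y) \<bullet> \<xi>)" for p and w' :: "'k::{finite,linorder} \<Rightarrow> real ^ 'n::{finite,linorder}" and \<xi>
    by (intro continuous_intros continuous_on_compose2[OF smooth_continuous_on[OF \<omega>, of UNIV]] continuous_on_frame_point) auto
  have int: "set_integrable lborel K (\<lambda>y. \<omega> (p + frame_point w' y) \<bullet> \<xi>)" if "compact K"
    for K p and w' :: "'k::{finite,linorder} \<Rightarrow> real ^ 'n::{finite,linorder}" and \<xi>
    by (rule set_integrable_continuous[OF that cont\<omega>])
  \<comment> \<open>Integrating the derivative in direction \<open>b\<close> over the height yields
    the slanted top minus the bottom, both still paired with \<open>frame_wedge w\<close>.\<close>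
  have "(LINT z|lborel. indicator R z * (frechet_derivative \<omega> (at (u + frame_point w (fst z) + snd z *\<^sub>R b)) b \<bullet> frame_wedge w))
      = (LINT y:unit_cube|lborel. (\<omega> (u + frame_point w y + y $ i *\<^sub>R b) - \<omega> (u + frame_point w y + 0 *\<^sub>R b)) \<bullet> frame_wedge w)"
    unfolding R_def
    by (rule strip_integral[OF compact_unit_cube _ _ _ \<omega> contq]) (auto simp: unit_cube_def intro!: continuous_intros)
  also have "\<dots> = (LINT y:unit_cube|lborel. \<omega> (u + frame_point (w(i := w i + b)) y) \<bullet> frame_wedge w)
      - (LINT y:unit_cube|lborel. \<omega> (u + frame_point w y) \<bullet> frame_wedge w)"
    by (subst set_integral_diff(2)[symmetric, OF int[OF compact_unit_cube] int[OF compact_unit_cube]])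
      (simp add: inner_diff_left frame_point_upd add.assoc)
  finally have lhs: "(LINT z|lborel. indicator R z * (frechet_derivative \<omega> (at (u + frame_point w (fst z) + snd z *\<^sub>R b)) b \<bullet> frame_wedge w))
    = (LINT y:unit_cube|lborel. \<omega> (u + frame_point (w(i := w i + b)) y) \<bullet> frame_wedge w)
      - (LINT y:unit_cube|lborel. \<omega> (u + frame_point w y) \<bullet> frame_wedge w)" .
  have "(LINT z|lborel. indicator R z * (frechet_derivative \<omega> (at (u + frame_point w (fst z) + snd z *\<^sub>R b)) b \<bullet> frame_wedge w))
      = (LINT z|lborel. (\<Sum>j\<in>UNIV. indicator R z * G j z))"
  proof -
    have "frechet_derivative \<omega> (at (u + frame_point w (fst z) + snd z *\<^sub>R b)) b \<bullet> frame_wedge w = (\<Sum>j\<in>UNIV. G j z)" for z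
      unfolding \<omega>_def G_def by (rule ext_deriv_closed_frame[OF \<alpha>])
    then show ?thesis by (simp only: sum_distrib_left)
  qed
  also have "\<dots> = (\<Sum>j\<in>UNIV. (LINT z|lborel. indicator R z * G j z))"
    by (rule Bochner_Integration.integral_sum) (rule intG)
  also have "\<dots> = (LINT z|lborel. indicator R z * G i z) + (\<Sum>j\<in>UNIV - {i}. (LINT z|lborel. indicator R z * G j z))"
    by (rule sum.remove) auto
  finally have split: "(LINT z|lborel. indicator R z * (frechet_derivative \<omega> (at (u + frame_point w (fst z) + snd z *\<^sub>R b)) b \<bullet> frame_wedge w))
    = (LINT z|lborel. indicator R z * G i z) + (\<Sum>j\<in>UNIV - {i}. (LINT z|lborel. indicator R z * G j z))" .
  have swap: "(LINT z|lborel. indicator R z * G j z) = (LINT z|lborel. indicator R (exchange j z) *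
      (frechet_derivative \<omega> (at (u + frame_point (w(j := b)) (fst z) + snd z *\<^sub>R w j)) (w j) \<bullet> frame_wedge (w(j := b))))" for j
  proof -
    have "(LINT z|lborel. indicator R z * G j z) = (LINT z|lborel. indicator R (exchange j z) * G j (exchange j z))"
      using borel_measurable_integrable[OF intG[of j]] by (subst lborel_integral_exchange) auto
    moreover have "u + frame_point w (fst (exchange j z)) + snd (exchange j z) *\<^sub>R b = u + frame_point (w(j := b)) (fst z) + snd z *\<^sub>R w j" for z
      by (cases z) (simp add: exchange_def frame_point_cart_upd frame_point_upd algebra_simps)
    ultimately show ?thesis by (simp add: G_def)
  qed
  \<comment> \<open>For \<open>j \<noteq> i\<close> the exchanged prism is the full strip 0 \<le> s
    \<le> 1 over \<open>below_diagonal i j\<close>, so its two ends are translates of each other by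
    \<open>w j\<close>.\<close>
  have side: "(LINT z|lborel. indicator R z * G j z) = piece_integral (u + w j) (w(j := b)) (below_diagonal i j) \<omega>
          - piece_integral u (w(j := b)) (below_diagonal i j) \<omega>" if j: "j \<noteq> i" for j
  proof -
    have "exchange j z \<in> R \<longleftrightarrow> z \<in> {(y, s). y \<in> below_diagonal i j \<and> 0 \<le> s \<and> s \<le> 1}" for z
      using j by (cases z) (auto simp: exchange_def R_def below_diagonal_def unit_cube_def cart_upd_def intro: order_trans; metis order_trans)
    then have ind: "indicator R (exchange j z) = (indicator {(y, s). y \<in> below_diagonal i j \<and> 0 \<le> s \<and> s \<le> 1} z :: real)" for z
      by (simp add: indicator_def)
    have "(LINT z|lborel. indicator R z * G j z)
      = (LINT y:below_diagonal i j|lborel. (\<omega> (u + frame_point (w(j := b)) y + 1 *\<^sub>R w j) - \<omega> (u + frame_point (w(j := b)) y + 0 *\<^sub>R w j)) \<bullet> frame_wedge (w(j := b)))"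
      unfolding swap ind by (rule strip_integral[OF compact_below_diagonal _ _ _ \<omega> contq]) auto
    also have "\<dots> = (LINT y:below_diagonal i j|lborel. \<omega> ((u + w j) + frame_point (w(j := b)) y) \<bullet> frame_wedge (w(j := b)))
       - (LINT y:below_diagonal i j|lborel. \<omega> (u + frame_point (w(j := b)) y) \<bullet> frame_wedge (w(j := b)))"
      by (subst set_integral_diff(2)[symmetric, OF int[OF compact_below_diagonal] int[OF compact_below_diagonal]])
        (simp add: inner_diff_left algebra_simps)
    finally show ?thesis by (simp add: piece_integral_def)
  qed
  \<comment> \<open>For \<open>j = i\<close> the exchanged prism lies between s = y_i and s = 1. The
    upper end is the face at \<open>u + w i\<close>; the lower end is the slanted top again, now
    paired with \<open>frame_wedge (w(i := b))\<close>.\<close>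
  have top: "(LINT z|lborel. indicator R z * G i z) = piece_integral (u + w i) (w(i := b)) unit_cube \<omega>
      - (LINT y:unit_cube|lborel. \<omega> (u + frame_point (w(i := w i + b)) y) \<bullet> frame_wedge (w(i := b)))"
  proof -
    have "exchange i z \<in> R \<longleftrightarrow> z \<in> {(y, s). y \<in> unit_cube \<and> y $ i \<le> s \<and> s \<le> 1}" for z
      by (cases z) (auto simp: exchange_def R_def unit_cube_def cart_upd_def intro: order_trans; metis order_trans)
    then have ind: "indicator R (exchange i z) = (indicator {(y, s). y \<in> unit_cube \<and> y $ i \<le> s \<and> s \<le> 1} z :: real)" for z
      by (simp add: indicator_def)
    have "(LINT z|lborel. indicator R z * G i z)
      = (LINT y:unit_cube|lborel. (\<omega> (u + frame_point (w(i := b)) y + 1 *\<^sub>R w i) - \<omega> (u + frame_point (w(i := b)) y + y $ i *\<^sub>R w i)) \<bullet> frame_wedge (w(i := b)))"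
      unfolding swap ind by (rule strip_integral[OF compact_unit_cube _ _ _ \<omega> contq]) (auto simp: unit_cube_def intro!: continuous_intros)
    also have "\<dots> = (LINT y:unit_cube|lborel. \<omega> ((u + w i) + frame_point (w(i := b)) y) \<bullet> frame_wedge (w(i := b)))
       - (LINT y:unit_cube|lborel. \<omega> (u + frame_point (w(i := w i + b)) y) \<bullet> frame_wedge (w(i := b)))"
      by (subst set_integral_diff(2)[symmetric, OF int[OF compact_unit_cube] int[OF compact_unit_cube]])
        (simp add: inner_diff_left frame_point_upd algebra_simps)
    finally show ?thesis by (simp add: piece_integral_def)
  qed
  \<comment> \<open>Additivity in slot \<open>i\<close> joins the two contributions of the slanted
    top to one piece with its own frame.\<close>
  have "frame_wedge (w(i := w i + b)) = frame_wedge w + frame_wedge (w(i := b))"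
    using linear_add[OF linear_frame_wedge, of w i "w i" b] by simp
  then have "piece_integral u (w(i := w i + b)) unit_cube \<omega>
      = (LINT y:unit_cube|lborel. \<omega> (u + frame_point (w(i := w i + b)) y) \<bullet> frame_wedge w)
      + (LINT y:unit_cube|lborel. \<omega> (u + frame_point (w(i := w i + b)) y) \<bullet> frame_wedge (w(i := b)))"
    unfolding piece_integral_def
    by (subst set_integral_add(2)[symmetric, OF int[OF compact_unit_cube] int[OF compact_unit_cube]])
      (simp add: inner_add_right)
  moreover have "piece_integral u w unit_cube \<omega> = (LINT y:unit_cube|lborel. \<omega> (u + frame_point w y) \<bullet> frame_wedge w)"
    by (simp add: piece_integral_def)
  ultimately show ?thesis using lhs split top side by simp
qed

section \<open>Boundary functionals modulo negligible ones\<close>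

section \<open>Boundaries of chains of pieces\<close>

text \<open>Functionals on forms become vectors, so that \<open>subspace\<close> and linear
  combinations apply to them. The pointwise simplification rules are switched off afterwards, which
  keeps them from being unfolded to values.\<close>

instantiation "fun" :: (type, real_vector) real_vector
begin
definition scaleR_fun :: "real \<Rightarrow> ('a \<Rightarrow> 'b) \<Rightarrow> 'a \<Rightarrow> 'b" where
  "scaleR_fun r f = (\<lambda>x. r *\<^sub>R f x)"
instance by standard (auto simp: scaleR_fun_def fun_eq_iff algebra_simps)
end

lemma scaleR_fun_apply: "(r *\<^sub>R f) x = r *\<^sub>R f x"
  by (simp add: scaleR_fun_def)

lemmas functional_apply = plus_fun_apply zero_fun_apply minus_apply uminus_apply scaleR_fun_apply

declare plus_fun_apply [simp del] zero_fun_apply [simp del] minus_apply [simp del] uminus_apply [simp del]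

text \<open>
  The piece \<open>(a, u, w, K)\<close> stands for the current \<open>\<omega> \<mapsto> a * piece_integral u w K \<omega>\<close>; \<open>bd\<close> is the
  boundary of the sum of the pieces of a list, a functional on smooth forms.
\<close>

type_synonym ('n, 'k) piece = "real \<times> (real ^ 'n) \<times> ('k \<Rightarrow> real ^ 'n) \<times> (real ^ 'k) set"

definition bd :: "('n::{finite,linorder}, 'k::{finite,linorder}) piece list \<Rightarrow> 'n form \<Rightarrow> real" where
  "bd c = (\<lambda>\<alpha>. if smooth \<alpha> then \<Sum>(a, u, w, K)\<leftarrow>c. a * piece_integral u w K (ext_deriv \<alpha>) else 0)"

definition pieces :: "('n::finite, 'k::finite) piece list \<Rightarrow> bool" where
  "pieces c \<longleftrightarrow> (\<forall>(a, u, w, K)\<in>set c. polytope K \<and> K \<subseteq> unit_cube)"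

text \<open>The volume of \<open>K\<close> is replaced by 1, an upper bound for subsets of the unit
  cube. The quantity serves for estimating error terms.\<close>

definition piece_mass :: "('n::{finite,linorder}, 'k::{finite,linorder}) piece list \<Rightarrow> real" where
  "piece_mass c = (\<Sum>(a, u, w, K)\<leftarrow>c. \<bar>a\<bar> * norm (frame_wedge w))"

text \<open>Overlapping pieces are charged separately, so cancellation is ignored. The weight stands
  inside \<open>\<phi>\<close> because a negative weight reverses the orientation and the functions
  used for \<open>\<phi>\<close> are only positively homogeneous.\<close>

definition piece_energy ::
    "('n::{finite,linorder} ext \<Rightarrow> real) \<Rightarrow> ('n, 'k::{finite,linorder}) piece list \<Rightarrow> real" where
  "piece_energy \<phi> c = (\<Sum>(a, u, w, K)\<leftarrow>c. measure lborel K * \<phi> (a *\<^sub>R frame_wedge w))"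

definition translate :: "real ^ 'n::finite \<Rightarrow> ('n form \<Rightarrow> real) \<Rightarrow> 'n form \<Rightarrow> real" where
  "translate t S = (\<lambda>\<alpha>. S (\<lambda>x. \<alpha> (t + x)))"

definition translates :: "(real ^ 'n::finite) list \<Rightarrow> ('n form \<Rightarrow> real) \<Rightarrow> 'n form \<Rightarrow> real" where
  "translates ts S = (\<Sum>t\<leftarrow>ts. translate t S)"

definition translate_pieces :: "real ^ 'n::finite \<Rightarrow> ('n, 'k) piece list \<Rightarrow> ('n, 'k) piece list" where
  "translate_pieces t c = map (\<lambda>(a, u, w, K). (a, t + u, w, K)) c"

definition scale_pieces :: "real \<Rightarrow> ('n, 'k) piece list \<Rightarrow> ('n, 'k) piece list" where
  "scale_pieces r c = map (\<lambda>(a, u, w, K). (r * a, u, w, K)) c"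

lemma pieces_simps [simp]:
  "pieces []" "pieces (c @ c') \<longleftrightarrow> pieces c \<and> pieces c'"
  "pieces ((a, u, w, K) # c) \<longleftrightarrow> polytope K \<and> K \<subseteq> unit_cube \<and> pieces c"
  "pieces (translate_pieces t c) \<longleftrightarrow> pieces c" "pieces (scale_pieces r c) \<longleftrightarrow> pieces c"
  "pieces (concat cs) \<longleftrightarrow> (\<forall>c\<in>set cs. pieces c)"
  by (simp_all add: pieces_def translate_pieces_def scale_pieces_def case_prod_unfold ball_Un)

lemma bd_simps [simp]: "bd [] = 0" "bd (c @ c') = bd c + bd c'"
  by (auto simp: bd_def fun_eq_iff functional_apply)

lemma bd_concat: "bd (concat cs) = (\<Sum>c\<leftarrow>cs. bd c)"
  by (induction cs) auto

lemma smooth_translate_iff: "smooth (\<lambda>x. \<alpha> (t + x)) \<longleftrightarrow> smooth \<alpha>"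
proof -
  have "smooth (\<lambda>x. \<alpha> (t + x))" if "smooth \<alpha>" for \<alpha> :: "real ^ 'a \<Rightarrow> 'b" and t
    using smooth_affine[OF linear_ident that, of t] by simp
  from this this[of "\<lambda>x. \<alpha> (t + x)" "- t"] show ?thesis by auto
qed

lemma bd_translate_pieces:
  fixes c :: "('n::{finite,linorder}, 'k::{finite,linorder}) piece list"
  shows "bd (translate_pieces t c) = translate t (bd c)"
proof -
  have "piece_integral (t + u) w K (ext_deriv \<alpha>) = piece_integral u w K (ext_deriv (\<lambda>x. \<alpha> (t + x)))" if "smooth \<alpha>"
    for u and w :: "'k::{finite,linorder} \<Rightarrow> real ^ 'n::{finite,linorder}" and K \<alpha>
    using ext_deriv_affine[OF that, of t 1] by (simp add: piece_integral_def add.assoc)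
  then show ?thesis
    by (auto simp: bd_def translate_def translate_pieces_def fun_eq_iff smooth_translate_iff o_def case_prod_unfold)
qed

lemma bd_scale_pieces: "bd (scale_pieces r c) = r *\<^sub>R bd c"
  by (auto simp: bd_def scale_pieces_def fun_eq_iff functional_apply o_def case_prod_unfold sum_list_const_mult mult.assoc)

lemma piece_mass_simps [simp]:
  "piece_mass [] = 0" "piece_mass (c @ c') = piece_mass c + piece_mass c'"
  "piece_mass ((a, u, w, K) # c) = \<bar>a\<bar> * norm (frame_wedge w) + piece_mass c"
  "piece_mass (translate_pieces t c) = piece_mass c" "piece_mass (scale_pieces r c) = \<bar>r\<bar> * piece_mass c"
  by (auto simp: piece_mass_def translate_pieces_def scale_pieces_def o_def case_prod_unfold abs_mult
      sum_list_const_mult mult.assoc)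

lemma piece_mass_concat: "piece_mass (concat cs) = (\<Sum>c\<leftarrow>cs. piece_mass c)"
  by (induction cs) auto

lemma piece_mass_nonneg: "0 \<le> piece_mass c"
  unfolding piece_mass_def by (rule sum_list_nonneg) auto

lemma piece_energy_simps [simp]:
  "piece_energy \<phi> [] = 0" "piece_energy \<phi> (c @ c') = piece_energy \<phi> c + piece_energy \<phi> c'"
  "piece_energy \<phi> (translate_pieces t c) = piece_energy \<phi> c"
  by (auto simp: piece_energy_def translate_pieces_def o_def case_prod_unfold)

lemma piece_energy_concat: "piece_energy \<phi> (concat cs) = (\<Sum>c\<leftarrow>cs. piece_energy \<phi> c)"
  by (induction cs) auto

lemma translate_linear [simp]:
  "translate t 0 = 0" "translate t (S + S') = translate t S + translate t S'"
  "translate t (S - S') = translate t S - translate t S'" "translate t (r *\<^sub>R S) = r *\<^sub>R translate t S"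
  by (auto simp: translate_def fun_eq_iff functional_apply)

lemma translate_translate: "translate t (translate s S) = translate (t + s) S"
  by (simp add: translate_def add.commute add.left_commute)

lemma translate_zero [simp]: "translate 0 S = S"
  by (simp add: translate_def)

lemma translates_simps [simp]:
  "translates [] S = 0" "translates (t # ts) S = translate t S + translates ts S"
  "translates (ts @ ts') S = translates ts S + translates ts' S"
  by (simp_all add: translates_def)

lemma translates_linear:
  "translates ts 0 = 0" "translates ts (S + S') = translates ts S + translates ts S'"
  "translates ts (S - S') = translates ts S - translates ts S'" "translates ts (r *\<^sub>R S) = r *\<^sub>R translates ts S"
  by (induction ts) (auto simp: algebra_simps)

lemma translates_translates:
  "translates ts (translates us S) = translates (concat (map (\<lambda>t. map ((+) t) us) ts)) S"
proof -
  have "translate t (translates us S) = translates (map ((+) t) us) S" for t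
    by (induction us) (auto simp: translate_translate)
  then show ?thesis by (induction ts) auto
qed

lemma translate_translates: "translate t (translates us S) = translates us (translate t S)"
  by (induction us) (auto simp: translate_translate add.commute)

lemma translates_commute: "translates ts (translates us S) = translates us (translates ts S)"
  by (induction ts) (auto simp: translates_linear translate_translates)

lemma translates_bd: "translates ts (bd c) = bd (concat (map (\<lambda>t. translate_pieces t c) ts))"
  by (induction ts) (auto simp: bd_translate_pieces)

lemma sum_list_map_const: "(\<Sum>x\<leftarrow>xs. c) = real (length xs) * c"
  by (induction xs) (auto simp: algebra_simps)

lemma piece_mass_translates: "piece_mass (concat (map (\<lambda>t. translate_pieces t c) ts)) = length ts * piece_mass c"
  by (simp add: piece_mass_concat o_def sum_list_map_const)

lemma piece_energy_translates: "piece_energy \<phi> (concat (map (\<lambda>t. translate_pieces t c) ts)) = length ts * piece_energy \<phi> c"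
  by (simp add: piece_energy_concat o_def sum_list_map_const)

section \<open>Functionals negligible on average\<close>

text \<open>Averaged over a suitable finite list of translations, the functional bounds a chain of
  mass at most \<open>e\<close>. Instead of dividing, both sides are multiplied by the length of the
  list, in which repetitions are allowed.\<close>

definition negligible_functionals :: "'k::{finite,linorder} itself \<Rightarrow> ('n::{finite,linorder} form \<Rightarrow> real) set" where
  "negligible_functionals _ = {S. \<forall>e>0. \<exists>ts (r :: ('n, 'k) piece list). ts \<noteq> [] \<and> pieces r \<and>
     piece_mass r \<le> e * real (length ts) \<and> translates ts S = bd r}"

lemma negligible_functionalsE:
  assumes "S \<in> negligible_functionals TYPE('k::{finite,linorder})" "e > 0"
  obtains ts and r :: "('n::{finite,linorder}, 'k::{finite,linorder}) piece list"
  where "ts \<noteq> []" "pieces r" "piece_mass r \<le> e * real (length ts)" "translates ts S = bd r"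
  using assms unfolding negligible_functionals_def by blast

lemma subspace_negligible_functionals:
  "subspace (negligible_functionals TYPE('k::{finite,linorder}) :: ('n::{finite,linorder} form \<Rightarrow> real) set)"
proof (rule subspaceI)
  let ?N = "negligible_functionals TYPE('k) :: ('n::{finite,linorder} form \<Rightarrow> real) set"
  show "0 \<in> ?N" unfolding negligible_functionals_def
  proof (intro CollectI allI impI exI conjI)
    show "translates [0] 0 = bd ([] :: ('n, 'k) piece list)" by simp
  qed auto
  fix S S' assume S: "S \<in> ?N" "S' \<in> ?N"
  show "S + S' \<in> ?N" unfolding negligible_functionals_def mem_Collect_eq
  proof (intro allI impI)
    fix e :: real assume "e > 0"
    then have e: "e / 2 > 0" by simp
    obtain ts and r :: "('n, 'k) piece list" where r: "ts \<noteq> []" "pieces r" "piece_mass r \<le> e / 2 * real (length ts)" "translates ts S = bd r"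
      using negligible_functionalsE[OF S(1) e] .
    obtain ts' and r' :: "('n, 'k) piece list" where r': "ts' \<noteq> []" "pieces r'" "piece_mass r' \<le> e / 2 * real (length ts')" "translates ts' S' = bd r'"
      using negligible_functionalsE[OF S(2) e] .
    \<comment> \<open>All sums of a translation from \<open>ts\<close> and one from
      \<open>ts'\<close>. Since translations commute, each of the two functionals can be averaged
      over its own list before the other list is applied.\<close>
    define us where "us = concat (map (\<lambda>t. map ((+) t) ts) ts')"
    have len: "length us = length ts' * length ts"
      unfolding us_def by (simp add: length_concat o_def sum_list_triv)
    define q where "q = concat (map (\<lambda>t. translate_pieces t r) ts') @ concat (map (\<lambda>t. translate_pieces t r') ts)"
    have "translates us (S + S') = translates ts' (translates ts S) + translates ts (translates ts' S')"
      unfolding us_def translates_translates[symmetric] translates_linear by (simp add: translates_commute[of ts'])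
    also have "\<dots> = bd q" by (simp add: r r' translates_bd q_def)
    finally have "translates us (S + S') = bd q" .
    moreover have "piece_mass q \<le> e * real (length us)"
    proof -
      have "piece_mass q = length ts' * piece_mass r + length ts * piece_mass r'"
        by (simp add: q_def piece_mass_translates)
      also have "\<dots> \<le> length ts' * (e / 2 * real (length ts)) + length ts * (e / 2 * real (length ts'))"
        by (intro add_mono mult_left_mono r r') auto
      finally show ?thesis by (simp add: len)
    qed
    moreover have "pieces q" using r r' by (simp add: q_def)
    moreover have "us \<noteq> []" using len r(1) r'(1) by auto
    ultimately show "\<exists>ts (r :: ('n, 'k) piece list). ts \<noteq> [] \<and> pieces r \<and> piece_mass r \<le> e * real (length ts) \<and> translates ts (S + S') = bd r"
      by blast
  qed
next
  let ?N = "negligible_functionals TYPE('k) :: ('n::{finite,linorder} form \<Rightarrow> real) set"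
  fix S and c :: real assume S: "S \<in> ?N"
  show "c *\<^sub>R S \<in> ?N" unfolding negligible_functionals_def mem_Collect_eq
  proof (intro allI impI)
    fix e :: real assume e: "e > 0"
    obtain ts and r :: "('n, 'k) piece list" where r: "ts \<noteq> []" "pieces r" "piece_mass r \<le> e / (\<bar>c\<bar> + 1) * real (length ts)" "translates ts S = bd r"
      using negligible_functionalsE[OF S, of "e / (\<bar>c\<bar> + 1)"] e by auto
    have "piece_mass (scale_pieces c r) \<le> \<bar>c\<bar> * (e / (\<bar>c\<bar> + 1) * real (length ts))"
      using mult_left_mono[OF r(3), of "\<bar>c\<bar>"] by simp
    also have "\<dots> = (\<bar>c\<bar> / (\<bar>c\<bar> + 1)) * (e * real (length ts))" by simp
    also have "\<dots> \<le> 1 * (e * real (length ts))" by (rule mult_right_mono) (use e in auto)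
    finally show "\<exists>ts (r :: ('n, 'k) piece list). ts \<noteq> [] \<and> pieces r \<and> piece_mass r \<le> e * real (length ts) \<and> translates ts (c *\<^sub>R S) = bd r"
      using r by (intro exI[of _ ts] exI[of _ "scale_pieces c r"]) (simp add: translates_linear bd_scale_pieces)
  qed
qed

text \<open>Averaging keeps the mass per translation, so a part that bounds arbitrarily small mass
  may be split off. This is what gives access to real factors, which are reached by
  approximation.\<close>

lemma negligible_functionals_closed:
  fixes S :: "'n::{finite,linorder} form \<Rightarrow> real"
  assumes "\<And>e. e > 0 \<Longrightarrow> \<exists>r :: ('n, 'k::{finite,linorder}) piece list. pieces r \<and> piece_mass r \<le> e \<and> S - bd r \<in> negligible_functionals TYPE('k)"
  shows "S \<in> negligible_functionals TYPE('k)"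
  unfolding negligible_functionals_def mem_Collect_eq
proof (intro allI impI)
  fix e :: real assume "e > 0"
  then have e: "e / 2 > 0" by simp
  obtain r :: "('n, 'k) piece list" where r: "pieces r" "piece_mass r \<le> e / 2" "S - bd r \<in> negligible_functionals TYPE('k)"
    using assms[OF e] by auto
  obtain ts and r' :: "('n, 'k) piece list" where r': "ts \<noteq> []" "pieces r'" "piece_mass r' \<le> e / 2 * real (length ts)" "translates ts (S - bd r) = bd r'"
    using negligible_functionalsE[OF r(3) e] .
  define q where "q = r' @ concat (map (\<lambda>t. translate_pieces t r) ts)"
  have "translates ts S = translates ts (S - bd r) + translates ts (bd r)" by (simp add: translates_linear)
  also have "\<dots> = bd q" by (simp add: r' q_def translates_bd)
  finally have "translates ts S = bd q" .
  moreover have "piece_mass q \<le> e / 2 * real (length ts) + length ts * (e / 2)"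
    unfolding q_def piece_mass_simps piece_mass_translates by (intro add_mono mult_left_mono r r') auto
  moreover have "pieces q" using r r' by (simp add: q_def)
  ultimately show "\<exists>ts (r :: ('n, 'k) piece list). ts \<noteq> [] \<and> pieces r \<and> piece_mass r \<le> e * real (length ts) \<and> translates ts S = bd r"
    using r'(1) by (intro exI[of _ ts] exI[of _ q]) simp
qed

text \<open>Over the translations 0, t, ..., (m - 1) t the sum telescopes: only the two end chains
  remain, of total mass \<open>2 * piece_mass c\<close>, which is small against
  \<open>m\<close>.\<close>

lemma negligible_translate:
  fixes c :: "('n::{finite,linorder}, 'k::{finite,linorder}) piece list"
  assumes "pieces c"
  shows "translate t (bd c) - bd c \<in> negligible_functionals TYPE('k)"
  unfolding negligible_functionals_def mem_Collect_eq
proof (intro allI impI)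
  fix e :: real assume e: "e > 0"
  obtain m where m: "2 * piece_mass c / e < real m" using reals_Archimedean2 by blast
  then have "m > 0" using e piece_mass_nonneg[of c] by (cases m) (auto simp: field_simps)
  have tel: "translates (map (\<lambda>j. real j *\<^sub>R t) [0..<m]) (translate t S - S) = translate (real m *\<^sub>R t) S - S" for S
    by (induction m) (auto simp: translate_translate algebra_simps)
  let ?q = "translate_pieces (real m *\<^sub>R t) c @ scale_pieces (- 1) c"
  have "translates (map (\<lambda>j. real j *\<^sub>R t) [0..<m]) (translate t (bd c) - bd c) = bd ?q"
    unfolding tel by (simp add: bd_translate_pieces bd_scale_pieces)
  moreover have "piece_mass ?q \<le> e * m"
    using m e by (simp add: field_simps)
  ultimately show "\<exists>ts (r :: ('n, 'k) piece list). ts \<noteq> [] \<and> pieces r \<and> piece_mass r \<le> e * real (length ts) \<and> translates ts (translate t (bd c) - bd c) = bd r"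
    using assms \<open>m > 0\<close> by (intro exI[of _ "map (\<lambda>j. real j *\<^sub>R t) [0..<m]"] exI[of _ ?q]) simp
qed

section \<open>Parallelepipeds\<close>

definition face :: "(real ^ 'k::{finite,linorder}) set \<Rightarrow> ('k \<Rightarrow> real ^ 'n::{finite,linorder}) \<Rightarrow> 'n form \<Rightarrow> real" where
  "face K w = bd [(1, 0, w, K)]"

lemma polytope_unit_cube: "polytope unit_cube"
  unfolding unit_cube_cbox by (rule polytope_interval)

lemma polytope_below_diagonal: "polytope (below_diagonal i j :: (real ^ 'k::finite) set)"
proof -
  have "below_diagonal i j = unit_cube \<inter> {y :: real ^ 'k. (axis j 1 - axis i 1) \<bullet> y \<le> 0}"
    by (auto simp: below_diagonal_def inner_diff_left inner_axis')
  then show ?thesis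
    by (simp add: polytope_Int_polyhedron polytope_unit_cube polyhedron_halfspace_le)
qed

lemma below_diagonal_subset: "below_diagonal i j \<subseteq> unit_cube"
  by (auto simp: below_diagonal_def)

lemma face_eq_0: "frame_wedge w = 0 \<Longrightarrow> face K w = 0"
  by (auto simp: face_def bd_def piece_integral_def fun_eq_iff functional_apply set_lebesgue_integral_def)

lemma translate_face: "translate t (face K w) = bd [(1, t, w, K)]"
  unfolding face_def bd_translate_pieces[symmetric] by (simp add: translate_pieces_def)

text \<open>The prism formula as an identity of functionals, with base points expressed by
  \<open>translate\<close>. The later relations between parallelepipeds are all drawn from
  it.\<close>

lemma face_prism:
  fixes w :: "'k::{finite,linorder} \<Rightarrow> real ^ 'n::{finite,linorder}"
  shows "face unit_cube (w(i := w i + b)) = face unit_cube w + translate (w i) (face unit_cube (w(i := b)))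
    + (\<Sum>j\<in>UNIV - {i}. translate (w j) (face (below_diagonal i j) (w(j := b))) - face (below_diagonal i j) (w(j := b)))"
proof -
  have "face unit_cube (w(i := w i + b)) \<alpha> = face unit_cube w \<alpha> + bd [(1, w i, w(i := b), unit_cube)] \<alpha>
    + (\<Sum>j\<in>UNIV - {i}. bd [(1, w j, w(j := b), below_diagonal i j)] \<alpha> - face (below_diagonal i j) (w(j := b)) \<alpha>)" for \<alpha>
  proof (cases "smooth \<alpha>")
    case True
    then show ?thesis using prism[OF True, of 0 w i b] by (simp add: face_def bd_def)
  qed (simp add: face_def bd_def)
  moreover have "sum f A \<alpha> = (\<Sum>x\<in>A. f x \<alpha>)" for f :: "'k::{finite,linorder} \<Rightarrow> 'n::{finite,linorder} form \<Rightarrow> real" and A \<alpha>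
    by (induction A rule: infinite_finite_induct) (simp_all add: functional_apply)
  ultimately show ?thesis by (simp add: fun_eq_iff translate_face functional_apply)
qed

text \<open>When the vector that is added is parallel to the edge in slot \<open>i\<close>, every
  side face has two parallel edges and vanishes, so stacking is exact and leaves no negligible
  error.\<close>

lemma face_multiple:
  fixes w :: "'k::{finite,linorder} \<Rightarrow> real ^ 'n::{finite,linorder}"
  shows "face unit_cube (w(i := real n *\<^sub>R w i)) = translates (map (\<lambda>j. real j *\<^sub>R w i) [0..<n]) (face unit_cube w)"
proof (induction n)
  case 0
  have "frame_wedge (w(i := 0)) = 0" by (rule linear_0[OF linear_frame_wedge])
  moreover have "w(i := real 0 *\<^sub>R w i) = w(i := 0)" by simp
  ultimately have "face unit_cube (w(i := real 0 *\<^sub>R w i)) = 0" by (simp only: face_eq_0)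
  then show ?case by (simp only: upt_0 list.map translates_simps)
next
  case (Suc n)
  let ?w = "w(i := real n *\<^sub>R w i)"
  have "frame_wedge (?w(j := w i)) = 0" if "j \<noteq> i" for j
  proof -
    have "?w(j := w i) = (w(j := w i))(i := real n *\<^sub>R w i)" using that by (simp add: fun_upd_twist)
    moreover have "frame_wedge ((w(j := w i))(i := w i)) = 0"
      by (rule frame_wedge_eq_0[of i j]) (use that in auto)
    ultimately show ?thesis using linear_scale[OF linear_frame_wedge, of "w(j := w i)" i "real n" "w i"] by simp
  qed
  then have "face unit_cube (?w(i := ?w i + w i)) = face unit_cube ?w + translate (?w i) (face unit_cube (?w(i := w i)))"
    unfolding face_prism[of ?w] by (simp add: face_eq_0)
  moreover have "?w(i := ?w i + w i) = w(i := real (Suc n) *\<^sub>R w i)" "?w(i := w i) = w" "?w i = real n *\<^sub>R w i"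
    by (simp_all add: fun_eq_iff algebra_simps)
  ultimately show ?case by (simp only: Suc upt_Suc le0 if_True map_append list.map translates_simps add_0_right)
qed

text \<open>The slots are scaled one after the other by \<open>face_multiple\<close>, and each of
  them multiplies the number of positions by \<open>n\<close>.\<close>

lemma face_subdivision:
  fixes w :: "'k::{finite,linorder} \<Rightarrow> real ^ 'n::{finite,linorder}"
  obtains ts where "length ts = n ^ CARD('k)" "face unit_cube (\<lambda>i. real n *\<^sub>R w i) = translates ts (face unit_cube w)"
proof -
  have "\<exists>ts. length ts = n ^ card I \<and> face unit_cube (\<lambda>i. if i \<in> I then real n *\<^sub>R w i else w i) = translates ts (face unit_cube w)"
    if "finite I" for I
    using that
  proof (induction I rule: finite_induct)
    case empty
    show ?case by (rule exI[of _ "[0]"]) simp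
  next
    case (insert i I)
    then obtain ts where ts: "length ts = n ^ card I"
      "face unit_cube (\<lambda>i. if i \<in> I then real n *\<^sub>R w i else w i) = translates ts (face unit_cube w)" by auto
    let ?w = "\<lambda>i. if i \<in> I then real n *\<^sub>R w i else w i"
    have "(\<lambda>l. if l \<in> insert i I then real n *\<^sub>R w l else w l) = ?w(i := real n *\<^sub>R ?w i)"
      using insert(2) by auto
    then have "face unit_cube (\<lambda>l. if l \<in> insert i I then real n *\<^sub>R w l else w l)
        = translates (map (\<lambda>j. real j *\<^sub>R ?w i) [0..<n]) (translates ts (face unit_cube w))"
      using face_multiple[of ?w i n] ts(2) by simp
    also have "\<dots> = translates (concat (map (\<lambda>t. map ((+) t) ts) (map (\<lambda>j. real j *\<^sub>R ?w i) [0..<n]))) (face unit_cube w)"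
      by (rule translates_translates)
    finally show ?case using insert ts(1)
      by (intro exI[of _ "concat (map (\<lambda>t. map ((+) t) ts) (map (\<lambda>j. real j *\<^sub>R ?w i) [0..<n]))"])
        (simp add: length_concat o_def sum_list_triv)
  qed
  from this[of UNIV] show thesis using that by auto
qed

text \<open>The parallelepiped with edge \<open>w i + t\<close> is decomposed by
  \<open>face_prism\<close> in two ways, and comparing them isolates the displacement of the
  original one. The clause \<open>t \<in> range v\<close> records that every remaining piece
  contains the direction \<open>t\<close>; later this separates lateral faces from the plane of
  \<open>w\<close>.\<close>

lemma face_cylinder:
  fixes w :: "'k::{finite,linorder} \<Rightarrow> real ^ 'n::{finite,linorder}"
  assumes w: "\<And>i. norm (w i) = R"
  obtains c :: "('n, 'k) piece list" where "pieces c" "translate t (face unit_cube w) - face unit_cube w = bd c"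
    "piece_mass c \<le> 4 * CARD('k) * norm t * R ^ (CARD('k) - 1)" "\<forall>(a, u, v, K)\<in>set c. t \<in> range v"
proof -
  obtain i :: 'k where True by blast
  have "R \<ge> 0" using w[of i] norm_ge_zero by metis
  define B where "B = norm t * R ^ (CARD('k) - 1)"
  have "B \<ge> 0" unfolding B_def using \<open>R \<ge> 0\<close> by simp
  let ?T = "\<lambda>j. below_diagonal i j"
  let ?m = "scale_pieces (- 1)"
  define c0 where "c0 = [(1, w i, w(i := t), unit_cube)] @ ?m [(1, 0, w(i := t), unit_cube :: (real ^ 'k::{finite,linorder}) set)]"
  define cc where "cc j = ([(1, w j, w(j := t), ?T j)] @ ?m [(1, 0, w(j := t), ?T j)])
      @ ?m ([(1, w j, w(i := t, j := w i), ?T j)] @ ?m [(1, 0, w(i := t, j := w i), ?T j)])" for j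
  let ?js = "sorted_list_of_set (UNIV - {i})"
  define c where "c = c0 @ concat (map cc ?js)"
  have "translate t (face unit_cube w) - face unit_cube w
      = translate (w i) (face unit_cube (w(i := t))) - face unit_cube (w(i := t))
      + (\<Sum>j\<in>UNIV - {i}. translate (w j) (face (?T j) (w(j := t))) - face (?T j) (w(j := t))
          - (translate (w j) (face (?T j) (w(i := t, j := w i))) - face (?T j) (w(i := t, j := w i))))"
  proof -
    have "face unit_cube (w(i := w i + t)) = face unit_cube w + translate (w i) (face unit_cube (w(i := t)))
    + (\<Sum>j\<in>UNIV - {i}. translate (w j) (face (?T j) (w(j := t))) - face (?T j) (w(j := t)))"
      by (rule face_prism)
    \<comment> \<open>The roles of \<open>w i\<close> and \<open>t\<close> are exchanged, so the
      translate of the original parallelepiped by \<open>t\<close> appears.\<close>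
    moreover have "face unit_cube (w(i := w i + t)) = face unit_cube (w(i := t)) + translate t (face unit_cube w)
    + (\<Sum>j\<in>UNIV - {i}. translate (w j) (face (?T j) (w(i := t, j := w i))) - face (?T j) (w(i := t, j := w i)))"
    proof -
      have "(\<Sum>j\<in>UNIV - {i}. translate ((w(i := t)) j) (face (?T j) (w(i := t, j := w i))) - face (?T j) (w(i := t, j := w i)))
       = (\<Sum>j\<in>UNIV - {i}. translate (w j) (face (?T j) (w(i := t, j := w i))) - face (?T j) (w(i := t, j := w i)))"
        by (rule sum.cong) auto
      then show ?thesis using face_prism[of "w(i := t)" i "w i"] by (simp add: add.commute)
    qed
    moreover have "r - p = q - q' + (s - s')" if "X = p + q + s" "X = q' + r + s'"
      for X p q s q' r s' :: "'n::{finite,linorder} form \<Rightarrow> real"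
    proof -
      have "r = X - q' - s'" "p = X - q - s" using that by (simp_all add: algebra_simps)
      then show ?thesis by (simp add: algebra_simps)
    qed
    ultimately show ?thesis unfolding sum_subtractf by blast
  qed
  also have "\<dots> = bd c"
  proof -
    have "bd c0 = translate (w i) (face unit_cube (w(i := t))) - face unit_cube (w(i := t))"
      by (simp only: c0_def bd_simps bd_scale_pieces translate_face[symmetric] face_def[symmetric]) simp
    moreover have "bd (cc j) = translate (w j) (face (?T j) (w(j := t))) - face (?T j) (w(j := t))
          - (translate (w j) (face (?T j) (w(i := t, j := w i))) - face (?T j) (w(i := t, j := w i)))" for j
      by (simp only: cc_def bd_simps bd_scale_pieces translate_face[symmetric] face_def[symmetric]) simp
    ultimately show ?thesis
      by (simp add: c_def bd_concat o_def sum_list_distinct_conv_sum_set)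
  qed
  finally have bdc: "translate t (face unit_cube w) - face unit_cube w = bd c" .
  have B1: "norm (frame_wedge (w(j := t))) \<le> B" for j
  proof -
    have "(\<Prod>l\<in>UNIV. norm ((w(j := t)) l)) = norm t * (\<Prod>l\<in>UNIV - {j}. norm ((w(j := t)) l))"
      by (subst prod.remove[of _ j]) auto
    also have "(\<Prod>l\<in>UNIV - {j}. norm ((w(j := t)) l)) = (\<Prod>l\<in>UNIV - {j}. R)"
      by (rule prod.cong) (auto simp: w)
    finally show ?thesis using norm_frame_wedge_le[of "w(j := t)"] by (simp add: B_def card_Diff_singleton)
  qed
  have B2: "norm (frame_wedge (w(i := t, j := w i))) \<le> B" if "j \<noteq> i" for j
  proof -
    have "(\<Prod>l\<in>UNIV. norm ((w(i := t, j := w i)) l)) = norm t * (\<Prod>l\<in>UNIV - {i}. norm ((w(i := t, j := w i)) l))"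
      using that by (subst prod.remove[of _ i]) auto
    also have "(\<Prod>l\<in>UNIV - {i}. norm ((w(i := t, j := w i)) l)) = (\<Prod>l\<in>UNIV - {i}. R)"
      by (rule prod.cong) (auto simp: w)
    finally have "norm (frame_wedge (w(i := t, j := w i))) \<le> norm t * (\<Prod>l\<in>UNIV - {i}. R)"
      using norm_frame_wedge_le[of "w(i := t, j := w i)"] by (simp only:)
    then show ?thesis by (simp add: B_def card_Diff_singleton)
  qed
  have "piece_mass c = piece_mass c0 + (\<Sum>j\<in>UNIV - {i}. piece_mass (cc j))"
    by (simp add: c_def piece_mass_concat o_def sum_list_distinct_conv_sum_set)
  \<comment> \<open>Two pieces in \<open>c0\<close> and four in each \<open>cc j\<close>, each of
    mass at most \<open>B\<close>; the final constant comes from 2 + 4 (k - 1) \<le> 4 k.\<close>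
  also have "\<dots> \<le> 2 * B + (\<Sum>j\<in>UNIV - {i}. 4 * B)"
  proof (intro add_mono sum_mono)
    show "piece_mass c0 \<le> 2 * B" using B1[of i] by (simp add: c0_def)
    show "piece_mass (cc j) \<le> 4 * B" if "j \<in> UNIV - {i}" for j
      using B1[of j] B2[of j] that by (simp add: cc_def)
  qed
  also have "\<dots> \<le> 4 * CARD('k) * B"
  proof -
    obtain m where "CARD('k) = Suc m" using not0_implies_Suc[of "CARD('k)"] by auto
    then show ?thesis using \<open>B \<ge> 0\<close> by (simp add: card_Diff_singleton algebra_simps)
  qed
  finally have "piece_mass c \<le> 4 * CARD('k) * norm t * R ^ (CARD('k) - 1)" by (simp add: B_def mult.assoc)
  moreover have "pieces c"
    by (auto simp: c_def c0_def cc_def polytope_unit_cube polytope_below_diagonal intro: subsetD[OF below_diagonal_subset])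
  moreover have "\<forall>(a, u, v, K)\<in>set c. t \<in> range v"
  proof -
    have "t \<in> range (w(j := t))" for j by (rule range_eqI[of _ _ j]) simp
    moreover have "t \<in> range (w(i := t, j := w i))" if "j \<noteq> i" for j by (rule range_eqI[of _ _ i]) (use that in simp)
    ultimately show ?thesis by (auto simp: c_def c0_def cc_def scale_pieces_def)
  qed
  ultimately show thesis using bdc that by blast
qed

section \<open>Multilinearity of parallelepipeds modulo negligible functionals\<close>

text \<open>The right-hand side of \<open>face_prism\<close> differs from the sum of the two
  parallelepipeds only by differences of translates, and these are negligible.\<close>

lemma face_add:
  fixes w :: "'k::{finite,linorder} \<Rightarrow> real ^ 'n::{finite,linorder}"
  shows "face unit_cube (w(i := x + y)) - face unit_cube (w(i := x)) - face unit_cube (w(i := y))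
    \<in> negligible_functionals TYPE('k)"
proof -
  let ?w = "w(i := x)"
  let ?D = "\<lambda>t K v. translate t (face K v) - face K v"
  have neg: "?D t K v \<in> negligible_functionals TYPE('k)" if "polytope K" "K \<subseteq> unit_cube"
    for t K and v :: "'k \<Rightarrow> real ^ 'n::{finite,linorder}"
    unfolding face_def by (rule negligible_translate) (use that in simp)
  have "face unit_cube (?w(i := ?w i + y)) = face unit_cube ?w + translate (?w i) (face unit_cube (?w(i := y)))
    + (\<Sum>j\<in>UNIV - {i}. ?D (?w j) (below_diagonal i j) (?w(j := y)))"
    by (rule face_prism)
  moreover have "?w(i := ?w i + y) = w(i := x + y)" "?w(i := y) = w(i := y)" "?w i = x" by simp_all
  ultimately have "face unit_cube (w(i := x + y)) - face unit_cube (w(i := x)) - face unit_cube (w(i := y))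
    = ?D x unit_cube (w(i := y)) + (\<Sum>j\<in>UNIV - {i}. ?D (?w j) (below_diagonal i j) (?w(j := y)))"
    by (simp only: algebra_simps)
  also have "\<dots> \<in> negligible_functionals TYPE('k)"
    by (intro subspace_add[OF subspace_negligible_functionals] subspace_sum[OF subspace_negligible_functionals] neg
        polytope_unit_cube polytope_below_diagonal below_diagonal_subset order_refl)
  finally show ?thesis .
qed

text \<open>
  Additivity gives homogeneity for integers; the error of replacing \<open>m * r\<close> by its integer part
  has bounded mass, so that dividing by \<open>m\<close> makes it small.
\<close>

lemma face_scale:
  fixes w :: "'k::{finite,linorder} \<Rightarrow> real ^ 'n::{finite,linorder}"
  shows "face unit_cube (w(i := r *\<^sub>R x)) - r *\<^sub>R face unit_cube (w(i := x)) \<in> negligible_functionals TYPE('k)"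
proof -
  define N where "N = (negligible_functionals TYPE('k) :: ('n::{finite,linorder} form \<Rightarrow> real) set)"
  have N: "subspace N" unfolding N_def by (rule subspace_negligible_functionals)
  define g where "g r = face unit_cube (w(i := r *\<^sub>R x))" for r
  have add: "g (r + s) - g r - g s \<in> N" for r s
    unfolding g_def N_def scaleR_add_left by (rule face_add)
  have zero: "g 0 = 0"
  proof -
    have "frame_wedge (w(i := 0)) = 0" by (rule linear_0[OF linear_frame_wedge])
    then show ?thesis by (simp only: g_def scaleR_zero_left face_eq_0)
  qed
  have nat: "g (real m * r) - real m *\<^sub>R g r \<in> N" for m r
  proof (induction m)
    case (Suc m)
    have "(g (real m * r + r) - g (real m * r) - g r) + (g (real m * r) - real m *\<^sub>R g r) \<in> N"
      by (intro subspace_add[OF N] add Suc)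
    then show ?case by (simp add: algebra_simps)
  qed (simp add: zero subspace_0[OF N])
  have neg: "g (- r) + g r \<in> N" for r
    using subspace_neg[OF N add[of "- r" r]] by (simp add: zero add.commute)
  have int: "g (real_of_int q) - real_of_int q *\<^sub>R g 1 \<in> N" for q
  proof (cases "q \<ge> 0")
    case True
    then show ?thesis using nat[of "nat q" 1] by simp
  next
    case False
    then have "real_of_int q = - real (nat (- q))" by simp
    then obtain m where m: "real_of_int q = - real m" by blast
    have "(g (- real m) + g (real m)) - (g (real m * 1) - real m *\<^sub>R g 1) \<in> N"
      by (intro subspace_diff[OF N] neg nat)
    then show ?thesis unfolding m by (simp add: algebra_simps)
  qed
  define M where "M = norm (frame_wedge (w(i := x)))"
  have "g r - r *\<^sub>R g 1 \<in> negligible_functionals TYPE('k)"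
  proof (rule negligible_functionals_closed)
    fix e :: real assume e: "e > 0"
    \<comment> \<open>The error left by the integer part consists of two pieces of mass at most
      \<open>M\<close> each and is divided by \<open>m\<close>.\<close>
    obtain m where m: "2 * M / e < real m" using reals_Archimedean2 by blast
    have "M \<ge> 0" by (simp add: M_def)
    then have m0: "real m > 0" using m e by (cases m) (auto simp: field_simps)
    define q where "q = \<lfloor>real m * r\<rfloor>"
    define f where "f = real m * r - real_of_int q"
    have f: "0 \<le> f" "f \<le> 1" unfolding f_def q_def by linarith+
    let ?c = "scale_pieces (1 / real m) ([(1, 0, w(i := f *\<^sub>R x), unit_cube)] @ scale_pieces (- f) [(1, 0, w(i := x), unit_cube)])"
    have bdc: "bd ?c = (1 / real m) *\<^sub>R (g f - f *\<^sub>R g 1)"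
      by (simp only: bd_scale_pieces bd_simps face_def[symmetric] g_def scaleR_one) simp
    have "piece_mass ?c = (1 / real m) * (f * M + f * M)"
      using f m0 linear_scale[OF linear_frame_wedge, of w i f x] by (simp add: M_def)
    also have "\<dots> \<le> (1 / real m) * (1 * M + 1 * M)"
      by (intro mult_left_mono add_mono mult_right_mono f) (use \<open>M \<ge> 0\<close> in auto)
    also have "\<dots> \<le> e" using m m0 e by (simp add: field_simps)
    finally have mass: "piece_mass ?c \<le> e" .
    have "(g (real m * r) - real_of_int q *\<^sub>R g 1 - g f) \<in> N"
    proof -
      have "(g (real_of_int q + f) - g (real_of_int q) - g f) + (g (real_of_int q) - real_of_int q *\<^sub>R g 1) \<in> N"
        by (intro subspace_add[OF N] add int)
      then show ?thesis by (simp add: f_def algebra_simps)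
    qed
    then have "(g (real m * r) - real_of_int q *\<^sub>R g 1 - g f) - (g (real m * r) - real m *\<^sub>R g r) \<in> N"
      by (rule subspace_diff[OF N _ nat])
    moreover have "(g (real m * r) - real_of_int q *\<^sub>R g 1 - g f) - (g (real m * r) - real m *\<^sub>R g r)
        = real m *\<^sub>R (g r - r *\<^sub>R g 1 - bd ?c)"
    proof -
      have "real_of_int q *\<^sub>R g 1 = real m *\<^sub>R (r *\<^sub>R g 1) - f *\<^sub>R g 1"
        unfolding f_def scaleR_diff_left by simp
      then show ?thesis unfolding bdc using m0 by (simp add: scaleR_diff_right)
    qed
    ultimately have "(1 / real m) *\<^sub>R (real m *\<^sub>R (g r - r *\<^sub>R g 1 - bd ?c)) \<in> N"
      using subspace_scale[OF N] by metis
    then have "g r - r *\<^sub>R g 1 - bd ?c \<in> N" using m0 by simp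
    then show "\<exists>c :: ('n, 'k) piece list. pieces c \<and> piece_mass c \<le> e \<and> g r - r *\<^sub>R g 1 - bd c \<in> negligible_functionals TYPE('k)"
      using mass unfolding N_def by (intro exI[of _ ?c]) (simp add: polytope_unit_cube)
  qed
  then show ?thesis by (simp only: g_def scaleR_one)
qed

lemma alternating_face:
  "alternating_mod (negligible_functionals TYPE('k))
     (face unit_cube :: ('k::{finite,linorder} \<Rightarrow> real ^ 'n::{finite,linorder}) \<Rightarrow> _)"
  unfolding alternating_mod_def
proof (intro conjI allI impI)
  fix w :: "'k \<Rightarrow> real ^ 'n::{finite,linorder}" and i j assume "i \<noteq> j" "w i = w j"
  then have "face unit_cube w = 0" by (intro face_eq_0 frame_wedge_eq_0)
  then show "face unit_cube w \<in> negligible_functionals TYPE('k)"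
    by (simp add: subspace_0[OF subspace_negligible_functionals])
qed (rule subspace_negligible_functionals face_add face_scale)+

lemma wedge_list_axes:
  fixes ns :: "'n::{finite,linorder} list"
  assumes "sorted_wrt (<) ns"
  shows "wedge_list (map (\<lambda>i. axis i 1) ns) = axis (set ns) 1"
  using assms
proof (induction ns)
  case (Cons n ns)
  have n: "n \<notin> set ns" using Cons by auto
  have "(ext_of_vec (axis n 1) \<and>\<^sub>e axis (set ns) 1) $ C = axis (insert n (set ns)) 1 $ C" for C
  proof -
    have "(ext_of_vec (axis n 1) \<and>\<^sub>e axis (set ns) 1) $ C
        = (\<Sum>i\<in>C. if i = n then insertion_sign n (C - {n}) * axis (set ns) 1 $ (C - {n}) else 0)"
      unfolding wedge_vec_nth by (rule sum.cong) (auto simp: axis_def)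
    also have "\<dots> = (if n \<in> C then insertion_sign n (C - {n}) * axis (set ns) 1 $ (C - {n}) else 0)"
      by simp
    also have "\<dots> = axis (insert n (set ns)) 1 $ C"
    proof (cases "C = insert n (set ns)")
      case True
      have "{a \<in> set ns. a < n} = {}" using Cons by auto
      then have "insertion_sign n (set ns) = 1" unfolding insertion_sign_def by (simp only: card.empty power_0)
      then show ?thesis using True n by (simp add: axis_def)
    next
      case False
      then show ?thesis using n by (auto simp: axis_def)
    qed
    finally show ?thesis .
  qed
  then have "ext_of_vec (axis n 1) \<and>\<^sub>e axis (set ns) 1 = axis (insert n (set ns)) 1" by (simp add: vec_eq_iff)
  then show ?case using Cons by simp
qed simp

lemma frame_wedge_axes:
  fixes \<phi> :: "'k::{finite,linorder} \<Rightarrow> 'n::{finite,linorder}"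
  assumes "strict_mono \<phi>"
  shows "frame_wedge (\<lambda>i. axis (\<phi> i) 1) = axis (range \<phi>) 1"
proof -
  let ?ks = "sorted_list_of_set (UNIV :: 'k set)"
  have "sorted_wrt (<) (map \<phi> ?ks)"
    unfolding sorted_wrt_map
    by (rule sorted_wrt_mono_rel[OF _ strict_sorted_list_of_set]) (use assms in \<open>auto simp: strict_mono_def\<close>)
  then have "wedge_list (map (\<lambda>i. axis i 1) (map \<phi> ?ks)) = axis (set (map \<phi> ?ks)) 1"
    by (rule wedge_list_axes)
  then show ?thesis by (simp add: frame_wedge_def o_def)
qed

text \<open>Modulo negligible functionals the boundary factors through the k-vector: the linear map
  \<open>G\<close> reproduces it on increasing selections of basis vectors, hence on all frames. A
  linear relation between k-vectors is therefore inherited by the boundaries.\<close>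

lemma face_linear_relation:
  fixes w :: "'i \<Rightarrow> 'k::{finite,linorder} \<Rightarrow> real ^ 'n::{finite,linorder}"
    and w0 :: "'k::{finite,linorder} \<Rightarrow> real ^ 'n::{finite,linorder}"
  assumes rel: "(\<Sum>l\<in>I. m l *\<^sub>R frame_wedge (w l)) = frame_wedge w0"
  shows "(\<Sum>l\<in>I. m l *\<^sub>R face unit_cube (w l)) - face unit_cube w0 \<in> negligible_functionals TYPE('k)"
proof -
  define N where "N = (negligible_functionals TYPE('k) :: ('n::{finite,linorder} form \<Rightarrow> real) set)"
  have N: "subspace N" unfolding N_def by (rule subspace_negligible_functionals)
  define e :: "'n::{finite,linorder} \<Rightarrow> real ^ 'n::{finite,linorder}" where "e i = axis i 1" for i
  define P where "P = (face unit_cube :: ('k \<Rightarrow> real ^ 'n::{finite,linorder}) \<Rightarrow> _)"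
  \<comment> \<open>The coordinate at \<open>range \<phi>\<close> is multiplied by the value of
    \<open>P\<close> on the corresponding basis frame. An increasing map is determined by its range,
    so a basis k-vector meets exactly one summand.\<close>
  define G where "G \<xi> = (\<Sum>\<phi>\<in>{\<phi> :: 'k \<Rightarrow> 'n. strict_mono \<phi>}. \<xi> $ range \<phi> *\<^sub>R P (e \<circ> \<phi>))" for \<xi> :: "'n ext"
  have G: "linear G"
    unfolding G_def by (rule linearI) (simp_all add: scaleR_add_left sum.distrib scaleR_sum_right)
  have P: "alternating_mod N P" unfolding N_def P_def by (rule alternating_face)
  have alt: "alternating_mod N (\<lambda>w. P w - G (frame_wedge w))"
    unfolding alternating_mod_def
  proof (intro conjI allI impI N)
    fix v :: "'k \<Rightarrow> real ^ 'n::{finite,linorder}" and i x y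
    have "P (v(i := x + y)) - P (v(i := x)) - P (v(i := y)) \<in> N" using P by (simp add: alternating_mod_def)
    then show "P (v(i := x + y)) - G (frame_wedge (v(i := x + y))) - (P (v(i := x)) - G (frame_wedge (v(i := x))))
        - (P (v(i := y)) - G (frame_wedge (v(i := y)))) \<in> N"
      by (simp add: linear_add[OF linear_frame_wedge] linear_add[OF G] algebra_simps)
  next
    fix v :: "'k \<Rightarrow> real ^ 'n::{finite,linorder}" and i r x
    have "P (v(i := r *\<^sub>R x)) - r *\<^sub>R P (v(i := x)) \<in> N" using P by (simp add: alternating_mod_def)
    then show "P (v(i := r *\<^sub>R x)) - G (frame_wedge (v(i := r *\<^sub>R x))) - r *\<^sub>R (P (v(i := x)) - G (frame_wedge (v(i := x)))) \<in> N"
      by (simp add: linear_scale[OF linear_frame_wedge] linear_scale[OF G] algebra_simps)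
  next
    fix v :: "'k \<Rightarrow> real ^ 'n::{finite,linorder}" and i j assume "i \<noteq> j" "v i = v j"
    then show "P v - G (frame_wedge v) \<in> N"
      using P by (simp add: alternating_mod_def frame_wedge_eq_0 linear_0[OF G])
  qed
  have zero: "P (e \<circ> \<phi>) - G (frame_wedge (e \<circ> \<phi>)) \<in> N" if "strict_mono \<phi>" for \<phi> :: "'k \<Rightarrow> 'n"
  proof -
    have inj: "\<psi> = \<phi>" if "strict_mono \<psi>" "range \<psi> = range \<phi>" for \<psi> :: "'k \<Rightarrow> 'n"
    proof -
      have s: "sorted_wrt (<) (map \<psi> (sorted_list_of_set UNIV))" if "strict_mono \<psi>" for \<psi> :: "'k \<Rightarrow> 'n"
        unfolding sorted_wrt_map
        by (rule sorted_wrt_mono_rel[OF _ strict_sorted_list_of_set]) (use that in \<open>auto simp: strict_mono_def\<close>)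
      have "map \<psi> (sorted_list_of_set UNIV) = map \<phi> (sorted_list_of_set UNIV)"
        by (rule strict_sorted_equal[OF s s]) (use that \<open>strict_mono \<phi>\<close> in auto)
      then show "\<psi> = \<phi>" by (simp only: map_eq_conv) (auto simp: fun_eq_iff)
    qed
    have "frame_wedge (e \<circ> \<phi>) = axis (range \<phi>) 1"
      using frame_wedge_axes[OF that] by (simp add: e_def o_def)
    then have "G (frame_wedge (e \<circ> \<phi>)) = (\<Sum>\<psi>\<in>{\<psi>. strict_mono \<psi>}. if \<psi> = \<phi> then P (e \<circ> \<phi>) else 0)"
      unfolding G_def by (intro sum.cong refl) (use inj in \<open>auto simp: axis_def\<close>)
    also have "\<dots> = P (e \<circ> \<phi>)" using that by simp
    finally show ?thesis by (simp add: subspace_0[OF N])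
  qed
  have main: "P v - G (frame_wedge v) \<in> N" for v
  proof (rule alternating_mod_basis[OF alt zero])
    have "axis i 1 \<in> range e" for i by (simp add: e_def)
    then have "Basis \<subseteq> range e" by (auto simp: Basis_vec_def)
    then have "span Basis \<subseteq> span (range e)" by (rule span_mono)
    then show "range v \<subseteq> span (range e)" by auto
  qed
  have "(\<Sum>l\<in>I. m l *\<^sub>R (P (w l) - G (frame_wedge (w l)))) - (P w0 - G (frame_wedge w0)) \<in> N"
    by (intro subspace_diff[OF N] subspace_sum[OF N] subspace_scale[OF N] main)
  moreover have "(\<Sum>l\<in>I. m l *\<^sub>R G (frame_wedge (w l))) = G (frame_wedge w0)"
    unfolding rel[symmetric] by (simp add: linear_sum[OF G] linear_scale[OF G])
  moreover have "(\<Sum>l\<in>I. m l *\<^sub>R (P (w l) - G (frame_wedge (w l)))) - (P w0 - G (frame_wedge w0))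
      = (\<Sum>l\<in>I. m l *\<^sub>R P (w l)) - P w0 - ((\<Sum>l\<in>I. m l *\<^sub>R G (frame_wedge (w l))) - G (frame_wedge w0))"
    unfolding scaleR_diff_right sum_subtractf by (simp only: algebra_simps)
  ultimately have "(\<Sum>l\<in>I. m l *\<^sub>R P (w l)) - P w0 \<in> N" by (simp only: diff_self diff_0_right)
  then show ?thesis unfolding N_def P_def .
qed

section \<open>From negligible errors to exact competitors\<close>

section \<open>Homogenization\<close>

lemma frame_wedge_scale:
  fixes w :: "'k::{finite,linorder} \<Rightarrow> real ^ 'n::{finite,linorder}"
  shows "frame_wedge (\<lambda>i. r *\<^sub>R w i) = r ^ CARD('k) *\<^sub>R frame_wedge w"
proof -
  have "wedge_list (map (\<lambda>i. r *\<^sub>R w i) xs) = r ^ length xs *\<^sub>R wedge_list (map w xs)" for xs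
    by (induction xs) (simp_all add: wedge_vec_linear_simps)
  from this[of "sorted_list_of_set UNIV"] show ?thesis by (simp add: frame_wedge_def)
qed

lemma frame_point_scale: "frame_point (\<lambda>i. r *\<^sub>R w i) y = r *\<^sub>R frame_point w y"
  by (simp add: frame_point_def scaleR_sum_right mult.commute)

definition shrink :: "real \<Rightarrow> ('n::finite, 'k) piece list \<Rightarrow> ('n, 'k) piece list" where
  "shrink r c = map (\<lambda>(a, u, w, K). (a, r *\<^sub>R u, \<lambda>i. r *\<^sub>R w i, K)) c"

text \<open>Dilation by \<open>r\<close> multiplies k-vectors by r^k; the exterior derivative of a
  dilated form has a further factor \<open>r\<close>, which the factor \<open>1 / r\<close> in front
  of the form compensates.\<close>

lemma bd_shrink:
  fixes c :: "('n::{finite,linorder}, 'k::{finite,linorder}) piece list"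
  assumes "r \<noteq> 0" "smooth \<alpha>"
  shows "bd (shrink r c) \<alpha> = r ^ CARD('k) * bd c (\<lambda>x. (1 / r) *\<^sub>R \<alpha> (r *\<^sub>R x))"
proof -
  let ?\<beta> = "\<lambda>x. (1 / r) *\<^sub>R \<alpha> (r *\<^sub>R x)"
  have sm: "smooth ?\<beta>"
    using smooth_affine[OF linear_scale_self assms(2), of 0 r]
    by (intro smooth_bounded_linear[OF bounded_linear_scaleR_right]) simp
  have "ext_deriv ?\<beta> = (\<lambda>x. ext_deriv \<alpha> (r *\<^sub>R x))"
  proof -
    have "ext_deriv (\<lambda>x. (1 / r) *\<^sub>R \<gamma> x) = (\<lambda>x. (1 / r) *\<^sub>R ext_deriv \<gamma> x)" if "smooth \<gamma>" for \<gamma> :: "'n form"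
    proof -
      have "partial_deriv i (\<lambda>x. (1 / r) *\<^sub>R \<gamma> x) = (\<lambda>x. (1 / r) *\<^sub>R partial_deriv i \<gamma> x)" for i
        by (rule partial_deriv_eqI) (intro has_derivative_scaleR_right smooth_imp_has_derivative that)
      then show ?thesis by (simp add: ext_deriv_alt fun_eq_iff scaleR_sum_right wedge_vec_linear_simps)
    qed
    from this[of "\<lambda>x. \<alpha> (r *\<^sub>R x)"] show ?thesis
      using smooth_affine[OF linear_scale_self assms(2), of 0 r] ext_deriv_affine[OF assms(2), of 0 r] assms(1)
      by simp
  qed
  then have "piece_integral (r *\<^sub>R u) (\<lambda>i. r *\<^sub>R w i) K (ext_deriv \<alpha>) = r ^ CARD('k) * piece_integral u w K (ext_deriv ?\<beta>)"
    for u and w :: "'k \<Rightarrow> real ^ 'n::{finite,linorder}" and K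
    unfolding piece_integral_def frame_point_scale frame_wedge_scale
    by (simp flip: scaleR_add_right set_integral_mult_right)
  then have "(\<Sum>(a, u, w, K)\<leftarrow>shrink r c. a * piece_integral u w K (ext_deriv \<alpha>))
      = r ^ CARD('k) * (\<Sum>(a, u, w, K)\<leftarrow>c. a * piece_integral u w K (ext_deriv ?\<beta>))"
    unfolding shrink_def by (induction c) (auto simp: algebra_simps)
  then show ?thesis using sm assms(2) by (simp add: bd_def)
qed

text \<open>
  The functional \<open>bd c - face unit_cube w0\<close> is the boundary of a chain of small mass after averaging
  over translations.  Hence \<open>N ^ k\<close> translated copies of \<open>c\<close>, placed along the subdivision of the cube
  of side \<open>N\<close> spanned by \<open>w0\<close> and averaged over these translations, have the boundary of that cube up
  to chains of mass \<open>e * N ^ k\<close> and \<open>O(N ^ (k - 1))\<close>.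
\<close>

lemma homogenization:
  fixes w0 :: "'k::{finite,linorder} \<Rightarrow> real ^ 'n::{finite,linorder}" and \<phi> :: "'n ext \<Rightarrow> real"
    and c :: "('n, 'k) piece list"
  assumes min: "\<And>c :: ('n::{finite,linorder}, 'k::{finite,linorder}) piece list. pieces c \<Longrightarrow> bd c = face unit_cube w0 \<Longrightarrow> \<phi> (frame_wedge w0) \<le> piece_energy \<phi> c"
    and hom: "\<And>r \<xi>. r \<ge> 0 \<Longrightarrow> \<phi> (r *\<^sub>R \<xi>) = r * \<phi> \<xi>"
    and bound: "\<And>r (w :: 'k::{finite,linorder} \<Rightarrow> real ^ 'n::{finite,linorder}). \<bar>\<phi> (r *\<^sub>R frame_wedge w)\<bar> \<le> C * norm (r *\<^sub>R frame_wedge w)"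
    and unit: "\<And>i. norm (w0 i) = 1"
    and c: "pieces c" "bd c - face unit_cube w0 \<in> negligible_functionals TYPE('k)"
  shows "\<phi> (frame_wedge w0) \<le> piece_energy \<phi> c"
proof -
  let ?k = "CARD('k)"
  \<comment> \<open>Turns the mass bounds for the error chains into energy bounds, whatever the sign
    of the energy.\<close>
  have energy_le: "\<bar>piece_energy \<phi> q\<bar> \<le> \<bar>C\<bar> * piece_mass q" if "pieces q" for q :: "('n, 'k) piece list"
    using that
  proof (induction q)
    case (Cons p q)
    obtain a u w K where p: "p = (a, u, w, K)" by (cases p)
    have "K \<subseteq> unit_cube" "polytope K" using Cons(2) p by auto
    then have "measure lborel K \<le> measure lborel (unit_cube :: (real ^ 'k::{finite,linorder}) set)"
      by (intro measure_mono_fmeasurable) (auto simp: unit_cube_cbox borel_compact polytope_imp_compact)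
    also have "\<dots> = 1" by (simp add: unit_cube_cbox)
    finally have K: "measure lborel K \<le> 1" .
    have "\<bar>measure lborel K * \<phi> (a *\<^sub>R frame_wedge w)\<bar> \<le> 1 * (\<bar>C\<bar> * norm (a *\<^sub>R frame_wedge w))"
      unfolding abs_mult
      by (intro mult_mono) (use K bound[of a w] in \<open>auto intro: order_trans[OF _ mult_right_mono[OF abs_ge_self]]\<close>)
    moreover have "\<bar>piece_energy \<phi> q\<bar> \<le> \<bar>C\<bar> * piece_mass q" using Cons by (simp add: p)
    moreover have "piece_energy \<phi> (p # q) = measure lborel K * \<phi> (a *\<^sub>R frame_wedge w) + piece_energy \<phi> q"
      by (simp add: piece_energy_def p)
    ultimately show ?case by (simp add: p algebra_simps)
  qed simp
  \<comment> \<open>Minimality passes to the cube of side \<open>n\<close> by shrinking its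
    competitor; energies scale with n^k by homogeneity.\<close>
  have scaled: "real n ^ ?k * \<phi> (frame_wedge w0) \<le> piece_energy \<phi> q"
    if n: "n > 0" and q: "pieces q" "bd q = face unit_cube (\<lambda>i. real n *\<^sub>R w0 i)" for n and q :: "('n, 'k) piece list"
  proof -
    let ?r = "1 / real n"
    have "bd (shrink ?r q) = face unit_cube w0"
    proof
      fix \<alpha> show "bd (shrink ?r q) \<alpha> = face unit_cube w0 \<alpha>"
      proof (cases "smooth \<alpha>")
        case True
        have "bd (shrink ?r q) \<alpha> = bd (shrink ?r [(1, 0, \<lambda>i. real n *\<^sub>R w0 i, unit_cube)]) \<alpha>"
          using n True q(2) by (simp add: bd_shrink face_def)
        also have "shrink ?r [(1, 0, \<lambda>i. real n *\<^sub>R w0 i, unit_cube)] = [(1, 0, w0, unit_cube)]"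
          using n by (simp add: shrink_def)
        finally show ?thesis by (simp add: face_def)
      qed (simp add: bd_def face_def)
    qed
    moreover have "pieces (shrink ?r q)"
      using q(1) by (auto simp: pieces_def shrink_def)
    ultimately have "\<phi> (frame_wedge w0) \<le> piece_energy \<phi> (shrink ?r q)" using min by blast
    also have "\<dots> = ?r ^ ?k * piece_energy \<phi> q"
    proof -
      have "\<phi> (a *\<^sub>R frame_wedge (\<lambda>i. ?r *\<^sub>R w i)) = ?r ^ ?k * \<phi> (a *\<^sub>R frame_wedge w)"
        for a and w :: "'k \<Rightarrow> real ^ 'n::{finite,linorder}"
        unfolding frame_wedge_scale using hom[of "?r ^ ?k" "a *\<^sub>R frame_wedge w"] by (simp add: mult.commute)
      then show ?thesis
        unfolding piece_energy_def shrink_def by (induction q) (auto simp: algebra_simps)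
    qed
    finally show ?thesis using n by (simp add: field_simps)
  qed
  have "\<phi> (frame_wedge w0) \<le> piece_energy \<phi> c + e" if e: "e > 0" for e
  proof -
    \<comment> \<open>One half of \<open>e\<close> is reserved for the chain \<open>r\<close>, the
      other half for the lateral faces; the summand 1 covers the case C = 0.\<close>
    define e' where "e' = e / (2 * (\<bar>C\<bar> + 1))"
    have e': "e' > 0" "\<bar>C\<bar> * e' \<le> e / 2" using e by (auto simp: e'_def field_simps)
    obtain ts and r :: "('n, 'k) piece list" where ts: "ts \<noteq> []" "pieces r" "piece_mass r \<le> e' * real (length ts)"
      "translates ts (bd c - face unit_cube w0) = bd r"
      by (rule negligible_functionalsE[OF c(2) e'(1)])
    define T where "T = real (length ts)"
    have T: "T > 0" using ts(1) by (simp add: T_def)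
    define B where "B = (\<Sum>t\<leftarrow>ts. 4 * real ?k * norm t)"
    have B: "B \<ge> 0" unfolding B_def by (rule sum_list_nonneg) auto
    \<comment> \<open>So large that the lateral faces, of energy at most |C| B n^(k-1) / T after
      averaging, stay below n^k e / 2.\<close>
    obtain n where n: "\<bar>C\<bar> * B / (T * (e / 2)) < real n" using reals_Archimedean2 by blast
    have "0 \<le> \<bar>C\<bar> * B / (T * (e / 2))" using B T e by simp
    then have n0: "n > 0" using n by (cases n) auto
    let ?w = "\<lambda>i. real n *\<^sub>R w0 i"
    obtain gs where gs: "length gs = n ^ ?k" "face unit_cube ?w = translates gs (face unit_cube w0)"
      by (rule face_subdivision[of n w0])
    have "\<exists>q :: ('n, 'k) piece list. pieces q \<and> translate t (face unit_cube ?w) - face unit_cube ?w = bd q \<and>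
       piece_mass q \<le> 4 * real ?k * norm t * real n ^ (?k - 1)" for t
    proof -
      have "norm (?w i) = real n" for i using unit by simp
      then show ?thesis by (rule face_cylinder[of ?w "real n" t]) auto
    qed
    then obtain q where q: "\<And>t. pieces (q t :: ('n, 'k) piece list)"
      "\<And>t. translate t (face unit_cube ?w) - face unit_cube ?w = bd (q t)"
      "\<And>t. piece_mass (q t) \<le> 4 * real ?k * norm t * real n ^ (?k - 1)" by metis
    \<comment> \<open>\<open>gs\<close> lists the positions of the n^k cells and \<open>ts\<close>
      the averaging translations, so \<open>c1\<close> contains n^k T copies of \<open>c\<close>.
      The chain \<open>r1\<close> fills the averaged error in every cell, and \<open>q1\<close>
      connects the T displaced large cubes with their common position.\<close>
    define c1 where "c1 = concat (map (\<lambda>t. translate_pieces t (concat (map (\<lambda>t. translate_pieces t c) ts))) gs)"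
    define r1 where "r1 = concat (map (\<lambda>t. translate_pieces t r) gs)"
    define q1 where "q1 = concat (map q ts)"
    have q1: "bd q1 = translates ts (face unit_cube ?w) - T *\<^sub>R face unit_cube ?w"
      unfolding q1_def T_def by (induction ts) (auto simp: q(2)[symmetric] algebra_simps)
    define z where "z = c1 @ scale_pieces (- 1) r1 @ scale_pieces (- 1) q1"
    have "bd z = translates gs (translates ts (bd c)) - translates gs (bd r) - bd q1"
      by (simp add: z_def c1_def r1_def translates_bd bd_scale_pieces)
    also have "translates gs (bd r) = translates gs (translates ts (bd c)) - translates gs (translates ts (face unit_cube w0))"
      by (simp only: ts(4)[symmetric] translates_linear)
    also have "translates gs (translates ts (face unit_cube w0)) = translates ts (face unit_cube ?w)"
      unfolding gs(2) by (rule translates_commute)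
    finally have "bd z = T *\<^sub>R face unit_cube ?w" by (simp add: q1)
    then have "bd (scale_pieces (1 / T) z) = face unit_cube ?w" using T by (simp add: bd_scale_pieces)
    moreover have "pieces (scale_pieces (1 / T) z)"
      using c(1) ts(2) q(1) by (simp add: z_def c1_def r1_def q1_def)
    ultimately have le: "real n ^ ?k * \<phi> (frame_wedge w0) \<le> piece_energy \<phi> (scale_pieces (1 / T) z)"
      by (intro scaled n0)
    have "piece_energy \<phi> (scale_pieces (1 / T) z) = (1 / T) * piece_energy \<phi> z"
    proof -
      have "\<phi> ((1 / T * a) *\<^sub>R \<xi>) = (1 / T) * \<phi> (a *\<^sub>R \<xi>)" for a \<xi>
        using hom[of "1 / T" "a *\<^sub>R \<xi>"] T by simp
      then show ?thesis
        unfolding piece_energy_def scale_pieces_def by (induction z) (auto simp: algebra_simps)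
    qed
    then have le': "real n ^ ?k * \<phi> (frame_wedge w0) \<le> (1 / T) * piece_energy \<phi> z" using le by simp
    have "piece_energy \<phi> z \<le> real n ^ ?k * (T * piece_energy \<phi> c) + \<bar>C\<bar> * (real n ^ ?k * (e' * T)) + \<bar>C\<bar> * (B * real n ^ (?k - 1))"
    proof -
      have "piece_energy \<phi> c1 = real n ^ ?k * (T * piece_energy \<phi> c)"
        unfolding c1_def piece_energy_translates by (simp add: gs T_def)
      moreover have "piece_energy \<phi> (scale_pieces (- 1) r1) \<le> \<bar>C\<bar> * (real n ^ ?k * (e' * T))"
      proof -
        have "piece_energy \<phi> (scale_pieces (- 1) r1) \<le> \<bar>C\<bar> * piece_mass (scale_pieces (- 1) r1)"
          using energy_le[of "scale_pieces (- 1) r1"] ts(2) by (simp add: r1_def)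
        also have "piece_mass (scale_pieces (- 1) r1) = real n ^ ?k * piece_mass r"
          by (simp add: r1_def piece_mass_translates gs)
        also have "\<bar>C\<bar> * (real n ^ ?k * piece_mass r) \<le> \<bar>C\<bar> * (real n ^ ?k * (e' * T))"
          by (intro mult_left_mono) (use ts(3) in \<open>auto simp: T_def\<close>)
        finally show ?thesis .
      qed
      moreover have "piece_energy \<phi> (scale_pieces (- 1) q1) \<le> \<bar>C\<bar> * (B * real n ^ (?k - 1))"
      proof -
        have "piece_energy \<phi> (scale_pieces (- 1) q1) \<le> \<bar>C\<bar> * piece_mass (scale_pieces (- 1) q1)"
          using energy_le[of "scale_pieces (- 1) q1"] q(1) by (simp add: q1_def)
        also have "piece_mass (scale_pieces (- 1) q1) = (\<Sum>t\<leftarrow>ts. piece_mass (q t))"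
          by (simp add: q1_def piece_mass_concat o_def)
        also have "\<dots> \<le> (\<Sum>t\<leftarrow>ts. 4 * real ?k * norm t * real n ^ (?k - 1))"
          by (rule sum_list_mono) (rule q(3))
        also have "\<dots> = B * real n ^ (?k - 1)" unfolding B_def by (simp add: sum_list_mult_const)
        finally show ?thesis by (simp add: mult_left_mono)
      qed
      ultimately show ?thesis by (simp add: z_def)
    qed
    then have "real n ^ ?k * \<phi> (frame_wedge w0)
        \<le> (1 / T) * (real n ^ ?k * (T * piece_energy \<phi> c) + \<bar>C\<bar> * (real n ^ ?k * (e' * T)) + \<bar>C\<bar> * (B * real n ^ (?k - 1)))"
      by (intro order_trans[OF le'] mult_left_mono) (use T in auto)
    also have "\<dots> = real n ^ ?k * piece_energy \<phi> c + real n ^ ?k * (\<bar>C\<bar> * e') + (\<bar>C\<bar> * B / T) * real n ^ (?k - 1)"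
      using T by (simp add: field_simps)
    also have "\<dots> \<le> real n ^ ?k * piece_energy \<phi> c + real n ^ ?k * (e / 2) + real n ^ ?k * (e / 2)"
    proof (intro add_mono mult_left_mono)
      have "\<bar>C\<bar> * B / T \<le> real n * (e / 2)" using n T e by (simp add: field_simps)
      then have "(\<bar>C\<bar> * B / T) * real n ^ (?k - 1) \<le> (real n * (e / 2)) * real n ^ (?k - 1)"
        by (rule mult_right_mono) simp
      also have "\<dots> = real n ^ Suc (?k - 1) * (e / 2)" by (simp only: power_Suc mult.commute mult.left_commute)
      also have "Suc (?k - 1) = ?k" by simp
      finally show "(\<bar>C\<bar> * B / T) * real n ^ (?k - 1) \<le> real n ^ ?k * (e / 2)" .
    qed (use e' in auto)
    also have "\<dots> = real n ^ ?k * (piece_energy \<phi> c + e)" by (simp add: algebra_simps)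
    finally show ?thesis using n0 by simp
  qed
  then show ?thesis by (rule field_le_epsilon)
qed

section \<open>Hausdorff measure, simplices and densities\<close>

section \<open>Hausdorff measure on parametrised planes\<close>

text \<open>A cover of \<open>A\<close> is mapped to a cover of the image, with diameters enlarged
  at most by the factor \<open>C\<close>. The covering sets are first cut down to \<open>A\<close>,
  where \<open>f\<close> is controlled.\<close>

lemma hausdorff_pre_lipschitz:
  fixes f :: "'a::metric_space \<Rightarrow> 'b::real_normed_vector"
  assumes C0: "C > 0" and lip: "\<And>x y. x \<in> A \<Longrightarrow> y \<in> A \<Longrightarrow> dist (f x) (f y) \<le> C * dist x y"
  shows "hausdorff_pre k (C * \<delta>) (f ` A) \<le> ennreal (C ^ k) * hausdorff_pre k \<delta> A"
proof -
  have C: "C \<ge> 0" using C0 by simp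
  have *: "hausdorff_pre k (C * \<delta>) (f ` A) \<le> ennreal (C ^ k) *
      (\<Sum>i. if E i = {} then 0 else ennreal (unit_ball_vol (real k) * (diameter (E i) / 2) ^ k))"
    if E: "A \<subseteq> (\<Union>i. E i)" "\<forall>i. bounded (E i) \<and> diameter (E i) \<le> \<delta>" for E :: "nat \<Rightarrow> 'a set"
  proof -
    define G where "G i = f ` (E i \<inter> A)" for i
    have diam: "bounded (G i) \<and> diameter (G i) \<le> C * diameter (E i)" for i
    proof -
      have d: "norm (x - y) \<le> C * diameter (E i)" if xy: "x \<in> G i" "y \<in> G i" for x y
      proof -
        obtain x' y' where xy': "x' \<in> E i \<inter> A" "y' \<in> E i \<inter> A" "x = f x'" "y = f y'"
          using xy by (auto simp: G_def)
        have "norm (x - y) \<le> C * dist x' y'" using lip[of x' y'] xy' by (simp add: dist_norm)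
        also have "\<dots> \<le> C * diameter (E i)"
          by (intro mult_left_mono C diameter_bounded_bound) (use E xy' in auto)
        finally show ?thesis .
      qed
      have "bounded (G i)"
      proof (cases "G i = {}")
        case False
        then obtain x where "x \<in> G i" by auto
        then show ?thesis using d unfolding bounded_def by (intro exI[of _ x] exI[of _ "C * diameter (E i)"]) (auto simp: dist_norm)
      qed simp
      moreover have "0 \<le> C * diameter (E i)" using C E diameter_ge_0[of "E i"] by simp
      then have "diameter (G i) \<le> C * diameter (E i)" by (intro diameter_le) (use d in auto)
      ultimately show ?thesis by simp
    qed
    have "hausdorff_pre k (C * \<delta>) (f ` A) \<le> (\<Sum>i. if G i = {} then 0 else ennreal (unit_ball_vol (real k) * (diameter (G i) / 2) ^ k))"
      unfolding hausdorff_pre_def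
    proof (rule INF_lower, intro CollectI conjI allI)
      show "f ` A \<subseteq> (\<Union>i. G i)" using E(1) unfolding G_def by blast
      show "bounded (G i)" for i using diam by simp
      show "diameter (G i) \<le> C * \<delta>" for i
        using diam[of i] mult_left_mono[OF _ C, of "diameter (E i)" \<delta>] E(2) by force
    qed
    also have "\<dots> \<le> (\<Sum>i. ennreal (C ^ k) * (if E i = {} then 0 else ennreal (unit_ball_vol (real k) * (diameter (E i) / 2) ^ k)))"
    proof (intro suminf_le summableI)
      fix i
      show "(if G i = {} then 0 else ennreal (unit_ball_vol (real k) * (diameter (G i) / 2) ^ k))
        \<le> ennreal (C ^ k) * (if E i = {} then 0 else ennreal (unit_ball_vol (real k) * (diameter (E i) / 2) ^ k))"
      proof (cases "G i = {}")
        case False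
        then have "E i \<noteq> {}" by (auto simp: G_def)
        have "(diameter (G i) / 2) ^ k \<le> (C * diameter (E i) / 2) ^ k"
          by (intro power_mono) (use diam[of i] diameter_ge_0[of "G i"] in auto)
        then have "unit_ball_vol (real k) * (diameter (G i) / 2) ^ k \<le> C ^ k * (unit_ball_vol (real k) * (diameter (E i) / 2) ^ k)"
          using mult_left_mono[of "(diameter (G i) / 2) ^ k" "(C * diameter (E i) / 2) ^ k" "unit_ball_vol (real k)"]
          by (simp add: power_mult_distrib power_divide mult.left_commute)
        then show ?thesis using False \<open>E i \<noteq> {}\<close> C by (simp add: ennreal_leI flip: ennreal_mult')
      qed simp
    qed
    also have "\<dots> = ennreal (C ^ k) * (\<Sum>i. if E i = {} then 0 else ennreal (unit_ball_vol (real k) * (diameter (E i) / 2) ^ k))"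
      by (rule ennreal_suminf_cmult)
    finally show ?thesis .
  qed
  \<comment> \<open>The constant is moved to the other side, so that the infimum over all covers can
    be taken on the right.\<close>
  have le: "ennreal (1 / C ^ k) * hausdorff_pre k (C * \<delta>) (f ` A) \<le>
      (\<Sum>i. if E i = {} then 0 else ennreal (unit_ball_vol (real k) * (diameter (E i) / 2) ^ k))"
    if E: "A \<subseteq> (\<Union>i. E i)" "\<forall>i. bounded (E i) \<and> diameter (E i) \<le> \<delta>" for E :: "nat \<Rightarrow> 'a set"
  proof -
    let ?s = "\<Sum>i. if E i = {} then 0 else ennreal (unit_ball_vol (real k) * (diameter (E i) / 2) ^ k)"
    have "ennreal (1 / C ^ k) * hausdorff_pre k (C * \<delta>) (f ` A) \<le> ennreal (1 / C ^ k) * (ennreal (C ^ k) * ?s)"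
      using * E by (intro mult_left_mono) auto
    also have "\<dots> = ?s" using C0 by (simp add: mult.assoc[symmetric] flip: ennreal_mult)
    finally show ?thesis .
  qed
  have "hausdorff_pre k (C * \<delta>) (f ` A) = ennreal (C ^ k) * (ennreal (1 / C ^ k) * hausdorff_pre k (C * \<delta>) (f ` A))"
    using C0 by (simp add: mult.assoc[symmetric] flip: ennreal_mult)
  also have "\<dots> \<le> ennreal (C ^ k) * hausdorff_pre k \<delta> A"
    unfolding hausdorff_pre_def[of k \<delta> A] by (intro mult_left_mono INF_greatest) (use le in auto)
  finally show ?thesis .
qed

lemma hausdorff_outer_lipschitz:
  fixes f :: "'a::metric_space \<Rightarrow> 'b::real_normed_vector"
  assumes C: "C > 0" and lip: "\<And>x y. x \<in> A \<Longrightarrow> y \<in> A \<Longrightarrow> dist (f x) (f y) \<le> C * dist x y"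
  shows "hausdorff_outer k (f ` A) \<le> ennreal (C ^ k) * hausdorff_outer k A"
  unfolding hausdorff_outer_def[of k "f ` A"]
proof (rule SUP_least)
  fix \<delta> :: real assume "\<delta> \<in> {0<..}"
  then have \<delta>: "\<delta> / C > 0" using C by simp
  have "hausdorff_pre k (C * (\<delta> / C)) (f ` A) \<le> ennreal (C ^ k) * hausdorff_pre k (\<delta> / C) A"
    by (rule hausdorff_pre_lipschitz) (use C lip in auto)
  also have "\<dots> \<le> ennreal (C ^ k) * hausdorff_outer k A"
    unfolding hausdorff_outer_def by (intro mult_left_mono SUP_upper) (use \<delta> in auto)
  finally show "hausdorff_pre k \<delta> (f ` A) \<le> ennreal (C ^ k) * hausdorff_outer k A" using C by simp
qed

lemma hausdorff_outer_translate:
  fixes A :: "'a::real_normed_vector set"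
  shows "hausdorff_outer k ((+) v ` A) = hausdorff_outer k A"
proof -
  have le: "hausdorff_outer k ((+) v ` A) \<le> hausdorff_outer k A" for v and A :: "'a set"
    using hausdorff_outer_lipschitz[of 1 A "(+) v" k] by simp
  have "hausdorff_outer k A = hausdorff_outer k ((+) (- v) ` (+) v ` A)" by (simp add: image_image)
  also have "\<dots> \<le> hausdorff_outer k ((+) v ` A)" by (rule le)
  finally show ?thesis using le by (intro antisym)
qed

lemma hausdorff_pre_Union:
  assumes "finite J" "\<delta> > 0"
  shows "hausdorff_pre k \<delta> (\<Union>j\<in>J. A j) \<le> (\<Sum>j\<in>J. hausdorff_pre k \<delta> (A j))"
  using assms(1)
proof (induction J rule: finite_induct)
  case empty
  then show ?case using hausdorff_pre_empty[OF assms(2)] by simp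
next
  case (insert j J)
  have "hausdorff_pre k \<delta> (\<Union>n. binaryset (A j) (\<Union>j\<in>J. A j) n) \<le> (\<Sum>n. hausdorff_pre k \<delta> (binaryset (A j) (\<Union>j\<in>J. A j) n))"
    by (rule hausdorff_pre_subadditive)
  also have "\<dots> = hausdorff_pre k \<delta> (A j) + hausdorff_pre k \<delta> (\<Union>j\<in>J. A j)"
    by (rule suminf_binaryset_eq) (rule hausdorff_pre_empty[OF assms(2)])
  finally show ?case using insert by (simp add: UN_binaryset_eq add_left_mono order_trans)
qed

text \<open>The cube is the union of \<open>2 ^ k\<close> copies of itself of half the size.\<close>

lemma hausdorff_outer_cube_finite:
  "hausdorff_outer CARD('k) (unit_cube :: (real ^ 'k::finite) set) < \<infinity>"
proof -
  let ?Q = "unit_cube :: (real ^ 'k) set" and ?k = "CARD('k)"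
  define h where "h S y = (1 / 2) *\<^sub>R y + (\<chi> i. if i \<in> S then 1 / 2 else 0)" for S and y :: "real ^ 'k"
  have cover: "?Q \<subseteq> (\<Union>S\<in>UNIV. h S ` ?Q)"
  proof
    fix y assume y: "y \<in> ?Q"
    let ?S = "{i. y $ i > 1 / 2}"
    let ?z = "\<chi> i. if y $ i > 1 / 2 then 2 * y $ i - 1 else 2 * y $ i"
    have "?z \<in> ?Q" using y by (auto simp: unit_cube_def)
    moreover have "y = h ?S ?z" by (auto simp: h_def vec_eq_iff field_simps)
    ultimately show "y \<in> (\<Union>S\<in>UNIV. h S ` ?Q)" by blast
  qed
  \<comment> \<open>The factors (1/2)^k of the 2^k copies cancel their number, so halving the mesh
    does not increase the premeasure, and the bound for one mesh holds for arbitrarily small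
    ones.\<close>
  have half: "hausdorff_pre ?k (\<delta> / 2) ?Q \<le> hausdorff_pre ?k \<delta> ?Q" if "\<delta> > 0" for \<delta>
  proof -
    have "hausdorff_pre ?k (\<delta> / 2) ?Q \<le> hausdorff_pre ?k (\<delta> / 2) (\<Union>S\<in>UNIV. h S ` ?Q)"
      by (rule hausdorff_pre_mono[OF cover])
    also have "\<dots> \<le> (\<Sum>S\<in>UNIV. hausdorff_pre ?k (\<delta> / 2) (h S ` ?Q))"
      by (rule hausdorff_pre_Union) (use that in auto)
    also have "\<dots> \<le> (\<Sum>S\<in>(UNIV :: 'k set set). ennreal ((1 / 2) ^ ?k) * hausdorff_pre ?k \<delta> ?Q)"
    proof (rule sum_mono)
      fix S :: "'k set"
      have "dist (h S x) (h S y) \<le> 1 / 2 * dist x y" for x y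
      proof -
        have "h S x - h S y = (1 / 2) *\<^sub>R (x - y)" by (simp add: h_def algebra_simps)
        then show ?thesis by (simp add: dist_norm)
      qed
      then show "hausdorff_pre ?k (\<delta> / 2) (h S ` ?Q) \<le> ennreal ((1 / 2) ^ ?k) * hausdorff_pre ?k \<delta> ?Q"
        using hausdorff_pre_lipschitz[of "1/2" ?Q "h S" ?k \<delta>] that by simp
    qed
    also have "\<dots> = ennreal (2 ^ ?k * (1 / 2) ^ ?k) * hausdorff_pre ?k \<delta> ?Q"
      by (simp add: card_UNIV_set ennreal_mult ennreal_power mult.assoc flip: ennreal_numeral)
    also have "\<dots> = hausdorff_pre ?k \<delta> ?Q" by (simp flip: power_mult_distrib)
    finally show ?thesis .
  qed
  define D where "D = diameter ?Q + 1"
  have bQ: "bounded ?Q" using compact_imp_bounded[OF compact_unit_cube] .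
  have D: "D > 0" unfolding D_def using diameter_ge_0[OF bQ] by simp
  define W where "W = ennreal (unit_ball_vol (real ?k) * (diameter ?Q / 2) ^ ?k)"
  have start: "hausdorff_pre ?k D ?Q \<le> W"
  proof -
    let ?E = "\<lambda>i. if i = (0::nat) then ?Q else {}"
    have "hausdorff_pre ?k D ?Q \<le> (\<Sum>i. if ?E i = {} then 0 else ennreal (unit_ball_vol (real ?k) * (diameter (?E i) / 2) ^ ?k))"
      unfolding hausdorff_pre_def by (rule INF_lower) (use bQ D in \<open>auto simp: D_def\<close>)
    also have "\<dots> = (\<Sum>i\<in>{0::nat}. if ?E i = {} then 0 else ennreal (unit_ball_vol (real ?k) * (diameter (?E i) / 2) ^ ?k))"
      by (rule suminf_finite) auto
    also have "\<dots> \<le> W" by (simp add: W_def)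
    finally show ?thesis .
  qed
  have all: "hausdorff_pre ?k (D / 2 ^ m) ?Q \<le> W" for m
  proof (induction m)
    case (Suc m)
    have "hausdorff_pre ?k (D / 2 ^ m / 2) ?Q \<le> hausdorff_pre ?k (D / 2 ^ m) ?Q" by (rule half) (use D in simp)
    then show ?case using Suc by (simp add: mult.commute)
  qed (use start in simp)
  have "hausdorff_outer ?k ?Q \<le> W"
    unfolding hausdorff_outer_def
  proof (rule SUP_least)
    fix \<delta> :: real assume \<delta>: "\<delta> \<in> {0<..}"
    obtain m where "D / \<delta> < 2 ^ m" using real_arch_pow[of 2 "D / \<delta>"] by auto
    then have "D / 2 ^ m \<le> \<delta>" using \<delta> by (simp add: field_simps)
    then show "hausdorff_pre ?k \<delta> ?Q \<le> W" using hausdorff_pre_antimono all order_trans by blast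
  qed
  also have "W < \<infinity>" by (simp add: W_def)
  finally show ?thesis .
qed

text \<open>A set lies in a ball whose radius is its diameter, and the Lebesgue measure of this ball
  is 2^k times the weight of the set in the premeasure. A cover of the cube by sets of small
  diameter thus has total weight at least 2^(-k).\<close>

lemma hausdorff_outer_cube_pos:
  "hausdorff_outer CARD('k) (unit_cube :: (real ^ 'k::finite) set) > 0"
proof -
  let ?Q = "unit_cube :: (real ^ 'k) set" and ?k = "CARD('k)"
  have "1 \<le> ennreal (2 ^ ?k) * (\<Sum>i. if E i = {} then 0 else ennreal (unit_ball_vol (real ?k) * (diameter (E i) / 2) ^ ?k))"
    if E: "?Q \<subseteq> (\<Union>i. E i)" "\<forall>i. bounded (E i) \<and> diameter (E i) \<le> 1" for E :: "nat \<Rightarrow> (real ^ 'k) set"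
  proof -
    define B where "B i = (if E i = {} then {} else cball (SOME x. x \<in> E i) (diameter (E i)))" for i
    have sub: "E i \<subseteq> B i" for i
    proof (cases "E i = {}")
      case False
      then have "(SOME x. x \<in> E i) \<in> E i" by (simp add: some_in_eq)
      then have "dist (SOME x. x \<in> E i) x \<le> diameter (E i)" if "x \<in> E i" for x
        by (intro diameter_bounded_bound) (use E(2) that in auto)
      then show ?thesis using False by (auto simp: B_def)
    qed (simp add: B_def)
    have "1 = emeasure lborel ?Q" by (simp add: unit_cube_cbox emeasure_lborel_cbox_eq)
    also have "\<dots> \<le> emeasure lborel (\<Union>i. B i)"
      by (rule emeasure_mono) (use E(1) sub in \<open>fastforce, auto simp: B_def\<close>)
    also have "\<dots> \<le> (\<Sum>i. emeasure lborel (B i))"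
      by (rule emeasure_subadditive_countably) (auto simp: B_def)
    also have "\<dots> = (\<Sum>i. ennreal (2 ^ ?k) * (if E i = {} then 0 else ennreal (unit_ball_vol (real ?k) * (diameter (E i) / 2) ^ ?k)))"
    proof (rule suminf_cong)
      fix i
      have "diameter (E i) \<ge> 0" using E(2) diameter_ge_0 by auto
      then have "emeasure lborel (cball x (diameter (E i))) = ennreal (unit_ball_vol (real ?k) * diameter (E i) ^ ?k)" for x :: "real ^ 'k"
        by (simp add: emeasure_cball)
      then show "emeasure lborel (B i) = ennreal (2 ^ ?k) * (if E i = {} then 0 else ennreal (unit_ball_vol (real ?k) * (diameter (E i) / 2) ^ ?k))"
        by (simp add: B_def power_divide flip: ennreal_mult')
    qed
    also have "\<dots> = ennreal (2 ^ ?k) * (\<Sum>i. if E i = {} then 0 else ennreal (unit_ball_vol (real ?k) * (diameter (E i) / 2) ^ ?k))"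
      by (rule ennreal_suminf_cmult)
    finally show ?thesis .
  qed
  then have le: "ennreal ((1 / 2) ^ ?k) \<le> (\<Sum>i. if E i = {} then 0 else ennreal (unit_ball_vol (real ?k) * (diameter (E i) / 2) ^ ?k))"
    if "?Q \<subseteq> (\<Union>i. E i)" "\<forall>i. bounded (E i) \<and> diameter (E i) \<le> 1" for E :: "nat \<Rightarrow> (real ^ 'k) set"
  proof -
    let ?s = "\<Sum>i. if E i = {} then 0 else ennreal (unit_ball_vol (real ?k) * (diameter (E i) / 2) ^ ?k)"
    have "ennreal ((1 / 2) ^ ?k) * 1 \<le> ennreal ((1 / 2) ^ ?k) * (ennreal (2 ^ ?k) * ?s)"
      using \<open>\<And>E. _ \<Longrightarrow> _ \<Longrightarrow> 1 \<le> _\<close>[OF that] by (rule mult_left_mono) simp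
    also have "\<dots> = ennreal ((1 / 2) ^ ?k * 2 ^ ?k) * ?s" by (simp add: ennreal_mult mult.assoc)
    also have "\<dots> = ?s" by (simp flip: power_mult_distrib)
    finally show ?thesis by simp
  qed
  have "ennreal ((1 / 2) ^ ?k) \<le> hausdorff_pre ?k 1 ?Q"
    unfolding hausdorff_pre_def by (rule INF_greatest) (use le in auto)
  also have "\<dots> \<le> hausdorff_outer ?k ?Q"
    unfolding hausdorff_outer_def by (rule SUP_upper) simp
  finally show ?thesis by (meson ennreal_less_zero_iff less_le_trans zero_less_power zero_less_divide_1_iff zero_less_numeral)
qed

text \<open>Cramer's rule: putting \<open>frame_point w y\<close> into slot \<open>j\<close>
  multiplies the k-vector of \<open>w\<close> by \<open>y $ j\<close>.\<close>

lemma inj_frame_point: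
  fixes w :: "'k::{finite,linorder} \<Rightarrow> real ^ 'n::{finite,linorder}"
  assumes "frame_wedge w \<noteq> 0"
  shows "inj (frame_point w)"
  unfolding linear_injective_0[OF linear_frame_point]
proof (intro allI impI)
  fix y assume y: "frame_point w y = 0"
  have "y $ j = 0" for j
  proof -
    have "0 = frame_wedge (w(j := frame_point w y))"
      using linear_0[OF linear_frame_wedge, of w j] y by simp
    also have "\<dots> = (\<Sum>i\<in>UNIV. y $ i *\<^sub>R frame_wedge (w(j := w i)))"
      unfolding frame_point_def
      by (simp add: linear_sum[OF linear_frame_wedge] linear_scale[OF linear_frame_wedge])
    also have "\<dots> = (\<Sum>i\<in>UNIV. if i = j then y $ j *\<^sub>R frame_wedge w else 0)"
    proof (rule sum.cong[OF refl])
      fix i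
      have "frame_wedge (w(j := w i)) = 0" if "i \<noteq> j" by (rule frame_wedge_eq_0[of i j]) (use that in auto)
      then show "y $ i *\<^sub>R frame_wedge (w(j := w i)) = (if i = j then y $ j *\<^sub>R frame_wedge w else 0)" by auto
    qed
    finally show "y $ j = 0" using assms by simp
  qed
  then show "y = 0" by (simp add: vec_eq_iff)
qed

text \<open>The ratio between Hausdorff measure on the plane of \<open>w\<close> and Lebesgue
  measure of the parameters. Its value stays open, since it cancels between densities and the
  measures of images.\<close>

definition hausdorff_factor :: "('k::finite \<Rightarrow> real ^ 'n::finite) \<Rightarrow> real" where
  "hausdorff_factor w = measure (hausdorff CARD('k)) (frame_point w ` unit_cube)"

context
  fixes w :: "'k::finite \<Rightarrow> real ^ 'n::finite" and u :: "real ^ 'n::finite" and H f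
  assumes inj: "inj (frame_point w)"
  defines "H \<equiv> hausdorff CARD('k) :: (real ^ 'n::finite) measure"
    and "f \<equiv> \<lambda>y. u + frame_point w y"
begin

text \<open>The parametrisation and its affine left inverse are both Lipschitz, which transfers
  finiteness and positivity from the measure of the unit cube.\<close>

lemma frame_image_facts:
  shows "continuous_on S f" "f \<in> borel \<rightarrow>\<^sub>M borel" "inj f" "closed (range f)"
    "B \<in> sets borel \<Longrightarrow> f ` B \<in> sets borel"
    "0 < emeasure H (f ` unit_cube)" "emeasure H (f ` unit_cube) < \<infinity>"
proof -
  let ?k = "CARD('k)"
  show cont: "continuous_on S f" for S unfolding f_def by (intro continuous_intros continuous_on_frame_point)
  then show "f \<in> borel \<rightarrow>\<^sub>M borel" by (intro borel_measurable_continuous_onI)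
  show "inj f" using inj by (auto simp: f_def inj_def)
  have "closed (range (frame_point w))" by (intro closed_subspace linear_subspace_image linear_frame_point subspace_UNIV)
  then show cl: "closed (range f)" unfolding f_def image_image[symmetric] using closed_translation[of "range (frame_point w)" u] by (simp add: image_image)
  obtain g where g: "linear g" "g \<circ> frame_point w = id"
    using linear_injective_left_inverse[OF linear_frame_point inj] by auto
  have gf: "g (f y - u) = y" for y using fun_cong[OF g(2), of y] by (simp add: f_def)
  have eq: "f ` B = range f \<inter> (\<lambda>x. g (x - u)) -` B" for B using gf by auto
  have mg: "(\<lambda>x. g (x - u)) \<in> borel \<rightarrow>\<^sub>M borel"
    by (intro borel_measurable_continuous_onI continuous_on_compose2[OF linear_continuous_on[of g UNIV]] continuous_intros)
      (use g(1) in \<open>auto simp: linear_conv_bounded_linear\<close>)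
  show "f ` B \<in> sets borel" if "B \<in> sets borel" for B
  proof -
    have "range f \<inter> (\<lambda>x. g (x - u)) -` B \<in> sets borel"
      using measurable_sets[OF mg that] borel_closed[OF cl] by (intro sets.Int) auto
    then show ?thesis by (simp only: eq[of B])
  qed
  then have Q: "f ` unit_cube \<in> sets borel" by (auto simp: unit_cube_cbox)
  have em: "emeasure H (f ` unit_cube) = hausdorff_outer ?k (f ` unit_cube)"
    unfolding H_def by (rule emeasure_hausdorff[OF Q])
  obtain C where C: "C > 0" "\<And>x. norm (frame_point w x) \<le> C * norm x"
    using linear_bounded_pos[OF linear_frame_point] by blast
  have "dist (f x) (f y) \<le> C * dist x y" for x y
    using C(2)[of "x - y"] by (simp add: f_def dist_norm linear_diff[OF linear_frame_point])
  then have "hausdorff_outer ?k (f ` unit_cube) \<le> ennreal (C ^ ?k) * hausdorff_outer ?k (unit_cube :: (real ^ 'k::finite) set)"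
    by (intro hausdorff_outer_lipschitz C) auto
  also have "\<dots> < \<infinity>" using hausdorff_outer_cube_finite[where 'k = 'k] by (simp add: ennreal_mult_less_top)
  finally show "emeasure H (f ` unit_cube) < \<infinity>" by (simp add: em)
  obtain C' where C': "C' > 0" "\<And>x. norm (g x) \<le> C' * norm x"
    using linear_bounded_pos[OF g(1)] by blast
  have "dist (g (x - u)) (g (y - u)) \<le> C' * dist x y" for x y
    using C'(2)[of "x - y"] linear_diff[OF g(1), of "x - u" "y - u"] by (simp add: dist_norm)
  then have "hausdorff_outer ?k ((\<lambda>x. g (x - u)) ` f ` unit_cube) \<le> ennreal (C' ^ ?k) * hausdorff_outer ?k (f ` unit_cube)"
    by (intro hausdorff_outer_lipschitz C') auto
  then have "0 < ennreal (C' ^ ?k) * hausdorff_outer ?k (f ` unit_cube)"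
    using hausdorff_outer_cube_pos[where 'k = 'k] by (simp add: image_image gf) 
  then show "0 < emeasure H (f ` unit_cube)" by (simp add: em ennreal_zero_less_mult_iff)
qed

text \<open>Transported to the parameters by the left inverse, Hausdorff measure on the plane is
  translation invariant, because shifting the parameter by \<open>v\<close> shifts the plane by
  \<open>frame_point w v\<close>. Hence it is a multiple of Lebesgue measure.\<close>

lemma density_hausdorff_frame:
  "density H (indicator (range f)) = density (distr lborel borel f) (\<lambda>_. ennreal (hausdorff_factor w))"
  and hausdorff_factor_pos: "hausdorff_factor w > 0"
  and emeasure_frame_image: "B \<in> sets borel \<Longrightarrow> emeasure H (f ` B) = ennreal (hausdorff_factor w) * emeasure lborel B"
proof -
  let ?k = "CARD('k)"
  note F = frame_image_facts
  obtain g where g: "linear g" "g \<circ> frame_point w = id"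
    using linear_injective_left_inverse[OF linear_frame_point inj] by auto
  have gf: "g (f y - u) = y" for y using fun_cong[OF g(2), of y] by (simp add: f_def)
  have mg: "(\<lambda>x. g (x - u)) \<in> borel \<rightarrow>\<^sub>M borel"
    by (intro borel_measurable_continuous_onI continuous_on_compose2[OF linear_continuous_on[of g UNIV]] continuous_intros)
      (use g(1) in \<open>auto simp: linear_conv_bounded_linear\<close>)
  have Hs: "sets H = sets borel" "space H = UNIV" by (simp_all add: H_def)
  have rf: "range f \<in> sets borel" using F(4) by (rule borel_closed)
  have tr: "emeasure H ((+) v ` A) = emeasure H A" if "A \<in> sets borel" for v A
  proof -
    have "(+) v ` A = (\<lambda>x. - v + x) -` A \<inter> space borel" by (auto intro!: image_eqI[of _ _ "_ - v"])
    then have "(+) v ` A \<in> sets borel" using measurable_sets[of "\<lambda>x. - v + x" borel borel A] that by simp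
    then show ?thesis using that by (simp add: H_def emeasure_hausdorff hausdorff_outer_translate)
  qed
  define M where "M = distr (density H (indicator (range f))) borel (\<lambda>x. g (x - u))"
  have M: "emeasure M B = emeasure H (f ` B)" if B: "B \<in> sets borel" for B
  proof -
    have eq: "f ` B = range f \<inter> (\<lambda>x. g (x - u)) -` B" using gf by auto
    have "emeasure M B = emeasure (density H (indicator (range f))) ((\<lambda>x. g (x - u)) -` B)"
      unfolding M_def using mg B Hs by (subst emeasure_distr) (auto simp: measurable_def)
    also have "\<dots> = (\<integral>\<^sup>+x. indicator (range f) x * indicator ((\<lambda>x. g (x - u)) -` B) x \<partial>H)"
      using rf measurable_sets[OF mg B] Hs by (intro emeasure_density) auto
    also have "\<dots> = (\<integral>\<^sup>+x. indicator (f ` B) x \<partial>H)"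
      unfolding eq by (intro nn_integral_cong) (auto simp: indicator_def)
    finally show ?thesis using F(5)[OF B] Hs by simp
  qed
  have inv: "distr M borel (\<lambda>x. v + x) = M" for v
  proof (rule measure_eqI)
    fix B assume "B \<in> sets (distr M borel (\<lambda>x. v + x))"
    then have B: "B \<in> sets borel" by simp
    have B': "(\<lambda>x. v + x) -` B \<in> sets borel" using measurable_sets[of "\<lambda>x. v + x" borel borel B] B by simp
    have "emeasure (distr M borel (\<lambda>x. v + x)) B = emeasure M ((\<lambda>x. v + x) -` B)"
      using B by (subst emeasure_distr) (auto simp: M_def)
    also have "\<dots> = emeasure H (f ` ((\<lambda>x. v + x) -` B))" by (rule M[OF B'])
    also have "\<dots> = emeasure H ((+) (frame_point w v) ` f ` ((\<lambda>x. v + x) -` B))"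
      by (rule tr[symmetric]) (rule F(5)[OF B'])
    also have "(+) (frame_point w v) ` f ` ((\<lambda>x. v + x) -` B) = f ` B"
    proof -
      have "frame_point w v + f y = f (v + y)" for y by (simp add: f_def linear_add[OF linear_frame_point])
      moreover have "(\<lambda>x. v + x) ` ((\<lambda>x. v + x) -` B) = B" by (auto intro!: image_eqI[of _ _ "_ - v"])
      ultimately show ?thesis by (metis (no_types, lifting) image_cong image_image)
    qed
    finally show "emeasure (distr M borel (\<lambda>x. v + x)) B = emeasure M B" by (simp add: M[OF B])
  qed (simp add: M_def)
  have Q: "unit_cube \<in> sets (borel :: (real ^ 'k::finite) measure)" by (simp add: unit_cube_cbox)
  have MQ: "emeasure M (cbox 0 One) = emeasure H (f ` unit_cube)" unfolding unit_cube_cbox[symmetric] by (rule M[OF Q])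
  have fac: "emeasure H (f ` unit_cube) = ennreal (hausdorff_factor w)"
  proof -
    have "f ` unit_cube = (+) u ` frame_point w ` unit_cube" by (simp add: f_def image_image)
    moreover have "frame_point w ` unit_cube \<in> sets borel"
      by (intro borel_compact compact_continuous_image compact_unit_cube continuous_on_frame_point)
    ultimately have "emeasure H (f ` unit_cube) = emeasure H (frame_point w ` unit_cube)" by (simp only: tr)
    then show ?thesis using F(7) unfolding hausdorff_factor_def by (simp add: H_def emeasure_eq_ennreal_measure less_top)
  qed
  show "hausdorff_factor w > 0" using F(6) unfolding fac by simp
  have em: "emeasure H (f ` B) = ennreal (hausdorff_factor w) * emeasure lborel B" if B: "B \<in> sets borel" for B
    using translation_invariant_measure[of M, OF _ inv _ B] MQ fac M[OF B] by (simp add: M_def)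
  then show "B \<in> sets borel \<Longrightarrow> emeasure H (f ` B) = ennreal (hausdorff_factor w) * emeasure lborel B" .
  show "density H (indicator (range f)) = density (distr lborel borel f) (\<lambda>_. ennreal (hausdorff_factor w))"
  proof (rule measure_eqI)
    fix A assume "A \<in> sets (density H (indicator (range f)))"
    then have A: "A \<in> sets borel" using Hs by simp
    have A': "f -` A \<in> sets borel" using measurable_sets[OF F(2) A] by simp
    have "emeasure (density H (indicator (range f))) A = (\<integral>\<^sup>+x. indicator (range f) x * indicator A x \<partial>H)"
      using rf A Hs by (intro emeasure_density) auto
    also have "\<dots> = (\<integral>\<^sup>+x. indicator (f ` (f -` A)) x \<partial>H)"
      by (intro nn_integral_cong) (auto simp: indicator_def)
    also have "\<dots> = ennreal (hausdorff_factor w) * emeasure lborel (f -` A)"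
      using F(5)[OF A'] em[OF A'] Hs by simp
    also have "\<dots> = emeasure (density (distr lborel borel f) (\<lambda>_. ennreal (hausdorff_factor w))) A"
      using A F(2) by (subst emeasure_density) (auto simp: nn_integral_cmult emeasure_distr)
    finally show "emeasure (density H (indicator (range f))) A = emeasure (density (distr lborel borel f) (\<lambda>_. ennreal (hausdorff_factor w))) A" .
  qed (simp add: Hs)
qed

lemma integral_frame_image:
  fixes \<phi> :: "real ^ 'n::finite \<Rightarrow> real"
  assumes K: "K \<in> sets borel" and \<phi>: "\<phi> \<in> borel_measurable borel"
  shows "(LINT x:f ` K|H. \<phi> x) = hausdorff_factor w * (LINT y:K|lborel. \<phi> (f y))"
proof -
  note F = frame_image_facts
  have rf: "range f \<in> sets borel" using F(4) by (rule borel_closed)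
  have fK: "f ` K \<in> sets borel" by (rule F(5)[OF K])
  let ?\<psi> = "\<lambda>x. indicator (f ` K) x *\<^sub>R \<phi> x"
  have \<psi>: "?\<psi> \<in> borel_measurable borel" using \<phi> fK by simp
  have "(LINT x|density H (indicator (range f)). ?\<psi> x) = (LINT x|H. indicator (range f) x *\<^sub>R ?\<psi> x)"
  proof -
    have "(LINT x|density H (\<lambda>x. ennreal (indicator (range f) x)). ?\<psi> x) = (LINT x|H. indicator (range f) x *\<^sub>R ?\<psi> x)"
      by (rule integral_density) (use \<psi> rf in \<open>auto simp: H_def\<close>)
    then show ?thesis by (simp add: ennreal_indicator)
  qed
  also have "\<dots> = (LINT x:f ` K|H. \<phi> x)"
    unfolding set_lebesgue_integral_def by (intro Bochner_Integration.integral_cong refl) (auto simp: indicator_def)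
  finally have 1: "(LINT x|density H (indicator (range f)). ?\<psi> x) = (LINT x:f ` K|H. \<phi> x)" .
  have "(LINT x|density (distr lborel borel f) (\<lambda>_. ennreal (hausdorff_factor w)). ?\<psi> x)
      = (LINT x|distr lborel borel f. hausdorff_factor w *\<^sub>R ?\<psi> x)"
    by (rule integral_density) (use \<psi> hausdorff_factor_pos in auto)
  also have "\<dots> = (LINT y|lborel. hausdorff_factor w *\<^sub>R ?\<psi> (f y))"
    by (rule integral_distr) (use F(2) \<psi> in auto)
  also have "\<dots> = hausdorff_factor w * (LINT y:K|lborel. \<phi> (f y))"
  proof -
    have "indicator (f ` K) (f y) = (indicator K y :: real)" for y
      using F(3) by (auto simp: indicator_def inj_image_mem_iff)
    then show ?thesis by (simp add: set_lebesgue_integral_def)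
  qed
  finally show ?thesis using 1 by (simp add: density_hausdorff_frame)
qed

text \<open>In the parameters the intersection is a proper affine subspace; it lies in a hyperplane
  and has Lebesgue measure 0.\<close>

lemma null_affine_frame_image:
  assumes A: "affine A" and nsub: "\<not> range f \<subseteq> A"
  shows "range f \<inter> A \<in> null_sets H"
proof -
  have "f -` A \<noteq> UNIV" using nsub by auto
  moreover have aff: "affine (f -` A)"
  proof -
    have "f (a *\<^sub>R x + b *\<^sub>R y) = a *\<^sub>R f x + b *\<^sub>R f y" if "a + b = 1" for a b x y
    proof -
      have "a *\<^sub>R u + b *\<^sub>R u = u" using that by (simp flip: scaleR_add_left)
      then show ?thesis
        by (simp add: f_def linear_add[OF linear_frame_point] linear_scale[OF linear_frame_point] algebra_simps)
    qed
    then show ?thesis using A unfolding affine_def by auto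
  qed
  ultimately have "affine hull (f -` A) \<noteq> UNIV" by (simp only: affine_hull_eq[THEN iffD2] simp_thms)
  then have "aff_dim (f -` A) \<noteq> DIM(real ^ 'k::finite)" using aff_dim_eq_full by blast
  then have "aff_dim (f -` A) < DIM(real ^ 'k::finite)" using aff_dim_le_DIM[of "f -` A"] by linarith
  then obtain a b where ab: "a \<noteq> 0" "f -` A \<subseteq> {x. a \<bullet> x = b}" by (rule aff_lowdim_subset_hyperplane)
  have Ab: "A \<in> sets borel" using A affine_closed borel_closed by blast
  have fA: "f -` A \<in> sets borel" using measurable_sets[OF frame_image_facts(2) Ab] by simp
  have "{x. a \<bullet> x = b} \<in> null_sets lborel"
  proof -
    have "{x. a \<bullet> x = b} \<in> null_sets lebesgue" using negligible_hyperplane[of a b] ab(1) by (simp add: negligible_iff_null_sets)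
    moreover have "{x. a \<bullet> x = b} \<in> sets lborel" by (auto intro!: borel_closed closed_hyperplane)
    ultimately show ?thesis by (simp add: null_sets_completion_iff)
  qed
  then have "emeasure lborel (f -` A) = 0" 
    by (intro null_setsD1[OF null_sets_subset[OF _ _ ab(2)]]) (use fA in simp_all)
  then have "emeasure H (f ` (f -` A)) = 0" using emeasure_frame_image[OF fA] by simp
  moreover have "f ` (f -` A) = range f \<inter> A" by auto
  ultimately show ?thesis using frame_image_facts(5)[OF fA] by (auto simp: H_def null_sets_def)
qed

end

section \<open>Simplices\<close>

lemma sum_set_nth:
  assumes "distinct us"
  shows "(\<Sum>x\<in>set us. g x) = (\<Sum>j<length us. g (us ! j))"
  by (rule sum.reindex_bij_betw[symmetric]) (rule bij_betw_nth[OF assms refl refl])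

lemma sum_UNIV_sorted_list:
  fixes g :: "'k::{finite,linorder} \<Rightarrow> 'a::comm_monoid_add"
  shows "(\<Sum>i\<in>UNIV. g i) = (\<Sum>j<CARD('k). g (sorted_list_of_set UNIV ! j))"
  using sum_set_nth[of "sorted_list_of_set (UNIV :: 'k set)" g] by simp

lemma frame_point_axis: "frame_point w (axis i 1) = w i"
  by (simp add: frame_point_def axis_def if_distrib[of "\<lambda>c. c *\<^sub>R _"] cong: if_cong)

lemma span_range_frame: "span (range w) = range (frame_point (w :: 'k::finite \<Rightarrow> 'a::real_vector))"
proof
  have "w i \<in> range (frame_point w)" for i using frame_point_axis[of w i] by (metis rangeI)
  then show "span (range w) \<subseteq> range (frame_point w)"
    by (intro span_minimal linear_subspace_image linear_frame_point subspace_UNIV) auto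
  show "range (frame_point w) \<subseteq> span (range w)"
    unfolding frame_point_def by (intro image_subsetI span_sum span_scale span_base rangeI)
qed

lemma affine_range_frame: "affine (range (\<lambda>y. u + frame_point w y))"
proof -
  have "affine ((+) u ` range (frame_point w))"
    using affine_translation[of "range (frame_point w)" u]
      subspace_imp_affine[OF linear_subspace_image[OF linear_frame_point subspace_UNIV]] by blast
  then show ?thesis by (simp add: image_image)
qed

text \<open>Two frames of one plane: \<open>v\<close> consists of the differences to the first
  vertex and parametrises the plane, \<open>e\<close> of the consecutive edges that define the
  orientation.\<close>

lemma simplex_frames:
  fixes us :: "(real ^ 'n::{finite,linorder}) list"
  assumes us: "nondegenerate_simplex CARD('k::{finite,linorder}) us"
  obtains u and v e :: "'k::{finite,linorder} \<Rightarrow> real ^ 'n::{finite,linorder}"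
  where "inj (frame_point v)" "convex hull (set us) \<subseteq> range (\<lambda>y. u + frame_point v y)"
    "map e (sorted_list_of_set UNIV) = map2 (-) (tl us) us"
    "range e \<subseteq> span (range v)" "range v \<subseteq> span (range e)"
proof -
  let ?k = "CARD('k)" let ?ks = "sorted_list_of_set (UNIV :: 'k set)"
  have len: "length us = Suc ?k" and dist: "distinct us" and indep: "\<not> affine_dependent (set us)"
    using us by (auto simp: nondegenerate_simplex_def)
  define u where "u = us ! 0"
  have "length (map (\<lambda>x. x - u) (tl us)) = ?k" using len by simp
  then obtain v :: "'k \<Rightarrow> real ^ 'n::{finite,linorder}" where v: "map v ?ks = map (\<lambda>x. x - u) (tl us)" by (rule frame_of_list)
  have "length (map2 (-) (tl us) us) = ?k" using len by simp
  then obtain e :: "'k \<Rightarrow> real ^ 'n::{finite,linorder}" where e: "map e ?ks = map2 (-) (tl us) us" by (rule frame_of_list)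
  have ks: "\<exists>j<?k. i = ?ks ! j" for i :: 'k
  proof -
    have "i \<in> set ?ks" by simp
    then show ?thesis unfolding in_set_conv_nth by auto
  qed
  have vj: "v (?ks ! j) = us ! Suc j - u" if "j < ?k" for j
    using arg_cong[OF v, of "\<lambda>l. l ! j"] that len by (simp add: nth_tl)
  have ej: "e (?ks ! j) = us ! Suc j - us ! j" if "j < ?k" for j
    using arg_cong[OF e, of "\<lambda>l. l ! j"] that len by (simp add: nth_tl)
  have inj: "inj (frame_point v)"
    unfolding linear_injective_0[OF linear_frame_point]
  proof (intro allI impI)
    fix y assume y: "frame_point v y = 0"
    \<comment> \<open>A linear relation among the differences to \<open>u\<close> becomes an affine
      relation among the vertices when \<open>u\<close> receives minus the sum of the
      coefficients.\<close>
    define c where "c j = (if j = 0 then - (\<Sum>i\<in>UNIV. y $ i) else y $ (?ks ! (j - 1)))" for j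
    define U where "U x = c (THE j. j < length us \<and> us ! j = x)" for x
    have Uj: "U (us ! j) = c j" if "j < length us" for j
    proof -
      have "(THE l. l < length us \<and> us ! l = us ! j) = j"
        by (rule the_equality) (use that dist in \<open>auto simp: nth_eq_iff_index_eq\<close>)
      then show ?thesis by (simp add: U_def)
    qed
    have "sum U (set us) = (\<Sum>j<Suc ?k. c j)"
      unfolding sum_set_nth[OF dist] len by (rule sum.cong) (auto simp: Uj len)
    also have "\<dots> = c 0 + (\<Sum>j<?k. c (Suc j))" by (rule sum.lessThan_Suc_shift)
    also have "(\<Sum>j<?k. c (Suc j)) = (\<Sum>i\<in>UNIV. y $ i)" by (simp add: c_def sum_UNIV_sorted_list)
    finally have s0: "sum U (set us) = 0" by (simp add: c_def)
    have "(\<Sum>x\<in>set us. U x *\<^sub>R x) = (\<Sum>j<Suc ?k. c j *\<^sub>R us ! j)"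
      unfolding sum_set_nth[OF dist] len by (rule sum.cong) (auto simp: Uj len)
    also have "\<dots> = c 0 *\<^sub>R u + (\<Sum>j<?k. c (Suc j) *\<^sub>R us ! Suc j)" by (simp only: sum.lessThan_Suc_shift u_def)
    also have "(\<Sum>j<?k. c (Suc j) *\<^sub>R us ! Suc j) = (\<Sum>j<?k. y $ (?ks ! j) *\<^sub>R (v (?ks ! j) + u))"
      by (rule sum.cong) (auto simp: c_def vj)
    also have "\<dots> = frame_point v y + (\<Sum>i\<in>UNIV. y $ i) *\<^sub>R u"
      by (simp add: frame_point_def sum_UNIV_sorted_list scaleR_add_right sum.distrib scaleR_sum_left)
    finally have "(\<Sum>x\<in>set us. U x *\<^sub>R x) = 0" by (simp add: y c_def)
    then have "\<forall>x\<in>set us. U x = 0" using indep s0 unfolding affine_dependent_explicit_finite[OF finite_set] by blast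
    then have "y $ (?ks ! j) = 0" if "j < ?k" for j
      using Uj[of "Suc j"] that len by (auto simp: c_def)
    then show "y = 0" using ks by (metis vec_eq_iff zero_index)
  qed
  have "us ! j \<in> range (\<lambda>y. u + frame_point v y)" if "j < length us" for j
  proof (cases j)
    case 0
    then have "us ! j = u + frame_point v 0" by (simp add: u_def linear_0[OF linear_frame_point])
    then show ?thesis by blast
  next
    case (Suc l)
    then have "us ! j = u + frame_point v (axis (?ks ! l) 1)" using vj[of l] that len by (simp add: frame_point_axis)
    then show ?thesis by blast
  qed
  then have "set us \<subseteq> range (\<lambda>y. u + frame_point v y)" by (auto simp: in_set_conv_nth)
  then have conv: "convex hull (set us) \<subseteq> range (\<lambda>y. u + frame_point v y)"
    by (rule hull_minimal) (rule affine_imp_convex[OF affine_range_frame])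
  have ev: "e i \<in> span (range v)" for i
  proof -
    obtain j where j: "j < ?k" "i = ?ks ! j" using ks by blast
    show ?thesis
    proof (cases j)
      case 0
      then have "e i = v i" using ej[OF j(1)] vj[OF j(1)] j(2) by (simp add: u_def)
      then show ?thesis by (simp add: span_base)
    next
      case (Suc l)
      then have "e i = v i - v (?ks ! l)" using ej[OF j(1)] vj[OF j(1)] vj[of l] j by simp
      then show ?thesis by (simp add: span_base span_diff)
    qed
  qed
  have ve: "us ! Suc j - u \<in> span (range e)" if "j < ?k" for j
    using that
  proof (induction j)
    case 0
    then have "us ! Suc 0 - u = e (?ks ! 0)" using ej[of 0] by (simp add: u_def)
    then show ?case by (simp add: span_base)
  next
    case (Suc j)
    then have "us ! Suc (Suc j) - u = e (?ks ! Suc j) + (us ! Suc j - u)" using ej[of "Suc j"] by simp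
    moreover have "us ! Suc j - u \<in> span (range e)" using Suc by simp
    ultimately show ?case by (simp only: span_add span_base rangeI)
  qed
  have "v i \<in> span (range e)" for i
  proof -
    obtain j where j: "j < ?k" "i = ?ks ! j" using ks by blast
    then show ?thesis using ve[of j] vj[of j] by simp
  qed
  then show thesis using that[OF inj conv e] ev by blast
qed

lemma orientation_frame:
  assumes "map e (sorted_list_of_set UNIV) = map2 (-) (tl us) us"
  shows "orientation us = sgn (frame_wedge e)"
  by (simp add: orientation_def frame_wedge_def assms)

text \<open>Only the simplices of full dimension in a simplicial subdivision are kept. The others
  are null sets, and so is the overlap of two distinct ones, which is a proper face of at least one
  of them.\<close>

lemma polytope_triangulation:
  fixes K :: "(real ^ 'k::finite) set"
  assumes "polytope K"
  obtains vss :: "(real ^ 'k::finite) list list"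
  where "\<And>vs. vs \<in> set vss \<Longrightarrow> nondegenerate_simplex CARD('k) vs"
    "AE y in lborel. indicator K y = (\<Sum>vs\<leftarrow>vss. indicator (convex hull (set vs)) y :: real)"
proof -
  obtain T where T: "simplicial_complex T" "\<Union>T = K"
    by (rule simplicial_subdivision_of_cell_complex[of "{K}"])
      (use assms in \<open>auto simp: face_of_refl polytope_imp_convex\<close>)
  have fin: "finite T" and simp: "\<And>S. S \<in> T \<Longrightarrow> \<exists>n. n simplex S"
    and face: "\<And>S S'. S \<in> T \<Longrightarrow> S' \<in> T \<Longrightarrow> (S \<inter> S') face_of S"
    using T(1) by (auto simp: simplicial_complex_def)
  let ?k = "int CARD('k)"
  define T' where "T' = {S \<in> T. aff_dim S = ?k}"
  have finT': "finite T'" using fin by (simp add: T'_def)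
  have "\<exists>vs. nondegenerate_simplex CARD('k) vs \<and> convex hull (set vs) = S" if "S \<in> T'" for S
  proof -
    have "S \<in> T" using that by (simp add: T'_def)
    then obtain n where n: "n simplex S" using simp by blast
    then have "n = ?k" using aff_dim_simplex[OF n] that by (simp add: T'_def)
    then obtain C where C: "\<not> affine_dependent C" "int (card C) = ?k + 1" "S = convex hull C"
      using n by (auto simp: simplex_def)
    obtain vs where "set vs = C" "distinct vs" using finite_distinct_list[OF aff_independent_finite[OF C(1)]] by auto
    then show ?thesis using C distinct_card[of vs]
      by (intro exI[of _ vs]) (auto simp: nondegenerate_simplex_def)
  qed
  then obtain h where h: "\<And>S. S \<in> T' \<Longrightarrow> nondegenerate_simplex CARD('k) (h S) \<and> convex hull (set (h S)) = S" by metis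
  obtain Ss where Ss: "set Ss = T'" "distinct Ss" using finite_distinct_list[OF finT'] by auto
  have null: "S \<in> null_sets lborel" if "aff_dim S < ?k" "closed S" for S :: "(real ^ 'k) set"
  proof -
    have "aff_dim S < DIM(real ^ 'k)" using that by simp
    then obtain a b where ab: "a \<noteq> 0" "S \<subseteq> {x. a \<bullet> x = b}" by (rule aff_lowdim_subset_hyperplane)
    then have "negligible S" using negligible_hyperplane negligible_subset by blast
    then have "S \<in> null_sets lebesgue" by (simp add: negligible_iff_null_sets)
    moreover have "S \<in> sets lborel" using that by (auto intro: borel_closed)
    ultimately show ?thesis by (simp add: null_sets_completion_iff)
  qed
  have closed: "closed S" if "S \<in> T" for S using simp[OF that] closed_simplex by blast
  define B where "B = (\<Union>S\<in>T - T'. S) \<union> (\<Union>S\<in>T'. \<Union>S'\<in>T' - {S}. S \<inter> S')"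
  have "(\<Union>S\<in>T - T'. S) \<in> null_sets lborel"
  proof (rule null_sets_UN')
    show "S \<in> null_sets lborel" if "S \<in> T - T'" for S
      by (rule null) (use that closed aff_dim_le_DIM[of S] in \<open>auto simp: T'_def\<close>)
  qed (use fin in \<open>simp add: countable_finite\<close>)
  moreover have "(\<Union>S\<in>T'. \<Union>S'\<in>T' - {S}. S \<inter> S') \<in> null_sets lborel"
  proof (intro null_sets_UN')
    fix S S' assume SS': "S \<in> T'" "S' \<in> T' - {S}"
    then have T: "S \<in> T" "S' \<in> T" "aff_dim S = ?k" "aff_dim S' = ?k" "S \<noteq> S'" by (auto simp: T'_def)
    have conv: "convex S" "convex S'" using T simp convex_simplex by blast+
    have "S \<inter> S' \<noteq> S \<or> S \<inter> S' \<noteq> S'" using T(5) by auto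
    then have "aff_dim (S \<inter> S') < ?k"
    proof
      assume "S \<inter> S' \<noteq> S"
      then show ?thesis using face_of_aff_dim_lt[OF conv(1) face[OF T(1,2)]] T(3) by simp
    next
      assume "S \<inter> S' \<noteq> S'"
      then show ?thesis using face_of_aff_dim_lt[OF conv(2) face[OF T(2,1)]] T(4) by (simp add: Int_commute)
    qed
    then show "S \<inter> S' \<in> null_sets lborel" using closed T by (intro null closed_Int) auto
  qed (use finT' in \<open>simp_all add: countable_finite\<close>)
  ultimately have B: "B \<in> null_sets lborel" unfolding B_def by (rule null_sets.Un)
  have eq: "indicator K y = (\<Sum>vs\<leftarrow>map h Ss. indicator (convex hull (set vs)) y :: real)" if y: "y \<notin> B" for y
  proof -
    have "(\<Sum>vs\<leftarrow>map h Ss. indicator (convex hull (set vs)) y :: real) = (\<Sum>S\<leftarrow>Ss. indicator S y)"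
      using h Ss(1) by (auto simp: o_def intro!: arg_cong[where f = sum_list])
    also have "\<dots> = (\<Sum>S\<in>T'. indicator S y)" using Ss by (simp add: sum_list_distinct_conv_sum_set)
    also have "\<dots> = indicator K y"
    proof (cases "y \<in> K")
      case True
      then obtain S where S: "S \<in> T" "y \<in> S" using T(2) by auto
      then have ST: "S \<in> T'" using y by (auto simp: B_def)
      have "y \<notin> S'" if "S' \<in> T' - {S}" for S' using y S(2) ST that by (auto simp: B_def)
      then have "(\<Sum>S\<in>T' - {S}. indicator S y :: real) = 0" by (intro sum.neutral) auto
      then show ?thesis using True S(2) by (simp add: sum.remove[OF finT' ST])
    next
      case False
      then have "indicator S y = (0 :: real)" if "S \<in> T'" for S using that T(2) by (auto simp: T'_def indicator_def)
      then show ?thesis using False by simp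
    qed
    finally show ?thesis by simp
  qed
  show thesis
  proof (rule that[of "map h Ss"])
    show "nondegenerate_simplex CARD('k) vs" if "vs \<in> set (map h Ss)" for vs using that h Ss(1) by auto
    show "AE y in lborel. indicator K y = (\<Sum>vs\<leftarrow>map h Ss. indicator (convex hull (set vs)) y :: real)"
      by (rule AE_I'[OF B]) (use eq in auto)
  qed
qed

lemma affine_image_independent:
  assumes "linear L" "inj L" "\<not> affine_dependent S"
  shows "\<not> affine_dependent ((\<lambda>y. u + L y) ` S)"
proof (cases "S = {}")
  case False
  then obtain a where a: "a \<in> S" by auto
  have "\<not> dependent ((\<lambda>x. - a + x) ` (S - {a}))" using assms(3) affine_dependent_iff_dependent2[OF a] by simp
  then have "\<not> dependent (L ` (\<lambda>x. - a + x) ` (S - {a}))"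
    by (rule linear_independent_injective_image[OF assms(1) _ inj_on_subset[OF assms(2) subset_UNIV]])
  also have "L ` (\<lambda>x. - a + x) ` (S - {a}) = (\<lambda>x. - (u + L a) + x) ` ((\<lambda>y. u + L y) ` S - {u + L a})"
  proof -
    have "(\<lambda>y. u + L y) ` S - {u + L a} = (\<lambda>y. u + L y) ` (S - {a})"
      using assms(2) by (auto simp: inj_def)
    then show ?thesis by (simp add: image_image linear_diff[OF assms(1)])
  qed
  finally show ?thesis using affine_dependent_iff_dependent2[of "u + L a" "(\<lambda>y. u + L y) ` S"] a by auto
qed simp

text \<open>A triangulation of \<open>K\<close> is mapped into the plane of \<open>w\<close>; null
  sets of parameters go to null sets, so the indicators add up almost everywhere.\<close>

lemma polyhedral_piece:
  fixes w :: "'k::{finite,linorder} \<Rightarrow> real ^ 'n::{finite,linorder}"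
  assumes w: "frame_wedge w \<noteq> 0" and K: "polytope K"
  obtains c :: "'n chain" where "\<forall>(a, us)\<in>set c. nondegenerate_simplex CARD('k) us"
    "AE x in hausdorff CARD('k). chain_density c x
       = (a * indicator ((\<lambda>y. u + frame_point w y) ` K) x / hausdorff_factor w) *\<^sub>R frame_wedge w"
proof -
  let ?k = "CARD('k)" let ?ks = "sorted_list_of_set (UNIV :: 'k set)"
  define f where "f y = u + frame_point w y" for y
  note inj = inj_frame_point[OF w]
  have injf: "inj f" using inj by (auto simp: f_def inj_def)
  obtain vss :: "(real ^ 'k::{finite,linorder}) list list" where vss: "\<And>vs. vs \<in> set vss \<Longrightarrow> nondegenerate_simplex ?k vs"
    "AE y in lborel. indicator K y = (\<Sum>vs\<leftarrow>vss. indicator (convex hull (set vs)) y :: real)"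
    by (rule polytope_triangulation[OF K]) blast
  have nd: "nondegenerate_simplex ?k (map f vs)" if "vs \<in> set vss" for vs
  proof -
    have "\<not> affine_dependent (f ` set vs)" unfolding f_def
      by (rule affine_image_independent[OF linear_frame_point inj]) (use vss(1)[OF that] in \<open>simp add: nondegenerate_simplex_def\<close>)
    moreover have "distinct (map f vs)"
      using vss(1)[OF that] inj_on_subset[OF injf subset_UNIV] by (simp add: nondegenerate_simplex_def distinct_map)
    ultimately show ?thesis using vss(1)[OF that] by (simp add: nondegenerate_simplex_def)
  qed
  \<comment> \<open>The vertex order of a simplex in the triangulation is arbitrary; the sign
    \<open>s\<close> corrects its coefficient when its orientation is opposite to that of
    \<open>w\<close>.\<close>
  have or: "\<exists>s. (s = 1 \<or> s = -1) \<and> orientation (map f vs) = s *\<^sub>R sgn (frame_wedge w)" if "vs \<in> set vss" for vs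
  proof -
    note ndvs = vss(1)[OF that]
    obtain u0 and v0 e0 :: "'k \<Rightarrow> real ^ 'k::{finite,linorder}" where v0: "inj (frame_point v0)"
      "convex hull (set vs) \<subseteq> range (\<lambda>y. u0 + frame_point v0 y)"
      "map e0 ?ks = map2 (-) (tl vs) vs" "range e0 \<subseteq> span (range v0)" "range v0 \<subseteq> span (range e0)"
      by (rule simplex_frames[OF ndvs])
    have "surj (frame_point v0)" using linear_injective_imp_surjective[OF linear_frame_point v0(1)] by simp
    then have "span (range v0) = UNIV" by (simp add: span_range_frame)
    then have top: "span (range e0) = UNIV" using span_minimal[OF v0(5) subspace_span] by auto
    define e where "e i = frame_point w (e0 i)" for i
    have "map2 (-) (tl (map f vs)) (map f vs) = map (frame_point w) (map2 (-) (tl vs) vs)"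
      by (rule nth_equalityI) (auto simp: f_def nth_tl linear_diff[OF linear_frame_point])
    also have "\<dots> = map e ?ks" unfolding v0(3)[symmetric] by (simp add: e_def)
    finally have e: "map e ?ks = map2 (-) (tl (map f vs)) (map f vs)" by simp
    have "range e = frame_point w ` range e0" by (auto simp: e_def)
    then have "span (range e) = frame_point w ` span (range e0)" by (simp only: linear_span_image[OF linear_frame_point])
    then have sp: "span (range e) = span (range w)" by (simp add: top span_range_frame[of w])
    have we: "range w \<subseteq> span (range e)" unfolding sp by (rule span_superset)
    have ew: "range e \<subseteq> span (range w)" unfolding sp[symmetric] by (rule span_superset)
    obtain c where c0: "frame_wedge w = c *\<^sub>R frame_wedge e" by (rule frame_wedge_proportional[OF we])
    obtain c' where c: "frame_wedge e = c' *\<^sub>R frame_wedge w" by (rule frame_wedge_proportional[OF ew])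
    have "c' \<noteq> 0" using c c0 w by auto
    then have "sgn c' = 1 \<or> sgn c' = -1" by (auto simp: sgn_if)
    moreover have "orientation (map f vs) = sgn c' *\<^sub>R sgn (frame_wedge w)"
      unfolding orientation_frame[OF e] c by (rule sgn_scaleR)
    ultimately show ?thesis by blast
  qed
  then obtain s where s: "\<And>vs. vs \<in> set vss \<Longrightarrow> (s vs = 1 \<or> s vs = -1) \<and> orientation (map f vs) = s vs *\<^sub>R sgn (frame_wedge w)" by metis
  define b where "b = a * norm (frame_wedge w) / hausdorff_factor w"
  define c where "c = map (\<lambda>vs. (b * s vs, map f vs)) vss"
  have conv: "convex hull (set (map f vs)) = f ` (convex hull (set vs))" for vs
  proof -
    have "f ` A = (+) u ` frame_point w ` A" for A by (simp add: f_def image_image)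
    then show ?thesis by (simp only: set_map convex_hull_translation convex_hull_linear_image[OF linear_frame_point])
  qed
  have dens: "chain_density c x = (b * (\<Sum>vs\<leftarrow>vss. indicator (f ` (convex hull (set vs))) x)) *\<^sub>R sgn (frame_wedge w)" for x
  proof -
    have "chain_density c x = (\<Sum>vs\<leftarrow>vss. (b * s vs * indicator (f ` (convex hull (set vs))) x) *\<^sub>R orientation (map f vs))"
      by (simp add: chain_density_def c_def o_def conv[unfolded set_map])
    also have "\<dots> = (\<Sum>vs\<leftarrow>vss. (b * indicator (f ` (convex hull (set vs))) x) *\<^sub>R sgn (frame_wedge w))"
    proof (intro arg_cong[where f = sum_list] map_cong refl)
      fix vs assume "vs \<in> set vss"
      from s[OF this] show "(b * s vs * indicator (f ` (convex hull (set vs))) x) *\<^sub>R orientation (map f vs)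
          = (b * indicator (f ` (convex hull (set vs))) x) *\<^sub>R sgn (frame_wedge w)" by auto
    qed
    also have "\<dots> = (b * (\<Sum>vs\<leftarrow>vss. indicator (f ` (convex hull (set vs))) x)) *\<^sub>R sgn (frame_wedge w)"
      by (induction vss) (auto simp: algebra_simps)
    finally show ?thesis .
  qed
  have "AE x in hausdorff ?k. chain_density c x
       = (a * indicator (f ` K) x / hausdorff_factor w) *\<^sub>R frame_wedge w"
  proof -
    obtain N where N: "N \<in> null_sets lborel" "{y. indicator K y \<noteq> (\<Sum>vs\<leftarrow>vss. indicator (convex hull (set vs)) y :: real)} \<subseteq> N"
      using vss(2) by (auto elim!: AE_E simp: null_sets_def)
    then have Nb: "N \<in> sets borel" by (auto dest: null_setsD2)
    have "f ` N \<in> null_sets (hausdorff ?k)"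
      using emeasure_frame_image[OF inj Nb, of u] frame_image_facts(5)[OF inj Nb, of u] null_setsD1[OF N(1)]
      by (auto simp: null_sets_def f_def[abs_def])
    then show ?thesis
    proof (rule AE_I')
      show "{x \<in> space (hausdorff ?k). chain_density c x \<noteq> (a * indicator (f ` K) x / hausdorff_factor w) *\<^sub>R frame_wedge w} \<subseteq> f ` N"
      proof (rule subsetI, rule ccontr)
        fix x assume x: "x \<in> {x \<in> space (hausdorff ?k). chain_density c x \<noteq> (a * indicator (f ` K) x / hausdorff_factor w) *\<^sub>R frame_wedge w}" "x \<notin> f ` N"
        have "(\<Sum>vs\<leftarrow>vss. indicator (f ` (convex hull (set vs))) x) = (indicator (f ` K) x :: real)"
        proof (cases "x \<in> range f")
          case True
          then obtain y where y: "x = f y" by auto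
          then have "y \<notin> N" using x(2) by auto
          then have "indicator K y = (\<Sum>vs\<leftarrow>vss. indicator (convex hull (set vs)) y :: real)" using N(2) by blast
          moreover have "indicator (f ` A) (f y) = (indicator A y :: real)" for A
            using injf by (simp add: indicator_def inj_image_mem_iff)
          ultimately show ?thesis by (simp add: y)
        next
          case False
          then have "indicator (f ` A) x = (0 :: real)" for A by (auto simp: indicator_def)
          then show ?thesis by (simp add: sum_list_0)
        qed
        then have "chain_density c x = (b * indicator (f ` K) x) *\<^sub>R sgn (frame_wedge w)" unfolding dens by simp
        also have "\<dots> = (a * indicator (f ` K) x / hausdorff_factor w) *\<^sub>R frame_wedge w"
          using w by (simp add: b_def sgn_div_norm)
        finally show False using x(1) by simp
      qed
    qed
  qed
  moreover have "\<forall>(a, us)\<in>set c. nondegenerate_simplex ?k us" using nd by (auto simp: c_def)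
  ultimately show thesis using that[of c] by (simp add: f_def[abs_def])
qed

section \<open>Densities of polyhedral chains\<close>

definition nondegenerate_chain :: "nat \<Rightarrow> 'n::finite chain \<Rightarrow> bool" where
  "nondegenerate_chain k c \<longleftrightarrow> (\<forall>(a, us)\<in>set c. nondegenerate_simplex k us)"

lemma simplex_borel: "convex hull (set us) \<in> sets (borel :: (real ^ 'n::finite) measure)"
  by (intro borel_compact finite_imp_compact_convex_hull) simp

lemma simplex_finite_measure:
  fixes us :: "(real ^ 'n::{finite,linorder}) list"
  assumes "nondegenerate_simplex CARD('k::{finite,linorder}) us"
  shows "emeasure (hausdorff CARD('k)) (convex hull (set us)) < \<infinity>"
proof -
  obtain u and v e :: "'k \<Rightarrow> real ^ 'n::{finite,linorder}" where v: "inj (frame_point v)"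
    "convex hull (set us) \<subseteq> range (\<lambda>y. u + frame_point v y)" "map e (sorted_list_of_set UNIV) = map2 (-) (tl us) us"
    "range e \<subseteq> span (range v)" "range v \<subseteq> span (range e)" by (rule simplex_frames[OF assms])
  obtain g where g: "linear g" "g \<circ> frame_point v = id"
    using linear_injective_left_inverse[OF linear_frame_point v(1)] by auto
  let ?f = "\<lambda>y. u + frame_point v y"
  have gf: "g (?f y - u) = y" for y using fun_cong[OF g(2), of y] by simp
  define K where "K = (\<lambda>x. g (x - u)) ` (convex hull (set us))"
  have "compact K" unfolding K_def
    by (intro compact_continuous_image continuous_on_compose2[OF linear_continuous_on[of g UNIV]]
        continuous_intros finite_imp_compact_convex_hull) (use g(1) in \<open>auto simp: linear_conv_bounded_linear\<close>)
  then have "emeasure lborel K < \<infinity>" "K \<in> sets borel" using emeasure_compact_finite borel_compact by auto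
  moreover have "?f ` K = convex hull (set us)"
  proof -
    have "?f (g (x - u)) = x" if "x \<in> convex hull (set us)" for x
    proof -
      from that v(2) obtain y where "x = ?f y" by blast
      then show ?thesis using gf by simp
    qed
    then show ?thesis by (simp add: K_def image_image)
  qed
  ultimately show ?thesis using emeasure_frame_image[OF v(1), of K u] by (simp add: ennreal_mult_less_top)
qed

lemma chain_density_simps [simp]:
  "chain_density [] x = 0"
  "chain_density (c @ c') x = chain_density c x + chain_density c' x"
  "chain_density ((a, us) # c) x = (a * indicator (convex hull (set us)) x) *\<^sub>R orientation us + chain_density c x"
  by (simp_all add: chain_density_def)

lemma chain_density_measurable [measurable]: "chain_density c \<in> borel_measurable borel"
proof -
  have "(\<lambda>x. \<Sum>p\<leftarrow>c. (fst p * indicator (convex hull (set (snd p))) x) *\<^sub>R orientation (snd p)) \<in> borel_measurable borel"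
  proof (induction c)
    case (Cons p c)
    note [measurable] = simplex_borel Cons
    show ?case by simp
  qed simp
  then show ?thesis by (simp add: chain_density_def[abs_def] case_prod_unfold)
qed

lemma finite_range_chain_density: "finite (range (chain_density c))"
proof (induction c)
  case Nil
  then show ?case by (simp add: chain_density_def[abs_def])
next
  case (Cons p c)
  obtain a us where p: "p = (a, us)" by (cases p)
  have "range (chain_density (p # c)) \<subseteq> (\<lambda>(x, y). x + y) ` ({0, a *\<^sub>R orientation us} \<times> range (chain_density c))"
    by (auto simp: p indicator_def image_iff)
  then show ?case by (rule finite_subset) (use Cons in auto)
qed

lemma chain_support_finite:
  assumes "nondegenerate_chain CARD('k::{finite,linorder}) (c :: 'n::{finite,linorder} chain)"
  shows "emeasure (hausdorff CARD('k)) {x. chain_density c x \<noteq> 0} < \<infinity>"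
  using assms
proof (induction c)
  case (Cons p c)
  obtain a us where p: "p = (a, us)" by (cases p)
  have m: "{x. chain_density d x \<noteq> 0} \<in> sets (borel :: (real ^ 'n::{finite,linorder}) measure)" for d :: "'n chain"
    using measurable_sets[OF chain_density_measurable[of d], of "- {0}"] by (auto simp: vimage_def)
  have "{x. chain_density (p # c) x \<noteq> 0} \<subseteq> convex hull (set us) \<union> {x. chain_density c x \<noteq> 0}"
    by (auto simp: p indicator_def split: if_splits)
  then have "emeasure (hausdorff CARD('k)) {x. chain_density (p # c) x \<noteq> 0}
      \<le> emeasure (hausdorff CARD('k)) (convex hull (set us) \<union> {x. chain_density c x \<noteq> 0})"
    by (rule emeasure_mono) (use sets.Un[OF simplex_borel[of us] m[of c]] in simp)
  also have "\<dots> \<le> emeasure (hausdorff CARD('k)) (convex hull (set us)) + emeasure (hausdorff CARD('k)) {x. chain_density c x \<noteq> 0}"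
    by (rule emeasure_subadditive) (simp_all add: m simplex_borel)
  also have "\<dots> < \<infinity>"
    using Cons simplex_finite_measure[where 'k = 'k, of us] by (simp add: nondegenerate_chain_def p ennreal_add_less_top)
  finally show ?case .
qed simp

text \<open>A density takes finitely many values on a set of finite measure and is 0 elsewhere;
  composed with \<open>h\<close> it is again a bounded simple function with such a support.\<close>

lemma integrable_chain_density:
  fixes h :: "'n::{finite,linorder} ext \<Rightarrow> 'b::{banach, second_countable_topology}"
  assumes "nondegenerate_chain CARD('k::{finite,linorder}) c" "h 0 = 0"
  shows "integrable (hausdorff CARD('k)) (\<lambda>x. h (chain_density c x))"
proof -
  let ?H = "hausdorff CARD('k) :: (real ^ 'n::{finite,linorder}) measure"
  have sf: "simple_function ?H (chain_density c)"
    unfolding simple_function_def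
    using finite_range_chain_density[of c] measurable_sets[OF chain_density_measurable[of c]] by auto
  then have sh: "simple_function ?H (\<lambda>x. h (chain_density c x))" using simple_function_compose[OF sf, of h] by (simp add: o_def)
  have S: "{x. chain_density c x \<noteq> 0} \<in> sets (borel :: (real ^ 'n::{finite,linorder}) measure)"
    using measurable_sets[OF chain_density_measurable[of c], of "- {0}"] by (auto simp: vimage_def)
  define B where "B = Max ((\<lambda>\<xi>. norm (h \<xi>)) ` range (chain_density c))"
  have B: "norm (h (chain_density c x)) \<le> B" for x
    unfolding B_def by (rule Max_ge) (use finite_range_chain_density[of c] in auto)
  have "integrable ?H (\<lambda>x. indicator {x. chain_density c x \<noteq> 0} x * B)"
    using chain_support_finite[OF assms(1)] S by (intro integrable_mult_left integrable_real_indicator) simp_all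
  then show ?thesis
  proof (rule Bochner_Integration.integrable_bound)
    show "(\<lambda>x. h (chain_density c x)) \<in> borel_measurable ?H" by (rule borel_measurable_simple_function[OF sh])
    show "AE x in ?H. norm (h (chain_density c x)) \<le> norm (indicator {x. chain_density c x \<noteq> 0} x * B)"
      using B assms(2) by (intro AE_I2) (auto simp: indicator_def intro: order_trans[OF _ abs_ge_self])
  qed
qed

lemma chain_current:
  fixes c :: "'n::{finite,linorder} chain"
  assumes c: "nondegenerate_chain CARD('k::{finite,linorder}) c" and \<omega>: "\<omega> \<in> test_forms CARD('k)"
  shows "(\<Sum>(a, us)\<leftarrow>c. a * simplex_current CARD('k) us \<omega>) = (LINT x|hausdorff CARD('k). \<omega> x \<bullet> chain_density c x)"
    and "integrable (hausdorff CARD('k)) (\<lambda>x. \<omega> x \<bullet> chain_density c x)"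
proof -
  let ?H = "hausdorff CARD('k) :: (real ^ 'n::{finite,linorder}) measure"
  have cont: "continuous_on UNIV \<omega>" using \<omega> by (auto simp: test_forms_iff intro: smooth_continuous_on)
  have int: "set_integrable ?H (convex hull (set us)) (\<lambda>x. \<omega> x \<bullet> \<xi>)" if "nondegenerate_simplex CARD('k) us" for us \<xi>
  proof -
    let ?S = "convex hull (set us)"
    have "compact ?S" by (intro finite_imp_compact_convex_hull) simp
    then have "bounded ((\<lambda>x. \<omega> x \<bullet> \<xi>) ` ?S)"
      by (intro compact_imp_bounded compact_continuous_image continuous_intros continuous_on_subset[OF cont]) auto
    then obtain B where B: "\<And>x. x \<in> ?S \<Longrightarrow> norm (\<omega> x \<bullet> \<xi>) \<le> B" by (auto simp: bounded_iff)
    have "integrable ?H (\<lambda>x. indicator ?S x * B)"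
      using simplex_finite_measure[OF that] by (intro integrable_mult_left integrable_real_indicator) (simp_all add: simplex_borel)
    then show ?thesis unfolding set_integrable_def
    proof (rule Bochner_Integration.integrable_bound)
      have "(\<lambda>x. \<omega> x \<bullet> \<xi>) \<in> borel_measurable borel"
        by (intro borel_measurable_continuous_onI continuous_intros cont)
      then show "(\<lambda>x. indicator ?S x *\<^sub>R (\<omega> x \<bullet> \<xi>)) \<in> borel_measurable ?H" using simplex_borel[of us] by simp
      show "AE x in ?H. norm (indicator ?S x *\<^sub>R (\<omega> x \<bullet> \<xi>)) \<le> norm (indicator ?S x * B)"
        using B by (intro AE_I2) (auto simp: indicator_def intro: order_trans[OF _ abs_ge_self])
    qed
  qed
  have "(\<Sum>(a, us)\<leftarrow>c. a * simplex_current CARD('k) us \<omega>) = (LINT x|?H. \<omega> x \<bullet> chain_density c x)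
      \<and> integrable ?H (\<lambda>x. \<omega> x \<bullet> chain_density c x)"
    using c
  proof (induction c)
    case (Cons p c)
    obtain a us where p: "p = (a, us)" by (cases p)
    have us: "nondegenerate_simplex CARD('k) us" using Cons by (simp add: nondegenerate_chain_def p)
    have IH: "(\<Sum>(a, us)\<leftarrow>c. a * simplex_current CARD('k) us \<omega>) = (LINT x|?H. \<omega> x \<bullet> chain_density c x)"
      "integrable ?H (\<lambda>x. \<omega> x \<bullet> chain_density c x)" using Cons by (auto simp: nondegenerate_chain_def)
    have split: "\<omega> x \<bullet> chain_density (p # c) x = a * (indicator (convex hull (set us)) x *\<^sub>R (\<omega> x \<bullet> orientation us)) + \<omega> x \<bullet> chain_density c x" for x
      by (simp add: p inner_add_right)
    have int': "integrable ?H (\<lambda>x. a * (indicator (convex hull (set us)) x *\<^sub>R (\<omega> x \<bullet> orientation us)))"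
      using int[OF us, of "orientation us"] unfolding set_integrable_def by (rule integrable_mult_right)
    have "(LINT x|?H. a * (indicator (convex hull (set us)) x *\<^sub>R (\<omega> x \<bullet> orientation us))) = a * simplex_current CARD('k) us \<omega>"
      using \<omega> by (simp add: simplex_current_def set_lebesgue_integral_def)
    moreover have "(LINT x|?H. a * (indicator (convex hull (set us)) x *\<^sub>R (\<omega> x \<bullet> orientation us)) + \<omega> x \<bullet> chain_density c x)
        = (LINT x|?H. a * (indicator (convex hull (set us)) x *\<^sub>R (\<omega> x \<bullet> orientation us))) + (LINT x|?H. \<omega> x \<bullet> chain_density c x)"
      by (rule Bochner_Integration.integral_add[OF int' IH(2)])
    ultimately show ?case unfolding split using IH(1) Bochner_Integration.integrable_add[OF int' IH(2)] by (simp only: p list.map sum_list.Cons prod.case simp_thms)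
  qed simp
  then show "(\<Sum>(a, us)\<leftarrow>c. a * simplex_current CARD('k) us \<omega>) = (LINT x|?H. \<omega> x \<bullet> chain_density c x)"
    "integrable ?H (\<lambda>x. \<omega> x \<bullet> chain_density c x)" by auto
qed

section \<open>Test forms determine the density of a chain\<close>

section \<open>Bump functions\<close>

text \<open>Membership in a class that contains a derivative of each of its members: the counterpart
  of \<open>smooth_coinduct\<close> on the line.\<close>

definition smooth_real :: "(real \<Rightarrow> real) \<Rightarrow> bool" where
  "smooth_real g \<longleftrightarrow> (\<exists>S. g \<in> S \<and> (\<forall>h\<in>S. \<exists>h'\<in>S. \<forall>t. (h has_real_derivative h' t) (at t)))"

lemma smooth_realE:
  assumes "smooth_real g"
  obtains g' where "smooth_real g'" "\<And>t. (g has_real_derivative g' t) (at t)"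
  using assms unfolding smooth_real_def by metis

text \<open>A partial derivative of a product of functions of separate coordinates is again such a
  product, with one factor replaced by its derivative.\<close>

lemma smooth_prod_coordinates:
  fixes g :: "'n::finite \<Rightarrow> real \<Rightarrow> real" and \<xi> :: "'b::real_normed_vector"
  assumes "\<And>i. smooth_real (g i)"
  shows "smooth (\<lambda>x. (\<Prod>i\<in>UNIV. g i (x $ i)) *\<^sub>R \<xi>)"
proof (rule smooth_coinduct[of _ "{(\<lambda>x :: real ^ 'n::finite. (\<Prod>i\<in>UNIV. g i (x $ i)) *\<^sub>R \<xi>) | g. \<forall>i. smooth_real (g i)}"])
  have der: "((\<lambda>x. (\<Prod>i\<in>UNIV. g i (x $ i)) *\<^sub>R \<xi>) has_derivative
      (\<lambda>v. (\<Sum>i\<in>UNIV. (v $ i * g' i (x $ i)) * (\<Prod>j\<in>UNIV - {i}. g j (x $ j))) *\<^sub>R \<xi>)) (at x)"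
    if g': "\<And>i t. (g i has_real_derivative g' i t) (at t)" for g g' :: "'n \<Rightarrow> real \<Rightarrow> real" and x
  proof -
    have "((\<lambda>x. g i (x $ i)) has_derivative (\<lambda>v. v $ i * g' i (x $ i))) (at x)" for i
      using DERIV_compose_FDERIV[OF g' bounded_linear_imp_has_derivative[OF bounded_linear_vec_nth]] .
    then show ?thesis
      by (intro has_derivative_scaleR_left has_derivative_prod)
  qed
  fix h assume "h \<in> {(\<lambda>x :: real ^ 'n::finite. (\<Prod>i\<in>UNIV. g i (x $ i)) *\<^sub>R \<xi>) | g. \<forall>i. smooth_real (g i)}"
  then obtain g where h: "h = (\<lambda>x. (\<Prod>i\<in>UNIV. g i (x $ i)) *\<^sub>R \<xi>)" and g: "\<And>i. smooth_real (g i)" by blast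
  have "\<forall>i. \<exists>g'. smooth_real g' \<and> (\<forall>t. (g i has_real_derivative g' t) (at t))" using smooth_realE[OF g] by metis
  then obtain g' where g': "\<And>i. smooth_real (g' i)" "\<And>i t. (g i has_real_derivative g' i t) (at t)" by metis
  show "h differentiable at x" for x unfolding h by (rule differentiableI[OF der[of g g', OF g'(2)]])
  show "partial_deriv i h \<in> {(\<lambda>x :: real ^ 'n::finite. (\<Prod>i\<in>UNIV. g i (x $ i)) *\<^sub>R \<xi>) | g. \<forall>i. smooth_real (g i)}" for i
  proof -
    let ?g = "\<lambda>j. if j = i then g' i else g j"
    have "partial_deriv i h = (\<lambda>x. (\<Sum>l\<in>UNIV. (axis i 1 $ l * g' l (x $ l)) * (\<Prod>j\<in>UNIV - {l}. g j (x $ j))) *\<^sub>R \<xi>)"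
      unfolding h by (rule partial_deriv_eqI) (rule der[of g g', OF g'(2)])
    also have "\<dots> = (\<lambda>x. (\<Prod>j\<in>UNIV. ?g j (x $ j)) *\<^sub>R \<xi>)"
    proof
      fix x
      have "(\<Sum>l\<in>UNIV. (axis i 1 $ l * g' l (x $ l)) * (\<Prod>j\<in>UNIV - {l}. g j (x $ j)))
          = (\<Sum>l\<in>UNIV. if l = i then g' i (x $ i) * (\<Prod>j\<in>UNIV - {i}. g j (x $ j)) else 0)"
        by (rule sum.cong) (auto simp: axis_def)
      also have "\<dots> = g' i (x $ i) * (\<Prod>j\<in>UNIV - {i}. g j (x $ j))" by simp
      also have "\<dots> = (\<Prod>j\<in>UNIV. ?g j (x $ j))"
        by (subst prod.remove[of UNIV i]) (auto intro!: prod.cong)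
      finally show "(\<Sum>l\<in>UNIV. (axis i 1 $ l * g' l (x $ l)) * (\<Prod>j\<in>UNIV - {l}. g j (x $ j))) *\<^sub>R \<xi> = (\<Prod>j\<in>UNIV. ?g j (x $ j)) *\<^sub>R \<xi>"
        by simp
    qed
    finally show ?thesis using g g'(1) by (intro CollectI exI[of _ ?g]) auto
  qed
qed (use assms in auto)

lemma power_le_fact_exp:
  assumes "(x::real) \<ge> 0"
  shows "x ^ n \<le> fact n * exp x"
proof -
  have "(\<Sum>m\<in>{n}. x ^ m /\<^sub>R fact m) \<le> (\<Sum>m. x ^ m /\<^sub>R fact m)"
    by (rule sum_le_suminf[OF summable_exp_generic]) (use assms in auto)
  then have "x ^ n / fact n \<le> exp x" by (simp add: exp_def field_simps)
  then show ?thesis by (simp add: field_simps)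
qed

text \<open>
  For \<open>p = 1\<close> and \<open>j = 0\<close> this is a bump on the interval from \<open>a\<close> to \<open>b\<close>; the other functions of this
  form are needed because the family is closed under derivatives.
\<close>

definition bump_term :: "real \<Rightarrow> real \<Rightarrow> real \<Rightarrow> real poly \<Rightarrow> nat \<Rightarrow> real \<Rightarrow> real" where
  "bump_term a b r p j t = (let q = (t - a) * (b - t) in if q > 0 then poly p t * exp (- (r / q)) / q ^ j else 0)"

lemma bump_term_derivative:
  fixes a b r :: real
  assumes r: "r > 0"
  defines "q \<equiv> [:- (a * b), a + b, - 1:]"
  shows "(bump_term a b r p j has_real_derivative
    bump_term a b r (pderiv p * q ^ 2 + smult r (p * pderiv q) - smult (real j) (p * q * pderiv q)) (j + 2) t) (at t)"
proof -
  have q: "poly q t = (t - a) * (b - t)" for t by (simp add: q_def algebra_simps)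
  have bt: "bump_term a b r p j t = (if poly q t > 0 then poly p t * exp (- (r / poly q t)) / poly q t ^ j else 0)" for p j t
    by (simp add: bump_term_def Let_def q)
  have contq: "continuous_on UNIV (poly q)" by (intro continuous_intros)
  consider "poly q t > 0" | "poly q t < 0" | "poly q t = 0" by linarith
  then show ?thesis
  proof cases
    case 1
    have "((\<lambda>t. poly p t * exp (- (r / poly q t)) / poly q t ^ j) has_real_derivative
        bump_term a b r (pderiv p * q ^ 2 + smult r (p * pderiv q) - smult (real j) (p * q * pderiv q)) (j + 2) t) (at t)"
    proof -
      let ?Q = "poly q t" and ?Q' = "poly (pderiv q) t" and ?E = "exp (- (r / poly q t))"
      have "((\<lambda>t. poly p t * exp (- (r / poly q t)) / poly q t ^ j) has_real_derivative
        ((poly (pderiv p) t * ?E + poly p t * (?E * (r * ?Q' / ?Q ^ 2))) * ?Q ^ j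
          - poly p t * ?E * (real j * ?Q ^ (j - 1) * ?Q')) / (?Q ^ j * ?Q ^ j)) (at t)"
        using 1 by (auto intro!: derivative_eq_intros simp: power2_eq_square field_simps)
      also have "((poly (pderiv p) t * ?E + poly p t * (?E * (r * ?Q' / ?Q ^ 2))) * ?Q ^ j
          - poly p t * ?E * (real j * ?Q ^ (j - 1) * ?Q')) / (?Q ^ j * ?Q ^ j)
        = bump_term a b r (pderiv p * q ^ 2 + smult r (p * pderiv q) - smult (real j) (p * q * pderiv q)) (j + 2) t"
      proof (cases j)
        case 0
        then show ?thesis using 1 by (simp add: bt field_simps power2_eq_square)
      next
        case (Suc l)
        then show ?thesis using 1 by (simp add: bt field_simps power2_eq_square)
      qed
      finally show ?thesis .
    qed
    then show ?thesis
    proof (rule has_field_derivative_transform_within_open)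
      show "open {t. poly q t > 0}" by (intro open_Collect_less continuous_intros)
      show "t \<in> {t. poly q t > 0}" using 1 by simp
      show "poly p s * exp (- (r / poly q s)) / poly q s ^ j = bump_term a b r p j s" if "s \<in> {t. poly q t > 0}" for s
        using that by (simp add: bt)
    qed
  next
    case 2
    have "((\<lambda>t. 0) has_real_derivative bump_term a b r (pderiv p * q ^ 2 + smult r (p * pderiv q) - smult (real j) (p * q * pderiv q)) (j + 2) t) (at t)"
      using 2 by (simp add: bt)
    then show ?thesis
    proof (rule has_field_derivative_transform_within_open)
      show "open {t. poly q t < 0}" by (intro open_Collect_less continuous_intros)
      show "t \<in> {t. poly q t < 0}" using 2 by simp
      show "0 = bump_term a b r p j s" if "s \<in> {t. poly q t < 0}" for s using that by (simp add: bt)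
    qed
  next
    case 3
    \<comment> \<open>At a zero of \<open>q\<close> the difference quotient is estimated directly.
      Within distance 1 of \<open>t\<close>, \<open>P\<close> bounds the polynomial \<open>p\<close>
      and \<open>L\<close> bounds the other linear factor of \<open>q\<close>.\<close>
    have "compact (poly p ` {t - 1..t + 1})" by (intro compact_continuous_image continuous_intros) auto
    then obtain P where P: "\<And>s. s \<in> {t - 1..t + 1} \<Longrightarrow> \<bar>poly p s\<bar> \<le> P"
      using compact_imp_bounded by (fastforce simp: bounded_iff)
    define L where "L = \<bar>b - a\<bar> + 1"
    define K where "K = P * (fact (j + 2) / r ^ (j + 2)) * L ^ 2"
    have P0: "P \<ge> 0" using P[of t] by simp
    have bound: "\<bar>bump_term a b r p j s\<bar> \<le> K * \<bar>s - t\<bar> ^ 2" if s: "\<bar>s - t\<bar> \<le> 1" for s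
    proof (cases "poly q s > 0")
      case True
      let ?x = "poly q s"
      \<comment> \<open>The exponent j + 2 leaves the second power of \<open>q\<close> after
        division by its j-th power, hence quadratic decay at the zero and derivative 0
        there.\<close>
      have "(r / ?x) ^ (j + 2) \<le> fact (j + 2) * exp (r / ?x)" by (rule power_le_fact_exp) (use True r in simp)
      then have "r ^ (j + 2) \<le> fact (j + 2) * exp (r / ?x) * ?x ^ (j + 2)"
        using True by (simp only: power_divide pos_divide_le_eq zero_less_power)
      moreover have "1 / E / X \<le> F / R * Y" if "R \<le> F * E * (X * Y)" "E > 0" "X > 0" "R > 0" for R E F X Y :: real
        using that by (simp add: field_simps)
      ultimately have "1 / exp (r / ?x) / ?x ^ j \<le> fact (j + 2) / r ^ (j + 2) * ?x ^ 2"
        using True r by (simp only: power_add[of ?x] exp_gt_zero zero_less_power)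
      then have "exp (- (r / ?x)) / ?x ^ j \<le> fact (j + 2) / r ^ (j + 2) * ?x ^ 2"
        by (simp only: exp_minus inverse_eq_divide)
      moreover have "?x ^ 2 \<le> (L * \<bar>s - t\<bar>) ^ 2"
      proof (rule power_mono)
        have "t = a \<or> t = b" using 3 by (auto simp: q)
        then show "?x \<le> L * \<bar>s - t\<bar>"
        proof
          assume t: "t = a"
          have "?x \<le> \<bar>b - s\<bar> * \<bar>s - t\<bar>" using abs_ge_self[of ?x] by (simp add: q t abs_mult mult.commute)
          also have "\<dots> \<le> L * \<bar>s - t\<bar>" by (intro mult_right_mono) (use s t in \<open>auto simp: L_def\<close>)
          finally show ?thesis .
        next
          assume t: "t = b"
          have "?x \<le> \<bar>s - a\<bar> * \<bar>s - t\<bar>" using abs_ge_self[of ?x] by (simp add: q t abs_mult abs_minus_commute)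
          also have "\<dots> \<le> L * \<bar>s - t\<bar>" by (intro mult_right_mono) (use s t in \<open>auto simp: L_def\<close>)
          finally show ?thesis .
        qed
      qed (use True in simp)
      ultimately have "exp (- (r / ?x)) / ?x ^ j \<le> fact (j + 2) / r ^ (j + 2) * (L * \<bar>s - t\<bar>) ^ 2"
        using r by (meson divide_nonneg_pos fact_ge_zero mult_left_mono order_trans zero_less_power)
      note le = this
      have "\<bar>poly p s\<bar> * (exp (- (r / ?x)) / ?x ^ j) \<le> P * (fact (j + 2) / r ^ (j + 2) * (L * \<bar>s - t\<bar>) ^ 2)"
      proof (rule mult_mono)
        have "s \<in> {t - 1..t + 1}" using s by (auto simp: abs_le_iff)
        then show "\<bar>poly p s\<bar> \<le> P" by (rule P)
      qed (rule le, use True P0 in auto)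
      then show ?thesis using True by (simp add: bt K_def abs_mult power_mult_distrib mult.assoc)
    next
      case False
      then show ?thesis using P0 r by (simp add: bt K_def)
    qed
    have zero: "bump_term a b r p' j' t = 0" for p' j' using 3 by (simp add: bt)
    have "((\<lambda>s. (bump_term a b r p j s - bump_term a b r p j t) / (s - t)) \<longlongrightarrow> 0) (at t)"
    proof (rule Lim_null_comparison)
      have "eventually (\<lambda>s. \<bar>s - t\<bar> < 1 \<and> s \<noteq> t) (at t)"
        using eventually_at[of "\<lambda>s. \<bar>s - t\<bar> < 1 \<and> s \<noteq> t" t UNIV] by (auto simp: dist_real_def intro!: exI[of _ 1])
      then show "\<forall>\<^sub>F s in at t. norm ((bump_term a b r p j s - bump_term a b r p j t) / (s - t)) \<le> K * \<bar>s - t\<bar>"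
      proof eventually_elim
        case (elim s)
        then have "\<bar>bump_term a b r p j s\<bar> \<le> K * \<bar>s - t\<bar> * \<bar>s - t\<bar>" using bound[of s] by (simp add: power2_eq_square mult.assoc)
        then show ?case using elim by (simp add: zero divide_le_eq)
      qed
      have "((\<lambda>s. K * \<bar>s - t\<bar>) \<longlongrightarrow> K * \<bar>t - t\<bar>) (at t)" by (intro tendsto_intros)
      then show "((\<lambda>s. K * \<bar>s - t\<bar>) \<longlongrightarrow> 0) (at t)" by simp
    qed
    then show ?thesis by (simp add: has_field_derivative_iff zero)
  qed
qed

lemma smooth_real_bump:
  assumes "r > 0"
  shows "smooth_real (bump_term a b r p j)"
  unfolding smooth_real_def
  by (rule exI[of _ "range (\<lambda>(p, j). bump_term a b r p j)"]) (use bump_term_derivative[OF assms] in fastforce)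

text \<open>As \<open>m\<close> grows the exponents tend to 0, so these functions converge to the
  indicator of the open box while remaining between 0 and 1.\<close>

definition box_bump :: "nat \<Rightarrow> real ^ 'n::finite \<Rightarrow> real ^ 'n \<Rightarrow> real ^ 'n \<Rightarrow> real" where
  "box_bump m a b x = (\<Prod>i\<in>UNIV. bump_term (a $ i) (b $ i) (1 / Suc m) 1 0 (x $ i))"

lemma box_bump_facts:
  fixes a b x :: "real ^ 'n::finite"
  assumes ab: "\<And>i. a $ i < b $ i"
  shows "0 \<le> box_bump m a b x" "box_bump m a b x \<le> 1" "x \<notin> box a b \<Longrightarrow> box_bump m a b x = 0"
    "(\<lambda>m. box_bump m a b x) \<longlonglongrightarrow> indicator (box a b) x"
proof -
  have pos: "(x $ i - a $ i) * (b $ i - x $ i) > 0 \<longleftrightarrow> a $ i < x $ i \<and> x $ i < b $ i" for i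
    using ab[of i] by (auto simp: zero_less_mult_iff)
  have bump: "bump_term (a $ i) (b $ i) (1 / Suc m) 1 0 (x $ i)
    = (if a $ i < x $ i \<and> x $ i < b $ i then exp (- ((1 / Suc m) / ((x $ i - a $ i) * (b $ i - x $ i)))) else 0)" for m i
    unfolding bump_term_def Let_def pos by simp
  have bump01: "0 \<le> bump_term (a $ i) (b $ i) (1 / Suc m) 1 0 (x $ i) \<and> bump_term (a $ i) (b $ i) (1 / Suc m) 1 0 (x $ i) \<le> 1" for m i
  proof (cases "a $ i < x $ i \<and> x $ i < b $ i")
    case True
    then have "(1 / Suc m) / ((x $ i - a $ i) * (b $ i - x $ i)) \<ge> 0" by simp
    then have "exp (- ((1 / Suc m) / ((x $ i - a $ i) * (b $ i - x $ i)))) \<le> 1" by simp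
    then show ?thesis unfolding bump using True by simp
  next
    case False
    then show ?thesis unfolding bump by simp
  qed
  show "0 \<le> box_bump m a b x" unfolding box_bump_def by (rule prod_nonneg) (use bump01 in auto)
  show "box_bump m a b x \<le> 1" unfolding box_bump_def by (rule prod_le_1) (use bump01 in auto)
  show zero: "box_bump m a b x = 0" if "x \<notin> box a b" for m
  proof -
    from that obtain i where i: "\<not> (a $ i < x $ i \<and> x $ i < b $ i)" unfolding mem_box_cart by blast
    then have "bump_term (a $ i) (b $ i) (1 / Suc m) 1 0 (x $ i) = 0" unfolding bump by simp
    then show ?thesis unfolding box_bump_def by (intro prod_zero) auto
  qed
  show "(\<lambda>m. box_bump m a b x) \<longlonglongrightarrow> indicator (box a b) x"
  proof (cases "x \<in> box a b")
    case True
    have "(\<lambda>m. bump_term (a $ i) (b $ i) (1 / Suc m) 1 0 (x $ i)) \<longlonglongrightarrow> 1" for i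
    proof -
      let ?q = "(x $ i - a $ i) * (b $ i - x $ i)"
      have "(\<lambda>m. exp (- (1 / real (Suc m) / ?q))) \<longlonglongrightarrow> exp (- (0 / ?q))"
      proof (intro tendsto_intros LIMSEQ_Suc[OF lim_1_over_n])
        have "a $ i < x $ i \<and> x $ i < b $ i" using True by (simp add: mem_box_cart)
        then show "?q \<noteq> 0" using pos[of i] by linarith
      qed
      moreover have "a $ i < x $ i \<and> x $ i < b $ i" using True by (simp add: mem_box_cart)
      ultimately show ?thesis unfolding bump by simp
    qed
    then have "(\<lambda>m. box_bump m a b x) \<longlonglongrightarrow> (\<Prod>i\<in>(UNIV :: 'n set). 1)"
      unfolding box_bump_def by (rule tendsto_prod)
    then show ?thesis using True by simp
  qed (simp add: zero)
qed

lemma box_bump_test_form: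
  fixes a b :: "real ^ 'n::{finite,linorder}"
  assumes ab: "\<And>i. a $ i < b $ i" and A: "card A = k"
  shows "(\<lambda>x. box_bump m a b x *\<^sub>R axis A 1) \<in> test_forms k"
proof -
  have "smooth (\<lambda>x. box_bump m a b x *\<^sub>R axis A (1::real))"
    unfolding box_bump_def by (rule smooth_prod_coordinates) (rule smooth_real_bump, simp)
  moreover have "{x. box_bump m a b x *\<^sub>R axis A (1::real) \<noteq> 0} \<subseteq> box a b"
    using box_bump_facts(3)[OF ab] by auto
  then have "bounded {x. box_bump m a b x *\<^sub>R axis A (1::real) \<noteq> 0}" using bounded_subset[OF bounded_box] by blast
  moreover have "range (\<lambda>x. box_bump m a b x *\<^sub>R axis A (1::real)) \<subseteq> multivectors k"
    using A by (auto simp: multivectors_def axis_def)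
  ultimately show ?thesis by (simp add: test_forms_iff)
qed

section \<open>The density is determined by the current\<close>

text \<open>Since \<open>ennreal\<close> cuts off negative values, \<open>P\<close> and
  \<open>N\<close> have the positive and the negative part of \<open>g\<close> as densities. They
  agree on boxes, which form an intersection-stable generator, hence everywhere; this forces both
  parts to vanish.\<close>

lemma AE_zero_if_box_integrals_zero:
  fixes g :: "'a::euclidean_space \<Rightarrow> real"
  assumes int: "integrable M g" and sets: "sets M = sets borel"
    and box: "\<And>a b. (LINT x:box a b|M. g x) = 0"
  shows "AE x in M. g x = 0"
proof -
  have sp: "space M = UNIV" using sets_eq_imp_space_eq[OF sets] by simp
  have gm: "g \<in> borel_measurable M" using int by simp
  define P where "P = density M (\<lambda>x. ennreal (g x))"
  define N where "N = density M (\<lambda>x. ennreal (- g x))"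
  have em: "emeasure P B = ennreal (LINT x|M. indicator B x * max 0 (g x))" "emeasure N B = ennreal (LINT x|M. indicator B x * max 0 (- g x))"
    if B: "B \<in> sets M" for B
  proof -
    have gen: "emeasure (density M (\<lambda>x. ennreal (h x))) B = ennreal (LINT x|M. indicator B x * max 0 (h x))"
      if h: "integrable M h" for h :: "'a \<Rightarrow> real"
    proof -
      have "emeasure (density M (\<lambda>x. ennreal (h x))) B = (\<integral>\<^sup>+x. ennreal (h x) * indicator B x \<partial>M)"
        using B h by (intro emeasure_density) auto
      also have "\<dots> = (\<integral>\<^sup>+x. ennreal (indicator B x * max 0 (h x)) \<partial>M)"
        by (intro nn_integral_cong) (auto simp: indicator_def max_def ennreal_neg)
      also have "\<dots> = ennreal (LINT x|M. indicator B x * max 0 (h x))"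
      proof (rule nn_integral_eq_integral)
        have "integrable M (\<lambda>x. max 0 (h x))" using h by (intro integrable_max) auto
        then show "integrable M (\<lambda>x. indicator B x * max 0 (h x))"
          using B integrable_mult_indicator[of B M "\<lambda>x. max 0 (h x)"] by simp
      qed auto
      finally show ?thesis .
    qed
    show "emeasure P B = ennreal (LINT x|M. indicator B x * max 0 (g x))" unfolding P_def by (rule gen[OF int])
    show "emeasure N B = ennreal (LINT x|M. indicator B x * max 0 (- g x))" unfolding N_def using gen[of "\<lambda>x. - g x"] int by simp
  qed
  have diff: "(LINT x|M. indicator B x * max 0 (g x)) - (LINT x|M. indicator B x * max 0 (- g x)) = (LINT x:B|M. g x)"
    if B: "B \<in> sets M" for B
  proof -
    have i: "integrable M (\<lambda>x. indicator B x * max 0 (h x))" if h: "integrable M h" for h :: "'a \<Rightarrow> real"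
    proof -
      have "integrable M (\<lambda>x. max 0 (h x))" using h by (intro integrable_max) auto
      then show ?thesis using B integrable_mult_indicator[of B M "\<lambda>x. max 0 (h x)"] by simp
    qed
    have "(LINT x|M. indicator B x * max 0 (g x)) - (LINT x|M. indicator B x * max 0 (- g x))
       = (LINT x|M. indicator B x * max 0 (g x) - indicator B x * max 0 (- g x))"
      by (rule Bochner_Integration.integral_diff[symmetric]) (use i[OF int] i[of "\<lambda>x. - g x"] int in auto)
    also have "\<dots> = (LINT x:B|M. g x)"
      unfolding set_lebesgue_integral_def by (intro Bochner_Integration.integral_cong refl) (auto simp: indicator_def max_def)
    finally show ?thesis .
  qed
  have "P = N"
  proof (rule measure_eqI_generator_eq[where E = "range (\<lambda>(a, b). box a b)" and A = "\<lambda>i. box (- (real i *\<^sub>R One)) (real i *\<^sub>R One)" and \<Omega> = UNIV])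
    show "Int_stable (range (\<lambda>(a, b). box a b :: 'a set))"
      by (auto simp: Int_stable_def box_Int_box)
    show "emeasure P X = emeasure N X" if "X \<in> range (\<lambda>(a, b). box a b)" for X
    proof -
      from that obtain a b where X: "X = box a b" by auto
      then have XM: "X \<in> sets M" using sets by simp
      show ?thesis unfolding em[OF XM] using diff[OF XM] box[of a b] by (simp add: X)
    qed
    show "sets P = sigma_sets UNIV (range (\<lambda>(a, b). box a b))" "sets N = sigma_sets UNIV (range (\<lambda>(a, b). box a b))"
      by (simp_all add: P_def N_def sets borel_eq_box)
    show "(\<Union>i. box (- (real i *\<^sub>R One)) (real i *\<^sub>R One)) = (UNIV :: 'a set)" by (rule UN_box_eq_UNIV)
    show "emeasure P (box (- (real i *\<^sub>R One)) (real i *\<^sub>R One)) \<noteq> \<infinity>" for i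
      using em(1)[of "box (- (real i *\<^sub>R One)) (real i *\<^sub>R One)"] sets by simp
  qed auto
  have nn: "AE x in M. h x \<le> 0" if h: "integrable M h" and eq: "density M (\<lambda>x. ennreal (h x)) = density M (\<lambda>x. ennreal (- h x))" for h :: "'a \<Rightarrow> real"
  proof -
    let ?B = "{x \<in> space M. h x > 0}"
    have B: "?B \<in> sets M" using h by (intro borel_measurable_less) auto
    have "(\<integral>\<^sup>+x. ennreal (h x) * indicator ?B x \<partial>M) = emeasure (density M (\<lambda>x. ennreal (h x))) ?B"
      using B h by (intro emeasure_density[symmetric]) auto
    also have "\<dots> = (\<integral>\<^sup>+x. ennreal (- h x) * indicator ?B x \<partial>M)"
      unfolding eq using B h by (intro emeasure_density) auto
    also have "\<dots> = (\<integral>\<^sup>+x. 0 \<partial>M)"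
      by (intro nn_integral_cong) (auto simp: indicator_def ennreal_neg)
    finally have "(\<integral>\<^sup>+x. ennreal (h x) * indicator ?B x \<partial>M) = 0" by simp
    then have "AE x in M. ennreal (h x) * indicator ?B x = 0"
      by (subst (asm) nn_integral_0_iff_AE) (use B h in auto)
    then show ?thesis using AE_space
    proof eventually_elim
      case (elim x)
      then show ?case by (cases "h x > 0") (auto simp: indicator_def)
    qed
  qed
  have "AE x in M. g x \<le> 0" using nn[OF int] \<open>P = N\<close> by (simp add: P_def N_def)
  moreover have "AE x in M. - g x \<le> 0" using nn[of "\<lambda>x. - g x"] int \<open>P = N\<close> by (simp add: P_def N_def)
  ultimately show ?thesis by eventually_elim simp
qed

lemma chain_density_multivectors:
  assumes "nondegenerate_chain k c"
  shows "chain_density c x \<in> multivectors k"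
  using assms
proof (induction c)
  case (Cons p c)
  obtain a us where p: "p = (a, us)" by (cases p)
  have len: "length us = Suc k" using Cons by (simp add: nondegenerate_chain_def nondegenerate_simplex_def p)
  have "orientation us \<in> multivectors k"
    using wedge_list_multivectors[of "map2 (-) (tl us) us"] len
    by (simp add: orientation_def sgn_div_norm subspace_scale[OF multivectors_subspace])
  then show ?case using Cons
    by (simp add: p nondegenerate_chain_def subspace_add[OF multivectors_subspace] subspace_scale[OF multivectors_subspace])
qed (simp add: subspace_0[OF multivectors_subspace])

text \<open>Bumps times a basis covector isolate one coordinate of the density, and in the limit its
  integral over a box. It follows that the choice of a representation in \<open>mass\<close> and
  \<open>energy\<close> does not matter.\<close>

lemma chain_density_unique:
  fixes c c' :: "'n::{finite,linorder} chain"
  assumes c: "nondegenerate_chain CARD('k::{finite,linorder}) c" and c': "nondegenerate_chain CARD('k) c'"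
    and eq: "\<And>\<omega>. \<omega> \<in> test_forms CARD('k) \<Longrightarrow>
      (\<Sum>(a, us)\<leftarrow>c. a * simplex_current CARD('k) us \<omega>) = (\<Sum>(a, us)\<leftarrow>c'. a * simplex_current CARD('k) us \<omega>)"
  shows "AE x in hausdorff CARD('k). chain_density c x = chain_density c' x"
proof -
  let ?H = "hausdorff CARD('k) :: (real ^ 'n::{finite,linorder}) measure"
  define g where "g A x = chain_density c x $ A - chain_density c' x $ A" for A x
  have gint: "integrable ?H (g A)" for A
    unfolding g_def by (intro Bochner_Integration.integrable_diff integrable_chain_density c c') auto
  have "AE x in ?H. g A x = 0" for A
  proof (cases "card A = CARD('k)")
    case False
    then have "g A x = 0" for x
      using chain_density_multivectors[OF c, of x] chain_density_multivectors[OF c', of x] by (simp add: g_def multivectors_def)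
    then show ?thesis by simp
  next
    case True
    show ?thesis
    proof (rule AE_zero_if_box_integrals_zero[OF gint])
      fix a b :: "real ^ 'n::{finite,linorder}"
      show "(LINT x:box a b|?H. g A x) = 0"
      proof (cases "\<forall>i. a $ i < b $ i")
        case False
        then obtain i where "\<not> a $ i < b $ i" by blast
        then have "x \<notin> box a b" for x unfolding mem_box_cart by (meson less_trans)
        then have "box a b = {}" by blast
        then show ?thesis by (simp add: set_lebesgue_integral_def)
      next
        case ab: True
        then have ab: "\<And>i. a $ i < b $ i" by simp
        have zero: "(LINT x|?H. box_bump m a b x * g A x) = 0" for m
        proof -
          let ?\<omega> = "\<lambda>x. box_bump m a b x *\<^sub>R axis A (1::real)"
          have \<omega>: "?\<omega> \<in> test_forms CARD('k)" by (rule box_bump_test_form[OF ab True])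
          have "(LINT x|?H. ?\<omega> x \<bullet> chain_density c x) = (LINT x|?H. ?\<omega> x \<bullet> chain_density c' x)"
            using eq[OF \<omega>] chain_current(1)[OF c \<omega>] chain_current(1)[OF c' \<omega>] by simp
          then have "(LINT x|?H. ?\<omega> x \<bullet> chain_density c x - ?\<omega> x \<bullet> chain_density c' x) = 0"
            using chain_current(2)[OF c \<omega>] chain_current(2)[OF c' \<omega>] by simp
          then show ?thesis by (simp add: g_def inner_axis' right_diff_distrib)
        qed
        have "(\<lambda>m. LINT x|?H. box_bump m a b x * g A x) \<longlonglongrightarrow> (LINT x|?H. indicator (box a b) x * g A x)"
        proof (rule integral_dominated_convergence[where w = "\<lambda>x. \<bar>g A x\<bar>"])
          show "(\<lambda>x. indicator (box a b) x * g A x) \<in> borel_measurable ?H"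
            using borel_measurable_integrable[OF gint[of A]] by simp
          show "(\<lambda>x. box_bump m a b x * g A x) \<in> borel_measurable ?H" for m
          proof -
            have "smooth (\<lambda>x. box_bump m a b x *\<^sub>R (1::real))"
              unfolding box_bump_def by (rule smooth_prod_coordinates) (rule smooth_real_bump, simp)
            then have "continuous_on UNIV (box_bump m a b)" using smooth_continuous_on by fastforce
            then have "box_bump m a b \<in> borel_measurable borel" by (rule borel_measurable_continuous_onI)
            then have "box_bump m a b \<in> borel_measurable ?H" by simp
            then show ?thesis using borel_measurable_integrable[OF gint[of A]] by simp
          qed
          show "integrable ?H (\<lambda>x. \<bar>g A x\<bar>)" using gint by simp
          show "AE x in ?H. (\<lambda>m. box_bump m a b x * g A x) \<longlonglongrightarrow> indicator (box a b) x * g A x"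
            by (intro AE_I2 tendsto_mult tendsto_const box_bump_facts(4)[OF ab])
          show "AE x in ?H. norm (box_bump m a b x * g A x) \<le> \<bar>g A x\<bar>" for m
          proof (intro AE_I2)
            fix x
            have "\<bar>box_bump m a b x\<bar> * \<bar>g A x\<bar> \<le> 1 * \<bar>g A x\<bar>"
              by (intro mult_right_mono) (use box_bump_facts(1,2)[OF ab, of m x] in auto)
            then show "norm (box_bump m a b x * g A x) \<le> \<bar>g A x\<bar>" by (simp add: abs_mult)
          qed
        qed
        then have "(LINT x|?H. indicator (box a b) x * g A x) = 0"
          unfolding zero using LIMSEQ_unique tendsto_const by blast
        then show ?thesis by (simp add: set_lebesgue_integral_def)
      qed
    qed simp
  qed
  then have "AE x in ?H. \<forall>A\<in>UNIV. g A x = 0" by (intro AE_finite_allI) auto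
  then show ?thesis by eventually_elim (simp add: g_def vec_eq_iff)
qed

section \<open>The ellipticity hypothesis in terms of pieces\<close>

section \<open>Orthonormal frames and the unit cube\<close>

text \<open>An orthonormal basis of the plane of \<open>w\<close> has a proportional k-vector of
  norm 1; if the factor is negative, one basis vector is reversed.\<close>

lemma orthonormal_frame_of_wedge:
  fixes w :: "'k::{finite,linorder} \<Rightarrow> real ^ 'n::{finite,linorder}"
  assumes w: "frame_wedge w \<noteq> 0"
  obtains b :: "'k \<Rightarrow> real ^ 'n::{finite,linorder}"
  where "orthonormal_frame b" "frame_wedge w = norm (frame_wedge w) *\<^sub>R frame_wedge b"
proof -
  let ?V = "span (range w)"
  obtain B where B: "B \<subseteq> ?V" "pairwise orthogonal B" "\<And>x. x \<in> B \<Longrightarrow> norm x = 1" "independent B"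
    "card B = dim ?V" "span B = ?V"
    using orthonormal_basis_subspace[OF subspace_span[of "range w"]] by blast
  have "dim ?V = CARD('k)"
    unfolding span_range_frame using dim_image_eq[OF linear_frame_point[of w], of UNIV] inj_frame_point[OF w] by simp
  then have "card B = CARD('k)" using B(5) by simp
  moreover have "finite B" using independent_imp_finite[OF B(4)] .
  ultimately obtain b where b: "bij_betw b (UNIV :: 'k set) B" using finite_same_card_bij[of "UNIV :: 'k set" B] by auto
  then have rb: "range b = B" and injb: "inj b" by (auto simp: bij_betw_def)
  have on: "orthonormal_frame b"
    unfolding orthonormal_frame_def
  proof (intro allI)
    fix i j
    have "norm (b i) = 1" using B(3) rb by blast
    then have "b i \<bullet> b i = 1" by (simp add: norm_eq_1)
    moreover have "b i \<bullet> b j = 0" if "i \<noteq> j"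
    proof -
      have "b i \<in> B" "b j \<in> B" "b i \<noteq> b j" using rb injb that by (auto dest: injD)
      then show ?thesis using B(2) by (simp add: pairwise_def orthogonal_def)
    qed
    ultimately show "b i \<bullet> b j = (if i = j then 1 else 0)" by auto
  qed
  have "range w \<subseteq> span (range b)" unfolding rb B(6) by (rule span_superset)
  then obtain c where c: "frame_wedge w = c *\<^sub>R frame_wedge b" by (rule frame_wedge_proportional)
  then have abs: "norm (frame_wedge w) = \<bar>c\<bar>" using norm_frame_wedge_orthonormal[OF on] by simp
  show thesis
  proof (cases "c \<ge> 0")
    case True
    then show thesis by (intro that[OF on]) (simp add: abs flip: c)
  next
    case False
    obtain i :: 'k where True by blast
    let ?b = "b(i := - b i)"
    have "orthonormal_frame ?b" using on by (auto simp: orthonormal_frame_def)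
    moreover have "frame_wedge ?b = - frame_wedge b" using linear_neg[OF linear_frame_wedge, of b i "b i"] by simp
    ultimately show thesis using that[of ?b] c abs False by simp
  qed
qed

lemma frame_point_axis_frame: "frame_point (\<lambda>i. axis i 1) y = y"
  using basis_expansion[of y] by (simp add: frame_point_def scalar_mult_eq_scaleR)

lemma frame_wedge_standard: "frame_wedge (\<lambda>i :: 'k::{finite,linorder}. axis i 1 :: real ^ 'k::{finite,linorder}) = axis UNIV 1"
  using frame_wedge_axes[of "\<lambda>i :: 'k. i"] by (simp add: strict_mono_def)

text \<open>The Hausdorff measure of dimension \<open>k\<close> on \<open>\<real>\<^sup>k\<close> is \<open>cube_factor\<close> times Lebesgue measure.\<close>

definition cube_factor :: "'k::{finite,linorder} itself \<Rightarrow> real" where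
  "cube_factor _ = hausdorff_factor (\<lambda>i :: 'k. axis i 1 :: real ^ 'k::{finite,linorder})"

lemma cube_integral:
  fixes \<phi> :: "real ^ 'k::{finite,linorder} \<Rightarrow> real"
  assumes "K \<in> sets borel" "\<phi> \<in> borel_measurable borel"
  shows "(LINT x:K|hausdorff CARD('k). \<phi> x) = cube_factor TYPE('k) * (LINT y:K|lborel. \<phi> y)"
    and "cube_factor TYPE('k) > 0"
proof -
  have inj: "inj (frame_point (\<lambda>i :: 'k. axis i 1 :: real ^ 'k::{finite,linorder}))"
    by (rule inj_frame_point) (simp add: frame_wedge_standard axis_eq_0_iff)
  show "cube_factor TYPE('k) > 0" unfolding cube_factor_def by (rule hausdorff_factor_pos[OF inj])
  show "(LINT x:K|hausdorff CARD('k). \<phi> x) = cube_factor TYPE('k) * (LINT y:K|lborel. \<phi> y)"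
    using integral_frame_image[OF inj assms, of 0] by (simp add: frame_point_axis_frame cube_factor_def)
qed

lemma multivectors_inner_eq_0:
  assumes "\<xi> \<in> multivectors k" "\<eta> \<in> multivectors l" "k \<noteq> l"
  shows "\<xi> \<bullet> \<eta> = 0"
  unfolding inner_vec_def by (rule sum.neutral) (use assms in \<open>auto simp: multivectors_def\<close>)

text \<open>The pullback is a test form because an injective linear map is proper, and its value on
  the standard frame is that of \<open>\<omega>\<close> on \<open>w\<close>. The constant comes from
  Hausdorff measure in the definition of the unit cube current.\<close>

lemma cube_current:
  fixes w :: "'k::{finite,linorder} \<Rightarrow> real ^ 'n::{finite,linorder}"
  assumes w: "orthonormal_frame w" and \<omega>: "\<omega> \<in> test_forms CARD('k)"
  shows "pushforward CARD('k) (frame_point w) unit_cube_current \<omega> = cube_factor TYPE('k) * piece_integral 0 w unit_cube \<omega>"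
proof -
  let ?L = "frame_point w"
  have sm: "smooth \<omega>" and mv: "range \<omega> \<subseteq> multivectors CARD('k)" using \<omega> by (auto simp: test_forms_iff)
  have D: "frechet_derivative ?L (at x) = ?L" for x
    by (rule frechet_derivative_at[symmetric])
      (intro bounded_linear_imp_has_derivative, simp add: linear_conv_bounded_linear[symmetric] linear_frame_point)
  define P where "P \<xi> = (\<chi> A. \<xi> \<bullet> wedge_list (map w (sorted_list_of_set A)))" for \<xi> :: "'n ext"
  have pb: "pullback ?L \<omega> = (\<lambda>x. P (\<omega> (0 + ?L x)))"
    by (simp add: pullback_def P_def D frame_point_axis cong: map_cong)
  have "linear P" unfolding P_def by (rule linearI) (simp_all add: vec_eq_iff inner_add_left)
  then have "smooth (\<lambda>x. P (\<omega> (0 + ?L x)))"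
    by (intro smooth_bounded_linear[OF _ smooth_affine[OF linear_frame_point sm]]) (simp add: linear_conv_bounded_linear)
  moreover have "bounded {x. P (\<omega> (0 + ?L x)) \<noteq> 0}"
  proof -
    obtain B where B: "\<And>x. \<omega> x \<noteq> 0 \<Longrightarrow> norm x \<le> B" using \<omega> by (auto simp: test_forms_iff bounded_iff)
    have "frame_wedge w \<noteq> 0" using norm_frame_wedge_orthonormal[OF w] by auto
    then have "inj ?L" by (rule inj_frame_point)
    then obtain C where C: "C > 0" "\<And>x. C * norm x \<le> norm (?L x)"
      by (rule linear_inj_bounded_below_pos[OF linear_frame_point]) blast
    have "norm x \<le> B / C" if "P (\<omega> (0 + ?L x)) \<noteq> 0" for x
    proof -
      have "\<omega> (?L x) \<noteq> 0" using that linear_0[OF \<open>linear P\<close>] by auto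
      then have "C * norm x \<le> B" using B C(2) order_trans by blast
      then show ?thesis using C(1) by (simp add: field_simps)
    qed
    then show ?thesis by (intro boundedI[of _ "B / C"]) auto
  qed
  moreover have "P (\<omega> x) \<in> multivectors CARD('k)" for x
  proof -
    have "\<omega> x \<bullet> wedge_list (map w (sorted_list_of_set A)) = 0" if "card A \<noteq> CARD('k)" for A
      by (rule multivectors_inner_eq_0[OF _ wedge_list_multivectors]) (use mv that in auto)
    then show ?thesis by (simp add: multivectors_def P_def)
  qed
  ultimately have "pullback ?L \<omega> \<in> test_forms CARD('k)" unfolding pb test_forms_iff by auto
  then have "pushforward CARD('k) ?L unit_cube_current \<omega>
      = (LINT x:unit_cube|hausdorff CARD('k). P (\<omega> (0 + ?L x)) \<bullet> frame_wedge (\<lambda>i :: 'k. axis i 1))"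
    using \<omega> by (simp add: pushforward_def unit_cube_current_def unit_cube_def frame_wedge_def pb)
  also have "\<dots> = (LINT x:unit_cube|hausdorff CARD('k). \<omega> (0 + ?L x) \<bullet> frame_wedge w)"
    by (simp add: frame_wedge_standard inner_axis P_def frame_wedge_def)
  also have "\<dots> = cube_factor TYPE('k) * piece_integral 0 w unit_cube \<omega>"
    unfolding piece_integral_def
    by (rule cube_integral(1)) (auto simp: unit_cube_cbox intro!: borel_measurable_continuous_onI continuous_intros
        continuous_on_compose2[OF smooth_continuous_on[OF sm, of UNIV]] continuous_on_frame_point)
  finally show ?thesis .
qed

section \<open>Densities of pieces\<close>

text \<open>The density, with respect to Hausdorff measure, of the current that
  \<open>piece_integral\<close> defines by Lebesgue measure; hence the factor in the
  denominator.\<close>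

definition piece_term ::
    "real ^ 'n::{finite,linorder} \<Rightarrow> ('n, 'k::{finite,linorder}) piece \<Rightarrow> 'n ext" where
  "piece_term x p = (case p of (a, u, w, K) \<Rightarrow>
     (a * indicator ((\<lambda>y. u + frame_point w y) ` K) x / hausdorff_factor w) *\<^sub>R frame_wedge w)"

definition piece_density ::
    "('n::{finite,linorder}, 'k::{finite,linorder}) piece list \<Rightarrow> real ^ 'n::{finite,linorder} \<Rightarrow> 'n ext" where
  "piece_density c x = (\<Sum>p\<leftarrow>c. piece_term x p)"

text \<open>The link between the two descriptions: boundaries are computed with
  \<open>piece_integral\<close>, whereas test pairs consist of chains of simplices. Pieces with a
  degenerate frame contribute nothing and are dropped.\<close>

lemma pieces_chain:
  fixes c :: "('n::{finite,linorder}, 'k::{finite,linorder}) piece list"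
  assumes "pieces c"
  obtains d :: "'n chain" where "nondegenerate_chain CARD('k) d"
    "AE x in hausdorff CARD('k). chain_density d x = piece_density c x"
    "\<And>\<omega>. \<omega> \<in> test_forms CARD('k) \<Longrightarrow> (\<Sum>(a, us)\<leftarrow>d. a * simplex_current CARD('k) us \<omega>) = (\<Sum>(a, u, w, K)\<leftarrow>c. a * piece_integral u w K \<omega>)"
proof -
  let ?H = "hausdorff CARD('k) :: (real ^ 'n::{finite,linorder}) measure"
  have "\<exists>d :: 'n chain. nondegenerate_chain CARD('k) d \<and>
    (AE x in ?H. chain_density d x = piece_density c x) \<and>
    (\<forall>\<omega>\<in>test_forms CARD('k). (\<Sum>(a, us)\<leftarrow>d. a * simplex_current CARD('k) us \<omega>) = (\<Sum>(a, u, w, K)\<leftarrow>c. a * piece_integral u w K \<omega>))"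
    using assms
  proof (induction c)
    case Nil
    show ?case by (rule exI[of _ "[]"]) (simp add: nondegenerate_chain_def piece_density_def)
  next
    case (Cons p c)
    obtain a u w K where p: "p = (a, u, w, K)" by (cases p)
    have K: "polytope K" using Cons.prems by (simp add: p)
    obtain d where d: "nondegenerate_chain CARD('k) d" "AE x in ?H. chain_density d x = piece_density c x"
      "\<forall>\<omega>\<in>test_forms CARD('k). (\<Sum>(a, us)\<leftarrow>d. a * simplex_current CARD('k) us \<omega>) = (\<Sum>(a, u, w, K)\<leftarrow>c. a * piece_integral u w K \<omega>)"
      using Cons by (auto simp: p)
    show ?case
    proof (cases "frame_wedge w = 0")
      case True
      then have "piece_density (p # c) = piece_density c" "piece_integral u w K \<omega> = 0" for \<omega>
        by (auto simp: piece_density_def piece_term_def p piece_integral_def set_lebesgue_integral_def)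
      then show ?thesis using d by (intro exI[of _ d]) (simp add: p)
    next
      case False
      obtain e :: "'n chain" where e: "\<forall>(a, us)\<in>set e. nondegenerate_simplex CARD('k) us"
        "AE x in ?H. chain_density e x = (a * indicator ((\<lambda>y. u + frame_point w y) ` K) x / hausdorff_factor w) *\<^sub>R frame_wedge w"
        by (rule polyhedral_piece[OF False K, of a u])
      have e': "nondegenerate_chain CARD('k) e" using e(1) by (simp add: nondegenerate_chain_def)
      note inj = inj_frame_point[OF False]
      have cur: "(\<Sum>(a, us)\<leftarrow>e. a * simplex_current CARD('k) us \<omega>) = a * piece_integral u w K \<omega>" if \<omega>: "\<omega> \<in> test_forms CARD('k)" for \<omega>
      proof -
        have cont: "continuous_on UNIV \<omega>" using \<omega> by (auto simp: test_forms_iff intro: smooth_continuous_on)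
        have Kb: "K \<in> sets borel" by (intro borel_compact polytope_imp_compact K)
        have mb: "(\<lambda>x. \<omega> x \<bullet> frame_wedge w) \<in> borel_measurable borel"
          by (intro borel_measurable_continuous_onI continuous_intros cont)
        have "(\<Sum>(a, us)\<leftarrow>e. a * simplex_current CARD('k) us \<omega>) = (LINT x|?H. \<omega> x \<bullet> chain_density e x)"
          by (rule chain_current(1)[OF e' \<omega>])
        also have "\<dots> = (LINT x|?H. (a / hausdorff_factor w) * (indicator ((\<lambda>y. u + frame_point w y) ` K) x *\<^sub>R (\<omega> x \<bullet> frame_wedge w)))"
        proof (rule integral_cong_AE)
          show "(\<lambda>x. \<omega> x \<bullet> chain_density e x) \<in> borel_measurable ?H"
            by (rule borel_measurable_integrable[OF chain_current(2)[OF e' \<omega>]])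
          show "(\<lambda>x. (a / hausdorff_factor w) * (indicator ((\<lambda>y. u + frame_point w y) ` K) x *\<^sub>R (\<omega> x \<bullet> frame_wedge w))) \<in> borel_measurable ?H"
            using mb frame_image_facts(5)[OF inj Kb, of u] by simp
          show "AE x in ?H. \<omega> x \<bullet> chain_density e x = (a / hausdorff_factor w) * (indicator ((\<lambda>y. u + frame_point w y) ` K) x *\<^sub>R (\<omega> x \<bullet> frame_wedge w))"
            using e(2) by eventually_elim simp
        qed
        also have "\<dots> = (a / hausdorff_factor w) * (LINT x:(\<lambda>y. u + frame_point w y) ` K|?H. \<omega> x \<bullet> frame_wedge w)"
          by (simp add: set_lebesgue_integral_def)
        also have "\<dots> = a * piece_integral u w K \<omega>"
          using integral_frame_image[OF inj Kb mb, of u] hausdorff_factor_pos[OF inj] by (simp add: piece_integral_def)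
        finally show ?thesis .
      qed
      have "AE x in ?H. chain_density (e @ d) x = piece_density (p # c) x"
        using e(2) d(2) by eventually_elim (simp add: piece_density_def piece_term_def p)
      then show ?thesis using e' d cur by (intro exI[of _ "e @ d"]) (auto simp: nondegenerate_chain_def p)
    qed
  qed
  then show thesis using that by blast
qed

lemma simple_function_piece_density:
  fixes c :: "('n::{finite,linorder}, 'k::{finite,linorder}) piece list"
  assumes "pieces c"
  shows "simple_function (hausdorff CARD('k)) (piece_density c)"
  using assms
proof (induction c)
  case Nil
  show ?case by (simp add: piece_density_def[abs_def])
next
  case (Cons p c)
  obtain a u w K where p: "p = (a, u, w, K)" by (cases p)
  let ?H = "hausdorff CARD('k) :: (real ^ 'n::{finite,linorder}) measure"
  have "simple_function ?H (\<lambda>x. piece_term x p)"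
  proof (cases "frame_wedge w = 0")
    case True
    then show ?thesis by (simp add: piece_term_def p)
  next
    case False
    have "K \<in> sets borel" using Cons.prems by (intro borel_compact polytope_imp_compact) (simp add: p)
    then have "(\<lambda>y. u + frame_point w y) ` K \<in> sets ?H"
      using frame_image_facts(5)[OF inj_frame_point[OF False]] by simp
    then have "simple_function ?H (indicator ((\<lambda>y. u + frame_point w y) ` K) :: _ \<Rightarrow> real)" by simp
    from simple_function_compose[OF this, of "\<lambda>r. (a * r / hausdorff_factor w) *\<^sub>R frame_wedge w"]
    show ?thesis by (simp add: piece_term_def p o_def)
  qed
  moreover have "simple_function ?H (piece_density c)" using Cons by (simp add: p)
  ultimately show ?case
    using simple_function_compose2[of ?H "\<lambda>x. piece_term x p" "piece_density c" "(+)"] by (simp add: piece_density_def[abs_def])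
qed

lemma integrable_piece_density:
  fixes c :: "('n::{finite,linorder}, 'k::{finite,linorder}) piece list"
    and h :: "'n ext \<Rightarrow> real"
  assumes c: "pieces c" and h: "h 0 = 0"
  shows "integrable (hausdorff CARD('k)) (\<lambda>x. h (piece_density c x))"
proof -
  let ?H = "hausdorff CARD('k) :: (real ^ 'n::{finite,linorder}) measure"
  obtain d :: "'n chain" where d: "nondegenerate_chain CARD('k) d" "AE x in ?H. chain_density d x = piece_density c x"
    using pieces_chain[OF c] by metis
  have int: "integrable ?H (\<lambda>x. h (chain_density d x))" by (rule integrable_chain_density[where 'k = 'k and c = d and h = h, OF d(1) h])
  have "simple_function ?H (\<lambda>x. h (piece_density c x))"
    using simple_function_compose[OF simple_function_piece_density[OF c], of h] by (simp add: o_def)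
  then have "(\<lambda>x. h (piece_density c x)) \<in> borel_measurable ?H" by (rule borel_measurable_simple_function)
  moreover have "AE x in ?H. h (piece_density c x) = h (chain_density d x)" using d(2) by eventually_elim simp
  ultimately show ?thesis using integrable_cong_AE[OF _ borel_measurable_integrable[OF int]] int by blast
qed

text \<open>The positively homogeneous extension of \<open>F - c\<close>. In these terms the
  hypothesis says that cubes minimise the integral of this function over densities, and the desired
  inequality with c_1 is a convexity property of it.\<close>

definition shifted_energy :: "('n::finite ext \<Rightarrow> real) \<Rightarrow> real \<Rightarrow> 'n ext \<Rightarrow> real" where
  "shifted_energy F c \<xi> = norm \<xi> * (F (sgn \<xi>) - c)"

lemma shifted_energy_zero [simp]: "shifted_energy F c 0 = 0"
  by (simp add: shifted_energy_def)

lemma shifted_energy_scale: "r \<ge> 0 \<Longrightarrow> shifted_energy F c (r *\<^sub>R \<xi>) = r * shifted_energy F c \<xi>"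
  by (cases "r = 0") (auto simp: shifted_energy_def sgn_scaleR)

lemma chain_shifted_energy:
  assumes c: "nondegenerate_chain CARD('k::{finite,linorder}) (c :: 'n::{finite,linorder} chain)"
  shows "chain_energy CARD('k) F c - c1 * chain_mass CARD('k) c = (LINT x|hausdorff CARD('k). shifted_energy F c1 (chain_density c x))"
proof -
  let ?H = "hausdorff CARD('k) :: (real ^ 'n::{finite,linorder}) measure"
  have "chain_energy CARD('k) F c = (LINT x|?H. norm (chain_density c x) * F (sgn (chain_density c x)))"
    unfolding chain_energy_def set_lebesgue_integral_def
    by (intro Bochner_Integration.integral_cong refl) (auto simp: indicator_def)
  moreover have "integrable ?H (\<lambda>x. norm (chain_density c x) * F (sgn (chain_density c x)))"
    by (rule integrable_chain_density[OF c, of "\<lambda>\<xi>. norm \<xi> * F (sgn \<xi>)"]) simp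
  moreover have "integrable ?H (\<lambda>x. norm (chain_density c x))"
    by (rule integrable_chain_density[OF c, of norm]) simp
  ultimately show ?thesis
    by (simp add: chain_mass_def shifted_energy_def right_diff_distrib mult.commute)
qed

text \<open>The test pair consists of \<open>cube_factor\<close> times the pieces and of the
  pushed-forward unit cube. The constant makes the boundaries equal and then divides out of the
  inequality.\<close>

lemma AUE_chain:
  fixes F :: "'n::{finite,linorder} ext \<Rightarrow> real" and w :: "'k::{finite,linorder} \<Rightarrow> real ^ 'n::{finite,linorder}"
    and c :: "('n, 'k) piece list"
  assumes aue: "AUE CARD('k) (polyhedral_test_pairs TYPE('k)) c1 F"
    and w: "orthonormal_frame w"
    and c: "pieces c" "bd c = face unit_cube w"
  shows "shifted_energy F c1 (frame_wedge w) \<le> (LINT x|hausdorff CARD('k). shifted_energy F c1 (piece_density c x))"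
proof -
  let ?k = "CARD('k)" let ?H = "hausdorff CARD('k) :: (real ^ 'n::{finite,linorder}) measure"
  let ?\<kappa> = "cube_factor TYPE('k)" let ?\<phi> = "shifted_energy F c1"
  have \<kappa>: "?\<kappa> > 0" by (rule cube_integral(2)[of UNIV "\<lambda>_. 0"]) auto
  have W1: "norm (frame_wedge w) = 1" by (rule norm_frame_wedge_orthonormal[OF w])
  then have W0: "frame_wedge w \<noteq> 0" by auto
  note inj = inj_frame_point[OF W0]
  have current: "represents ?k d (\<lambda>\<omega>. \<Sum>(a, us)\<leftarrow>d. a * simplex_current ?k us \<omega>)" if "nondegenerate_chain ?k d" for d :: "'n chain"
    using that by (simp add: represents_def nondegenerate_chain_def)
  \<comment> \<open>\<open>energy\<close> and \<open>mass\<close> refer to a chosen representation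
    \<open>e\<close>; as the density is determined almost everywhere, it may be replaced by the
    given \<open>d\<close>.\<close>
  have total: "energy ?k F T - c1 * mass ?k T = (LINT x|?H. ?\<phi> (chain_density d x))"
    if d: "nondegenerate_chain ?k d" "T = (\<lambda>\<omega>. \<Sum>(a, us)\<leftarrow>d. a * simplex_current ?k us \<omega>)" for T and d :: "'n chain"
  proof -
    define e where "e = (SOME e. represents ?k e T)"
    have "represents ?k e T" unfolding e_def by (rule someI[of _ d]) (use current[OF d(1)] d(2) in simp)
    then have e: "nondegenerate_chain ?k e" "T = (\<lambda>\<omega>. \<Sum>(a, us)\<leftarrow>e. a * simplex_current ?k us \<omega>)"
      by (auto simp: represents_def nondegenerate_chain_def)
    have "AE x in ?H. chain_density e x = chain_density d x"
      by (rule chain_density_unique[OF e(1) d(1)]) (metis d(2) e(2))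
    then have "(LINT x|?H. ?\<phi> (chain_density e x)) = (LINT x|?H. ?\<phi> (chain_density d x))"
      by (intro integral_cong_AE borel_measurable_integrable integrable_chain_density e d) (auto elim!: eventually_mono)
    moreover have "energy ?k F T - c1 * mass ?k T = (LINT x|?H. ?\<phi> (chain_density e x))"
      unfolding energy_def mass_def e_def[symmetric] by (rule chain_shifted_energy[OF e(1)])
    ultimately show ?thesis by simp
  qed
  let ?D = "pushforward ?k (frame_point w) unit_cube_current"
  obtain d0 :: "'n chain" where d0: "nondegenerate_chain ?k d0" "AE x in ?H. chain_density d0 x = piece_density [(?\<kappa>, 0, w, unit_cube)] x"
    "\<And>\<omega>. \<omega> \<in> test_forms ?k \<Longrightarrow> (\<Sum>(a, us)\<leftarrow>d0. a * simplex_current ?k us \<omega>) = (\<Sum>(a, u, w, K)\<leftarrow>[(?\<kappa>, 0, w, unit_cube)]. a * piece_integral u w K \<omega>)"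
    using pieces_chain[of "[(?\<kappa>, 0, w, unit_cube)]"] by (auto simp: polytope_unit_cube)
  obtain d :: "'n chain" where d: "nondegenerate_chain ?k d" "AE x in ?H. chain_density d x = piece_density (scale_pieces ?\<kappa> c) x"
    "\<And>\<omega>. \<omega> \<in> test_forms ?k \<Longrightarrow> (\<Sum>(a, us)\<leftarrow>d. a * simplex_current ?k us \<omega>) = (\<Sum>(a, u, w, K)\<leftarrow>scale_pieces ?\<kappa> c. a * piece_integral u w K \<omega>)"
    using pieces_chain[of "scale_pieces ?\<kappa> c"] c(1) by auto
  let ?S = "\<lambda>\<omega>. \<Sum>(a, us)\<leftarrow>d. a * simplex_current ?k us \<omega>"
  have D: "?D = (\<lambda>\<omega>. \<Sum>(a, us)\<leftarrow>d0. a * simplex_current ?k us \<omega>)"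
  proof
    fix \<omega>
    show "?D \<omega> = (\<Sum>(a, us)\<leftarrow>d0. a * simplex_current ?k us \<omega>)"
    proof (cases "\<omega> \<in> test_forms ?k")
      case True
      then show ?thesis using d0(3) cube_current[OF w] by simp
    next
      case False
      then have "(\<Sum>(a, us)\<leftarrow>d0. a * simplex_current ?k us \<omega>) = 0"
        by (simp add: simplex_current_def case_prod_unfold)
      then show ?thesis using False by (simp add: pushforward_def)
    qed
  qed
  have "(?S, ?D) \<in> polyhedral_test_pairs TYPE('k)"
    unfolding polyhedral_test_pairs_def
  proof (intro CollectI case_prodI conjI exI)
    show "?S \<in> polyhedral_chains ?k" using current[OF d(1)] by (auto simp: polyhedral_chains_def)
    \<comment> \<open>The projection of the test pair is the adjoint of the isometric embedding
      \<open>frame_point w\<close>, so its own adjoint is this embedding again.\<close>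
    have adj: "adjoint (adjoint (frame_point w)) = frame_point w" by (rule adjoint_adjoint[OF linear_frame_point])
    show "?D = pushforward ?k (adjoint (adjoint (frame_point w))) unit_cube_current" by (simp add: adj)
    show "orthogonal_projection (adjoint (frame_point w))"
      unfolding orthogonal_projection_def adj
    proof
      show "linear (adjoint (frame_point w))" by (rule adjoint_linear[OF linear_frame_point])
      have iso: "frame_point w x \<bullet> frame_point w y = x \<bullet> y" for x y
      proof -
        have "frame_point w x \<bullet> frame_point w y = (\<Sum>i\<in>UNIV. \<Sum>j\<in>UNIV. if i = j then x $ i * y $ i else 0)"
          unfolding frame_point_def inner_sum_left inner_sum_right
          using w by (intro sum.cong) (auto simp: orthonormal_frame_def)
        then show ?thesis by (simp add: inner_vec_def)
      qed
      have "x \<bullet> adjoint (frame_point w) (frame_point w y) = x \<bullet> y" for x y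
        using adjoint_works[OF linear_frame_point[of w], of x "frame_point w y"] iso by simp
      then show "adjoint (frame_point w) \<circ> frame_point w = id"
        by (intro ext) (simp, metis vector_eq_ldot)
    qed
    show "boundary ?k ?S = boundary ?k ?D"
    proof
      fix \<alpha>
      show "boundary ?k ?S \<alpha> = boundary ?k ?D \<alpha>"
      proof (cases "\<alpha> \<in> test_forms (?k - 1)")
        case True
        then have d\<alpha>: "ext_deriv \<alpha> \<in> test_forms ?k" using test_forms_ext_deriv[OF True] by simp
        have sm: "smooth \<alpha>" using True by (simp add: test_forms_iff)
        have "?S (ext_deriv \<alpha>) = bd (scale_pieces ?\<kappa> c) \<alpha>" using d(3)[OF d\<alpha>] sm by (simp add: bd_def)
        also have "\<dots> = ?\<kappa> * face unit_cube w \<alpha>" by (simp add: bd_scale_pieces c(2) functional_apply)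
        also have "\<dots> = ?D (ext_deriv \<alpha>)" using cube_current[OF w d\<alpha>] sm by (simp add: face_def bd_def)
        finally show ?thesis using True by (simp add: boundary_def)
      qed (simp add: boundary_def)
    qed
  qed
  then have "energy ?k F ?S - energy ?k F ?D \<ge> c1 * (mass ?k ?S - mass ?k ?D)" using aue unfolding AUE_def by blast
  then have le: "energy ?k F ?D - c1 * mass ?k ?D \<le> energy ?k F ?S - c1 * mass ?k ?S" by (simp add: algebra_simps)
  have intS: "energy ?k F ?S - c1 * mass ?k ?S = ?\<kappa> * (LINT x|?H. ?\<phi> (piece_density c x))"
  proof -
    have "piece_density (scale_pieces r c) x = r *\<^sub>R piece_density c x" for r x
      unfolding piece_density_def scale_pieces_def
      by (induction c) (auto simp: piece_term_def algebra_simps)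
    then have AE: "AE x in ?H. chain_density d x = ?\<kappa> *\<^sub>R piece_density c x" using d(2) by simp
    have "integrable ?H (\<lambda>x. ?\<phi> (chain_density d x))" by (intro integrable_chain_density d) simp
    then have m: "(\<lambda>x. ?\<phi> (chain_density d x)) \<in> borel_measurable ?H" by simp
    have "(LINT x|?H. ?\<phi> (piece_density c x)) = (LINT x|?H. (1 / ?\<kappa>) * ?\<phi> (chain_density d x))"
    proof (rule integral_cong_AE)
      show "(\<lambda>x. ?\<phi> (piece_density c x)) \<in> borel_measurable ?H"
        by (intro borel_measurable_integrable integrable_piece_density c) simp
      show "AE x in ?H. ?\<phi> (piece_density c x) = 1 / ?\<kappa> * ?\<phi> (chain_density d x)"
        using AE by eventually_elim (use \<kappa> in \<open>simp add: shifted_energy_scale\<close>)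
    qed (use m in simp)
    also have "\<dots> = (1 / ?\<kappa>) * (energy ?k F ?S - c1 * mass ?k ?S)" by (simp add: total[OF d(1) refl])
    finally show ?thesis using \<kappa> by simp
  qed
  have "energy ?k F ?D - c1 * mass ?k ?D = ?\<kappa> * ?\<phi> (frame_wedge w)"
  proof -
    let ?f = "\<lambda>y. 0 + frame_point w y"
    have Q: "unit_cube \<in> sets (borel :: (real ^ 'k::{finite,linorder}) measure)" by (simp add: unit_cube_cbox)
    have fac: "hausdorff_factor w > 0" by (rule hausdorff_factor_pos[OF inj])
    have "(LINT x|?H. ?\<phi> (chain_density d0 x)) = (LINT x|?H. indicator (?f ` unit_cube) x * (?\<kappa> / hausdorff_factor w * ?\<phi> (frame_wedge w)))"
    proof (rule integral_cong_AE)
      show "(\<lambda>x. ?\<phi> (chain_density d0 x)) \<in> borel_measurable ?H"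
        by (intro borel_measurable_integrable integrable_chain_density d0) simp
      show "(\<lambda>x. indicator (?f ` unit_cube) x * (?\<kappa> / hausdorff_factor w * ?\<phi> (frame_wedge w))) \<in> borel_measurable ?H"
        using frame_image_facts(5)[OF inj Q, of 0] by simp
      show "AE x in ?H. ?\<phi> (chain_density d0 x) = indicator (?f ` unit_cube) x * (?\<kappa> / hausdorff_factor w * ?\<phi> (frame_wedge w))"
        using d0(2)
      proof eventually_elim
        case (elim x)
        then show ?case using \<kappa> fac
          by (cases "x \<in> ?f ` unit_cube") (simp_all add: piece_density_def piece_term_def shifted_energy_scale)
      qed
    qed
    also have "\<dots> = measure ?H (?f ` unit_cube) * (?\<kappa> / hausdorff_factor w * ?\<phi> (frame_wedge w))"
      using frame_image_facts(5)[OF inj Q, of 0] by simp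
    also have "measure ?H (?f ` unit_cube) = hausdorff_factor w" by (simp add: hausdorff_factor_def)
    finally show ?thesis using fac total[OF d0(1) D] by simp
  qed
  then have "?\<kappa> * ?\<phi> (frame_wedge w) \<le> ?\<kappa> * (LINT x|?H. ?\<phi> (piece_density c x))" using le intS by simp
  then show ?thesis using \<kappa> by simp
qed

section \<open>Subadditivity on common planes and the conclusion\<close>

section \<open>Subadditivity of the energy\<close>

lemma frame_plane_subset:
  assumes "range (\<lambda>y. u + frame_point w y) \<subseteq> range (\<lambda>y. u' + frame_point w' y)"
  shows "range w \<subseteq> span (range w')"
proof -
  have "w i \<in> range (frame_point w')" for i
  proof -
    obtain a b where ab: "u + frame_point w (axis i 1) = u' + frame_point w' a" "u + frame_point w 0 = u' + frame_point w' b"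
      using assms by blast
    have "w i = frame_point w' (a - b)"
      using ab by (simp add: frame_point_axis linear_diff[OF linear_frame_point] linear_0[OF linear_frame_point] algebra_simps)
    then show ?thesis by blast
  qed
  then show ?thesis by (auto simp: span_range_frame)
qed

text \<open>A plane that is not contained in the other one meets it in a null set, by
  \<open>null_affine_frame_image\<close>.\<close>

lemma piece_terms_overlap:
  fixes w w' :: "'k::{finite,linorder} \<Rightarrow> real ^ 'n::{finite,linorder}"
  shows "AE x in hausdorff CARD('k). piece_term x (a, u, w, K) \<noteq> 0 \<and> piece_term x (a', u', w', K') \<noteq> 0 \<longrightarrow>
    range (\<lambda>y. u + frame_point w y) \<subseteq> range (\<lambda>y. u' + frame_point w' y)"
proof (cases "frame_wedge w = 0 \<or> range (\<lambda>y. u + frame_point w y) \<subseteq> range (\<lambda>y. u' + frame_point w' y)")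
  case True
  then show ?thesis by (auto simp: piece_term_def)
next
  case False
  then have "range (\<lambda>y. u + frame_point w y) \<inter> range (\<lambda>y. u' + frame_point w' y) \<in> null_sets (hausdorff CARD('k))"
    by (intro null_affine_frame_image inj_frame_point affine_range_frame) auto
  then show ?thesis
  proof (rule AE_I')
    show "{x \<in> space (hausdorff CARD('k)). \<not> (piece_term x (a, u, w, K) \<noteq> 0 \<and> piece_term x (a', u', w', K') \<noteq> 0 \<longrightarrow>
        range (\<lambda>y. u + frame_point w y) \<subseteq> range (\<lambda>y. u' + frame_point w' y))}
      \<subseteq> range (\<lambda>y. u + frame_point w y) \<inter> range (\<lambda>y. u' + frame_point w' y)"
      by (auto simp: piece_term_def indicator_def split: if_splits)
  qed
qed

text \<open>Almost everywhere, pieces that meet have frames with the same span and hence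
  proportional k-vectors. Any nonzero term supplies the common direction; where all terms vanish, an
  arbitrary frame will do.\<close>

lemma piece_terms_collinear:
  fixes c :: "('n::{finite,linorder}, 'k::{finite,linorder}) piece list"
  shows "AE x in hausdorff CARD('k). \<exists>v :: 'k \<Rightarrow> real ^ 'n::{finite,linorder}. \<forall>p\<in>set c. \<exists>s. piece_term x p = s *\<^sub>R frame_wedge v"
proof -
  let ?H = "hausdorff CARD('k) :: (real ^ 'n::{finite,linorder}) measure"
  let ?w = "\<lambda>p :: ('n, 'k) piece. fst (snd (snd p))"
  have pair: "AE x in ?H. piece_term x p \<noteq> 0 \<and> piece_term x q \<noteq> 0 \<longrightarrow> (\<exists>s. frame_wedge (?w p) = s *\<^sub>R frame_wedge (?w q))"
    for p q :: "('n, 'k) piece"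
  proof -
    obtain a u w K a' u' w' K' where pq: "p = (a, u, w, K)" "q = (a', u', w', K')" by (cases p, cases q)
    show ?thesis using piece_terms_overlap[of a u w K a' u' w' K']
    proof eventually_elim
      case (elim x)
      show ?case
      proof
        assume "piece_term x p \<noteq> 0 \<and> piece_term x q \<noteq> 0"
        then have "range w \<subseteq> span (range w')" using elim frame_plane_subset[of u w u' w'] by (simp add: pq)
        then obtain s where "frame_wedge w = s *\<^sub>R frame_wedge w'" by (rule frame_wedge_proportional)
        then show "\<exists>s. frame_wedge (?w p) = s *\<^sub>R frame_wedge (?w q)" by (auto simp: pq)
      qed
    qed
  qed
  have "AE x in ?H. \<forall>p\<in>set c. \<forall>q\<in>set c. piece_term x p \<noteq> 0 \<and> piece_term x q \<noteq> 0 \<longrightarrow> (\<exists>s. frame_wedge (?w p) = s *\<^sub>R frame_wedge (?w q))"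
    by (intro AE_finite_allI pair) auto
  then show ?thesis
  proof eventually_elim
    case (elim x)
    show ?case
    proof (cases "\<exists>q\<in>set c. piece_term x q \<noteq> 0")
      case False
      then show ?thesis by (intro exI[of _ "\<lambda>_. 0"] ballI exI[of _ 0]) auto
    next
      case True
      then obtain q where q: "q \<in> set c" "piece_term x q \<noteq> 0" by blast
      have "\<exists>s. piece_term x p = s *\<^sub>R frame_wedge (?w q)" if p: "p \<in> set c" for p
      proof (cases "piece_term x p = 0")
        case True
        then show ?thesis by (intro exI[of _ 0]) simp
      next
        case False
        then obtain s where s: "frame_wedge (?w p) = s *\<^sub>R frame_wedge (?w q)" using elim p q by blast
        obtain r where "piece_term x p = r *\<^sub>R frame_wedge (?w p)" by (cases p) (auto simp: piece_term_def)
        then show ?thesis unfolding s by (intro exI[of _ "r * s"]) simp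
      qed
      then show ?thesis by blast
    qed
  qed
qed

text \<open>On the line through \<open>\<xi>\<close> the function is linear on either side of 0, and
  the sign condition says that it is the maximum of the two linear functions.\<close>

lemma subadditive_on_line:
  fixes \<phi> :: "'a::real_vector \<Rightarrow> real"
  assumes hom: "\<And>r \<xi>. r \<ge> 0 \<Longrightarrow> \<phi> (r *\<^sub>R \<xi>) = r * \<phi> \<xi>"
    and sym: "\<phi> \<xi> + \<phi> (- \<xi>) \<ge> 0"
    and line: "\<And>p. p \<in> set c \<Longrightarrow> \<exists>s. t p = s *\<^sub>R \<xi>"
  shows "\<phi> (\<Sum>p\<leftarrow>c. t p) \<le> (\<Sum>p\<leftarrow>c. \<phi> (t p))"
proof -
  have val: "\<phi> (r *\<^sub>R \<xi>) = r * \<phi> \<xi> \<or> \<phi> (r *\<^sub>R \<xi>) = - r * \<phi> (- \<xi>)" for r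
    using hom[of r \<xi>] hom[of "- r" "- \<xi>"] by (cases "r \<ge> 0") auto
  have ge: "r * \<phi> \<xi> \<le> \<phi> (r *\<^sub>R \<xi>) \<and> - r * \<phi> (- \<xi>) \<le> \<phi> (r *\<^sub>R \<xi>)" for r
  proof (cases "r \<ge> 0")
    case True
    have "0 \<le> r * (\<phi> \<xi> + \<phi> (- \<xi>))" using True sym by simp
    then show ?thesis using hom[OF True, of \<xi>] by (simp add: algebra_simps)
  next
    case False
    then have "0 \<le> (- r) * (\<phi> \<xi> + \<phi> (- \<xi>))" using sym by (intro mult_nonneg_nonneg) auto
    then show ?thesis using hom[of "- r" "- \<xi>"] False by (simp add: algebra_simps)
  qed
  have add: "\<phi> (r *\<^sub>R \<xi> + s *\<^sub>R \<xi>) \<le> \<phi> (r *\<^sub>R \<xi>) + \<phi> (s *\<^sub>R \<xi>)" for r s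
    using val[of "r + s"] ge[of r] ge[of s] by (auto simp: algebra_simps)
  have "(\<exists>s. (\<Sum>p\<leftarrow>c. t p) = s *\<^sub>R \<xi>) \<and> \<phi> (\<Sum>p\<leftarrow>c. t p) \<le> (\<Sum>p\<leftarrow>c. \<phi> (t p))"
    using line
  proof (induction c)
    case Nil
    then show ?case using hom[of 0 \<xi>] by (auto intro: exI[of _ 0])
  next
    case (Cons p c)
    obtain s where s: "(\<Sum>p\<leftarrow>c. t p) = s *\<^sub>R \<xi>" and IH: "\<phi> (\<Sum>p\<leftarrow>c. t p) \<le> (\<Sum>p\<leftarrow>c. \<phi> (t p))"
      using Cons.IH[OF Cons.prems] by (meson list.set_intros(2))
    obtain r where r: "t p = r *\<^sub>R \<xi>" using Cons.prems by auto
    have "\<phi> (t p + (\<Sum>p\<leftarrow>c. t p)) \<le> \<phi> (t p) + \<phi> (\<Sum>p\<leftarrow>c. t p)" unfolding r s by (rule add)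
    moreover have "t p + (\<Sum>p\<leftarrow>c. t p) = (r + s) *\<^sub>R \<xi>" by (simp add: r s scaleR_add_left)
    ultimately show ?case using IH by (simp add: exI[of _ "r + s"])
  qed
  then show ?thesis ..
qed

text \<open>The factor \<open>1 / hausdorff_factor w\<close> in the density cancels against the
  Hausdorff measure of the image of \<open>K\<close>.\<close>

lemma piece_term_integral:
  fixes w :: "'k::{finite,linorder} \<Rightarrow> real ^ 'n::{finite,linorder}" and h :: "'n ext \<Rightarrow> real"
  assumes hom: "\<And>r \<xi>. r \<ge> 0 \<Longrightarrow> h (r *\<^sub>R \<xi>) = r * h \<xi>" and K: "polytope K"
  shows "integrable (hausdorff CARD('k)) (\<lambda>x. h (piece_term x (a, u, w, K)))" (is ?int)
    and "(LINT x|hausdorff CARD('k). h (piece_term x (a, u, w, K))) = measure lborel K * h (a *\<^sub>R frame_wedge w)" (is ?eq)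
proof -
  let ?H = "hausdorff CARD('k) :: (real ^ 'n::{finite,linorder}) measure"
  have h0: "h 0 = 0" using hom[of 0 0] by simp
  have "?int \<and> ?eq"
  proof (cases "frame_wedge w = 0")
    case True
    then show ?thesis by (simp add: piece_term_def h0)
  next
    case False
    note inj = inj_frame_point[OF False]
    have fac: "hausdorff_factor w > 0" by (rule hausdorff_factor_pos[OF inj])
    have comp: "compact K" by (rule polytope_imp_compact[OF K])
    then have Kb: "K \<in> sets borel" by (rule borel_compact)
    let ?f = "\<lambda>y. u + frame_point w y"
    have fK: "?f ` K \<in> sets ?H" using frame_image_facts(5)[OF inj Kb] by simp
    have em: "emeasure ?H (?f ` K) = ennreal (hausdorff_factor w) * emeasure lborel K" by (rule emeasure_frame_image[OF inj Kb])
    also have "emeasure lborel K = ennreal (measure lborel K)"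
      using emeasure_compact_finite[OF comp] by (simp add: emeasure_eq_ennreal_measure)
    finally have em: "emeasure ?H (?f ` K) = ennreal (hausdorff_factor w * measure lborel K)"
      using fac by (simp add: ennreal_mult)
    then have m: "measure ?H (?f ` K) = hausdorff_factor w * measure lborel K"
      using fac by (simp add: measure_def)
    have eq: "h (piece_term x (a, u, w, K)) = indicator (?f ` K) x * (h (a *\<^sub>R frame_wedge w) / hausdorff_factor w)" for x
    proof (cases "x \<in> ?f ` K")
      case True
      then show ?thesis using hom[of "1 / hausdorff_factor w" "a *\<^sub>R frame_wedge w"] fac by (simp add: piece_term_def)
    qed (simp add: piece_term_def h0)
    show ?thesis unfolding eq using fK m fac em by (simp add: integrable_mult_left integrable_real_indicator)
  qed
  then show ?int ?eq by auto
qed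

lemma piece_terms_integral:
  fixes c :: "('n::{finite,linorder}, 'k::{finite,linorder}) piece list" and h :: "'n ext \<Rightarrow> real"
  assumes hom: "\<And>r \<xi>. r \<ge> 0 \<Longrightarrow> h (r *\<^sub>R \<xi>) = r * h \<xi>" and c: "pieces c"
  shows "integrable (hausdorff CARD('k)) (\<lambda>x. \<Sum>p\<leftarrow>c. h (piece_term x p))"
    and "(LINT x|hausdorff CARD('k). (\<Sum>p\<leftarrow>c. h (piece_term x p))) = piece_energy h c"
proof -
  let ?H = "hausdorff CARD('k) :: (real ^ 'n::{finite,linorder}) measure"
  have "integrable ?H (\<lambda>x. \<Sum>p\<leftarrow>c. h (piece_term x p)) \<and> (LINT x|?H. (\<Sum>p\<leftarrow>c. h (piece_term x p))) = piece_energy h c"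
    using c
  proof (induction c)
    case (Cons p c)
    obtain a u w K where p: "p = (a, u, w, K)" by (cases p)
    have K: "polytope K" using Cons.prems by (simp add: p)
    note int = piece_term_integral[where a = a and u = u and w = w, OF hom K]
    show ?case using Cons int by (simp add: p piece_energy_def)
  qed (simp add: piece_energy_def)
  then show "integrable ?H (\<lambda>x. \<Sum>p\<leftarrow>c. h (piece_term x p))"
    "(LINT x|?H. (\<Sum>p\<leftarrow>c. h (piece_term x p))) = piece_energy h c" by auto
qed

text \<open>On the left the terms are added before \<open>\<phi>\<close> is applied, on the right
  each is charged separately. At almost every point they lie on one line, where
  \<open>subadditive_on_line\<close> applies.\<close>

lemma energy_subadditive:
  fixes c :: "('n::{finite,linorder}, 'k::{finite,linorder}) piece list" and \<phi> :: "'n ext \<Rightarrow> real"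
  assumes hom: "\<And>r \<xi>. r \<ge> 0 \<Longrightarrow> \<phi> (r *\<^sub>R \<xi>) = r * \<phi> \<xi>"
    and sym: "\<And>w :: 'k \<Rightarrow> real ^ 'n::{finite,linorder}. \<phi> (frame_wedge w) + \<phi> (- frame_wedge w) \<ge> 0"
    and c: "pieces c"
  shows "(LINT x|hausdorff CARD('k). \<phi> (piece_density c x)) \<le> piece_energy \<phi> c"
proof -
  let ?H = "hausdorff CARD('k) :: (real ^ 'n::{finite,linorder}) measure"
  have "\<phi> 0 = 0" using hom[of 0 0] by simp
  then have "integrable ?H (\<lambda>x. \<phi> (piece_density c x))" by (intro integrable_piece_density c)
  moreover have "AE x in ?H. \<phi> (piece_density c x) \<le> (\<Sum>p\<leftarrow>c. \<phi> (piece_term x p))"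
    using piece_terms_collinear[of c]
  proof eventually_elim
    case (elim x)
    then obtain v :: "'k \<Rightarrow> real ^ 'n::{finite,linorder}" where "\<forall>p\<in>set c. \<exists>s. piece_term x p = s *\<^sub>R frame_wedge v" by blast
    then show ?case unfolding piece_density_def by (intro subadditive_on_line[OF hom sym[of v]]) auto
  qed
  ultimately have "(LINT x|?H. \<phi> (piece_density c x)) \<le> (LINT x|?H. (\<Sum>p\<leftarrow>c. \<phi> (piece_term x p)))"
    by (intro integral_mono_AE piece_terms_integral(1)[OF hom c])
  then show ?thesis by (simp add: piece_terms_integral(2)[OF hom c])
qed

lemma measure_le_1:
  assumes "polytope K" "K \<subseteq> unit_cube"
  shows "measure lborel K \<le> 1"
proof -
  have "measure lborel K \<le> measure lborel (unit_cube :: (real ^ 'a) set)"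
    using assms by (intro measure_mono_fmeasurable) (auto simp: unit_cube_cbox borel_compact polytope_imp_compact)
  then show ?thesis by (simp add: unit_cube_cbox)
qed

lemma piece_energy_norm_le: "pieces c \<Longrightarrow> piece_energy norm c \<le> piece_mass c"
  unfolding piece_energy_def piece_mass_def pieces_def
  by (rule sum_list_mono) (fastforce intro!: mult_left_le_one_le measure_le_1)

text \<open>
  The competitor is twice the cube minus the cube translated by a small vector orthogonal to it,
  completed by the lateral faces between them.
\<close>

lemma energy_symmetric_orthonormal:
  fixes F :: "'n::{finite,linorder} ext \<Rightarrow> real" and w :: "'k::{finite,linorder} \<Rightarrow> real ^ 'n::{finite,linorder}"
    and c1 :: real
  defines "\<phi> \<equiv> shifted_energy F c1"
  assumes aue: "AUE CARD('k) (polyhedral_test_pairs TYPE('k)) c1 F" and kn: "CARD('k) < CARD('n)"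
    and bound: "\<And>r (v :: 'k \<Rightarrow> real ^ 'n::{finite,linorder}). \<bar>\<phi> (r *\<^sub>R frame_wedge v)\<bar> \<le> C * norm (r *\<^sub>R frame_wedge v)"
    and w: "orthonormal_frame w"
  shows "\<phi> (frame_wedge w) + \<phi> (- frame_wedge w) \<ge> 0"
proof -
  let ?H = "hausdorff CARD('k) :: (real ^ 'n::{finite,linorder}) measure"
  let ?Q = "unit_cube :: (real ^ 'k::{finite,linorder}) set"
  have hom: "\<phi> (r *\<^sub>R \<xi>) = r * \<phi> \<xi>" if "r \<ge> 0" for r \<xi> unfolding \<phi>_def by (rule shifted_energy_scale[OF that])
  have \<phi>0: "\<phi> 0 = 0" by (simp add: \<phi>_def)
  have W1: "norm (frame_wedge w) = 1" by (rule norm_frame_wedge_orthonormal[OF w])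
  then have W0: "frame_wedge w \<noteq> 0" by auto
  have C: "C \<ge> 0" using bound[of 1 w] W1 by simp
  have "dim (span (range w)) = CARD('k)"
    unfolding span_range_frame using dim_image_eq[OF linear_frame_point[of w], of UNIV] inj_frame_point[OF W0] by simp
  then have "dim (range w) < DIM(real ^ 'n::{finite,linorder})" using kn by simp
  \<comment> \<open>The strict inequality between the dimensions leaves a direction orthogonal to
    the plane of the cube.\<close>
  then obtain \<nu>' where \<nu>': "\<nu>' \<noteq> 0" "\<And>y. y \<in> span (range w) \<Longrightarrow> orthogonal \<nu>' y"
    using orthogonal_to_subspace_exists[of "range w"] by blast
  define \<nu> where "\<nu> = (1 / norm \<nu>') *\<^sub>R \<nu>'"
  have \<nu>: "norm \<nu> = 1" "\<nu> \<bullet> y = 0" if "y \<in> span (range w)" for y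
    using \<nu>'(1) \<nu>'(2)[OF that] by (auto simp: \<nu>_def orthogonal_def)
  have \<nu>1: "norm \<nu> = 1" using \<nu>(1)[OF span_zero] .
  \<comment> \<open>\<open>d\<close> is the distance between the cubes; the lateral faces cost a
    multiple of \<open>d\<close>, and \<open>d\<close> is made arbitrarily small at the end.\<close>
  have est: "0 \<le> \<phi> (frame_wedge w) + \<phi> (- frame_wedge w) + d * (4 * real CARD('k) * C)" if d: "d > 0" for d
  proof -
    define t where "t = d *\<^sub>R \<nu>"
    have tn: "norm t = d" using d by (simp add: t_def \<nu>1)
    have t: "t \<notin> span (range w)"
    proof
      assume "t \<in> span (range w)"
      then have "\<nu> \<bullet> t = 0" by (rule \<nu>(2))
      then show False using d \<nu>1 by (simp add: t_def norm_eq_1)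
    qed
    have norm1: "norm (w i) = 1" for i using w by (simp add: orthonormal_frame_def norm_eq_1)
    obtain q :: "('n, 'k) piece list" where q: "pieces q" "translate t (face unit_cube w) - face unit_cube w = bd q"
      "piece_mass q \<le> real (4 * CARD('k)) * norm t * 1 ^ (CARD('k) - 1)" "\<forall>(a, u, v, K)\<in>set q. t \<in> range v"
      by (rule face_cylinder[of w 1 t, OF norm1])
    \<comment> \<open>The weights 2 and -1 add up to 1: once \<open>q\<close> fills the gap between
      the translated and the original boundary, one cube boundary remains.\<close>
    define p1 p2 where "p1 = (2 :: real, 0 :: real ^ 'n::{finite,linorder}, w, ?Q)" and "p2 = (- 1 :: real, t, w, ?Q)"
    define c where "c = [p1, p2] @ q"
    have "[p1] = scale_pieces 2 [(1, 0, w, ?Q)]" "[p2] = scale_pieces (- 1) [(1, t, w, ?Q)]"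
      by (simp_all add: p1_def p2_def scale_pieces_def)
    then have p12: "bd [p1] = 2 *\<^sub>R face ?Q w" "bd [p2] = - translate t (face ?Q w)"
      by (simp_all only: bd_scale_pieces translate_face) (simp_all add: face_def)
    have "bd c = bd [p1] + bd [p2] + bd q" using bd_simps(2)[of "[p1]" "[p2] @ q"] bd_simps(2)[of "[p2]" q] by (simp add: c_def add.assoc)
    also have "\<dots> = face ?Q w" unfolding p12 q(2)[symmetric] by (simp add: scaleR_2)
    finally have bdc: "bd c = face ?Q w" .
    have pc: "pieces c" using q(1) by (simp add: c_def p1_def p2_def polytope_unit_cube)
    \<comment> \<open>The cubes lie in distinct parallel planes, so their opposite orientations do
      not cancel in the density. This is the reason for displacing the copy.\<close>
    have no12: "AE x in ?H. \<not> (piece_term x p2 \<noteq> 0 \<and> piece_term x p1 \<noteq> 0)"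
    proof -
      have "\<not> range (\<lambda>y. t + frame_point w y) \<subseteq> range (\<lambda>y. 0 + frame_point w y)"
      proof
        assume "range (\<lambda>y. t + frame_point w y) \<subseteq> range (\<lambda>y. 0 + frame_point w y)"
        then have "t + frame_point w 0 \<in> range (frame_point w)" by auto
        then show False using t by (simp add: span_range_frame linear_0[OF linear_frame_point])
      qed
      then show ?thesis using piece_terms_overlap[of "- 1" t w ?Q 2 0 w ?Q] by (auto simp: p1_def p2_def elim!: eventually_mono)
    qed
    \<comment> \<open>Each lateral frame contains \<open>t\<close>, which does not lie in the span
      of \<open>w\<close>, so lateral faces meet the planes of both cubes in null sets.\<close>
    have noq: "AE x in ?H. \<forall>p\<in>set q. piece_term x p \<noteq> 0 \<longrightarrow> piece_term x p1 = 0 \<and> piece_term x p2 = 0"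
    proof (rule AE_finite_allI)
      fix p assume p: "p \<in> set q"
      obtain a u v K where p': "p = (a, u, v, K)" by (cases p)
      have "t \<in> range v" using q(4) p p' by auto
      then have "\<not> range v \<subseteq> span (range w)" using t by auto
      then have n: "\<not> range (\<lambda>y. u + frame_point v y) \<subseteq> range (\<lambda>y. u' + frame_point w y)" for u'
        using frame_plane_subset[of u v u' w] by argo
      then show "AE x in ?H. piece_term x p \<noteq> 0 \<longrightarrow> piece_term x p1 = 0 \<and> piece_term x p2 = 0"
        using piece_terms_overlap[of a u v K 2 0 w ?Q] piece_terms_overlap[of a u v K "- 1" t w ?Q]
        unfolding p' p1_def p2_def by eventually_elim (use n[of 0] n[of t] in argo)
    qed simp
    \<comment> \<open>For the lateral pieces only the bound by \<open>C\<close> is at hand, since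
      subadditivity relies on the inequality being proved. Their sum is still a multiple of one
      k-vector, so the bound applies to it.\<close>
    have "AE x in ?H. \<phi> (piece_density c x) \<le> (\<Sum>p\<leftarrow>[p1, p2]. \<phi> (piece_term x p)) + C * (\<Sum>p\<leftarrow>q. norm (piece_term x p))"
      using no12 noq piece_terms_collinear[of q]
    proof eventually_elim
      case (elim x)
      show ?case
      proof (cases "\<exists>p\<in>set q. piece_term x p \<noteq> 0")
        case True
        then have z: "piece_term x p1 = 0" "piece_term x p2 = 0" using elim(2) by auto
        obtain v :: "'k \<Rightarrow> real ^ 'n::{finite,linorder}" where v: "\<forall>p\<in>set q. \<exists>s. piece_term x p = s *\<^sub>R frame_wedge v" using elim(3) by blast
        have "\<exists>s. (\<Sum>p\<leftarrow>q. piece_term x p) = s *\<^sub>R frame_wedge v"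
          using v
        proof (induction q)
          case Nil
          then show ?case by (auto intro: exI[of _ 0])
        next
          case (Cons p q)
          then obtain r s where "piece_term x p = r *\<^sub>R frame_wedge v" "(\<Sum>p\<leftarrow>q. piece_term x p) = s *\<^sub>R frame_wedge v" by auto
          then show ?case by (intro exI[of _ "r + s"]) (simp add: scaleR_add_left)
        qed
        then obtain s where s: "(\<Sum>p\<leftarrow>q. piece_term x p) = s *\<^sub>R frame_wedge v" by blast
        have "\<phi> (\<Sum>p\<leftarrow>q. piece_term x p) \<le> C * norm (\<Sum>p\<leftarrow>q. piece_term x p)"
          unfolding s using bound[of s v] by linarith
        also have "norm (\<Sum>p\<leftarrow>q. piece_term x p) \<le> (\<Sum>p\<leftarrow>q. norm (piece_term x p))"
          by (induction q) (auto intro: order_trans[OF norm_triangle_ineq])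
        finally have "\<phi> (\<Sum>p\<leftarrow>q. piece_term x p) \<le> C * (\<Sum>p\<leftarrow>q. norm (piece_term x p))" using C by (simp add: mult_left_mono)
        then show ?thesis by (simp add: piece_density_def c_def z \<phi>0)
      next
        case False
        then have "(\<Sum>p\<leftarrow>q. piece_term x p) = 0" "(\<Sum>p\<leftarrow>q. norm (piece_term x p)) = 0"
          by (induction q) auto
        then show ?thesis using elim(1) by (auto simp: piece_density_def c_def \<phi>0)
      qed
    qed
    moreover have pp: "pieces [p1, p2]" by (simp add: p1_def p2_def polytope_unit_cube)
    moreover have nh: "norm (r *\<^sub>R \<xi>) = r * norm \<xi>" if "r \<ge> 0" for r and \<xi> :: "'n ext" using that by simp
    ultimately have "(LINT x|?H. \<phi> (piece_density c x)) \<le> (LINT x|?H. (\<Sum>p\<leftarrow>[p1, p2]. \<phi> (piece_term x p)) + C * (\<Sum>p\<leftarrow>q. norm (piece_term x p)))"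
      by (intro integral_mono_AE Bochner_Integration.integrable_add integrable_mult_right
          piece_terms_integral(1)[OF hom pp] piece_terms_integral(1)[OF nh q(1)] integrable_piece_density pc \<phi>0)
    also have "\<dots> = (LINT x|?H. (\<Sum>p\<leftarrow>[p1, p2]. \<phi> (piece_term x p))) + (LINT x|?H. C * (\<Sum>p\<leftarrow>q. norm (piece_term x p)))"
      by (intro Bochner_Integration.integral_add integrable_mult_right piece_terms_integral(1)[OF hom pp] piece_terms_integral(1)[OF nh q(1)])
    also have "\<dots> = piece_energy \<phi> [p1, p2] + C * piece_energy norm q"
      using piece_terms_integral(2)[OF hom pp] piece_terms_integral(2)[OF nh q(1)] by (simp only: integral_mult_right_zero)
    \<comment> \<open>One of the two copies cancels against the energy of the cube in
      \<open>AUE_chain\<close>, which leaves the sum for the two orientations.\<close>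
    also have "piece_energy \<phi> [p1, p2] = 2 * \<phi> (frame_wedge w) + \<phi> (- frame_wedge w)"
      using hom[of 2 "frame_wedge w"] by (simp add: piece_energy_def p1_def p2_def unit_cube_cbox)
    also have "C * piece_energy norm q \<le> C * (4 * real CARD('k) * d)"
      using piece_energy_norm_le[OF q(1)] q(3) C by (intro mult_left_mono) (auto simp: tn)
    finally have "(LINT x|?H. \<phi> (piece_density c x)) \<le> 2 * \<phi> (frame_wedge w) + \<phi> (- frame_wedge w) + C * (4 * real CARD('k) * d)"
      by simp
    moreover have "\<phi> (frame_wedge w) \<le> (LINT x|?H. \<phi> (piece_density c x))"
      unfolding \<phi>_def by (rule AUE_chain[OF aue w pc bdc])
    ultimately show ?thesis by (simp add: algebra_simps)
  qed
  have "0 \<le> \<phi> (frame_wedge w) + \<phi> (- frame_wedge w) + e" if e: "e > 0" for e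
  proof -
    let ?d = "e / (4 * real CARD('k) * C + 1)"
    have pos: "4 * real CARD('k) * C + 1 > 0" using C by (simp add: add_nonneg_pos)
    have "?d * (4 * real CARD('k) * C) \<le> e" using e pos C by (simp add: field_simps)
    moreover have "?d > 0" using e pos by simp
    ultimately show ?thesis using est[of ?d] by linarith
  qed
  then show ?thesis by (rule field_le_epsilon)
qed

lemma grassmannian_frame:
  fixes \<eta> :: "'n::{finite,linorder} ext"
  assumes "\<eta> \<in> oriented_grassmannian CARD('k::{finite,linorder})"
  obtains w :: "'k::{finite,linorder} \<Rightarrow> real ^ 'n::{finite,linorder}" where "\<eta> = frame_wedge w" "norm \<eta> = 1"
proof -
  obtain vs where vs: "length vs = CARD('k)" "\<eta> = wedge_list vs" and n: "norm \<eta> = 1"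
    using assms by (auto simp: oriented_grassmannian_def simple_multivector_def)
  obtain w :: "'k \<Rightarrow> real ^ 'n::{finite,linorder}" where "map w (sorted_list_of_set UNIV) = vs" by (rule frame_of_list[OF vs(1)])
  then show thesis using that[of w] vs n by (simp add: frame_wedge_def)
qed

text \<open>The scalar is absorbed into one vector of the frame, whose index type is
  nonempty.\<close>

lemma frame_wedge_scaled:
  fixes w :: "'k::{finite,linorder} \<Rightarrow> real ^ 'n::{finite,linorder}"
  obtains v :: "'k \<Rightarrow> real ^ 'n::{finite,linorder}" where "r *\<^sub>R frame_wedge w = frame_wedge v"
proof -
  obtain i :: 'k where True by blast
  have "frame_wedge (w(i := r *\<^sub>R w i)) = r *\<^sub>R frame_wedge w"
    using linear_scale[OF linear_frame_wedge, of w i r "w i"] by simp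
  then show thesis using that by metis
qed

text \<open>Unit k-vectors have distance at most 2, so a Lipschitz function is bounded on the
  Grassmannian. The bound is stated for multiples of frame k-vectors, because \<open>F\<close> is
  controlled only on simple ones.\<close>

lemma shifted_energy_bound:
  fixes F :: "'n::{finite,linorder} ext \<Rightarrow> real"
  assumes lip: "L-lipschitz_on (oriented_grassmannian CARD('k::{finite,linorder})) F"
  obtains C where "\<And>r (v :: 'k::{finite,linorder} \<Rightarrow> real ^ 'n::{finite,linorder}).
    \<bar>shifted_energy F c (r *\<^sub>R frame_wedge v)\<bar> \<le> C * norm (r *\<^sub>R frame_wedge v)"
proof -
  let ?G = "oriented_grassmannian CARD('k) :: 'n ext set"
  obtain B where B: "\<And>\<xi>. \<xi> \<in> ?G \<Longrightarrow> \<bar>F \<xi> - c\<bar> \<le> B"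
  proof (cases "?G = {}")
    case False
    then obtain \<xi>0 where \<xi>0: "\<xi>0 \<in> ?G" by auto
    have L: "L \<ge> 0" using lip by (rule lipschitz_on_nonneg)
    have "\<bar>F \<xi> - c\<bar> \<le> \<bar>F \<xi>0 - c\<bar> + L * 2" if \<xi>: "\<xi> \<in> ?G" for \<xi>
    proof -
      have "dist (F \<xi>) (F \<xi>0) \<le> L * dist \<xi> \<xi>0" by (rule lipschitz_onD[OF lip \<xi> \<xi>0])
      also have "dist \<xi> \<xi>0 \<le> norm \<xi> + norm \<xi>0" by (simp add: dist_norm norm_triangle_ineq4)
      also have "norm \<xi> + norm \<xi>0 = 2" using \<xi> \<xi>0 by (simp add: oriented_grassmannian_def)
      finally have "\<bar>F \<xi> - F \<xi>0\<bar> \<le> L * 2" using L by (simp add: dist_real_def mult_left_mono)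
      then show ?thesis by linarith
    qed
    then show thesis by (rule that)
  qed (use that in auto)
  have "\<bar>shifted_energy F c (r *\<^sub>R frame_wedge v)\<bar> \<le> B * norm (r *\<^sub>R frame_wedge v)"
    for r and v :: "'k \<Rightarrow> real ^ 'n::{finite,linorder}"
  proof (cases "r *\<^sub>R frame_wedge v = 0")
    case True
    then show ?thesis unfolding True by simp
  next
    case False
    let ?\<xi> = "r *\<^sub>R frame_wedge v"
    have "sgn ?\<xi> = (inverse (norm ?\<xi>) * r) *\<^sub>R frame_wedge v" by (simp add: sgn_div_norm)
    then obtain v' :: "'k \<Rightarrow> real ^ 'n::{finite,linorder}" where "sgn ?\<xi> = frame_wedge v'" by (metis frame_wedge_scaled)
    then have "simple_multivector CARD('k) (sgn ?\<xi>)"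
      unfolding simple_multivector_def by (intro exI[of _ "map v' (sorted_list_of_set UNIV)"]) (simp add: frame_wedge_def)
    then have "sgn ?\<xi> \<in> ?G" using False by (simp add: oriented_grassmannian_def norm_sgn)
    then have "norm ?\<xi> * \<bar>F (sgn ?\<xi>) - c\<bar> \<le> norm ?\<xi> * B" by (intro mult_left_mono B) auto
    then show ?thesis by (simp add: shifted_energy_def abs_mult mult.commute)
  qed
  then show thesis by (rule that)
qed

theorem theorem5p10:
  fixes k :: nat and F :: "'n::{finite,linorder} ext \<Rightarrow> real" and c1 c2 :: real
  assumes "k = CARD('k::{finite,linorder})" and "1 \<le> k" and "k < CARD('n)"
    and "integrand k F"
    and "\<exists>L. L-lipschitz_on (oriented_grassmannian k) F"
    and "0 < c2" and "c2 < c1"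
    and "AUE k (polyhedral_test_pairs TYPE('k)) c1 F"
  shows "UPC k c2 F"
proof -
  note k = assms(1)
  obtain L where "L-lipschitz_on (oriented_grassmannian CARD('k)) F" using assms(5) unfolding k by blast
  then obtain C where bound: "\<And>r (v :: 'k \<Rightarrow> real ^ 'n::{finite,linorder}).
      \<bar>shifted_energy F c1 (r *\<^sub>R frame_wedge v)\<bar> \<le> C * norm (r *\<^sub>R frame_wedge v)"
    by (rule shifted_energy_bound) blast
  let ?\<phi> = "shifted_energy F c1"
  have kn: "CARD('k) < CARD('n)" and aue: "AUE CARD('k) (polyhedral_test_pairs TYPE('k)) c1 F"
    using assms(3,8) unfolding k .
  have sym: "?\<phi> (frame_wedge w) + ?\<phi> (- frame_wedge w) \<ge> 0" for w :: "'k \<Rightarrow> real ^ 'n::{finite,linorder}"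
  proof (cases "frame_wedge w = 0")
    case False
    obtain b :: "'k \<Rightarrow> real ^ 'n::{finite,linorder}" where b: "orthonormal_frame b" "frame_wedge w = norm (frame_wedge w) *\<^sub>R frame_wedge b"
      by (rule orthonormal_frame_of_wedge[OF False])
    have "?\<phi> (frame_wedge b) + ?\<phi> (- frame_wedge b) \<ge> 0"
      by (rule energy_symmetric_orthonormal[OF aue kn bound b(1)])
    moreover have "?\<phi> (frame_wedge w) = norm (frame_wedge w) * ?\<phi> (frame_wedge b)"
      by (subst b(2)) (rule shifted_energy_scale, simp)
    moreover have "?\<phi> (- frame_wedge w) = norm (frame_wedge w) * ?\<phi> (- frame_wedge b)"
      by (subst b(2), subst scaleR_minus_right[symmetric]) (rule shifted_energy_scale, simp)
    ultimately show ?thesis by (simp flip: distrib_left)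
  qed simp
  show ?thesis
    unfolding UPC_def
  proof (intro allI impI)
    fix d :: nat and m :: "nat \<Rightarrow> real" and \<eta> :: "nat \<Rightarrow> 'n ext"
    assume "d > 0 \<and> (\<forall>i\<in>{1..d}. m i > 0) \<and> (\<forall>i\<in>{0..d}. \<eta> i \<in> oriented_grassmannian k) \<and>
      \<eta> 0 = (\<Sum>i=1..d. m i *\<^sub>R \<eta> i)"
    then have m: "\<And>i. i \<in> {1..d} \<Longrightarrow> m i > 0" and \<eta>: "\<And>i. i \<in> {0..d} \<Longrightarrow> \<eta> i \<in> oriented_grassmannian CARD('k)"
      and rel: "\<eta> 0 = (\<Sum>i=1..d. m i *\<^sub>R \<eta> i)" unfolding k by auto
    have norm1: "norm (\<eta> i) = 1" if "i \<in> {0..d}" for i using \<eta>[OF that] by (simp add: oriented_grassmannian_def)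
    have "\<exists>w :: 'k \<Rightarrow> real ^ 'n::{finite,linorder}. \<eta> i = frame_wedge w" if "i \<in> {0..d}" for i
      by (rule grassmannian_frame[OF \<eta>[OF that]]) blast
    then obtain w :: "nat \<Rightarrow> 'k \<Rightarrow> real ^ 'n::{finite,linorder}" where w: "\<And>i. i \<in> {0..d} \<Longrightarrow> \<eta> i = frame_wedge (w i)" by metis
    have "frame_wedge (w 0) \<noteq> 0" using w[of 0] norm1[of 0] by auto
    \<comment> \<open>The cube of a test pair has an orthonormal frame, so the unit k-vector is
      represented by such a frame; the frames \<open>w i\<close> of the other k-vectors may be
      skew.\<close>
    then obtain b :: "'k \<Rightarrow> real ^ 'n::{finite,linorder}" where b: "orthonormal_frame b" "frame_wedge (w 0) = norm (frame_wedge (w 0)) *\<^sub>R frame_wedge b"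
      by (rule orthonormal_frame_of_wedge)
    then have \<eta>0: "\<eta> 0 = frame_wedge b" using w[of 0] norm1[of 0] by simp
    \<comment> \<open>All parallelepipeds are placed at the origin: a translation changes the
      boundary only by a negligible functional.\<close>
    define c where "c = map (\<lambda>i. (m i, 0 :: real ^ 'n::{finite,linorder}, w i, unit_cube :: (real ^ 'k::{finite,linorder}) set)) [1..<Suc d]"
    have "bd c = (\<Sum>i=1..d. m i *\<^sub>R face unit_cube (w i))"
    proof -
      have "bd [(a, 0, v, unit_cube)] = a *\<^sub>R face unit_cube v" for a and v :: "'k \<Rightarrow> real ^ 'n::{finite,linorder}"
        using bd_scale_pieces[of a "[(1, 0, v, unit_cube)]"] by (simp add: scale_pieces_def face_def)
      moreover have "bd (map f xs) = (\<Sum>i\<leftarrow>xs. bd [f i])" for f :: "nat \<Rightarrow> ('n, 'k) piece" and xs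
        using bd_concat[of "map (\<lambda>i. [f i]) xs"] by (simp add: o_def concat_map_singleton)
      ultimately have "bd c = (\<Sum>i\<leftarrow>[1..<Suc d]. m i *\<^sub>R face unit_cube (w i))" by (simp only: c_def)
      then show ?thesis
        by (simp only: sum_list_distinct_conv_sum_set distinct_upt set_upt atLeastLessThanSuc_atLeastAtMost)
    qed
    moreover have "(\<Sum>i=1..d. m i *\<^sub>R face unit_cube (w i)) - face unit_cube b \<in> negligible_functionals TYPE('k)"
    proof (rule face_linear_relation)
      show "(\<Sum>i=1..d. m i *\<^sub>R frame_wedge (w i)) = frame_wedge b"
        unfolding \<eta>0[symmetric] rel by (rule sum.cong) (auto simp: w)
    qed
    ultimately have neg: "bd c - face unit_cube b \<in> negligible_functionals TYPE('k)" by simp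
    have pc: "pieces c" by (auto simp: c_def pieces_def polytope_unit_cube)
    \<comment> \<open>The cube is minimal among lists with exactly its boundary;
      \<open>homogenization\<close> extends this to \<open>c\<close>, whose boundary is correct only
      modulo negligible functionals.\<close>
    have "?\<phi> (frame_wedge b) \<le> piece_energy ?\<phi> c"
    proof (rule homogenization[OF _ shifted_energy_scale bound _ pc neg])
      fix q :: "('n, 'k) piece list" assume q: "pieces q" "bd q = face unit_cube b"
      have "?\<phi> (frame_wedge b) \<le> (LINT x|hausdorff CARD('k). ?\<phi> (piece_density q x))"
        by (rule AUE_chain[OF aue b(1) q])
      also have "\<dots> \<le> piece_energy ?\<phi> q" by (rule energy_subadditive[OF shifted_energy_scale sym q(1)])
      finally show "?\<phi> (frame_wedge b) \<le> piece_energy ?\<phi> q" .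
    qed (use b(1) in \<open>simp_all add: orthonormal_frame_def norm_eq_1\<close>)
    also have "piece_energy ?\<phi> c = (\<Sum>i\<leftarrow>[1..<Suc d]. ?\<phi> (m i *\<^sub>R frame_wedge (w i)))"
      by (simp add: piece_energy_def c_def o_def unit_cube_cbox del: upt_Suc)
    also have "\<dots> = (\<Sum>i=1..d. ?\<phi> (m i *\<^sub>R frame_wedge (w i)))"
      by (simp only: sum_list_distinct_conv_sum_set distinct_upt set_upt atLeastLessThanSuc_atLeastAtMost)
    also have "\<dots> = (\<Sum>i=1..d. m i * (F (\<eta> i) - c1))"
    proof (rule sum.cong[OF refl])
      fix i assume i: "i \<in> {1..d}"
      then have "?\<phi> (m i *\<^sub>R frame_wedge (w i)) = m i * ?\<phi> (\<eta> i)" using m[OF i] w[of i] by (simp add: shifted_energy_scale)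
      then show "?\<phi> (m i *\<^sub>R frame_wedge (w i)) = m i * (F (\<eta> i) - c1)"
        using norm1[of i] i by (simp add: shifted_energy_def sgn_div_norm)
    qed
    also have "?\<phi> (frame_wedge b) = F (\<eta> 0) - c1"
      using norm1[of 0] by (simp add: \<eta>0[symmetric] shifted_energy_def sgn_div_norm)
    finally have main: "F (\<eta> 0) - c1 \<le> (\<Sum>i=1..d. m i * F (\<eta> i)) - c1 * (\<Sum>i=1..d. m i)"
      by (simp add: right_diff_distrib sum_subtractf sum_distrib_left mult.commute)
    \<comment> \<open>By the triangle inequality the excess \<Sum> m_i - 1 is nonnegative, so its
      coefficient c_1 may be lowered to c_2.\<close>
    have "1 = norm (\<Sum>i=1..d. m i *\<^sub>R \<eta> i)" using norm1[of 0] rel by simp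
    also have "\<dots> \<le> (\<Sum>i=1..d. norm (m i *\<^sub>R \<eta> i))" by (rule norm_sum)
    also have "\<dots> = (\<Sum>i=1..d. m i)" by (rule sum.cong) (use m norm1 in \<open>auto simp: less_imp_le\<close>)
    finally have "c2 * ((\<Sum>i=1..d. m i) - 1) \<le> c1 * ((\<Sum>i=1..d. m i) - 1)"
      using assms(7) by (intro mult_right_mono) auto
    moreover have "(\<Sum>i=1..d. m i * norm (\<eta> i)) = (\<Sum>i=1..d. m i)" by (rule sum.cong) (use norm1 in auto)
    ultimately show "(\<Sum>i=1..d. m i * F (\<eta> i)) - F (\<eta> 0) \<ge> c2 * ((\<Sum>i=1..d. m i * norm (\<eta> i)) - norm (\<eta> 0))"
      using main norm1[of 0] by (simp add: algebra_simps)
  qed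
qed

end
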